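(* Assume the setting of the context: $K(\mathbf v,\mathbf u)=k(v_x,u_x)b(v_\perp)$ is a collision kernel and $f_0(\mathbf v)=a_0(v_x)b(v_\perp)$ an initial particle density satisfying mass conservation and (A1)-(A4), $V_\infty\ge 0$, and $E=F_0(V_\infty)$. Assume the Irreversal Criterion $$\int_0^\infty k(0,z)\,a_0(z+V_\infty)\,dz>a_0(V_\infty).$$ Let the initial velocity of the cylinder be $V_0=V_\infty+\gamma$ with $\gamma>0$. Then there are constants $\gamma_1>0$ and $c,C>0$ (not depending on $\gamma$) such that for every $\gamma\in(0,\gamma_1)$ the following hold. (a) There exists at least one solution $(V,f)$ of the body-particle problem, i.e. $V\in C^1([0,\infty))$, $V(0)=V_0$, $\frac{dV}{dt}=E-F(t)$ for $t\ge 0$, where $F(t)$ is the force given in the context, and $f_\pm\in L^\infty$ (for $t\in[0,\infty)$, $\mathbf x\in\partial\Omega(t)$, $\mathbf v\in\mathbb R^d$) are the (almost everywhere defined) pre- and post-collision boundary densities determined explicitly by $V$ and $f_0$. (b) Every solution in this sense satisfies, for all $0<t<\infty$, $$0<\gamma e^{-B_0t}+\frac{c\,\gamma^{p+1}}{t^{d+p}}\,\chi\{t\ge t_0+1\}<V(t)-V_\infty<\gamma e^{-B_\infty t}+\frac{C\gamma^{p+1}}{(1+t)^{d+p}},$$ where $B_0=\max_{[V_\infty-\gamma,V_\infty+\gamma]}F_0'$, $B_\infty=\min_{[V_\infty-\gamma,V_\infty+\gamma]}F_0'$ and $t_0=|\ln\gamma|$. In particular there is no velocity reversal: $V(t)>V_\infty$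 for all $t>0$.
   Context: Notation. $d\ge1$; $\mathbf x=(x,x_\perp)\in\mathbb R\times\mathbb R^{d-1}$, $\mathbf v=(v_x,v_\perp)\in\mathbb R\times\mathbb R^{d-1}$; $\mathbf i$ is the unit vector in the $x$-direction; $\chi\{\cdot\}$ is the indicator of a condition. Body. $\Omega(t)=\{(x,x_\perp):|x-X(t)|\le H,\ |x_\perp|\le r\}$ is a rigid cylinder parallel to the $x$-axis ($H,r>0$ fixed), moving only in the $x$-direction with $\frac{dX}{dt}=V(t)$, $\frac{dV}{dt}=E-F(t)$, where $E\ge 0$ is a constant force and $F$ is the force due to the particles. $\partial\Omega_R(t)$, $\partial\Omega_L(t)$ are its right and left ends. Particles. The density $f(t,\mathbf x,\mathbf v)$ satisfies $\partial_tf+\mathbf v\cdot\nabla_{\mathbf x}f=0$ outside $\Omega(t)$ and $f(0,\mathbf x,\mathbf v)=f_0(\mathbf v)$. On $\partial\Omega(t)$, $f_\pm(t,\mathbf x;\mathbf v)=\lim_{\epsilon\to0^+}f(t\pm\epsilon,\mathbf x\pm\epsilon\mathbf v,\mathbf v)$ are the densities after ($+$, outgoing velocities) and before ($-$, incoming velocities) collision; on the right end incoming means $v_x\le V(t)$ and outgoing $v_x\ge V(t)$, on the left end the opposite. Reflection law at the ends, for outgoing $\mathbf v$: $$f_+(t,\mathbf x;\mathbf v)=\int_{(u_x-V(t))(v_x-V(t))\le0}K(\mathbf v-\mathbf iV(t);\mathbf u-\mathbf iV(t))\,f_-(t,\mathbf x;\mathbf u)\,d\mathbf u .$$ On the lateral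 boundary, with outward normal $\mathbf n$: $f_+(t,\mathbf x;\mathbf v)=\int_{\mathbf u\cdot\mathbf n\le0}K_S(\mathbf v;\mathbf u)f_0(\mathbf u)\,d\mathbf u$ with $K_S\geq 0$ satisfying $\int_{\mathbf v\cdot\mathbf n\ge0}(\mathbf v\cdot\mathbf n)K_S(\mathbf v;\mathbf u)\,d\mathbf v=|\mathbf u\cdot\mathbf n|$; this produces no net horizontal force. Given the motion, $f_-$ at an end is explicit: for incoming $(t,\mathbf x,\mathbf u)$, if the backward path $\mathbf x-(t-s)\mathbf u$ lies on that end at some time $s\in(0,t)$ (a precollision), then $f_-(t,\mathbf x;\mathbf u)=f_+(\tau,\boldsymbol\xi;\mathbf u)$, with $\tau$ the latest such time and $\boldsymbol\xi=\mathbf x-(t-\tau)\mathbf u$; otherwise $f_-(t,\mathbf x;\mathbf u)=f_0(\mathbf u)$. (Precollision times can accumulate at $t$ only if $u_x=V(t)$, a null set.) Force. With $\ell(w)=w^2+\int_0^\infty v^2k(v,w)\,dv$, $$F(t)=\int_{\partial\Omega_R(t)}\!dS_{\mathbf x}\!\int_{u_x\le V(t)}\!\ell(u_x-V(t))f_-(t,\mathbf x;\mathbf u)\,d\mathbf u-\int_{\partial\Omega_L(t)}\!dS_{\mathbf x}\!\int_{u_x\ge V(t)}\!\ell(u_x-V(t))f_-(t,\mathbf x;\mathbf u)\,d\mathbf u ,$$ and, for $w\in\mathbb R$, $$F_0(w)=|\partial\Omega_L|\Big(\int_{u_x\le w}\ell(u_x-w)f_0(\mathbf u)\,d\mathbf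 u-\int_{u_x\ge w}\ell(u_x-w)f_0(\mathbf u)\,d\mathbf u\Big).$$ It is a standing fact that $F_0$ is an increasing $C^1$ function, with $B_0\ge B_\infty>0$. The equilibrium velocity $V_\infty\ge0$ is determined by $F_0(V_\infty)=E$. Standing assumptions on $K$, $f_0$, for some $\gamma=\gamma_*>0$ (hence for all smaller $\gamma$): Mass conservation: $\int_{v_x\ge0}v_xK(\mathbf v,\mathbf u)\,d\mathbf v=|u_x|$. (A1) $f_0(\mathbf v)=a_0(v_x)b(v_\perp)$, $K(\mathbf v,\mathbf u)=k(v_x,u_x)b(v_\perp)$, $\int b\,dv_\perp=1$, $b(0)>0$, all factors nonnegative and continuous, $f_0$ bounded, $a_0$ even, and $k$ even in each of its variables. (A2) $\sup_{|u_x|\le\gamma}\sup_{v_x\in\mathbb R}k(v_x,u_x)<\infty$. (A3) There are $0<p\le2$ and constants $c',C'>0$ with $c'|u_x|^p\le\int_{v_x\ge0}v_x^2k(v_x,u_x)\,dv_x\le C'|u_x|^p$ for $u_x\in[-\gamma,\gamma]$; moreover this integral is an even function of $u_x$, $C^1$ for $u_x\ne0$ and strictly decreasing for $u_x<0$. (A4) There is $M\in L^1(\mathbb R)$ with $k(v_x,z-y-V_\infty)a_0(z)\le M(z)$ for $|v_x|<2\gamma$, $|y|<\gamma$, $z\in\mathbb R$.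
   Formalization: In (a), f_+ ∈ L^∞ is claimed only if one reflection of f_0 (at the ends for wall velocities near V_∞, and on the lateral boundary) gives a bounded density; the stated assumptions on K and K_S allow unbounded f_+. Existence, f_- ∈ L^∞ and (b) need no such condition. *)

theory Defs
  imports "HOL-Analysis.Analysis"
begin

text \<open>
  The space of positions and velocities is an arbitrary Euclidean space
  \<^typ>\<open>'a::euclidean_space\<close>, of dimension \<open>d = DIM('a) \<ge> 1\<close>. The direction of motion
  \<^bold>\<open>i\<close> is a basis vector \<open>axis\<close>; the first component of \<open>v\<close> is \<open>v \<bullet> axis\<close>, and
  the transversal component, an element of \<open>R\<^sup>d\<^sup>-\<^sup>1\<close>, is the orthogonal projection \<open>perp\<close>
  of \<open>v\<close> to the hyperplane orthogonal to \<open>axis\<close> (which is \<open>{0}\<close> if \<open>d = 1\<close>).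

  The lateral kernel \<open>latker n v u\<close> may depend on the outward normal \<open>n\<close>: for \<open>d \<ge> 3\<close> no
  function of \<open>v\<close> and \<open>u\<close> alone satisfies the flux condition for all normals at once.
\<close>

record 'a body_gas =
  axis :: 'a
  radius :: real
  halflen :: real
  kx :: "real \<Rightarrow> real \<Rightarrow> real"
  dens :: "real \<Rightarrow> real"
  trans :: "'a \<Rightarrow> real"
  latker :: "'a \<Rightarrow> 'a \<Rightarrow> 'a \<Rightarrow> real"

definition perp :: "'a::euclidean_space body_gas \<Rightarrow> 'a \<Rightarrow> 'a" where
  "perp G v = v - (v \<bullet> axis G) *\<^sub>R axis G"

definition hyperplane :: "'a::euclidean_space body_gas \<Rightarrow> 'a set" where
  "hyperplane G = {y. y \<bullet> axis G = 0}"

definition disk :: "'a::euclidean_space body_gas \<Rightarrow> 'a set" where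
  "disk G = {y \<in> hyperplane G. norm y \<le> radius G}"

text \<open>
  \<open>(d-1)\<close>-dimensional Lebesgue measure on the hyperplane, built as \<^const>\<open>lborel\<close> is built on
  the whole space. For \<open>d = 1\<close> it is the unit point mass at \<open>0\<close>.
\<close>
definition lperp :: "'a::euclidean_space body_gas \<Rightarrow> 'a measure" where
  "lperp G = distr (\<Pi>\<^sub>M b\<in>Basis - {axis G}. lborel) (restrict_space borel (hyperplane G))
     (\<lambda>f. \<Sum>b\<in>Basis - {axis G}. f b *\<^sub>R b)"

definition f0 :: "'a::euclidean_space body_gas \<Rightarrow> 'a \<Rightarrow> real" where
  "f0 G v = dens G (v \<bullet> axis G) * trans G (perp G v)"

definition K :: "'a::euclidean_space body_gas \<Rightarrow> 'a \<Rightarrow> 'a \<Rightarrow> real" where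
  "K G v u = kx G (v \<bullet> axis G) (u \<bullet> axis G) * trans G (perp G v)"

definition transfer :: "'a::euclidean_space body_gas \<Rightarrow> real \<Rightarrow> real" where
  "transfer G w = (LINT v:{0..}|lborel. v\<^sup>2 * kx G v w)"

definition ell :: "'a::euclidean_space body_gas \<Rightarrow> real \<Rightarrow> real" where
  "ell G w = w\<^sup>2 + transfer G w"

definition F0 :: "'a::euclidean_space body_gas \<Rightarrow> real \<Rightarrow> real" where
  "F0 G w = measure (lperp G) (disk G) *
     ((LINT u:{u. u \<bullet> axis G \<le> w}|lborel. ell G (u \<bullet> axis G - w) * f0 G u)
    - (LINT u:{u. u \<bullet> axis G \<ge> w}|lborel. ell G (u \<bullet> axis G - w) * f0 G u))"

definition B0 :: "'a::euclidean_space body_gas \<Rightarrow> real \<Rightarrow> real \<Rightarrow> real" where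
  "B0 G Vinf \<gamma> = (SUP w\<in>{Vinf - \<gamma>..Vinf + \<gamma>}. deriv (F0 G) w)"

definition Binf :: "'a::euclidean_space body_gas \<Rightarrow> real \<Rightarrow> real \<Rightarrow> real" where
  "Binf G Vinf \<gamma> = (INF w\<in>{Vinf - \<gamma>..Vinf + \<gamma>}. deriv (F0 G) w)"


subsection \<open>Standing assumptions\<close>

definition cylinder :: "'a::euclidean_space body_gas \<Rightarrow> bool" where
  "cylinder G \<longleftrightarrow> axis G \<in> Basis \<and> radius G > 0 \<and> halflen G > 0"

definition mass_conservation :: "'a::euclidean_space body_gas \<Rightarrow> bool" where
  "mass_conservation G \<longleftrightarrow>
     (\<forall>u. (\<integral>\<^sup>+v\<in>{v. v \<bullet> axis G \<ge> 0}. ennreal ((v \<bullet> axis G) * K G v u) \<partial>lborel)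
        = ennreal \<bar>u \<bullet> axis G\<bar>)"

text \<open>The factorizations of \<^const>\<open>f0\<close> and \<^const>\<open>K\<close> are part of their definitions.\<close>
definition A1 :: "'a::euclidean_space body_gas \<Rightarrow> bool" where
  "A1 G \<longleftrightarrow>
     has_bochner_integral (lperp G) (trans G) 1 \<and> trans G 0 > 0 \<and>
     (\<forall>y\<in>hyperplane G. trans G y \<ge> 0) \<and> (\<forall>z. dens G z \<ge> 0) \<and> (\<forall>v u. kx G v u \<ge> 0) \<and>
     continuous_on (hyperplane G) (trans G) \<and> continuous_on UNIV (dens G) \<and>
     continuous_on UNIV (\<lambda>(v, u). kx G v u) \<and>
     bounded (range (f0 G)) \<and>
     (\<forall>z. dens G (- z) = dens G z) \<and>
     (\<forall>v u. kx G (- v) u = kx G v u) \<and> (\<forall>v u. kx G v (- u) = kx G v u)"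

definition A2 :: "'a::euclidean_space body_gas \<Rightarrow> real \<Rightarrow> bool" where
  "A2 G \<gamma> \<longleftrightarrow> (\<exists>M. \<forall>u v. \<bar>u\<bar> \<le> \<gamma> \<longrightarrow> kx G v u \<le> M)"

definition A3 :: "'a::euclidean_space body_gas \<Rightarrow> real \<Rightarrow> real \<Rightarrow> bool" where
  "A3 G p \<gamma> \<longleftrightarrow> 0 < p \<and> p \<le> 2 \<and>
     (\<forall>u. set_integrable lborel {0..} (\<lambda>v. v\<^sup>2 * kx G v u)) \<and>
     (\<exists>c>0. \<exists>C>0. \<forall>u\<in>{-\<gamma>..\<gamma>}. c * \<bar>u\<bar> powr p \<le> transfer G u \<and> transfer G u \<le> C * \<bar>u\<bar> powr p) \<and>
     (\<forall>u. transfer G (- u) = transfer G u) \<and>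
     transfer G C1_differentiable_on (- {0}) \<and>
     strict_antimono_on {..<0} (transfer G)"

definition A4 :: "'a::euclidean_space body_gas \<Rightarrow> real \<Rightarrow> real \<Rightarrow> bool" where
  "A4 G Vinf \<gamma> \<longleftrightarrow> (\<exists>M. integrable lborel M \<and>
     (\<forall>v y z. \<bar>v\<bar> < 2 * \<gamma> \<longrightarrow> \<bar>y\<bar> < \<gamma> \<longrightarrow> kx G v (z - y - Vinf) * dens G z \<le> M z))"

definition lateral_kernel :: "'a::euclidean_space body_gas \<Rightarrow> bool" where
  "lateral_kernel G \<longleftrightarrow>
     (\<lambda>(n, v, u). latker G n v u) \<in> borel_measurable borel \<and>
     (\<forall>n v u. latker G n v u \<ge> 0) \<and>
     (\<forall>n\<in>hyperplane G. norm n = 1 \<longrightarrow> (\<forall>u. u \<bullet> n \<le> 0 \<longrightarrow>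
        (\<integral>\<^sup>+v\<in>{v. v \<bullet> n \<ge> 0}. ennreal ((v \<bullet> n) * latker G n v u) \<partial>lborel) = ennreal \<bar>u \<bullet> n\<bar>))"

text \<open>
  The standing facts on \<^const>\<open>F0\<close>: its integrals converge, it is increasing and \<open>C\<^sup>1\<close>, and
  its derivative is positive near \<open>Vinf\<close> (which gives \<open>Binf > 0\<close>). The other assumptions do not
  imply them: they do not even bound the second moment of \<^const>\<open>dens\<close>.
\<close>
definition F0_regular :: "'a::euclidean_space body_gas \<Rightarrow> real \<Rightarrow> real \<Rightarrow> bool" where
  "F0_regular G Vinf \<gamma> \<longleftrightarrow>
     (\<forall>w. integrable lborel (\<lambda>u. ell G (u \<bullet> axis G - w) * f0 G u)) \<and>
     strict_mono (F0 G) \<and> F0 G C1_differentiable_on UNIV \<and>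
     (\<forall>w\<in>{Vinf - \<gamma>..Vinf + \<gamma>}. deriv (F0 G) w > 0)"

definition irreversal_criterion :: "'a::euclidean_space body_gas \<Rightarrow> real \<Rightarrow> bool" where
  "irreversal_criterion G Vinf \<longleftrightarrow>
     (LINT z:{0..}|lborel. kx G 0 z * dens G (z + Vinf)) > dens G Vinf"


subsection \<open>The body-particle problem\<close>

text \<open>
  The end with sign \<open>s = 1\<close> is the right one and the end with \<open>s = -1\<close> the left one, for a
  body centred at \<open>\<xi>\<close>. For a body velocity \<open>w\<close>, a velocity \<open>u\<close> is incoming at this end
  if \<open>s * (u \<bullet> axis - w) \<le> 0\<close> and outgoing if \<open>s * (u \<bullet> axis - w) \<ge> 0\<close>.
\<close>
definition face :: "'a::euclidean_space body_gas \<Rightarrow> real \<Rightarrow> real \<Rightarrow> 'a set" where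
  "face G s \<xi> = {x. x \<bullet> axis G = \<xi> + s * halflen G \<and> norm (perp G x) \<le> radius G}"

definition face_in :: "'a::euclidean_space body_gas \<Rightarrow> real \<Rightarrow> real \<Rightarrow> 'a set" where
  "face_in G s w = {u. s * (u \<bullet> axis G - w) \<le> 0}"

definition face_out :: "'a::euclidean_space body_gas \<Rightarrow> real \<Rightarrow> real \<Rightarrow> 'a set" where
  "face_out G s w = {v. s * (v \<bullet> axis G - w) \<ge> 0}"

text \<open>The circular edges, a null set of the surface, are counted with the ends only.\<close>
definition lateral :: "'a::euclidean_space body_gas \<Rightarrow> real \<Rightarrow> 'a set" where
  "lateral G \<xi> = {x. \<bar>x \<bullet> axis G - \<xi>\<bar> < halflen G \<and> norm (perp G x) = radius G}"

definition normal :: "'a::euclidean_space body_gas \<Rightarrow> 'a \<Rightarrow> 'a" where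
  "normal G x = perp G x /\<^sub>R radius G"

definition in_phase ::
  "'a::euclidean_space body_gas \<Rightarrow> (real \<Rightarrow> real) \<Rightarrow> (real \<Rightarrow> real) \<Rightarrow> (real \<times> 'a \<times> 'a) set" where
  "in_phase G X V = {(t, x, u). t \<ge> 0 \<and>
     ((\<exists>s\<in>{1, -1}. x \<in> face G s (X t) \<and> u \<in> face_in G s (V t)) \<or>
      (x \<in> lateral G (X t) \<and> u \<bullet> normal G x \<le> 0))}"

definition out_phase ::
  "'a::euclidean_space body_gas \<Rightarrow> (real \<Rightarrow> real) \<Rightarrow> (real \<Rightarrow> real) \<Rightarrow> (real \<times> 'a \<times> 'a) set" where
  "out_phase G X V = {(t, x, v). t \<ge> 0 \<and>
     ((\<exists>s\<in>{1, -1}. x \<in> face G s (X t) \<and> v \<in> face_out G s (V t)) \<or>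
      (x \<in> lateral G (X t) \<and> v \<bullet> normal G x \<ge> 0))}"

definition precollisions ::
  "'a::euclidean_space body_gas \<Rightarrow> (real \<Rightarrow> real) \<Rightarrow> real \<Rightarrow> real \<Rightarrow> 'a \<Rightarrow> 'a \<Rightarrow> real set" where
  "precollisions G X s t x u = {\<tau>. 0 < \<tau> \<and> \<tau> < t \<and> x - (t - \<tau>) *\<^sub>R u \<in> face G s (X \<tau>)}"

text \<open>
  Densities are Borel representatives. The value \<open>fm t x u\<close> is prescribed except on the null set
  \<open>u \<bullet> axis = V t\<close>, off which a latest precollision time exists as soon as there is any.
\<close>
definition pre_law ::
  "'a::euclidean_space body_gas \<Rightarrow> (real \<Rightarrow> real) \<Rightarrow> (real \<Rightarrow> real) \<Rightarrow>
   (real \<Rightarrow> 'a \<Rightarrow> 'a \<Rightarrow> real) \<Rightarrow> (real \<Rightarrow> 'a \<Rightarrow> 'a \<Rightarrow> real) \<Rightarrow> bool" where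
  "pre_law G X V fm fp \<longleftrightarrow>
     (\<forall>t\<ge>0. \<forall>s\<in>{1, -1}. \<forall>x\<in>face G s (X t). \<forall>u\<in>face_in G s (V t). u \<bullet> axis G \<noteq> V t \<longrightarrow>
        fm t x u =
          (if precollisions G X s t x u = {} then f0 G u
           else let \<tau> = (GREATEST \<tau>. \<tau> \<in> precollisions G X s t x u)
                in fp \<tau> (x - (t - \<tau>) *\<^sub>R u) u)) \<and>
     (\<forall>t\<ge>0. \<forall>x\<in>lateral G (X t). \<forall>u. u \<bullet> normal G x \<le> 0 \<longrightarrow> fm t x u = f0 G u)"

text \<open>
  The reflection integral at the ends has to converge for almost all outgoing \<open>v\<close>; where it
  diverges, \<open>fp t x v\<close> is \<open>0\<close> by the convention for \<^const>\<open>set_lebesgue_integral\<close>. For outgoing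
  \<open>v\<close> with \<open>v \<bullet> axis \<noteq> V t\<close>, the set \<open>(u\<^sub>x - V)(v\<^sub>x - V) \<le> 0\<close> is the set of incoming
  velocities.
\<close>
definition post_law ::
  "'a::euclidean_space body_gas \<Rightarrow> (real \<Rightarrow> real) \<Rightarrow> (real \<Rightarrow> real) \<Rightarrow>
   (real \<Rightarrow> 'a \<Rightarrow> 'a \<Rightarrow> real) \<Rightarrow> (real \<Rightarrow> 'a \<Rightarrow> 'a \<Rightarrow> real) \<Rightarrow> bool" where
  "post_law G X V fm fp \<longleftrightarrow>
     (\<forall>t\<ge>0. \<forall>s\<in>{1, -1}. \<forall>x\<in>face G s (X t).
        let g = (\<lambda>v u. K G (v - V t *\<^sub>R axis G) (u - V t *\<^sub>R axis G) * fm t x u) in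
        (AE v in lborel. v \<in> face_out G s (V t) \<longrightarrow>
           set_integrable lborel (face_in G s (V t)) (g v)) \<and>
        (\<forall>v\<in>face_out G s (V t). fp t x v = (LINT u:face_in G s (V t)|lborel. g v u))) \<and>
     (\<forall>t\<ge>0. \<forall>x\<in>lateral G (X t). \<forall>v. v \<bullet> normal G x \<ge> 0 \<longrightarrow>
        fp t x v = (LINT u:{u. u \<bullet> normal G x \<le> 0}|lborel. latker G (normal G x) v u * f0 G u))"

definition face_point :: "'a::euclidean_space body_gas \<Rightarrow> real \<Rightarrow> real \<Rightarrow> 'a \<Rightarrow> 'a" where
  "face_point G s \<xi> y = (\<xi> + s * halflen G) *\<^sub>R axis G + y"

definition face_force ::
  "'a::euclidean_space body_gas \<Rightarrow> (real \<Rightarrow> real) \<Rightarrow> (real \<Rightarrow> real) \<Rightarrow>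
   (real \<Rightarrow> 'a \<Rightarrow> 'a \<Rightarrow> real) \<Rightarrow> real \<Rightarrow> real \<Rightarrow> real" where
  "face_force G X V fm s t =
     (LINT y:disk G|lperp G. LINT u:face_in G s (V t)|lborel.
        ell G (u \<bullet> axis G - V t) * fm t (face_point G s (X t) y) u)"

definition force_converges ::
  "'a::euclidean_space body_gas \<Rightarrow> (real \<Rightarrow> real) \<Rightarrow> (real \<Rightarrow> real) \<Rightarrow>
   (real \<Rightarrow> 'a \<Rightarrow> 'a \<Rightarrow> real) \<Rightarrow> real \<Rightarrow> real \<Rightarrow> bool" where
  "force_converges G X V fm s t \<longleftrightarrow>
     set_integrable (lperp G \<Otimes>\<^sub>M lborel) (disk G \<times> face_in G s (V t))
       (\<lambda>(y, u). ell G (u \<bullet> axis G - V t) * fm t (face_point G s (X t) y) u)"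

definition force ::
  "'a::euclidean_space body_gas \<Rightarrow> (real \<Rightarrow> real) \<Rightarrow> (real \<Rightarrow> real) \<Rightarrow>
   (real \<Rightarrow> 'a \<Rightarrow> 'a \<Rightarrow> real) \<Rightarrow> real \<Rightarrow> real" where
  "force G X V fm t = face_force G X V fm 1 t - face_force G X V fm (- 1) t"

definition bounded_on ::
  "(real \<times> 'a \<times> 'a) set \<Rightarrow> (real \<Rightarrow> 'a \<Rightarrow> 'a \<Rightarrow> real) \<Rightarrow> bool" where
  "bounded_on S f \<longleftrightarrow> (\<exists>M. \<forall>(t, x, v)\<in>S. \<bar>f t x v\<bar> \<le> M)"

text \<open>
  \<open>fm\<close> and \<open>fp\<close> are the pre- and postcollision densities. Boundedness of \<open>fp\<close> is kept apart from
  this definition because it needs \<open>bounded_emission\<close>, see below.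
\<close>
definition solution ::
  "'a::euclidean_space body_gas \<Rightarrow> real \<Rightarrow> real \<Rightarrow> real \<Rightarrow> (real \<Rightarrow> real) \<Rightarrow> (real \<Rightarrow> real) \<Rightarrow>
   (real \<Rightarrow> 'a \<Rightarrow> 'a \<Rightarrow> real) \<Rightarrow> (real \<Rightarrow> 'a \<Rightarrow> 'a \<Rightarrow> real) \<Rightarrow> bool" where
  "solution G E X0 V0 X V fm fp \<longleftrightarrow>
     X 0 = X0 \<and> (\<forall>t\<ge>0. (X has_real_derivative V t) (at t within {0..})) \<and>
     V 0 = V0 \<and> (\<forall>t\<ge>0. (V has_real_derivative (E - force G X V fm t)) (at t within {0..})) \<and>
     continuous_on {0..} (\<lambda>t. E - force G X V fm t) \<and>
     (\<forall>t\<ge>0. \<forall>s\<in>{1, -1}. force_converges G X V fm s t) \<and>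
     set_borel_measurable borel (in_phase G X V) (\<lambda>(t, x, u). fm t x u) \<and>
     set_borel_measurable borel (out_phase G X V) (\<lambda>(t, x, v). fp t x v) \<and>
     bounded_on (in_phase G X V) fm \<and>
     pre_law G X V fm fp \<and> post_law G X V fm fp"

text \<open>
  Boundedness of the densities that the undisturbed gas \<^const>\<open>f0\<close> produces by one reflection, at an
  end that moves with a velocity near \<open>Vinf\<close>, and at the lateral boundary. For \<open>|v\<^sub>x|\<close> large, or
  on the lateral boundary, the other assumptions allow these integrals to be unbounded or
  infinite, and then the postcollision densities are not in \<open>L\<^sup>\<infinity>\<close>.
\<close>
definition bounded_emission :: "'a::euclidean_space body_gas \<Rightarrow> real \<Rightarrow> real \<Rightarrow> bool" where
  "bounded_emission G Vinf \<gamma> \<longleftrightarrow>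
     (\<exists>M::real. \<forall>w\<in>{Vinf - \<gamma><..<Vinf + \<gamma>}. \<forall>v.
        (\<integral>\<^sup>+u. ennreal (K G (v - w *\<^sub>R axis G) (u - w *\<^sub>R axis G) * f0 G u) \<partial>lborel) \<le> ennreal M) \<and>
     (\<exists>M::real. \<forall>n\<in>hyperplane G. norm n = 1 \<longrightarrow> (\<forall>v. v \<bullet> n \<ge> 0 \<longrightarrow>
        (\<integral>\<^sup>+u\<in>{u. u \<bullet> n \<le> 0}. ennreal (latker G n v u * f0 G u) \<partial>lborel) \<le> ennreal M))"

end

theory Submission
  imports Defs "HOL-Library.Diagonal_Subsequence"
begin

text \<open>
  The force is \<open>F0 (V t)\<close> plus the drags of the particles that hit an end for at least the second
  time. Such a particle has mean velocity \<open>(X t - X \<tau>) / (t - \<tau>)\<close> since its latest collision time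
  \<open>\<tau>\<close> and a transversal velocity of order \<open>radius / (t - \<tau>)\<close>; this gives the power
  \<open>t powr - (d + p)\<close>. As all axial velocities involved lie in a short interval, the density
  reemitted by an end differs little from its value for fresh particles, and by the irreversal criterion the
  reemitted particles outnumber the particles of \<open>f0\<close> that they replace. Hence the left end is pushed
  forward, while the drag at the right end is of higher order in \<open>V - Vinf\<close>. A continuity argument for
  \<open>V - Vinf\<close> turns these estimates into the two bounds, for \<open>V\<close> replaced in the force by its
  truncation to a neighbourhood of \<open>Vinf\<close> as well, so that it is enough to solve the truncated
  problem. The latter is solved by Tonelli's delay scheme: the latest collision time depends continuously on the
  motion except for the countably many velocities of particles that touch an end tangentially, and
  therefore so does the force.
\<close>

section \<open>Separation of the axial velocity component\<close>

text \<open>The exponent d + p is a count. A recolliding particle transfers momentum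
  \<open>ell\<close>, of order p in its axial velocity relative to the end; the axial velocities
  fill an interval of the same order as that relative velocity, which gives one more factor; the
  transversal velocities fill a (d-1)-dimensional ball of radius of order 1 / t. Two obstacles shape
  the proof. The bounds concern every solution and uniqueness is not established, so the estimates
  must hold for arbitrary densities that obey the boundary laws, not only for constructed ones; they
  are derived from these laws and the boundedness of \<open>fm\<close>, by following a particle back
  through its collisions. And the latest collision time jumps at some velocities when the motion is
  perturbed, so what is proved about the dependence of the force on the motion is continuity, not a
  Lipschitz estimate. Existence therefore rests on compactness; a contraction is used only to find
  the reemitted densities for a given motion.\<close>

lemma sets_lperp: "sets (lperp G) = sets (restrict_space borel (hyperplane G))"
  by (simp add: lperp_def)

lemma space_lperp: "space (lperp G) = hyperplane G"
  by (simp add: lperp_def space_restrict_space)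

lemma borel_measurable_lperp: "f \<in> borel_measurable borel \<Longrightarrow> f \<in> borel_measurable (lperp G)"
  by (subst measurable_cong_sets[OF sets_lperp refl]) (rule measurable_restrict_space1)

lemma closed_hyperplane: "closed (hyperplane G)"
  unfolding hyperplane_def by (intro closed_Collect_eq continuous_intros)

lemma hyperplane_borel [measurable]: "hyperplane G \<in> sets borel"
  by (rule borel_closed[OF closed_hyperplane])

lemma sets_lperp_iff: "A \<in> sets (lperp G) \<longleftrightarrow> A \<in> sets borel \<and> A \<subseteq> hyperplane G"
  unfolding sets_lperp by (subst sets_restrict_space_iff) auto

lemma incl_lperp: "(\<lambda>y. y) \<in> measurable (lperp G) borel"
  by (rule borel_measurable_lperp) simp

lemma continuous_perp [continuous_intros]: "continuous_on S (perp G)"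
  unfolding perp_def by (intro continuous_intros)

lemma borel_measurable_perp [measurable]: "perp G \<in> borel_measurable borel"
  by (intro borel_measurable_continuous_onI continuous_intros)

lemma closed_disk: "closed (disk G)"
proof -
  have "disk G = hyperplane G \<inter> cball 0 (radius G)"
    by (auto simp: disk_def)
  then show ?thesis
    using closed_hyperplane by auto
qed

lemma disk_lperp [measurable]: "disk G \<in> sets (lperp G)"
  using closed_disk by (auto simp: sets_lperp_iff disk_def)

lemma component_measurable:
  "b \<in> B \<Longrightarrow> (\<lambda>f. f b) \<in> borel_measurable (\<Pi>\<^sub>M b\<in>B. (lborel :: real measure))"
  using measurable_component_singleton[of b B "\<lambda>_. lborel :: real measure"]
  by (simp add: measurable_cong_sets[OF refl sets_lborel])

locale axial =
  fixes G :: "'a::euclidean_space body_gas"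
  assumes axis_Basis [simp]: "axis G \<in> Basis"
begin

lemma axis_inner [simp]: "axis G \<bullet> axis G = 1"
  using axis_Basis inner_Basis by fastforce

lemma perp_hyperplane [simp]: "perp G v \<in> hyperplane G"
  by (simp add: perp_def hyperplane_def inner_diff_left)

lemma perp_inner [simp]: "perp G v \<bullet> axis G = 0"
  by (simp add: perp_def inner_diff_left)

lemma perp_id: "y \<in> hyperplane G \<Longrightarrow> perp G y = y"
  by (simp add: perp_def hyperplane_def)

lemma decompose: "(v \<bullet> axis G) *\<^sub>R axis G + perp G v = v"
  by (simp add: perp_def)

lemma combine_inner [simp]: "y \<in> hyperplane G \<Longrightarrow> (z *\<^sub>R axis G + y) \<bullet> axis G = z"
  by (simp add: hyperplane_def inner_add_left)

lemma combine_perp [simp]: "y \<in> hyperplane G \<Longrightarrow> perp G (z *\<^sub>R axis G + y) = y"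
  by (simp add: perp_def hyperplane_def inner_add_left)

lemma perp_diff: "perp G (u - v) = perp G u - perp G v"
  by (simp add: perp_def inner_diff_left algebra_simps)

lemma perp_add: "perp G (u + v) = perp G u + perp G v"
  by (simp add: perp_def inner_add_left algebra_simps)

lemma perp_scaleR: "perp G (c *\<^sub>R u) = c *\<^sub>R perp G u"
  by (simp add: perp_def algebra_simps)

lemma perp_axis [simp]: "perp G (axis G) = 0"
  by (simp add: perp_def)

definition embed :: "('a \<Rightarrow> real) \<Rightarrow> 'a" where
  "embed f = (\<Sum>b\<in>Basis - {axis G}. f b *\<^sub>R b)"

lemma embed_hyperplane: "embed f \<in> hyperplane G"
proof -
  have "(\<Sum>b\<in>Basis - {axis G}. f b * (b \<bullet> axis G)) = 0"
    by (rule sum.neutral) (auto simp: inner_Basis)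
  then show ?thesis
    by (simp add: embed_def hyperplane_def inner_sum_left)
qed

lemma embed_inner: "b \<in> Basis - {axis G} \<Longrightarrow> embed f \<bullet> b = f b"
  by (auto simp: embed_def inner_sum_left inner_Basis if_distrib cong: if_cong)

lemma embed_measurable [measurable]:
  "embed \<in> measurable (\<Pi>\<^sub>M b\<in>Basis - {axis G}. lborel) (restrict_space borel (hyperplane G))"
proof (rule measurable_restrict_space2)
  show "embed \<in> (\<Pi>\<^sub>M b\<in>Basis - {axis G}. lborel) \<rightarrow>\<^sub>M borel"
    unfolding embed_def
    by (intro borel_measurable_sum borel_measurable_scaleR borel_measurable_const component_measurable)
qed (auto simp: embed_hyperplane)

lemma lperp_embed: "lperp G = distr (\<Pi>\<^sub>M b\<in>Basis - {axis G}. lborel) (restrict_space borel (hyperplane G)) embed"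
  unfolding lperp_def embed_def by simp

text \<open>Lebesgue measure is the image of a product over \<open>Basis\<close>; splitting off the
  factor of the axis leaves exactly the product that defines \<open>lperp\<close>.\<close>

lemma nn_integral_lborel_split:
  assumes [measurable]: "f \<in> borel_measurable borel"
  shows "(\<integral>\<^sup>+u. f u \<partial>lborel) = (\<integral>\<^sup>+z. \<integral>\<^sup>+y. f (z *\<^sub>R axis G + y) \<partial>lperp G \<partial>lborel)"
proof -
  interpret P: product_sigma_finite "\<lambda>b::'a. lborel :: real measure"
    by standard
  let ?B = "Basis - {axis G}"
  have B: "(Basis :: 'a set) = insert (axis G) ?B"
    by auto
  have sum_eq: "(\<Sum>b\<in>Basis. (g(axis G := z)) b *\<^sub>R b) = z *\<^sub>R axis G + embed g" for g z
    by (subst B, subst sum.insert) (auto simp: embed_def)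
  have "(\<integral>\<^sup>+u. f u \<partial>lborel) = (\<integral>\<^sup>+g. f (\<Sum>b\<in>Basis. g b *\<^sub>R b) \<partial>(\<Pi>\<^sub>M b\<in>Basis. lborel))"
    by (subst lborel_eq, subst nn_integral_distr)
       (auto intro!: borel_measurable_sum borel_measurable_scaleR component_measurable)
  also have "\<dots> = (\<integral>\<^sup>+g. f (\<Sum>b\<in>Basis. g b *\<^sub>R b) \<partial>(\<Pi>\<^sub>M b\<in>insert (axis G) ?B. lborel))"
    using B by simp
  also have "\<dots> = (\<integral>\<^sup>+z. \<integral>\<^sup>+g. f (\<Sum>b\<in>Basis. (g(axis G := z)) b *\<^sub>R b) \<partial>(\<Pi>\<^sub>M b\<in>?B. lborel) \<partial>lborel)"
  proof (rule P.product_nn_integral_insert_rev)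
    have "(\<lambda>g. \<Sum>b\<in>insert (axis G) ?B. g b *\<^sub>R b) \<in> borel_measurable (\<Pi>\<^sub>M b\<in>insert (axis G) ?B. (lborel :: real measure))"
      by (intro borel_measurable_sum borel_measurable_scaleR borel_measurable_const component_measurable)
    then show "(\<lambda>g. f (\<Sum>b\<in>Basis. g b *\<^sub>R b)) \<in> borel_measurable (\<Pi>\<^sub>M b\<in>insert (axis G) ?B. (lborel :: real measure))"
      unfolding B[symmetric] by measurable
  qed auto
  also have "\<dots> = (\<integral>\<^sup>+z. \<integral>\<^sup>+y. f (z *\<^sub>R axis G + y) \<partial>lperp G \<partial>lborel)"
    unfolding sum_eq lperp_embed
    by (intro nn_integral_cong, subst nn_integral_distr)
       (auto intro!: measurable_restrict_space1)
  finally show ?thesis .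
qed

text \<open>Cubes are the sets whose transversal measure can be read off the product; balls are then
  compared with them. This also covers d = 1, where the exponent d - 1 is 0 and the measure is
  1.\<close>

definition perp_box :: "real \<Rightarrow> 'a set" where
  "perp_box \<rho> = {y \<in> hyperplane G. \<forall>b\<in>Basis - {axis G}. \<bar>y \<bullet> b\<bar> \<le> \<rho>}"

lemma perp_box_sets [measurable]: "perp_box \<rho> \<in> sets (lperp G)"
proof -
  have "perp_box \<rho> = hyperplane G \<inter> (\<Inter>b\<in>Basis - {axis G}. {y. \<bar>y \<bullet> b\<bar> \<le> \<rho>})"
    by (auto simp: perp_box_def)
  moreover have "closed \<dots>"
    by (intro closed_Int closed_hyperplane closed_INT ballI closed_Collect_le continuous_intros)
  ultimately show ?thesis
    by (auto simp: sets_lperp_iff)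
qed

lemma emeasure_perp_box:
  assumes "\<rho> \<ge> 0"
  shows "emeasure (lperp G) (perp_box \<rho>) = ennreal ((2 * \<rho>) ^ (DIM('a) - 1))"
proof -
  interpret P: product_sigma_finite "\<lambda>b::'a. lborel :: real measure"
    by standard
  let ?B = "Basis - {axis G}"
  have abs_iff: "\<bar>x\<bar> \<le> \<rho> \<longleftrightarrow> - \<rho> \<le> x \<and> x \<le> \<rho>" for x
    by linarith
  have "emeasure (lperp G) (perp_box \<rho>)
      = emeasure (\<Pi>\<^sub>M b\<in>?B. lborel) (embed -` perp_box \<rho> \<inter> space (\<Pi>\<^sub>M b\<in>?B. lborel))"
    using perp_box_sets[of \<rho>] unfolding lperp_embed by (subst emeasure_distr) auto
  also have "embed -` perp_box \<rho> \<inter> space (\<Pi>\<^sub>M b\<in>?B. lborel) = Pi\<^sub>E ?B (\<lambda>b. {-\<rho>..\<rho>})"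
  proof (rule set_eqI)
    fix f :: "'a \<Rightarrow> real"
    have "embed f \<in> perp_box \<rho> \<longleftrightarrow> (\<forall>b\<in>?B. \<bar>f b\<bar> \<le> \<rho>)"
      unfolding perp_box_def using embed_hyperplane embed_inner by simp
    moreover have "\<dots> \<longleftrightarrow> (\<forall>b\<in>?B. f b \<in> {-\<rho>..\<rho>})"
      unfolding abs_iff by simp
    moreover have "f \<in> space (\<Pi>\<^sub>M b\<in>?B. (lborel :: real measure)) \<longleftrightarrow> f \<in> extensional ?B"
      by (simp add: space_PiM PiE_def)
    ultimately show "f \<in> embed -` perp_box \<rho> \<inter> space (\<Pi>\<^sub>M b\<in>?B. lborel) \<longleftrightarrow> f \<in> Pi\<^sub>E ?B (\<lambda>b. {-\<rho>..\<rho>})"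
      unfolding PiE_iff Int_iff vimage_eq by blast
  qed
  also have "emeasure (\<Pi>\<^sub>M b\<in>?B. lborel) \<dots> = (\<Prod>b\<in>?B. emeasure lborel {-\<rho>..\<rho>})"
    by (rule P.emeasure_PiM) auto
  also have "\<dots> = ennreal ((2 * \<rho>) ^ (DIM('a) - 1))"
    using assms by (simp add: ennreal_power)
  finally show ?thesis .
qed

lemma sigma_finite_lperp: "sigma_finite_measure (lperp G)"
proof
  let ?A = "range (\<lambda>n::nat. perp_box (real n))"
  have "y \<in> \<Union> ?A" if "y \<in> hyperplane G" for y
  proof -
    obtain n :: nat where n: "norm y \<le> real n"
      using real_arch_simple by blast
    have "\<bar>y \<bullet> b\<bar> \<le> real n" if "b \<in> Basis" for b
      using Basis_le_norm[OF that, of y] n by linarith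
    then show ?thesis
      using that by (auto simp: perp_box_def)
  qed
  moreover have "\<Union> ?A \<subseteq> hyperplane G"
    by (auto simp: perp_box_def)
  ultimately have "\<Union> ?A = space (lperp G)"
    by (auto simp: space_lperp)
  then show "\<exists>A. countable A \<and> A \<subseteq> sets (lperp G) \<and> \<Union> A = space (lperp G) \<and> (\<forall>a\<in>A. emeasure (lperp G) a \<noteq> \<infinity>)"
    by (intro exI[of _ ?A]) (auto simp: emeasure_perp_box)
qed

sublocale lp: sigma_finite_measure "lperp G"
  by (rule sigma_finite_lperp)

sublocale lpair: pair_sigma_finite "lborel :: real measure" "lperp G" ..

lemma combine_measurable [measurable]:
  "(\<lambda>(z, y). z *\<^sub>R axis G + y) \<in> borel_measurable (lborel \<Otimes>\<^sub>M lperp G)"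
  unfolding case_prod_beta
  by (intro borel_measurable_add borel_measurable_scaleR measurable_compose[OF measurable_snd incl_lperp]) measurable

lemma lborel_eq_pair: "(lborel :: 'a measure) = distr (lborel \<Otimes>\<^sub>M lperp G) borel (\<lambda>(z, y). z *\<^sub>R axis G + y)"
proof (rule measure_eqI)
  fix A :: "'a set"
  assume "A \<in> sets lborel"
  then have [measurable]: "A \<in> sets borel"
    by simp
  have "emeasure lborel A = (\<integral>\<^sup>+u. indicator A u \<partial>lborel)"
    by simp
  also have "\<dots> = (\<integral>\<^sup>+z. \<integral>\<^sup>+y. indicator A (z *\<^sub>R axis G + y) \<partial>lperp G \<partial>lborel)"
    by (rule nn_integral_lborel_split) simp
  also have "\<dots> = (\<integral>\<^sup>+x. indicator A (case x of (z, y) \<Rightarrow> z *\<^sub>R axis G + y) \<partial>(lborel \<Otimes>\<^sub>M lperp G))"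
    by (subst lp.nn_integral_fst[symmetric]) auto
  also have "\<dots> = (\<integral>\<^sup>+x. indicator A x \<partial>distr (lborel \<Otimes>\<^sub>M lperp G) borel (\<lambda>(z, y). z *\<^sub>R axis G + y))"
    by (subst nn_integral_distr) auto
  finally show "emeasure lborel A = emeasure (distr (lborel \<Otimes>\<^sub>M lperp G) borel (\<lambda>(z, y). z *\<^sub>R axis G + y)) A"
    by simp
qed simp

lemma integrable_lborel_pair:
  fixes f :: "'a \<Rightarrow> real"
  assumes "f \<in> borel_measurable borel"
  shows "integrable lborel f \<longleftrightarrow> integrable (lborel \<Otimes>\<^sub>M lperp G) (\<lambda>(z, y). f (z *\<^sub>R axis G + y))"
  using assms by (subst lborel_eq_pair, subst integrable_distr_eq) (auto simp: case_prod_unfold)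

lemma integral_lborel_pair:
  fixes f :: "'a \<Rightarrow> real"
  assumes "f \<in> borel_measurable borel"
  shows "integral\<^sup>L lborel f = integral\<^sup>L (lborel \<Otimes>\<^sub>M lperp G) (\<lambda>(z, y). f (z *\<^sub>R axis G + y))"
  using assms by (subst lborel_eq_pair, subst integral_distr) (auto simp: case_prod_unfold)

lemma integral_lborel_split:
  fixes f :: "'a \<Rightarrow> real"
  assumes "integrable lborel f"
  shows "integral\<^sup>L lborel f = (LINT z|lborel. LINT y|lperp G. f (z *\<^sub>R axis G + y))"
proof -
  have [measurable]: "f \<in> borel_measurable borel"
    using assms by auto
  then show ?thesis
    using assms integrable_lborel_pair[of f] integral_lborel_pair[of f] lpair.integral_fst'[of "\<lambda>(z, y). f (z *\<^sub>R axis G + y)"]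
    by auto
qed

text \<open>The majorants and the undisturbed density all factor in this way, so their integrals
  over velocity space reduce to an axial integral times a transversal mass.\<close>

lemma has_integral_product:
  fixes g :: "real \<Rightarrow> real" and h :: "'a \<Rightarrow> real"
  assumes g: "integrable lborel g" and h: "integrable (lperp G) h"
  shows "integrable lborel (\<lambda>u. g (u \<bullet> axis G) * h (perp G u))" (is ?I)
    and "(LINT u|lborel. g (u \<bullet> axis G) * h (perp G u)) = (LINT z|lborel. g z) * (LINT y|lperp G. h y)" (is ?E)
proof -
  have gm [measurable]: "g \<in> borel_measurable borel" and hm [measurable]: "h \<in> borel_measurable (lperp G)"
    using g h by auto
  have pm: "perp G \<in> measurable borel (lperp G)"
    by (subst measurable_cong_sets[OF refl sets_lperp]) (auto intro!: measurable_restrict_space2)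
  have m: "(\<lambda>u. g (u \<bullet> axis G) * h (perp G u)) \<in> borel_measurable borel"
    using measurable_compose[OF pm hm] by measurable
  have gp: "integrable (lborel \<Otimes>\<^sub>M lperp G) (\<lambda>x. g (fst x) * h (snd x))"
  proof (rule lpair.Fubini_integrable)
    show "integrable lborel (\<lambda>x. LINT y|lperp G. norm (g (fst (x, y)) * h (snd (x, y))))"
      using g by (simp add: abs_mult)
    show "AE x in lborel. integrable (lperp G) (\<lambda>y. g (fst (x, y)) * h (snd (x, y)))"
      using h by simp
  qed measurable
  have eq: "(\<lambda>(z, y). g ((z *\<^sub>R axis G + y) \<bullet> axis G) * h (perp G (z *\<^sub>R axis G + y))) x = g (fst x) * h (snd x)"
    if "x \<in> space (lborel \<Otimes>\<^sub>M lperp G)" for x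
    using that by (auto simp: space_pair_measure space_lperp)
  show ?I
    unfolding integrable_lborel_pair[OF m] using gp
    by (subst Bochner_Integration.integrable_cong[OF refl eq]) auto
  have "(LINT u|lborel. g (u \<bullet> axis G) * h (perp G u)) = (LINT x|(lborel \<Otimes>\<^sub>M lperp G). g (fst x) * h (snd x))"
    unfolding integral_lborel_pair[OF m] by (rule Bochner_Integration.integral_cong[OF refl eq])
  also have "\<dots> = (LINT z|lborel. LINT y|lperp G. g z * h y)"
    using lpair.integral_fst'[OF gp] by simp
  finally show ?E
    by simp
qed

lemma nn_integral_product:
  assumes g [measurable]: "g \<in> borel_measurable borel" and h [measurable]: "h \<in> borel_measurable (lperp G)"
  shows "(\<integral>\<^sup>+u. g (u \<bullet> axis G) * h (perp G u) \<partial>lborel) = (\<integral>\<^sup>+z. g z \<partial>lborel) * (\<integral>\<^sup>+y. h y \<partial>lperp G)"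
proof -
  have pm [measurable]: "perp G \<in> measurable borel (lperp G)"
    by (subst measurable_cong_sets[OF refl sets_lperp]) (auto intro!: measurable_restrict_space2)
  have "(\<integral>\<^sup>+u. g (u \<bullet> axis G) * h (perp G u) \<partial>lborel)
     = (\<integral>\<^sup>+z. \<integral>\<^sup>+y. g ((z *\<^sub>R axis G + y) \<bullet> axis G) * h (perp G (z *\<^sub>R axis G + y)) \<partial>lperp G \<partial>lborel)"
    by (rule nn_integral_lborel_split) measurable
  also have "\<dots> = (\<integral>\<^sup>+z. \<integral>\<^sup>+y. g z * h y \<partial>lperp G \<partial>lborel)"
    by (intro nn_integral_cong) (auto simp: space_lperp)
  also have "\<dots> = (\<integral>\<^sup>+z. g z \<partial>lborel) * (\<integral>\<^sup>+y. h y \<partial>lperp G)"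
    by (simp add: nn_integral_cmult nn_integral_multc)
  finally show ?thesis .
qed

section \<open>Volumes of transversal balls, and spheres as null sets\<close>

lemma ball_subset_perp_box: "y \<in> hyperplane G \<Longrightarrow> norm y \<le> \<rho> \<Longrightarrow> y \<in> perp_box \<rho>"
  using Basis_le_norm[of _ y] by (fastforce simp: perp_box_def)

lemma perp_box_subset_ball:
  assumes "y \<in> perp_box \<rho>" "\<rho> \<ge> 0"
  shows "norm y \<le> real DIM('a) * \<rho>"
proof -
  have "norm y \<le> (\<Sum>b\<in>Basis. \<bar>y \<bullet> b\<bar>)"
    by (rule norm_le_l1)
  also have "\<dots> \<le> (\<Sum>b\<in>(Basis::'a set). \<rho>)"
    using assms by (intro sum_mono) (auto simp: perp_box_def hyperplane_def)
  finally show ?thesis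
    by simp
qed

lemma emeasure_ball_le:
  assumes "\<rho> \<ge> 0"
  shows "emeasure (lperp G) {y \<in> hyperplane G. norm y \<le> \<rho>} \<le> ennreal ((2 * \<rho>) ^ (DIM('a) - 1))"
proof -
  have "{y \<in> hyperplane G. norm y \<le> \<rho>} \<subseteq> perp_box \<rho>"
    using ball_subset_perp_box by blast
  from emeasure_mono[OF this perp_box_sets] show ?thesis
    by (simp only: emeasure_perp_box[OF assms])
qed

lemma ball_lperp [measurable]: "{y \<in> hyperplane G. norm y \<le> \<rho>} \<in> sets (lperp G)"
proof -
  have "{y \<in> hyperplane G. norm y \<le> \<rho>} = hyperplane G \<inter> cball 0 \<rho>"
    by auto
  then show ?thesis
    using closed_Int[OF closed_hyperplane closed_cball] by (auto simp: sets_lperp_iff)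
qed

text \<open>The norm is at most the sum of the absolute coordinates, so the ball contains the cube
  of half side \<open>\<rho> / real DIM('a)\<close>.\<close>

lemma emeasure_ball_ge:
  assumes "\<rho> \<ge> 0"
  shows "ennreal ((2 * \<rho> / real DIM('a)) ^ (DIM('a) - 1)) \<le> emeasure (lperp G) {y \<in> hyperplane G. norm y \<le> \<rho>}"
proof -
  have "perp_box (\<rho> / real DIM('a)) \<subseteq> {y \<in> hyperplane G. norm y \<le> \<rho>}"
    using perp_box_subset_ball[of _ "\<rho> / real DIM('a)"] assms by (fastforce simp: perp_box_def)
  from emeasure_mono[OF this ball_lperp] show ?thesis
    using assms by (simp add: emeasure_perp_box)
qed

lemma measure_ball_ge:
  assumes "\<rho> \<ge> 0"
  shows "(2 * \<rho> / real DIM('a)) ^ (DIM('a) - 1) \<le> measure (lperp G) {y \<in> hyperplane G. norm y \<le> \<rho>}"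
proof -
  have "emeasure (lperp G) {y \<in> hyperplane G. norm y \<le> \<rho>} \<noteq> top"
    using emeasure_ball_le[OF assms] by (auto simp: top_unique)
  then have "emeasure (lperp G) {y \<in> hyperplane G. norm y \<le> \<rho>}
      = ennreal (measure (lperp G) {y \<in> hyperplane G. norm y \<le> \<rho>})"
    by (rule emeasure_eq_ennreal_measure)
  then show ?thesis
    using emeasure_ball_ge[OF assms] by simp
qed

lemma measure_ball_le:
  assumes "\<rho> \<ge> 0"
  shows "measure (lperp G) {y \<in> hyperplane G. norm y \<le> \<rho>} \<le> (2 * \<rho>) ^ (DIM('a) - 1)"
  using emeasure_ball_le[OF assms] assms by (simp add: measure_def enn2real_leI)

lemma disk_finite: "emeasure (lperp G) (disk G) < \<infinity>"
proof (cases "radius G \<ge> 0")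
  case True
  then show ?thesis
    using emeasure_ball_le[of "radius G"] by (auto simp: disk_def intro: le_less_trans)
next
  case False
  then have "disk G = {}"
    by (auto simp: disk_def) (meson norm_ge_zero order_trans)
  then show ?thesis
    by simp
qed

text \<open>By Fubini, since the boundary of the cylinder over the ball is a null set.\<close>
lemma perp_sphere_null:
  assumes "c \<noteq> 0" "\<rho> > 0" and a: "a \<in> hyperplane G"
  shows "AE w in lperp G. norm (a + c *\<^sub>R w) \<noteq> \<rho>"
proof -
  let ?f = "\<lambda>u. a + c *\<^sub>R perp G u"
  let ?C = "?f -` cball 0 \<rho>"
  have "linear (\<lambda>u. c *\<^sub>R perp G u)"
    by (rule linearI) (auto simp: perp_add perp_scaleR scaleR_add_right)
  then have "convex ((\<lambda>u. c *\<^sub>R perp G u) -` cball (- a) \<rho>)"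
    by (intro convex_linear_vimage convex_cball)
  moreover have "(\<lambda>u. c *\<^sub>R perp G u) -` cball (- a) \<rho> = ?C"
  proof -
    have "dist (- a) x = norm (a + x)" for x
      by (metis dist_norm norm_minus_cancel minus_add_distrib uminus_add_conv_diff add.commute diff_conv_add_uminus)
    then show ?thesis
      by auto
  qed
  ultimately have "convex ?C"
    by simp
  then have "negligible (frontier ?C)"
    by (rule negligible_convex_frontier)
  moreover have "{u. norm (?f u) = \<rho>} \<subseteq> frontier ?C"
  proof (rule subsetI)
    fix u assume "u \<in> {u. norm (?f u) = \<rho>}"
    then have u: "\<rho> = norm (?f u)"
      by simp
    have "u \<notin> interior ?C"
    proof
      assume "u \<in> interior ?C"
      then obtain e where e: "e > 0" "cball u e \<subseteq> ?C"
        by (meson mem_interior_cball)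
      define \<epsilon> where "\<epsilon> = e * \<bar>c\<bar> / \<rho>"
      have eps: "\<epsilon> > 0"
        using assms e by (simp add: \<epsilon>_def)
      \<comment> \<open>A displacement of length e that dilates \<open>?f u\<close> by the factor 1
        + \<epsilon>: it stays in the ball around u but leaves the cylinder.\<close>
      let ?u = "u + (\<epsilon> / c) *\<^sub>R ?f u"
      have "norm ((\<epsilon> / c) *\<^sub>R ?f u) = e"
        using assms(1,2) e(1) unfolding norm_scaleR u[symmetric] by (simp add: \<epsilon>_def abs_mult)
      then have "?u \<in> cball u e"
        by (simp add: dist_norm)
      then have "norm (?f ?u) \<le> \<rho>"
        using e by auto
      moreover have "?f ?u = (1 + \<epsilon>) *\<^sub>R ?f u"
        using assms by (simp add: perp_add perp_scaleR perp_id[OF a] perp_id algebra_simps)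
      then have "norm (?f ?u) = (1 + \<epsilon>) * \<rho>"
        using u eps by (metis abs_of_pos add_pos_pos norm_scaleR zero_less_one)
      moreover have "\<epsilon> * \<rho> > 0"
        using eps assms(2) by simp
      ultimately show False
        by (simp add: distrib_right)
    qed
    then show "u \<in> frontier ?C"
      using u closure_subset[of ?C] by (auto simp: frontier_def)
  qed
  ultimately have "negligible {u. norm (?f u) = \<rho>}"
    using negligible_subset by blast
  moreover have b: "{u. norm (?f u) = \<rho>} \<in> sets borel"
    by measurable
  ultimately have "emeasure lborel {u. norm (?f u) = \<rho>} = 0"
    by (auto simp: negligible_iff_null_sets null_sets_completion_iff)
  also have "emeasure lborel {u. norm (?f u) = \<rho>}
    = (\<integral>\<^sup>+u. 1 * indicator {w. norm (a + c *\<^sub>R w) = \<rho>} (perp G u) \<partial>lborel)"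
  proof -
    have "emeasure lborel {u. norm (?f u) = \<rho>} = (\<integral>\<^sup>+u. indicator {u. norm (?f u) = \<rho>} u \<partial>lborel)"
      using b by simp
    then show ?thesis
      by (simp add: indicator_def)
  qed
  \<comment> \<open>The axial factor is infinite, so the product can only vanish if the transversal
    factor does.\<close>
  also have "\<dots> = (\<integral>\<^sup>+z. 1 \<partial>(lborel :: real measure)) * (\<integral>\<^sup>+w. indicator {w. norm (a + c *\<^sub>R w) = \<rho>} w \<partial>lperp G)"
    by (rule nn_integral_product) (auto intro!: borel_measurable_lperp)
  finally have "(\<integral>\<^sup>+w. indicator {w. norm (a + c *\<^sub>R w) = \<rho>} w \<partial>lperp G) = 0"
    by (simp add: ennreal_top_mult split: if_splits)
  then have "AE w in lperp G. indicator {w. norm (a + c *\<^sub>R w) = \<rho>} w = (0::ennreal)"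
    by (subst (asm) nn_integral_0_iff_AE) (auto intro!: borel_measurable_lperp)
  then show ?thesis
    by eventually_elim (auto simp: indicator_def split: if_splits)
qed

end

section \<open>Recollision times\<close>

text \<open>The equation says that z is the mean velocity of the body over [\<tau>, t]. It is the
  axial half of the condition for a precollision; the transversal position does not enter, and
  neither does the choice of the end.\<close>

definition crossings :: "(real \<Rightarrow> real) \<Rightarrow> real \<Rightarrow> real \<Rightarrow> real set" where
  "crossings X t z = {\<tau>. 0 < \<tau> \<and> \<tau> < t \<and> X t - X \<tau> = (t - \<tau>) * z}"

definition last_crossing :: "(real \<Rightarrow> real) \<Rightarrow> real \<Rightarrow> real \<Rightarrow> real" where
  "last_crossing X t z = (GREATEST \<tau>. \<tau> \<in> crossings X t z)"

locale trajectory =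
  fixes X V :: "real \<Rightarrow> real"
  assumes X_deriv: "\<And>t. t \<ge> 0 \<Longrightarrow> (X has_real_derivative V t) (at t within {0..})"
    and V_cont: "continuous_on {0..} V"
begin

lemma X_cont: "continuous_on {0..} X"
  by (meson DERIV_continuous_on X_deriv atLeast_iff)

lemma X_mvt:
  assumes "0 \<le> \<tau>" "\<tau> < t"
  shows "\<exists>\<sigma>. \<tau> < \<sigma> \<and> \<sigma> < t \<and> X t - X \<tau> = (t - \<tau>) * V \<sigma>"
proof -
  have D: "(X has_real_derivative V \<sigma>) (at \<sigma>)" if "\<tau> < \<sigma>" "\<sigma> < t" for \<sigma>
  proof -
    have "at \<sigma> within {0..} = at \<sigma>"
      using that assms by (intro at_within_interior) (auto simp: interior_real_atLeast)
    then show ?thesis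
      using X_deriv[of \<sigma>] that assms by auto
  qed
  have "continuous_on {\<tau>..t} X"
    using X_cont by (rule continuous_on_subset) (use assms in auto)
  then obtain l \<sigma> where "\<tau> < \<sigma>" "\<sigma> < t" "(X has_real_derivative l) (at \<sigma>)" "X t - X \<tau> = (t - \<tau>) * l"
    using MVT[OF assms(2), of X] D by (metis real_differentiable_def)
  then show ?thesis
    using D DERIV_unique by blast
qed

lemma crossing_mean:
  assumes "\<tau> \<in> crossings X t z"
  obtains \<sigma> where "\<tau> < \<sigma>" "\<sigma> < t" "z = V \<sigma>"
proof -
  have "0 < \<tau>" "\<tau> < t" "X t - X \<tau> = (t - \<tau>) * z"
    using assms by (auto simp: crossings_def)
  then show ?thesis
    using X_mvt[of \<tau> t] that by auto
qed

text \<open>Mean velocities over short intervals before t are close to \<open>V t\<close>, hence on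
  the same side of z as \<open>V t\<close>. The sign s lets one statement serve both ends.\<close>

lemma no_crossing_near:
  assumes "t > 0" and s: "s * (z - V t) < 0"
  obtains \<eta> where "\<eta> > 0" "\<eta> \<le> t" "\<And>\<tau>. t - \<eta> < \<tau> \<Longrightarrow> \<tau> < t \<Longrightarrow> s * (X t - X \<tau> - (t - \<tau>) * z) > 0"
proof -
  have "(V \<longlongrightarrow> V t) (at t within {0..})"
    using V_cont assms by (auto simp: continuous_on_def)
  then have "((\<lambda>\<sigma>. s * (V \<sigma> - z)) \<longlongrightarrow> s * (V t - z)) (at t within {0..})"
    by (intro tendsto_intros)
  moreover have "s * (V t - z) > 0"
    using s by (simp add: algebra_simps)
  ultimately have "\<forall>\<^sub>F \<sigma> in at t within {0..}. s * (V \<sigma> - z) > 0"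
    using order_tendstoD(1) by blast
  then obtain d where d: "d > 0" "\<And>\<sigma>. \<sigma> \<ge> 0 \<Longrightarrow> \<sigma> \<noteq> t \<Longrightarrow> dist \<sigma> t < d \<Longrightarrow> s * (V \<sigma> - z) > 0"
    by (auto simp: eventually_at)
  show ?thesis
  proof (rule that[of "min d t"])
    fix \<tau> assume tau: "t - min d t < \<tau>" "\<tau> < t"
    then have "0 \<le> \<tau>"
      by linarith
    then obtain \<sigma> where \<sigma>: "\<tau> < \<sigma>" "\<sigma> < t" "X t - X \<tau> = (t - \<tau>) * V \<sigma>"
      using X_mvt[of \<tau> t] tau by auto
    have "s * (V \<sigma> - z) > 0"
      using tau \<sigma> \<open>0 \<le> \<tau>\<close> by (intro d) (auto simp: dist_real_def)
    then have "(t - \<tau>) * (s * (V \<sigma> - z)) > 0"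
      using tau by simp
    then show "s * (X t - X \<tau> - (t - \<tau>) * z) > 0"
      unfolding \<sigma>(3) by (simp add: algebra_simps)
  qed (use d assms in auto)
qed

lemma crossing_continuous: "continuous_on {0..} (\<lambda>\<tau>. X t - X \<tau> - (t - \<tau>) * z)"
  by (intro continuous_intros X_cont)

text \<open>Crossing times stay away from t when z differs from \<open>V t\<close>; so those after a
  given one form a compact set and have a maximum.\<close>

lemma last_crossing:
  assumes z: "z \<noteq> V t" and ne: "crossings X t z \<noteq> {}"
  shows "last_crossing X t z \<in> crossings X t z"
    and "\<And>\<tau>. \<tau> \<in> crossings X t z \<Longrightarrow> \<tau> \<le> last_crossing X t z"
proof -
  obtain \<tau>0 where \<tau>0: "\<tau>0 \<in> crossings X t z"
    using ne by auto
  then have t: "0 < \<tau>0" "\<tau>0 < t"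
    by (auto simp: crossings_def)
  define s where "s = (if z < V t then 1 else - 1 :: real)"
  have s: "s * (z - V t) < 0"
    using z by (auto simp: s_def)
  obtain \<eta> where \<eta>: "\<eta> > 0" "\<eta> \<le> t"
      "\<And>\<tau>. t - \<eta> < \<tau> \<Longrightarrow> \<tau> < t \<Longrightarrow> s * (X t - X \<tau> - (t - \<tau>) * z) > 0"
    using no_crossing_near[of t s z] s t by auto
  have le: "\<tau> \<le> t - \<eta>" if "\<tau> \<in> crossings X t z" for \<tau>
    using \<eta>(3)[of \<tau>] that by (force simp: crossings_def)
  \<comment> \<open>Starting at a known crossing turns the open condition \<open>0 < \<tau>\<close>
    into a closed one without losing the maximum.\<close>
  let ?S = "{\<tau> \<in> {\<tau>0..t - \<eta>}. X t - X \<tau> - (t - \<tau>) * z = 0}"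
  have "continuous_on {\<tau>0..t - \<eta>} (\<lambda>\<tau>. X t - X \<tau> - (t - \<tau>) * z)"
    by (rule continuous_on_subset[OF crossing_continuous]) (use t in auto)
  then have "closed ({\<tau>0..t - \<eta>} \<inter> (\<lambda>\<tau>. X t - X \<tau> - (t - \<tau>) * z) -` {0})"
    by (rule continuous_closed_preimage) auto
  then have "compact ({\<tau>0..t - \<eta>} \<inter> (\<lambda>\<tau>. X t - X \<tau> - (t - \<tau>) * z) -` {0})"
    by (meson bounded_closed_interval bounded_Int compact_eq_bounded_closed)
  moreover have "({\<tau>0..t - \<eta>} \<inter> (\<lambda>\<tau>. X t - X \<tau> - (t - \<tau>) * z) -` {0}) = ?S"
    by auto
  ultimately have "compact ?S"
    by simp
  moreover have "\<tau>0 \<in> ?S"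
    using \<tau>0 le[OF \<tau>0] by (auto simp: crossings_def)
  then have "?S \<noteq> {}"
    by blast
  ultimately obtain m where m: "m \<in> ?S" "\<And>\<tau>. \<tau> \<in> ?S \<Longrightarrow> \<tau> \<le> m"
    using compact_attains_sup[of ?S] by blast
  have mc: "m \<in> crossings X t z"
    using m(1) t \<eta> by (auto simp: crossings_def)
  have mx: "\<tau> \<le> m" if "\<tau> \<in> crossings X t z" for \<tau>
  proof (cases "\<tau> \<ge> \<tau>0")
    case True
    then show ?thesis
      using that le[OF that] by (intro m(2)) (auto simp: crossings_def)
  next
    case False
    then show ?thesis
      using m(1) by auto
  qed
  have "last_crossing X t z = m"
    unfolding last_crossing_def using mc mx by (intro Greatest_equality)
  then show "last_crossing X t z \<in> crossings X t z"
    and "\<And>\<tau>. \<tau> \<in> crossings X t z \<Longrightarrow> \<tau> \<le> last_crossing X t z"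
    using mc mx by auto
qed

text \<open>By the intermediate value theorem the sign found just before t persists backwards as
  long as no crossing occurs.\<close>

lemma sign_after_last_crossing:
  assumes s: "s * (z - V t) < 0" "0 \<le> a"
    and no: "\<And>\<tau>. a < \<tau> \<Longrightarrow> \<tau> < t \<Longrightarrow> \<tau> \<notin> crossings X t z"
    and \<tau>: "a < \<tau>" "\<tau> < t"
  shows "s * (X t - X \<tau> - (t - \<tau>) * z) > 0"
proof (rule ccontr)
  assume neg: "\<not> ?thesis"
  obtain \<eta> where \<eta>: "\<eta> > 0" "\<eta> \<le> t"
      "\<And>\<tau>. t - \<eta> < \<tau> \<Longrightarrow> \<tau> < t \<Longrightarrow> s * (X t - X \<tau> - (t - \<tau>) * z) > 0"
    using no_crossing_near[of t s z] s \<tau> by auto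
  define \<sigma> where "\<sigma> = max \<tau> (t - \<eta> / 2)"
  have \<sigma>: "\<tau> \<le> \<sigma>" "\<sigma> < t" "s * (X t - X \<sigma> - (t - \<sigma>) * z) > 0"
    using \<tau> \<eta> by (auto simp: \<sigma>_def intro!: \<eta>(3))
  have "continuous_on {\<tau>..\<sigma>} (\<lambda>\<tau>. s * (X t - X \<tau> - (t - \<tau>) * z))"
    by (intro continuous_intros continuous_on_subset[OF X_cont]) (use \<tau> s in auto)
  then obtain \<rho> where "\<tau> \<le> \<rho>" "\<rho> \<le> \<sigma>" "s * (X t - X \<rho> - (t - \<rho>) * z) = 0"
    using IVT'[of "\<lambda>\<tau>. s * (X t - X \<tau> - (t - \<tau>) * z)" \<tau> 0 \<sigma>] neg \<sigma> by auto
  moreover have "s \<noteq> 0"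
    using s by auto
  ultimately have "\<rho> \<in> crossings X t z"
    using \<tau> \<sigma> s by (auto simp: crossings_def)
  then show False
    using no[of \<rho>] \<open>\<tau> \<le> \<rho>\<close> \<open>\<rho> \<le> \<sigma>\<close> \<tau> \<sigma> by auto
qed

lemma sign_after_last:
  assumes s: "s * (z - V t) < 0" and ne: "crossings X t z \<noteq> {}"
    and \<tau>: "last_crossing X t z < \<tau>" "\<tau> < t"
  shows "s * (X t - X \<tau> - (t - \<tau>) * z) > 0"
proof (rule sign_after_last_crossing[OF s(1) _ _ \<tau>])
  have z: "z \<noteq> V t"
    using s by auto
  show "0 \<le> last_crossing X t z"
    using last_crossing(1)[OF z ne] by (auto simp: crossings_def)
  show "\<tau> \<notin> crossings X t z" if "last_crossing X t z < \<tau>" for \<tau>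
    using last_crossing(2)[OF z ne, of \<tau>] that by auto
qed

text \<open>This makes the reflection law applicable at the earlier collision. If z were strictly on
  the incoming side there, the gap from the crossing to a slightly later time and the gap from that
  time to t would both have the sign s, while their sum is zero.\<close>

lemma last_crossing_outgoing:
  assumes s: "s * (z - V t) < 0" and ne: "crossings X t z \<noteq> {}"
  shows "s * (z - V (last_crossing X t z)) \<ge> 0"
proof (rule ccontr)
  let ?m = "last_crossing X t z"
  assume neg: "\<not> ?thesis"
  have z: "z \<noteq> V t"
    using s by auto
  note m = last_crossing(1)[OF z ne]
  have m0: "0 < ?m" "?m < t"
    using m by (auto simp: crossings_def)
  have "((\<lambda>\<sigma>. s * (V \<sigma> - z)) \<longlongrightarrow> s * (V ?m - z)) (at ?m within {0..})"
    using V_cont m0 by (intro tendsto_intros) (auto simp: continuous_on_def)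
  moreover have "s * (V ?m - z) > 0"
    using neg by (simp add: algebra_simps)
  ultimately have "\<forall>\<^sub>F \<sigma> in at ?m within {0..}. s * (V \<sigma> - z) > 0"
    using order_tendstoD(1) by blast
  then obtain d where d: "d > 0" "\<And>\<sigma>. \<sigma> \<ge> 0 \<Longrightarrow> \<sigma> \<noteq> ?m \<Longrightarrow> dist \<sigma> ?m < d \<Longrightarrow> s * (V \<sigma> - z) > 0"
    by (auto simp: eventually_at)
  define \<tau> where "\<tau> = min ((?m + t) / 2) (?m + d / 2)"
  have \<tau>: "?m < \<tau>" "\<tau> < t" "\<tau> < ?m + d"
    using m0 d by (auto simp: \<tau>_def min_def field_simps)
  obtain \<sigma> where \<sigma>: "?m < \<sigma>" "\<sigma> < \<tau>" "X \<tau> - X ?m = (\<tau> - ?m) * V \<sigma>"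
    using X_mvt[of ?m \<tau>] \<tau> m0 by auto
  have "s * (V \<sigma> - z) > 0"
    using \<sigma> \<tau> m0 by (intro d) (auto simp: dist_real_def)
  then have "(\<tau> - ?m) * (s * (V \<sigma> - z)) > 0"
    using \<tau> by simp
  then have "s * (X \<tau> - X ?m - (\<tau> - ?m) * z) > 0"
    unfolding \<sigma>(3) by (simp add: algebra_simps)
  moreover have "s * (X t - X \<tau> - (t - \<tau>) * z) > 0"
    by (rule sign_after_last[OF s ne]) (use \<tau> in auto)
  moreover have "X t - X ?m - (t - ?m) * z = 0"
    using m by (auto simp: crossings_def)
  then have "s * (X t - X \<tau> - (t - \<tau>) * z) + s * (X \<tau> - X ?m - (\<tau> - ?m) * z) = 0"
    by (metis (no_types, opaque_lifting) distrib_left mult_zero_right add.commute add_diff_cancel diff_add_cancel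
        left_diff_distrib diff_diff_eq2 add_diff_eq)
  ultimately show False
    by linarith
qed

text \<open>The gap has opposite signs near time 0 and near time t. The lower bound of the drag
  needs recollisions, and they are produced here.\<close>

lemma crossing_exists:
  assumes z: "s * (z - V t) < 0" "s * (X t - X 0 - t * z) < 0" "t > 0"
  shows "crossings X t z \<noteq> {}"
proof
  assume "crossings X t z = {}"
  then have pos: "s * (X t - X \<tau> - (t - \<tau>) * z) > 0" if "0 < \<tau>" "\<tau> < t" for \<tau>
    using sign_after_last_crossing[OF z(1), of 0 \<tau>] that by auto
  have "((\<lambda>\<tau>. s * (X t - X \<tau> - (t - \<tau>) * z)) \<longlongrightarrow> s * (X t - X 0 - (t - 0) * z)) (at 0 within {0..})"
    using X_cont by (intro tendsto_intros) (auto simp: continuous_on_def)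
  then have "\<forall>\<^sub>F \<tau> in at 0 within {0..}. s * (X t - X \<tau> - (t - \<tau>) * z) < 0"
    using z(2) order_tendstoD(2) by fastforce
  then obtain d where d: "d > 0" "\<And>\<sigma>. \<sigma> \<ge> 0 \<Longrightarrow> \<sigma> \<noteq> 0 \<Longrightarrow> dist \<sigma> 0 < d \<Longrightarrow> s * (X t - X \<sigma> - (t - \<sigma>) * z) < 0"
    by (auto simp: eventually_at)
  have "s * (X t - X (min (d/2) (t/2)) - (t - min (d/2) (t/2)) * z) < 0"
    using d z by (intro d(2)) (auto simp: dist_real_def)
  moreover have "s * (X t - X (min (d/2) (t/2)) - (t - min (d/2) (t/2)) * z) > 0"
    using d z by (intro pos) (auto simp: min_def)
  ultimately show False
    by linarith
qed

end

section \<open>Precollisions in terms of axial and transversal components\<close>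

definition hit :: "'a::euclidean_space body_gas \<Rightarrow> (real \<Rightarrow> real) \<Rightarrow> real \<Rightarrow> 'a \<Rightarrow> real \<Rightarrow> 'a \<Rightarrow> bool" where
  "hit G X t y z w \<longleftrightarrow> crossings X t z \<noteq> {} \<and> norm (y - (t - last_crossing X t z) *\<^sub>R w) \<le> radius G"

definition origin :: "(real \<Rightarrow> real) \<Rightarrow> real \<Rightarrow> 'a::euclidean_space \<Rightarrow> real \<Rightarrow> 'a \<Rightarrow> 'a" where
  "origin X t y z w = y - (t - last_crossing X t z) *\<^sub>R w"

context axial
begin

lemma face_iff: "x \<in> face G s \<xi> \<longleftrightarrow> (\<exists>y\<in>disk G. x = face_point G s \<xi> y)"
proof
  assume x: "x \<in> face G s \<xi>"
  then show "\<exists>y\<in>disk G. x = face_point G s \<xi> y"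
    using decompose[of x] by (intro bexI[of _ "perp G x"]) (auto simp: face_def disk_def face_point_def)
next
  assume "\<exists>y\<in>disk G. x = face_point G s \<xi> y"
  then show "x \<in> face G s \<xi>"
    by (auto simp: face_def disk_def face_point_def)
qed

lemma face_point_perp [simp]: "y \<in> hyperplane G \<Longrightarrow> perp G (face_point G s \<xi> y) = y"
  by (simp add: face_point_def)

lemma face_point_inner [simp]: "y \<in> hyperplane G \<Longrightarrow> face_point G s \<xi> y \<bullet> axis G = \<xi> + s * halflen G"
  by (simp add: face_point_def)

lemma face_point_face: "y \<in> disk G \<Longrightarrow> face_point G s \<xi> y \<in> face G s \<xi>"
  using face_iff by blast

lemma hyperplane_diff: "y \<in> hyperplane G \<Longrightarrow> w \<in> hyperplane G \<Longrightarrow> y - c *\<^sub>R w \<in> hyperplane G"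
  by (simp add: hyperplane_def inner_diff_left)

lemma precollisions_iff:
  assumes "y \<in> disk G"
  shows "\<tau> \<in> precollisions G X s t (face_point G s (X t) y) u \<longleftrightarrow>
    \<tau> \<in> crossings X t (u \<bullet> axis G) \<and> norm (y - (t - \<tau>) *\<^sub>R perp G u) \<le> radius G"
proof -
  have y: "y \<in> hyperplane G"
    using assms by (simp add: disk_def)
  have "perp G (face_point G s (X t) y - c *\<^sub>R u) = y - c *\<^sub>R perp G u" for c
    using y by (simp add: perp_diff perp_scaleR)
  moreover have "(face_point G s (X t) y - c *\<^sub>R u) \<bullet> axis G = X \<tau> + s * halflen G \<longleftrightarrow> X t - X \<tau> = c * (u \<bullet> axis G)" for c
    using y by (auto simp: inner_diff_left)
  ultimately show ?thesis
    by (simp add: precollisions_def crossings_def face_def)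
qed

text \<open>The disk is convex: at the last axial crossing the particle is, transversally, between
  its positions at an earlier precollision and at time t, which both lie in the disk. So a particle
  that met the end before also met it at its last axial crossing, and the latest collision time
  depends on the axial velocity alone.\<close>

lemma precollisions_last:
  fixes s :: real
  assumes tr: "trajectory X V" and y: "y \<in> disk G" and u: "u \<bullet> axis G \<noteq> V t"
  defines "P \<equiv> precollisions G X s t (face_point G s (X t) y) u"
    and "m \<equiv> last_crossing X t (u \<bullet> axis G)"
  shows "P \<noteq> {} \<longleftrightarrow> hit G X t y (u \<bullet> axis G) (perp G u)"
    and "P \<noteq> {} \<Longrightarrow> (GREATEST \<tau>. \<tau> \<in> P) = m"
proof -
  interpret trajectory X V
    by (rule tr)
  have mP: "m \<in> P \<and> (\<forall>\<tau>\<in>P. \<tau> \<le> m)" if ne: "P \<noteq> {}"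
  proof -
    obtain \<tau> where "\<tau> \<in> P"
      using ne by auto
    then have \<tau>: "\<tau> \<in> crossings X t (u \<bullet> axis G)" "norm (y - (t - \<tau>) *\<^sub>R perp G u) \<le> radius G"
      using precollisions_iff[OF y] by (auto simp: P_def)
    then have c: "crossings X t (u \<bullet> axis G) \<noteq> {}"
      by auto
    note m = last_crossing[OF u c, folded m_def]
    have "norm (y - (t - m) *\<^sub>R perp G u) \<le> radius G"
    proof -
      \<comment> \<open>Weight of the earlier position in the convex combination.\<close>
      define \<theta> where "\<theta> = (t - m) / (t - \<tau>)"
      have ord: "\<tau> \<le> m" "m < t"
        using m \<tau> by (auto simp: crossings_def)
      then have \<theta>: "0 \<le> \<theta>" "\<theta> \<le> 1" "\<theta> * (t - \<tau>) = t - m"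
        by (auto simp: \<theta>_def)
      have "y - (t - m) *\<^sub>R perp G u = (1 - \<theta>) *\<^sub>R y + \<theta> *\<^sub>R (y - (t - \<tau>) *\<^sub>R perp G u)"
        unfolding \<theta>(3)[symmetric] by (simp add: algebra_simps)
      also have "norm \<dots> \<le> (1 - \<theta>) * norm y + \<theta> * norm (y - (t - \<tau>) *\<^sub>R perp G u)"
        using \<theta> by (metis abs_of_nonneg diff_ge_0_iff_ge norm_scaleR norm_triangle_ineq)
      also have "\<dots> \<le> (1 - \<theta>) * radius G + \<theta> * radius G"
        using y \<tau> \<theta> by (intro add_mono mult_left_mono) (auto simp: disk_def)
      finally show ?thesis
        by (simp add: algebra_simps)
    qed
    then have "m \<in> P"
      using m precollisions_iff[OF y] by (auto simp: P_def)
    moreover have "\<forall>\<tau>\<in>P. \<tau> \<le> m"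
      using m precollisions_iff[OF y] by (auto simp: P_def)
    ultimately show ?thesis
      by blast
  qed
  show "P \<noteq> {} \<longleftrightarrow> hit G X t y (u \<bullet> axis G) (perp G u)"
  proof
    assume "P \<noteq> {}"
    then show "hit G X t y (u \<bullet> axis G) (perp G u)"
      using mP precollisions_iff[OF y, of m X s t u] by (auto simp: hit_def P_def m_def)
  next
    assume "hit G X t y (u \<bullet> axis G) (perp G u)"
    then have "m \<in> P"
      using last_crossing(1)[OF u] precollisions_iff[OF y, of m X s t u] by (auto simp: hit_def P_def m_def)
    then show "P \<noteq> {}"
      by auto
  qed
  show "(GREATEST \<tau>. \<tau> \<in> P) = m" if "P \<noteq> {}"
    using mP[OF that] by (intro Greatest_equality) auto
qed

lemma origin_disk:
  assumes "hit G X t y z w" "y \<in> hyperplane G" "w \<in> hyperplane G"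
  shows "origin X t y z w \<in> disk G"
  using assms by (auto simp: hit_def origin_def disk_def hyperplane_diff)

lemma face_point_back:
  assumes "y \<in> hyperplane G" "\<tau> \<in> crossings X t (u \<bullet> axis G)"
  shows "face_point G s (X t) y - (t - \<tau>) *\<^sub>R u = face_point G s (X \<tau>) (y - (t - \<tau>) *\<^sub>R perp G u)"
proof -
  have "X t - (t - \<tau>) * (u \<bullet> axis G) = X \<tau>"
    using assms by (auto simp: crossings_def)
  moreover have "(t - \<tau>) *\<^sub>R u = ((t - \<tau>) * (u \<bullet> axis G)) *\<^sub>R axis G + (t - \<tau>) *\<^sub>R perp G u"
    by (metis decompose scaleR_add_right scaleR_scaleR)
  ultimately show ?thesis
    unfolding face_point_def by (smt (verit) add.commute add.assoc diff_diff_add add_diff_eq diff_add_eq scaleR_left_diff_distrib)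
qed

end

section \<open>Reemission\<close>

text \<open>If f is not integrable its integral is 0 by convention, and the bound survives because g
  is nonnegative almost everywhere.\<close>

lemma abs_integral_le:
  fixes f g :: "'b \<Rightarrow> real"
  assumes g: "integrable M g" and le: "AE x in M. \<bar>f x\<bar> \<le> g x"
  shows "\<bar>integral\<^sup>L M f\<bar> \<le> integral\<^sup>L M g"
proof (cases "integrable M f")
  case True
  have "\<bar>integral\<^sup>L M f\<bar> \<le> (LINT x|M. \<bar>f x\<bar>)"
    by (rule integral_abs_bound)
  also have "\<dots> \<le> integral\<^sup>L M g"
    by (rule integral_mono_AE) (use True g le in auto)
  finally show ?thesis .
next
  case False
  have "0 \<le> integral\<^sup>L M g"
    by (rule integral_nonneg_AE) (use le in eventually_elim, linarith)
  then show ?thesis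
    using False by (simp add: not_integrable_integral_eq)
qed

text \<open>
  Particles that recollide have axial velocities in an interval of length \<open>2 * \<epsilon>\<close>, so \<open>small1\<close>
  makes the contribution of their repeated reemissions a contraction, and \<open>small2\<close> keeps it below half the gain
  in \<open>irrev\<close>.
\<close>
locale gas = axial G for G :: "'a::euclidean_space body_gas" +
  fixes p Vinf \<epsilon> cl Cl Kmax Amax Bmax \<delta> :: real and M :: "real \<Rightarrow> real"
  assumes radius_pos: "radius G > 0" and halflen_pos: "halflen G > 0"
    and p_pos: "p > 0" and eps_pos: "\<epsilon> > 0" and delta_pos: "\<delta> > 0"
    and trans_int: "has_bochner_integral (lperp G) (trans G) 1"
    and trans_nonneg: "\<And>y. y \<in> hyperplane G \<Longrightarrow> trans G y \<ge> 0"
    and trans_le: "\<And>y. y \<in> hyperplane G \<Longrightarrow> trans G y \<le> Bmax"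
    and trans_zero: "trans G 0 > 0"
    and trans_cont: "continuous_on (hyperplane G) (trans G)"
    and dens_nonneg: "\<And>z. dens G z \<ge> 0" and dens_le: "\<And>z. dens G z \<le> Amax"
    and dens_cont: "continuous_on UNIV (dens G)"
    and dens_moment: "integrable lborel (\<lambda>z. \<bar>z\<bar> * dens G z)"
    and kx_nonneg: "\<And>v u. kx G v u \<ge> 0"
    and kx_cont: "continuous_on UNIV (\<lambda>(v, u). kx G v u)"
    and kx_le: "\<And>v u. \<bar>u\<bar> \<le> 2 * \<epsilon> \<Longrightarrow> kx G v u \<le> Kmax"
    and kx_even: "\<And>v u. kx G (- v) u = kx G v u"
    and kx_mass: "\<And>u. (\<integral>\<^sup>+v\<in>{0..}. ennreal (v * kx G v u) \<partial>lborel) = ennreal \<bar>u\<bar>"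
    and ell_nonneg: "\<And>w. ell G w \<ge> 0" and ell_cont: "continuous_on UNIV (ell G)"
    and ell_le: "\<And>w. \<bar>w\<bar> \<le> 2 * \<epsilon> \<Longrightarrow> ell G w \<le> Cl * \<bar>w\<bar> powr p"
    and ell_ge: "\<And>w. \<bar>w\<bar> \<le> 2 * \<epsilon> \<Longrightarrow> cl * \<bar>w\<bar> powr p \<le> ell G w"
    and cl_pos: "cl > 0" and Cl_nonneg: "Cl \<ge> 0"
    and ell_int: "\<And>w. integrable lborel (\<lambda>u. ell G (u \<bullet> axis G - w) * f0 G u)"
    and M_int: "integrable lborel M"
    and kx_dens_le: "\<And>v w z. \<bar>v\<bar> \<le> 2 * \<epsilon> \<Longrightarrow> \<bar>w - Vinf\<bar> \<le> \<epsilon> \<Longrightarrow> kx G v (z - w) * dens G z \<le> M z"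
    and irrev: "\<And>v w z'. \<bar>v\<bar> \<le> 2 * \<epsilon> \<Longrightarrow> \<bar>w - Vinf\<bar> \<le> \<epsilon> \<Longrightarrow> \<bar>z' - Vinf\<bar> \<le> \<epsilon> \<Longrightarrow>
        dens G z' + 2 * \<delta> \<le> (LINT z:{w..}|lborel. kx G v (z - w) * dens G z)"
    and small1: "2 * \<epsilon> * Kmax \<le> 1 / 2"
    and small2: "2 * \<epsilon> * Kmax * (2 * integral\<^sup>L lborel M + Amax) \<le> \<delta>"
begin

text \<open>A bound that reproduces itself: fresh particles contribute at most the integral of M,
  which is \<open>Nmax / 2\<close>, and by \<open>small1\<close> recolliding particles bounded by
  \<open>Nmax\<close> contribute at most \<open>Nmax / 2\<close>.\<close>

definition Nmax :: real where "Nmax = 2 * integral\<^sup>L lborel M"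

lemma Kmax_nonneg: "Kmax \<ge> 0"
proof -
  have "kx G 0 0 \<le> Kmax"
    using eps_pos by (intro kx_le) auto
  then show ?thesis
    using kx_nonneg[of 0 0] by linarith
qed

lemma Amax_nonneg: "Amax \<ge> 0"
  using dens_nonneg[of 0] dens_le[of 0] by linarith

lemma M_nonneg: "M z \<ge> 0"
  using kx_dens_le[of 0 Vinf z] kx_nonneg[of 0 "z - Vinf"] dens_nonneg[of z] eps_pos
  by (smt (verit) mult_nonneg_nonneg)

lemma Nmax_nonneg: "Nmax \<ge> 0"
  using M_nonneg by (simp add: Nmax_def)

lemma zero_hyperplane [simp]: "0 \<in> hyperplane G"
  by (simp add: hyperplane_def)

lemma Bmax_nonneg: "Bmax \<ge> 0"
  using trans_nonneg[of 0] trans_le[of 0] by auto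

lemma trans_integrable: "integrable (lperp G) (trans G)" and trans_integral: "integral\<^sup>L (lperp G) (trans G) = 1"
  using trans_int by (auto simp: has_bochner_integral_iff)

lemma trans_perp_measurable [measurable]: "(\<lambda>u. trans G (perp G u)) \<in> borel_measurable borel"
proof (rule borel_measurable_continuous_onI)
  show "continuous_on UNIV (\<lambda>u. trans G (perp G u))"
    by (rule continuous_on_compose2[OF trans_cont continuous_perp]) auto
qed

lemma dens_measurable [measurable]: "dens G \<in> borel_measurable borel"
  by (rule borel_measurable_continuous_onI[OF dens_cont])

lemma ell_measurable [measurable]: "ell G \<in> borel_measurable borel"
  by (rule borel_measurable_continuous_onI[OF ell_cont])

lemma kx_measurable [measurable]: "(\<lambda>(v, u). kx G v u) \<in> borel_measurable borel"
  by (rule borel_measurable_continuous_onI[OF kx_cont])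

lemma kx_measurable' [measurable (raw)]:
  assumes "f \<in> borel_measurable N" "g \<in> borel_measurable N"
  shows "(\<lambda>x. kx G (f x) (g x)) \<in> borel_measurable N"
proof -
  have "(\<lambda>x. (f x, g x)) \<in> N \<rightarrow>\<^sub>M borel"
    using assms by (rule borel_measurable_Pair)
  from measurable_compose[OF this kx_measurable] show ?thesis
    by simp
qed

lemma f0_measurable [measurable]: "f0 G \<in> borel_measurable borel"
  unfolding f0_def by measurable

lemma face_in_measurable [measurable]: "face_in G s w \<in> sets borel"
  unfolding face_in_def by measurable

lemma AE_inner_neq: "AE u in lborel. u \<bullet> axis G \<noteq> c"
proof -
  have "negligible {u. axis G \<bullet> u = c}"
    by (rule negligible_hyperplane) (use axis_Basis nonzero_Basis in blast)
  moreover have "{u. axis G \<bullet> u = c} \<in> sets borel"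
    by measurable
  ultimately have "{u. axis G \<bullet> u = c} \<in> null_sets lborel"
    by (auto simp: negligible_iff_null_sets null_sets_completion_iff)
  from AE_not_in[OF this] show ?thesis
    by (simp add: inner_commute)
qed

lemma trans_mass_interval:
  assumes "a \<le> b"
  shows "integrable lborel (\<lambda>u. c * indicator {a..b} (u \<bullet> axis G) * trans G (perp G u))"
    and "(LINT u|lborel. c * indicator {a..b} (u \<bullet> axis G) * trans G (perp G u)) = c * (b - a)"
proof -
  have "integrable lborel (\<lambda>z. c * indicator {a..b} z :: real)"
    by (intro integrable_mult_right integrable_real_indicator) (auto simp: emeasure_lborel_Icc_eq)
  from has_integral_product[OF this trans_integrable]
  show "integrable lborel (\<lambda>u. c * indicator {a..b} (u \<bullet> axis G) * trans G (perp G u))"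
    and "(LINT u|lborel. c * indicator {a..b} (u \<bullet> axis G) * trans G (perp G u)) = c * (b - a)"
    using assms by (auto simp: trans_integral)
qed

text \<open>The axial factor of the density that an end of velocity w would reemit if every incoming
  particle still had the density \<open>f0\<close>.\<close>

definition fresh :: "real \<Rightarrow> real \<Rightarrow> real \<Rightarrow> real" where
  "fresh s w v = (LINT z:{z. s * (z - w) \<le> 0}|lborel. kx G (v - w) (z - w) * dens G z)"

lemma fresh_integrable:
  assumes "\<bar>v - w\<bar> \<le> 2 * \<epsilon>" "\<bar>w - Vinf\<bar> \<le> \<epsilon>"
  shows "integrable lborel (\<lambda>z. indicator {z. s * (z - w) \<le> 0} z * (kx G (v - w) (z - w) * dens G z))"
proof (rule Bochner_Integration.integrable_bound[OF M_int])
  show "(\<lambda>z. indicator {z. s * (z - w) \<le> 0} z * (kx G (v - w) (z - w) * dens G z)) \<in> borel_measurable lborel"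
    by measurable
  show "AE z in lborel. norm (indicator {z. s * (z - w) \<le> 0} z * (kx G (v - w) (z - w) * dens G z)) \<le> norm (M z)"
    using assms kx_dens_le[of "v - w" w] kx_nonneg dens_nonneg M_nonneg
    by (intro AE_I2) (auto simp: indicator_def)
qed

lemma fresh_left_gain:
  assumes "\<bar>v - w\<bar> \<le> 2 * \<epsilon>" "\<bar>w - Vinf\<bar> \<le> \<epsilon>" "\<bar>z' - Vinf\<bar> \<le> \<epsilon>"
  shows "dens G z' + 2 * \<delta> \<le> fresh (- 1) w v"
proof -
  have "{z. - 1 * (z - w) \<le> 0} = {w..}"
    by auto
  then show ?thesis
    using irrev[OF assms] by (simp add: fresh_def)
qed

end

text \<open>The equation of motion is deliberately absent. The locale is instantiated by arbitrary
  solutions and also by the densities constructed for a prescribed motion, for which that equation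
  has yet to be established.\<close>

locale kinetic = gas G p Vinf \<epsilon> cl Cl Kmax Amax Bmax \<delta> M + trajectory X V
  for G :: "'a::euclidean_space body_gas" and p Vinf \<epsilon> cl Cl Kmax Amax Bmax \<delta> M X V +
  fixes fm fp :: "real \<Rightarrow> 'a \<Rightarrow> 'a \<Rightarrow> real"
  assumes fm_meas: "set_borel_measurable borel (in_phase G X V) (\<lambda>(t, x, u). fm t x u)"
    and fm_bounded: "bounded_on (in_phase G X V) fm"
    and pre: "pre_law G X V fm fp" and post: "post_law G X V fm fp"
    and conv: "\<And>t s. t \<ge> 0 \<Longrightarrow> s \<in> {1, - 1} \<Longrightarrow> force_converges G X V fm s t"
begin

text \<open>What remains of \<open>fp\<close> after division by the transversal profile: the kernel
  sees the outgoing transversal velocity only through \<open>trans G\<close>.\<close>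

definition reemit :: "real \<Rightarrow> real \<Rightarrow> 'a \<Rightarrow> real \<Rightarrow> real" where
  "reemit s \<tau> y v = (LINT u:face_in G s (V \<tau>)|lborel.
     kx G (v - V \<tau>) (u \<bullet> axis G - V \<tau>) * fm \<tau> (face_point G s (X \<tau>) y) u)"

text \<open>The density \<open>fm\<close> divided by the transversal profile.\<close>
definition psi :: "real \<Rightarrow> real \<Rightarrow> 'a \<Rightarrow> real \<Rightarrow> 'a \<Rightarrow> real" where
  "psi s t y z w = (if hit G X t y z w then reemit s (last_crossing X t z) (origin X t y z w) z else dens G z)"

lemma fp_eq:
  assumes t: "t \<ge> 0" and s: "s \<in> {1, - 1}" and y: "y \<in> disk G" and v: "v \<in> face_out G s (V t)"
  shows "fp t (face_point G s (X t) y) v = trans G (perp G v) * reemit s t y (v \<bullet> axis G)"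
proof -
  have "fp t (face_point G s (X t) y) v = (LINT u:face_in G s (V t)|lborel.
     K G (v - V t *\<^sub>R axis G) (u - V t *\<^sub>R axis G) * fm t (face_point G s (X t) y) u)"
  proof -
    have "\<forall>t\<ge>0. \<forall>s\<in>{1, - 1}. \<forall>x\<in>face G s (X t). \<forall>v\<in>face_out G s (V t). fp t x v = (LINT u:face_in G s (V t)|lborel.
       K G (v - V t *\<^sub>R axis G) (u - V t *\<^sub>R axis G) * fm t x u)"
      using post unfolding post_law_def Let_def by blast
    from this[rule_format, OF t s face_point_face[OF y] v] show ?thesis .
  qed
  also have "\<dots> = (LINT u|lborel. trans G (perp G v) * (indicator (face_in G s (V t)) u *
     (kx G (v \<bullet> axis G - V t) (u \<bullet> axis G - V t) * fm t (face_point G s (X t) y) u)))"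
    unfolding set_lebesgue_integral_def K_def
    by (intro Bochner_Integration.integral_cong) (auto simp: inner_diff_left perp_diff perp_scaleR)
  finally show ?thesis
    by (simp add: reemit_def set_lebesgue_integral_def)
qed

text \<open>Both boundary laws become one recursion. The particle is traced back to its last
  crossing, where it was outgoing by \<open>last_crossing_outgoing\<close>, so that its density is
  the one reemitted there.\<close>

lemma fm_eq:
  assumes t: "t \<ge> 0" and s: "s \<in> {1, - 1}" and y: "y \<in> disk G" and u: "u \<in> face_in G s (V t)" "u \<bullet> axis G \<noteq> V t"
  shows "fm t (face_point G s (X t) y) u = trans G (perp G u) * psi s t y (u \<bullet> axis G) (perp G u)"
proof -
  let ?z = "u \<bullet> axis G" and ?w = "perp G u"
  let ?P = "precollisions G X s t (face_point G s (X t) y) u" and ?m = "last_crossing X t (u \<bullet> axis G)"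
  have tr: "trajectory X V" ..
  have law: "fm t (face_point G s (X t) y) u = (if ?P = {} then f0 G u
      else fp (GREATEST \<tau>. \<tau> \<in> ?P) (face_point G s (X t) y - (t - (GREATEST \<tau>. \<tau> \<in> ?P)) *\<^sub>R u) u)"
  proof -
    have "\<forall>t\<ge>0. \<forall>s\<in>{1, - 1}. \<forall>x\<in>face G s (X t). \<forall>u\<in>face_in G s (V t). u \<bullet> axis G \<noteq> V t \<longrightarrow>
        fm t x u =
          (if precollisions G X s t x u = {} then f0 G u
           else fp (GREATEST \<tau>. \<tau> \<in> precollisions G X s t x u)
              (x - (t - (GREATEST \<tau>. \<tau> \<in> precollisions G X s t x u)) *\<^sub>R u) u)"
      using pre unfolding pre_law_def Let_def by (rule conjunct1)
    from this[rule_format, OF t s face_point_face[OF y] u] show ?thesis .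
  qed
  have yh: "y \<in> hyperplane G"
    using y by (simp add: disk_def)
  show ?thesis
  proof (cases "hit G X t y ?z ?w")
    case False
    then show ?thesis
      using law precollisions_last(1)[OF tr y u(2), of s] by (simp add: psi_def f0_def)
  next
    case True
    then have ne: "crossings X t ?z \<noteq> {}"
      by (simp add: hit_def)
    have P: "?P \<noteq> {}"
      using precollisions_last(1)[OF tr y u(2), of s] True by simp
    have m: "?m \<in> crossings X t ?z"
      by (rule last_crossing(1)[OF u(2) ne])
    have "s * (?z - V t) < 0"
      using u s by (auto simp: face_in_def)
    then have out: "u \<in> face_out G s (V ?m)"
      using last_crossing_outgoing ne by (auto simp: face_out_def)
    have "fm t (face_point G s (X t) y) u = fp ?m (face_point G s (X t) y - (t - ?m) *\<^sub>R u) u"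
      using law P precollisions_last(2)[OF tr y u(2) P] by simp
    also have "\<dots> = fp ?m (face_point G s (X ?m) (origin X t y ?z ?w)) u"
      unfolding face_point_back[OF yh m] origin_def ..
    also have "\<dots> = trans G ?w * reemit s ?m (origin X t y ?z ?w) ?z"
      using m out origin_disk[OF True yh] s by (intro fp_eq) (auto simp: crossings_def)
    finally show ?thesis
      using True by (simp add: psi_def)
  qed
qed

lemma in_phase_face_iff:
  assumes "y \<in> disk G" "s \<in> {1, - 1}" "t \<ge> 0"
  shows "(t, face_point G s (X t) y, u) \<in> in_phase G X V \<longleftrightarrow> u \<in> face_in G s (V t)"
  using assms halflen_pos by (auto simp: in_phase_def face_def lateral_def disk_def)

lemma fm_slice_measurable:
  assumes "y \<in> disk G" "s \<in> {1, - 1}" "t \<ge> 0"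
  shows "(\<lambda>u. indicator (face_in G s (V t)) u * fm t (face_point G s (X t) y) u) \<in> borel_measurable borel"
proof -
  have "(\<lambda>u. (t, face_point G s (X t) y, u)) \<in> borel_measurable borel"
    by (intro borel_measurable_continuous_onI continuous_intros)
  from measurable_compose[OF this fm_meas[unfolded set_borel_measurable_def]]
  show ?thesis
    using in_phase_face_iff[OF assms] by (simp add: indicator_def)
qed

end

section \<open>Bounds for the densities of recolliding particles\<close>

context kinetic
begin

definition near :: "real \<Rightarrow> bool" where
  "near T \<longleftrightarrow> (\<forall>t\<in>{0..T}. \<bar>V t - Vinf\<bar> \<le> \<epsilon>)"

text \<open>The axial velocity of a recolliding particle is a mean velocity of the body, hence by
  the mean value theorem a velocity that the body had in between.\<close>

lemma hit_near:
  assumes T: "near T" and t: "t \<le> T" and hit: "hit G X t y z w" and z: "z \<noteq> V t"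
  shows "\<bar>z - Vinf\<bar> \<le> \<epsilon>" "0 < last_crossing X t z" "last_crossing X t z < t"
    "last_crossing X t z \<in> crossings X t z"
proof -
  have m: "last_crossing X t z \<in> crossings X t z"
    using last_crossing(1)[OF z] hit by (simp add: hit_def)
  then obtain \<sigma> where "last_crossing X t z < \<sigma>" "\<sigma> < t" "z = V \<sigma>"
    by (rule crossing_mean)
  then show "\<bar>z - Vinf\<bar> \<le> \<epsilon>"
    using T t m by (auto simp: near_def crossings_def)
  show "0 < last_crossing X t z" "last_crossing X t z < t" "last_crossing X t z \<in> crossings X t z"
    using m by (auto simp: crossings_def)
qed

text \<open>The incoming particles are either fresh or recolliding, and the latter have axial
  velocities in an interval of length \<open>2 * \<epsilon>\<close>, where the kernel is at most
  \<open>Kmax\<close>. The first estimate feeds the iteration of bounds, the second compares with a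
  gas without recollisions.\<close>

lemma reemit_bounds:
  assumes T: "near T" and \<tau>: "0 \<le> \<tau>" "\<tau> \<le> T" and s: "s \<in> {1, - 1}" and y: "y \<in> disk G"
    and v: "\<bar>v - Vinf\<bar> \<le> \<epsilon>" and N: "N \<ge> 0"
    and psi: "\<And>z w. s * (z - V \<tau>) < 0 \<Longrightarrow> w \<in> hyperplane G \<Longrightarrow> hit G X \<tau> y z w \<Longrightarrow> \<bar>psi s \<tau> y z w\<bar> \<le> N"
  shows "\<bar>reemit s \<tau> y v\<bar> \<le> Nmax / 2 + 2 * \<epsilon> * Kmax * N"
    and "\<bar>reemit s \<tau> y v - fresh s (V \<tau>) v\<bar> \<le> 2 * \<epsilon> * Kmax * (N + Amax)"
proof -
  have V\<tau>: "\<bar>V \<tau> - Vinf\<bar> \<le> \<epsilon>"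
    using T \<tau> by (auto simp: near_def)
  have vV: "\<bar>v - V \<tau>\<bar> \<le> 2 * \<epsilon>"
    using V\<tau> v by linarith
  let ?I = "indicator (face_in G s (V \<tau>)) :: 'a \<Rightarrow> real"
  let ?x = "face_point G s (X \<tau>) y"
  let ?k = "\<lambda>z. kx G (v - V \<tau>) (z - V \<tau>)"
  let ?J = "indicator {Vinf - \<epsilon>..Vinf + \<epsilon>} :: real \<Rightarrow> real"
  define f where "f u = ?I u * (?k (u \<bullet> axis G) * fm \<tau> ?x u)" for u
  define g where "g z = indicator {z. s * (z - V \<tau>) \<le> 0} z * (?k z * dens G z)" for z
  have sz: "s * (z - V \<tau>) < 0" if "u \<in> face_in G s (V \<tau>)" "u \<bullet> axis G = z" "z \<noteq> V \<tau>" for u z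
    using that s by (auto simp: face_in_def)
  have diff: "\<bar>f u - g (u \<bullet> axis G) * trans G (perp G u)\<bar> \<le> Kmax * (N + Amax) * ?J (u \<bullet> axis G) * trans G (perp G u)"
    and bound: "\<bar>f u\<bar> \<le> (M (u \<bullet> axis G) + Kmax * N * ?J (u \<bullet> axis G)) * trans G (perp G u)"
    if u: "u \<bullet> axis G \<noteq> V \<tau>" for u
  proof -
    let ?z = "u \<bullet> axis G" and ?w = "perp G u"
    have w0: "trans G ?w \<ge> 0"
      by (rule trans_nonneg) simp
    have kn: "0 \<le> ?k ?z"
      by (rule kx_nonneg)
    \<comment> \<open>Outgoing, fresh and recolliding particles. The first two give no deviation
      from the product \<open>g * trans\<close>; only the third needs the bound N, and it lives on
      the short interval \<open>?J\<close>.\<close>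
    consider "u \<notin> face_in G s (V \<tau>)" | "u \<in> face_in G s (V \<tau>)" "\<not> hit G X \<tau> y ?z ?w"
      | "u \<in> face_in G s (V \<tau>)" "hit G X \<tau> y ?z ?w"
      by blast
    then have "\<bar>f u - g ?z * trans G ?w\<bar> \<le> Kmax * (N + Amax) * ?J ?z * trans G ?w
      \<and> \<bar>f u\<bar> \<le> (M ?z + Kmax * N * ?J ?z) * trans G ?w"
    proof cases
      case 1
      then have "f u = 0" "g ?z = 0"
        by (auto simp: f_def g_def face_in_def)
      then show ?thesis
        using w0 Kmax_nonneg N Amax_nonneg M_nonneg by (auto intro!: mult_nonneg_nonneg add_nonneg_nonneg)
    next
      case 2
      have "f u = ?k ?z * (trans G ?w * dens G ?z)"
        using 2 fm_eq[OF \<tau>(1) s y 2(1) u] by (simp add: f_def psi_def)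
      moreover have "g ?z = ?k ?z * dens G ?z"
        using 2 by (auto simp: g_def face_in_def)
      ultimately have eq: "f u = g ?z * trans G ?w" and g: "0 \<le> g ?z" "g ?z \<le> M ?z"
        using kx_dens_le[OF vV V\<tau>, of ?z] kn dens_nonneg by auto
      have "g ?z \<le> M ?z + Kmax * N * ?J ?z"
        using g Kmax_nonneg N by (auto simp: indicator_def intro: order_trans)
      then have "\<bar>f u\<bar> \<le> (M ?z + Kmax * N * ?J ?z) * trans G ?w"
        using eq g w0 by (simp add: abs_mult mult_right_mono)
      then show ?thesis
        using eq w0 Kmax_nonneg N Amax_nonneg by (auto intro!: mult_nonneg_nonneg)
    next
      case 3
      note sz' = sz[OF 3(1) refl u]
      have z: "\<bar>?z - Vinf\<bar> \<le> \<epsilon>"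
        by (rule hit_near(1)[OF T \<tau>(2) 3(2) u])
      have J: "?J ?z = 1"
        using z by (auto simp: indicator_def abs_le_iff)
      have K: "?k ?z \<le> Kmax"
        using z V\<tau> by (intro kx_le) linarith
      have P: "\<bar>psi s \<tau> y ?z ?w\<bar> \<le> N"
        by (rule psi[OF sz' _ 3(2)]) simp
      have f: "f u = ?k ?z * psi s \<tau> y ?z ?w * trans G ?w"
        using 3 fm_eq[OF \<tau>(1) s y 3(1) u] by (simp add: f_def)
      have g: "g ?z = ?k ?z * dens G ?z"
        using 3 by (auto simp: g_def face_in_def)
      have "\<bar>f u\<bar> = ?k ?z * \<bar>psi s \<tau> y ?z ?w\<bar> * trans G ?w"
        using f kn w0 by (simp add: abs_mult)
      also have "\<dots> \<le> Kmax * N * trans G ?w"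
        using K P kn w0 N Kmax_nonneg by (intro mult_right_mono mult_mono) auto
      also have "\<dots> \<le> (M ?z + Kmax * N * ?J ?z) * trans G ?w"
        using J M_nonneg w0 by (simp add: mult_right_mono)
      finally have 1: "\<bar>f u\<bar> \<le> (M ?z + Kmax * N * ?J ?z) * trans G ?w" .
      have "f u - g ?z * trans G ?w = ?k ?z * (psi s \<tau> y ?z ?w - dens G ?z) * trans G ?w"
        unfolding f g by (simp add: algebra_simps)
      then have "\<bar>f u - g ?z * trans G ?w\<bar> = ?k ?z * \<bar>psi s \<tau> y ?z ?w - dens G ?z\<bar> * trans G ?w"
        using kn w0 by (simp add: abs_mult)
      also have "\<dots> \<le> Kmax * (N + Amax) * trans G ?w"
        using K P kn w0 N Kmax_nonneg dens_nonneg[of ?z] dens_le[of ?z] by (intro mult_right_mono mult_mono) auto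
      finally show ?thesis
        using 1 J by simp
    qed
    then show "\<bar>f u - g ?z * trans G ?w\<bar> \<le> Kmax * (N + Amax) * ?J ?z * trans G ?w"
      and "\<bar>f u\<bar> \<le> (M ?z + Kmax * N * ?J ?z) * trans G ?w"
      by auto
  qed
  have J_int: "integrable lborel (\<lambda>z. c * ?J z)" for c
    by (intro integrable_mult_right integrable_real_indicator) (auto simp: emeasure_lborel_Icc_eq)
  have hz: "integrable lborel (\<lambda>z. M z + Kmax * N * ?J z)"
    by (intro Bochner_Integration.integrable_add M_int J_int)
  have hz_val: "(LINT z|lborel. M z + Kmax * N * ?J z) = Nmax / 2 + 2 * \<epsilon> * Kmax * N"
    using eps_pos by (subst Bochner_Integration.integral_add[OF M_int J_int]) (simp add: Nmax_def)
  have H: "integrable lborel (\<lambda>u. (M (u \<bullet> axis G) + Kmax * N * ?J (u \<bullet> axis G)) * trans G (perp G u))"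
    "(LINT u|lborel. (M (u \<bullet> axis G) + Kmax * N * ?J (u \<bullet> axis G)) * trans G (perp G u)) = Nmax / 2 + 2 * \<epsilon> * Kmax * N"
    using has_integral_product[OF hz trans_integrable] hz_val by (auto simp: trans_integral)
  have re: "reemit s \<tau> y v = integral\<^sup>L lborel f"
    by (simp add: reemit_def f_def[abs_def] set_lebesgue_integral_def)
  have AEb: "AE u in lborel. \<bar>f u\<bar> \<le> (M (u \<bullet> axis G) + Kmax * N * ?J (u \<bullet> axis G)) * trans G (perp G u)"
    using AE_inner_neq by eventually_elim (rule bound)
  show "\<bar>reemit s \<tau> y v\<bar> \<le> Nmax / 2 + 2 * \<epsilon> * Kmax * N"
    unfolding re using abs_integral_le[OF H(1) AEb] H(2) by simp
  have fmeas: "f \<in> borel_measurable borel"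
  proof -
    have [measurable]: "(\<lambda>u. ?I u * fm \<tau> ?x u) \<in> borel_measurable borel"
      by (rule fm_slice_measurable[OF y s \<tau>(1)])
    have "f = (\<lambda>u. ?k (u \<bullet> axis G) * (?I u * fm \<tau> ?x u))"
      by (auto simp: f_def)
    then show ?thesis
      by (simp only:) measurable
  qed
  have fint: "integrable lborel f"
  proof (rule Bochner_Integration.integrable_bound[OF H(1)])
    show "AE u in lborel. norm (f u) \<le> norm ((M (u \<bullet> axis G) + Kmax * N * ?J (u \<bullet> axis G)) * trans G (perp G u))"
      using AEb by eventually_elim auto
  qed (use fmeas in simp)
  have gint: "integrable lborel g"
    using fresh_integrable[OF vV V\<tau>] by (simp add: g_def[abs_def])
  have gval: "integral\<^sup>L lborel g = fresh s (V \<tau>) v"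
    by (simp add: fresh_def set_lebesgue_integral_def g_def[abs_def])
  have G: "integrable lborel (\<lambda>u. g (u \<bullet> axis G) * trans G (perp G u))"
    "(LINT u|lborel. g (u \<bullet> axis G) * trans G (perp G u)) = fresh s (V \<tau>) v"
    using has_integral_product[OF gint trans_integrable] gval by (auto simp: trans_integral)
  have "reemit s \<tau> y v - fresh s (V \<tau>) v = (LINT u|lborel. f u - g (u \<bullet> axis G) * trans G (perp G u))"
    using fint G re by simp
  also have "\<bar>\<dots>\<bar> \<le> (LINT u|lborel. Kmax * (N + Amax) * ?J (u \<bullet> axis G) * trans G (perp G u))"
  proof (rule abs_integral_le)
    show "AE u in lborel. \<bar>f u - g (u \<bullet> axis G) * trans G (perp G u)\<bar> \<le> Kmax * (N + Amax) * ?J (u \<bullet> axis G) * trans G (perp G u)"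
      using AE_inner_neq by eventually_elim (rule diff)
  qed (rule trans_mass_interval, use eps_pos in simp)
  also have "\<dots> = 2 * \<epsilon> * Kmax * (N + Amax)"
    using eps_pos by (subst trans_mass_interval) auto
  finally show "\<bar>reemit s \<tau> y v - fresh s (V \<tau>) v\<bar> \<le> 2 * \<epsilon> * Kmax * (N + Amax)" .
qed

text \<open>A hitting particle and the one with the same first velocity component and no transversal
  velocity collide at the same time, so the boundedness of \<open>fm\<close> bounds the reemission.\<close>
lemma psi_a_priori_bound:
  obtains N where "N \<ge> 0"
    "\<And>t s y z w. t \<ge> 0 \<Longrightarrow> s \<in> {1, - 1} \<Longrightarrow> y \<in> disk G \<Longrightarrow> s * (z - V t) < 0 \<Longrightarrow> w \<in> hyperplane G \<Longrightarrow>
       hit G X t y z w \<Longrightarrow> \<bar>psi s t y z w\<bar> \<le> N"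
proof -
  obtain B where B: "\<And>t x u. (t, x, u) \<in> in_phase G X V \<Longrightarrow> \<bar>fm t x u\<bar> \<le> B"
    using fm_bounded unfolding bounded_on_def by fastforce
  show ?thesis
  proof (rule that[of "\<bar>B\<bar> / trans G 0"])
    show "0 \<le> \<bar>B\<bar> / trans G 0"
      using trans_zero by simp
    fix t s y z w
    assume t: "t \<ge> 0" and s: "s \<in> {1, - 1}" and y: "y \<in> disk G" and z: "s * (z - V t) < 0"
      and w: "w \<in> hyperplane G" and hit: "hit G X t y z w"
    have yh: "y \<in> hyperplane G"
      using y by (simp add: disk_def)
    let ?y = "origin X t y z w"
    have y': "?y \<in> disk G"
      by (rule origin_disk[OF hit yh w])
    have hit': "hit G X t ?y z 0"
      using hit y' by (auto simp: hit_def disk_def)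
    have org: "origin X t ?y z 0 = ?y"
      by (simp add: origin_def)
    have u: "z *\<^sub>R axis G \<in> face_in G s (V t)" "z *\<^sub>R axis G \<bullet> axis G \<noteq> V t"
      using z by (auto simp: face_in_def)
    have "fm t (face_point G s (X t) ?y) (z *\<^sub>R axis G) = trans G 0 * psi s t ?y z 0"
      using fm_eq[OF t s y' u] by (simp add: perp_scaleR)
    moreover have "psi s t ?y z 0 = psi s t y z w"
      using hit hit' org by (simp add: psi_def)
    moreover have "\<bar>fm t (face_point G s (X t) ?y) (z *\<^sub>R axis G)\<bar> \<le> \<bar>B\<bar>"
      using B in_phase_face_iff[OF y' s t] u(1) by (meson abs_ge_self order_trans)
    ultimately show "\<bar>psi s t y z w\<bar> \<le> \<bar>B\<bar> / trans G 0"
      using trans_zero by (simp add: abs_mult field_simps)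
  qed
qed

text \<open>The a priori bound depends on the solution, \<open>Nmax\<close> does not. Each collision
  followed backwards halves the excess of the bound over \<open>Nmax\<close>; the number j of these
  collisions is the induction variable.\<close>

lemma psi_bound:
  assumes T: "near T" and t: "0 \<le> t" "t \<le> T" and s: "s \<in> {1, - 1}" and y: "y \<in> disk G"
    and z: "s * (z - V t) < 0" and w: "w \<in> hyperplane G" and hit: "hit G X t y z w"
  shows "\<bar>psi s t y z w\<bar> \<le> Nmax"
proof -
  obtain N where N: "N \<ge> 0"
    "\<And>t s y z w. t \<ge> 0 \<Longrightarrow> s \<in> {1, - 1} \<Longrightarrow> y \<in> disk G \<Longrightarrow> s * (z - V t) < 0 \<Longrightarrow> w \<in> hyperplane G \<Longrightarrow>
       hit G X t y z w \<Longrightarrow> \<bar>psi s t y z w\<bar> \<le> N"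
    using psi_a_priori_bound by blast
  have "\<bar>psi s t y z w\<bar> \<le> Nmax + N * (1 / 2) ^ j" for j :: nat
    using t s y z w hit
  proof (induction j arbitrary: t s y z w)
    case 0
    then show ?case
      using N(2)[of t s y z w] Nmax_nonneg by simp
  next
    case (Suc j)
    let ?m = "last_crossing X t z" and ?y = "origin X t y z w"
    have zV: "z \<noteq> V t"
      using Suc.prems by auto
    note m = hit_near[OF T \<open>t \<le> T\<close> \<open>hit G X t y z w\<close> zV]
    have "y \<in> hyperplane G"
      using Suc.prems by (simp add: disk_def)
    then have y: "?y \<in> disk G"
      using Suc.prems origin_disk by blast
    have pos: "0 \<le> Nmax + N * (1 / 2) ^ j"
      using N(1) Nmax_nonneg by simp
    have "\<bar>psi s t y z w\<bar> = \<bar>reemit s ?m ?y z\<bar>"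
      using Suc.prems by (simp add: psi_def)
    also have "\<dots> \<le> Nmax / 2 + 2 * \<epsilon> * Kmax * (Nmax + N * (1 / 2) ^ j)"
    proof (rule reemit_bounds(1)[OF T _ _ _ y _ pos])
      show "\<bar>psi s ?m ?y z' w'\<bar> \<le> Nmax + N * (1 / 2) ^ j"
        if "s * (z' - V ?m) < 0" "w' \<in> hyperplane G" "hit G X ?m ?y z' w'" for z' w'
        using that m y Suc.prems by (intro Suc.IH) auto
    qed (use m Suc.prems in auto)
    also have "\<dots> \<le> Nmax / 2 + 1 / 2 * (Nmax + N * (1 / 2) ^ j)"
      by (intro add_left_mono mult_right_mono small1 pos)
    finally show ?case
      by (simp add: add_divide_distrib)
  qed
  then show ?thesis
  proof (intro LIMSEQ_le_const)
    show "(\<lambda>j. Nmax + N * (1 / 2) ^ j) \<longlonglongrightarrow> Nmax"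
      using tendsto_add[OF tendsto_const tendsto_mult_right_zero[OF LIMSEQ_power_zero[of "1 / 2 :: real"]], of Nmax N] by simp
  qed auto
qed

text \<open>A recolliding particle was reemitted earlier by the same end. A fresh gas would give it
  at least \<open>dens G z + 2 * \<delta>\<close>, and by \<open>small2\<close> the particles that
  are not fresh spoil at most \<delta> of this.\<close>

lemma psi_left_gain:
  assumes T: "near T" and t: "0 \<le> t" "t \<le> T" and y: "y \<in> disk G"
    and z: "z > V t" and w: "w \<in> hyperplane G" and hit: "hit G X t y z w"
  shows "psi (- 1) t y z w \<ge> dens G z + \<delta>"
proof -
  let ?m = "last_crossing X t z" and ?y = "origin X t y z w"
  have zV: "z \<noteq> V t"
    using z by auto
  note m = hit_near[OF T t(2) hit zV]
  have "y \<in> hyperplane G"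
    using y by (simp add: disk_def)
  then have y': "?y \<in> disk G"
    using hit w origin_disk by blast
  have Vm: "\<bar>V ?m - Vinf\<bar> \<le> \<epsilon>"
    using T m t by (auto simp: near_def)
  have "\<bar>reemit (- 1) ?m ?y z - fresh (- 1) (V ?m) z\<bar> \<le> 2 * \<epsilon> * Kmax * (Nmax + Amax)"
  proof (rule reemit_bounds(2)[OF T _ _ _ y' m(1) Nmax_nonneg])
    show "\<bar>psi (- 1) ?m ?y z' w'\<bar> \<le> Nmax"
      if "- 1 * (z' - V ?m) < 0" "w' \<in> hyperplane G" "hit G X ?m ?y z' w'" for z' w'
      using that m y' t by (intro psi_bound[OF T]) auto
  qed (use m t in auto)
  moreover have "dens G z + 2 * \<delta> \<le> fresh (- 1) (V ?m) z"
    using m(1) Vm by (intro fresh_left_gain) linarith+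
  moreover have "2 * \<epsilon> * Kmax * (Nmax + Amax) \<le> \<delta>"
    using small2 by (simp add: Nmax_def)
  ultimately show ?thesis
    using hit by (simp add: psi_def)
qed

section \<open>The drag of recolliding particles\<close>

definition tmass :: "real \<Rightarrow> real" where
  "tmass \<rho> = (LINT w|lperp G. indicator {w. norm w \<le> \<rho>} w * trans G w)"

lemma tmass_integrable: "integrable (lperp G) (\<lambda>w. indicator {w. norm w \<le> \<rho>} w * trans G w)"
proof (rule Bochner_Integration.integrable_bound[OF trans_integrable])
  have "(\<lambda>w::'a. indicator {w. norm w \<le> \<rho>} w :: real) \<in> borel_measurable (lperp G)"
    by (rule borel_measurable_lperp) measurable
  then show "(\<lambda>w. indicator {w. norm w \<le> \<rho>} w * trans G w) \<in> borel_measurable (lperp G)"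
    using trans_integrable by (intro borel_measurable_times) auto
qed (auto simp: indicator_def)

lemma tmass_nonneg: "0 \<le> tmass \<rho>"
  unfolding tmass_def using trans_nonneg
  by (intro integral_nonneg_AE AE_I2) (auto simp: space_lperp)

lemma tmass_le_1: "tmass \<rho> \<le> 1"
  unfolding tmass_def trans_integral[symmetric]
  by (rule integral_mono[OF tmass_integrable trans_integrable])
     (use trans_nonneg in \<open>auto simp: space_lperp indicator_def\<close>)

lemma tmass_le:
  assumes "\<rho> \<ge> 0"
  shows "tmass \<rho> \<le> Bmax * (2 * \<rho>) ^ (DIM('a) - 1)"
proof -
  let ?S = "{w \<in> hyperplane G. norm w \<le> \<rho>}"
  have fin: "emeasure (lperp G) ?S < \<infinity>"
    using emeasure_ball_le[OF assms] by (auto intro: le_less_trans)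
  have "tmass \<rho> \<le> (LINT w|lperp G. Bmax * indicator ?S w)"
    unfolding tmass_def
  proof (rule integral_mono[OF tmass_integrable])
    show "integrable (lperp G) (\<lambda>w. Bmax * indicator ?S w)"
      using fin by (intro integrable_mult_right integrable_real_indicator) auto
    show "indicator {w. norm w \<le> \<rho>} w * trans G w \<le> Bmax * indicator ?S w" if "w \<in> space (lperp G)" for w
      using that trans_le[of w] Bmax_nonneg by (auto simp: space_lperp indicator_def)
  qed
  also have "\<dots> = Bmax * measure (lperp G) ?S"
    by simp
  also have "\<dots> \<le> Bmax * (2 * \<rho>) ^ (DIM('a) - 1)"
    by (intro mult_left_mono measure_ball_le assms Bmax_nonneg)
  finally show ?thesis .
qed

text \<open>Subtracting the undisturbed density leaves the effect of recollisions only: by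
  \<open>excess_density_eq\<close> the integrand vanishes where the particle does not hit.\<close>

definition excess :: "real \<Rightarrow> real \<Rightarrow> 'a \<Rightarrow> real" where
  "excess s t y = (LINT u:face_in G s (V t)|lborel.
     ell G (u \<bullet> axis G - V t) * (fm t (face_point G s (X t) y) u - f0 G u))"

definition drag :: "real \<Rightarrow> real \<Rightarrow> real" where
  "drag s t = (LINT y:disk G|lperp G. excess s t y)"

definition excess_density :: "real \<Rightarrow> real \<Rightarrow> 'a \<Rightarrow> 'a \<Rightarrow> real" where
  "excess_density s t y u = indicator (face_in G s (V t)) u *
     (ell G (u \<bullet> axis G - V t) * (fm t (face_point G s (X t) y) u - f0 G u))"

lemma excess_density_eq:
  assumes t: "0 \<le> t" and s: "s \<in> {1, - 1}" and y: "y \<in> disk G" and u: "u \<bullet> axis G \<noteq> V t"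
  shows "excess_density s t y u =
    (if u \<in> face_in G s (V t) \<and> hit G X t y (u \<bullet> axis G) (perp G u)
     then ell G (u \<bullet> axis G - V t) * (trans G (perp G u) * (psi s t y (u \<bullet> axis G) (perp G u) - dens G (u \<bullet> axis G)))
     else 0)"
proof (cases "u \<in> face_in G s (V t)")
  case True
  then show ?thesis
    using fm_eq[OF t s y True u]
    by (auto simp: excess_density_def f0_def psi_def algebra_simps)
qed (simp add: excess_density_def)

text \<open>Majorant for two classes of recolliding particles: those constrained in the axial
  velocity only, which serves for recent collisions, and those constrained also in the transversal
  velocity, which serves for collisions long ago.\<close>

definition wall_bound :: "real \<Rightarrow> real \<Rightarrow> real \<Rightarrow> real \<Rightarrow> real \<Rightarrow> real \<Rightarrow> real \<Rightarrow> 'a \<Rightarrow> real" where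
  "wall_bound a1 b1 \<eta>1 a2 b2 \<eta>2 \<rho> u = (Nmax + Amax) * Cl *
     (\<eta>1 powr p * indicator {a1..b1} (u \<bullet> axis G) * trans G (perp G u) +
      \<eta>2 powr p * indicator {a2..b2} (u \<bullet> axis G) * (indicator {w. norm w \<le> \<rho>} (perp G u) * trans G (perp G u)))"

lemma wall_bound_integral:
  assumes "a1 \<le> b1" "a2 \<le> b2"
  shows "integrable lborel (wall_bound a1 b1 \<eta>1 a2 b2 \<eta>2 \<rho>)"
    and "integral\<^sup>L lborel (wall_bound a1 b1 \<eta>1 a2 b2 \<eta>2 \<rho>)
      = (Nmax + Amax) * Cl * (\<eta>1 powr p * (b1 - a1) + \<eta>2 powr p * (b2 - a2) * tmass \<rho>)"
proof -
  have J: "integrable lborel (\<lambda>z. c * indicator {a2..b2} z :: real)" for c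
    by (intro integrable_mult_right integrable_real_indicator) (auto simp: emeasure_lborel_Icc_eq)
  note P1 = trans_mass_interval[OF assms(1), of "\<eta>1 powr p"]
    and P2 = has_integral_product[OF J tmass_integrable, of "\<eta>2 powr p" \<rho>]
  show "integrable lborel (wall_bound a1 b1 \<eta>1 a2 b2 \<eta>2 \<rho>)"
    unfolding wall_bound_def[abs_def]
    by (intro integrable_mult_right Bochner_Integration.integrable_add P1(1) P2(1))
  show "integral\<^sup>L lborel (wall_bound a1 b1 \<eta>1 a2 b2 \<eta>2 \<rho>)
      = (Nmax + Amax) * Cl * (\<eta>1 powr p * (b1 - a1) + \<eta>2 powr p * (b2 - a2) * tmass \<rho>)"
    unfolding wall_bound_def[abs_def]
    using assms by (simp add: Bochner_Integration.integral_add[OF P1(1) P2(1)] P1(2) P2(2) tmass_def)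
qed

lemma excess_density_le:
  assumes T: "near T" and t: "0 \<le> t" "t \<le> T" and s: "s \<in> {1, - 1}" and y: "y \<in> disk G"
    and u: "u \<bullet> axis G \<noteq> V t"
    and hits: "\<And>z w. s * (z - V t) < 0 \<Longrightarrow> w \<in> hyperplane G \<Longrightarrow> hit G X t y z w \<Longrightarrow>
        (z \<in> {a1..b1} \<and> \<bar>z - V t\<bar> \<le> \<eta>1) \<or> (z \<in> {a2..b2} \<and> \<bar>z - V t\<bar> \<le> \<eta>2 \<and> norm w \<le> \<rho>)"
  shows "\<bar>excess_density s t y u\<bar> \<le> wall_bound a1 b1 \<eta>1 a2 b2 \<eta>2 \<rho> u"
proof -
  let ?z = "u \<bullet> axis G" and ?w = "perp G u"
  have w0: "trans G ?w \<ge> 0"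
    by (rule trans_nonneg) simp
  have NA: "0 \<le> Nmax + Amax"
    using Nmax_nonneg Amax_nonneg by simp
  show ?thesis
  proof (cases "u \<in> face_in G s (V t) \<and> hit G X t y ?z ?w")
    case False
    then have "excess_density s t y u = 0"
      unfolding excess_density_eq[OF t(1) s y u] by (rule if_not_P)
    then show ?thesis
      using w0 NA Cl_nonneg by (auto simp: wall_bound_def intro!: mult_nonneg_nonneg add_nonneg_nonneg)
  next
    case True
    have sz: "s * (?z - V t) < 0"
      using True u s by (auto simp: face_in_def)
    have z: "\<bar>?z - V t\<bar> \<le> 2 * \<epsilon>"
    proof -
      have "\<bar>?z - Vinf\<bar> \<le> \<epsilon>"
        using hit_near(1)[OF T t(2) _ u] True by blast
      moreover have "\<bar>V t - Vinf\<bar> \<le> \<epsilon>"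
        using T t by (simp add: near_def)
      ultimately show ?thesis
        by linarith
    qed
    have P: "\<bar>psi s t y ?z ?w - dens G ?z\<bar> \<le> Nmax + Amax"
    proof -
      have "\<bar>psi s t y ?z ?w\<bar> \<le> Nmax"
        using True by (intro psi_bound[OF T t s y sz]) auto
      then show ?thesis
        using dens_nonneg[of ?z] dens_le[of ?z] by linarith
    qed
    define \<eta> where "\<eta> = \<bar>?z - V t\<bar>"
    have "\<bar>excess_density s t y u\<bar> = ell G (?z - V t) * (trans G ?w * \<bar>psi s t y ?z ?w - dens G ?z\<bar>)"
      unfolding excess_density_eq[OF t(1) s y u] using True w0 ell_nonneg by (simp add: abs_mult)
    also have "\<dots> \<le> (Cl * \<eta> powr p) * (trans G ?w * (Nmax + Amax))"
      using w0 ell_nonneg ell_le[OF z] P Cl_nonneg unfolding \<eta>_def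
      by (intro mult_mono) auto
    also have "\<dots> = (Nmax + Amax) * Cl * (\<eta> powr p * trans G ?w)"
      by simp
    also have "\<dots> \<le> wall_bound a1 b1 \<eta>1 a2 b2 \<eta>2 \<rho> u"
      unfolding wall_bound_def
    proof (rule mult_left_mono)
      have pm: "\<eta> powr p \<le> \<eta>' powr p" if "\<eta> \<le> \<eta>'" for \<eta>'
        using that p_pos by (intro powr_mono2) (auto simp: \<eta>_def)
      show "\<eta> powr p * trans G ?w \<le> \<eta>1 powr p * indicator {a1..b1} ?z * trans G ?w +
          \<eta>2 powr p * indicator {a2..b2} ?z * (indicator {w. norm w \<le> \<rho>} ?w * trans G ?w)"
      proof -
        have n1: "0 \<le> \<eta>1 powr p * indicator {a1..b1} ?z * trans G ?w"
          and n2: "0 \<le> \<eta>2 powr p * indicator {a2..b2} ?z * (indicator {w. norm w \<le> \<rho>} ?w * trans G ?w)"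
          using w0 by simp_all
        consider (1) "?z \<in> {a1..b1}" "\<eta> \<le> \<eta>1" | (2) "?z \<in> {a2..b2}" "\<eta> \<le> \<eta>2" "norm ?w \<le> \<rho>"
          using hits[OF sz perp_hyperplane] True unfolding \<eta>_def by blast
        then show ?thesis
        proof cases
          case 1
          then show ?thesis
            using mult_right_mono[OF pm[OF 1(2)] w0] n2 by simp
        next
          case 2
          then show ?thesis
            using mult_right_mono[OF pm[OF 2(2)] w0] n1 by simp
        qed
      qed
    qed (use NA Cl_nonneg in simp)
    finally show ?thesis .
  qed
qed

lemma excess_density_measurable:
  assumes "0 \<le> t" "s \<in> {1, - 1}" "y \<in> disk G"
  shows "excess_density s t y \<in> borel_measurable borel"
proof -
  let ?I = "indicator (face_in G s (V t)) :: 'a \<Rightarrow> real"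
  have [measurable]: "(\<lambda>u. ?I u * fm t (face_point G s (X t) y) u) \<in> borel_measurable borel"
    by (rule fm_slice_measurable[OF assms(3,2,1)])
  have "excess_density s t y = (\<lambda>u. ell G (u \<bullet> axis G - V t) * (?I u * fm t (face_point G s (X t) y) u - ?I u * f0 G u))"
    by (auto simp: excess_density_def fun_eq_iff algebra_simps)
  then show ?thesis
    by (simp only:) measurable
qed

lemma excess_integral: "excess s t y = integral\<^sup>L lborel (excess_density s t y)"
  by (simp add: excess_def set_lebesgue_integral_def excess_density_def[abs_def])

lemma excess_integrable:
  assumes T: "near T" and t: "0 \<le> t" "t \<le> T" and s: "s \<in> {1, - 1}" and y: "y \<in> disk G"
  shows "integrable lborel (excess_density s t y)"
proof (rule Bochner_Integration.integrable_bound)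
  \<comment> \<open>The second class is void; the first contains every recolliding particle.\<close>
  let ?B = "wall_bound (Vinf - \<epsilon>) (Vinf + \<epsilon>) (2 * \<epsilon>) 0 0 0 0"
  show "integrable lborel ?B"
    by (rule wall_bound_integral) (use eps_pos in auto)
  show "excess_density s t y \<in> borel_measurable lborel"
    using excess_density_measurable[OF t(1) s y] by simp
  have bnd: "\<bar>excess_density s t y u\<bar> \<le> ?B u" if "u \<bullet> axis G \<noteq> V t" for u
  proof (rule excess_density_le[OF T t s y that])
    fix z w assume *: "s * (z - V t) < 0" "hit G X t y z w"
    then have "\<bar>z - Vinf\<bar> \<le> \<epsilon>"
      by (intro hit_near(1)[OF T t(2)]) auto
    moreover have "\<bar>V t - Vinf\<bar> \<le> \<epsilon>"
      using T t by (simp add: near_def)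
    ultimately have "z \<in> {Vinf - \<epsilon>..Vinf + \<epsilon>} \<and> \<bar>z - V t\<bar> \<le> 2 * \<epsilon>"
      by auto
    then show "(z \<in> {Vinf - \<epsilon>..Vinf + \<epsilon>} \<and> \<bar>z - V t\<bar> \<le> 2 * \<epsilon>) \<or> (z \<in> {0..0} \<and> \<bar>z - V t\<bar> \<le> 0 \<and> norm w \<le> 0)" ..
  qed
  show "AE u in lborel. norm (excess_density s t y u) \<le> norm (?B u)"
    using AE_inner_neq[of "V t"]
  proof eventually_elim
    case (elim u)
    then show ?case
      using bnd[OF elim] by simp
  qed
qed

text \<open>The exponent p + 1 consists of p from \<open>ell\<close> and 1 from the length of the
  axial interval.\<close>

lemma excess_le:
  assumes T: "near T" and t: "0 \<le> t" "t \<le> T" and s: "s \<in> {1, - 1}" and y: "y \<in> disk G"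
    and hits: "\<And>z w. s * (z - V t) < 0 \<Longrightarrow> w \<in> hyperplane G \<Longrightarrow> hit G X t y z w \<Longrightarrow>
        (z \<in> {a1..b1} \<and> \<bar>z - V t\<bar> \<le> \<eta>1) \<or> (z \<in> {a2..b2} \<and> \<bar>z - V t\<bar> \<le> \<eta>2 \<and> norm w \<le> \<rho>)"
    and len: "a1 \<le> b1" "b1 - a1 \<le> \<eta>1" "a2 \<le> b2" "b2 - a2 \<le> \<eta>2"
  shows "\<bar>excess s t y\<bar> \<le> (Nmax + Amax) * Cl * (\<eta>1 powr (p + 1) + \<eta>2 powr (p + 1) * tmass \<rho>)"
proof -
  have pw: "\<eta> powr p * (b - a) \<le> \<eta> powr (p + 1)" if "a \<le> b" "b - a \<le> \<eta>" for \<eta> a b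
  proof -
    have "\<eta> powr p * (b - a) \<le> \<eta> powr p * \<eta>"
      using that by (intro mult_left_mono) auto
    also have "\<dots> = \<eta> powr (p + 1)"
      using that by (simp add: powr_add)
    finally show ?thesis .
  qed
  have "\<bar>excess s t y\<bar> \<le> integral\<^sup>L lborel (wall_bound a1 b1 \<eta>1 a2 b2 \<eta>2 \<rho>)"
    unfolding excess_integral
  proof (rule abs_integral_le[OF wall_bound_integral(1)[OF len(1,3)]])
    show "AE u in lborel. \<bar>excess_density s t y u\<bar> \<le> wall_bound a1 b1 \<eta>1 a2 b2 \<eta>2 \<rho> u"
      using AE_inner_neq[of "V t"] by eventually_elim (rule excess_density_le[OF T t s y _ hits])
  qed
  also have "\<dots> \<le> (Nmax + Amax) * Cl * (\<eta>1 powr (p + 1) + \<eta>2 powr (p + 1) * tmass \<rho>)"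
    unfolding wall_bound_integral(2)[OF len(1,3)]
    using Nmax_nonneg Amax_nonneg Cl_nonneg
    by (intro mult_left_mono add_mono mult_right_mono pw len tmass_nonneg) auto
  finally show ?thesis .
qed

text \<open>The contribution of \<open>f0\<close> does not depend on the position on the disk, so
  convergence of the force integral passes to the excess, and the face force splits.\<close>

lemma drag_integrable:
  assumes T: "near T" and t: "0 \<le> t" "t \<le> T" and s: "s \<in> {1, - 1}"
  shows "integrable (lperp G) (\<lambda>y. indicator (disk G) y * excess s t y)"
    and "face_force G X V fm s t = drag s t +
      measure (lperp G) (disk G) * (LINT u:face_in G s (V t)|lborel. ell G (u \<bullet> axis G - V t) * f0 G u)"
proof -
  interpret Q: pair_sigma_finite "lperp G" "lborel :: 'a measure" ..
  let ?I = "indicator (face_in G s (V t)) :: 'a \<Rightarrow> real" and ?D = "indicator (disk G) :: 'a \<Rightarrow> real"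
  let ?h = "\<lambda>y u. ell G (u \<bullet> axis G - V t) * fm t (face_point G s (X t) y) u"
  define c where "c = (LINT u:face_in G s (V t)|lborel. ell G (u \<bullet> axis G - V t) * f0 G u)"
  have cint: "integrable lborel (\<lambda>u. ?I u * (ell G (u \<bullet> axis G - V t) * f0 G u))"
  proof (rule Bochner_Integration.integrable_bound[OF ell_int[of "V t"]])
    show "(\<lambda>u. ?I u * (ell G (u \<bullet> axis G - V t) * f0 G u)) \<in> borel_measurable lborel"
      by measurable
  qed (auto simp: indicator_def)
  have inner: "(LINT u:face_in G s (V t)|lborel. ?h y u) = excess s t y + c" if y: "y \<in> disk G" for y
  proof -
    have "(LINT u:face_in G s (V t)|lborel. ?h y u)
      = (LINT u|lborel. excess_density s t y u + ?I u * (ell G (u \<bullet> axis G - V t) * f0 G u))"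
      unfolding set_lebesgue_integral_def
      by (intro Bochner_Integration.integral_cong) (auto simp: excess_density_def algebra_simps)
    also have "\<dots> = excess s t y + c"
      by (subst Bochner_Integration.integral_add[OF excess_integrable[OF T t s y] cint])
         (simp add: excess_integral c_def set_lebesgue_integral_def)
    finally show ?thesis .
  qed
  have "integrable (lperp G \<Otimes>\<^sub>M lborel) (\<lambda>x. indicator (disk G \<times> face_in G s (V t)) x * (case x of (y, u) \<Rightarrow> ?h y u))"
    using conv[OF t(1) s] by (simp add: force_converges_def set_integrable_def)
  then have "integrable (lperp G) (\<lambda>y. LINT u|lborel. indicator (disk G \<times> face_in G s (V t)) (y, u) * ?h y u)"
    using Q.integrable_fst'[of "\<lambda>x. indicator (disk G \<times> face_in G s (V t)) x * (case x of (y, u) \<Rightarrow> ?h y u)"] by simp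
  moreover have "(\<lambda>y. LINT u|lborel. indicator (disk G \<times> face_in G s (V t)) (y, u) * ?h y u)
      = (\<lambda>y. ?D y * (excess s t y + c))"
  proof
    fix y
    show "(LINT u|lborel. indicator (disk G \<times> face_in G s (V t)) (y, u) * ?h y u) = ?D y * (excess s t y + c)"
      using inner[of y] by (cases "y \<in> disk G") (simp_all add: indicator_times set_lebesgue_integral_def)
  qed
  ultimately have i1: "integrable (lperp G) (\<lambda>y. ?D y * (excess s t y + c))"
    by simp
  have i2: "integrable (lperp G) (\<lambda>y. c * ?D y)"
    using disk_finite by (intro integrable_mult_right integrable_real_indicator) auto
  have "(\<lambda>y. ?D y * excess s t y) = (\<lambda>y. ?D y * (excess s t y + c) - c * ?D y)"
    by (auto simp: algebra_simps)
  with i1 i2 show i3: "integrable (lperp G) (\<lambda>y. ?D y * excess s t y)"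
    by simp
  have "face_force G X V fm s t = (LINT y|lperp G. ?D y * excess s t y + c * ?D y)"
    unfolding face_force_def set_lebesgue_integral_def[of "lperp G"]
    by (intro Bochner_Integration.integral_cong) (auto simp: inner indicator_def)
  also have "\<dots> = drag s t + measure (lperp G) (disk G) * c"
    using i3 i2 by (simp add: drag_def set_lebesgue_integral_def)
  finally show "face_force G X V fm s t = drag s t +
      measure (lperp G) (disk G) * (LINT u:face_in G s (V t)|lborel. ell G (u \<bullet> axis G - V t) * f0 G u)"
    by (simp add: c_def)
qed

lemma force_eq:
  assumes T: "near T" and t: "0 \<le> t" "t \<le> T"
  shows "force G X V fm t = F0 G (V t) + drag 1 t - drag (- 1) t"
proof -
  have "face_in G 1 (V t) = {u. u \<bullet> axis G \<le> V t}" "face_in G (- 1) (V t) = {u. u \<bullet> axis G \<ge> V t}"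
    by (auto simp: face_in_def)
  then show ?thesis
    using drag_integrable(2)[OF T t, of 1] drag_integrable(2)[OF T t, of "- 1"]
    by (simp add: force_def F0_def algebra_simps)
qed

lemma drag_le:
  assumes T: "near T" and t: "0 \<le> t" "t \<le> T" and s: "s \<in> {1, - 1}"
    and le: "\<And>y. y \<in> disk G \<Longrightarrow> \<bar>excess s t y\<bar> \<le> B"
  shows "\<bar>drag s t\<bar> \<le> measure (lperp G) (disk G) * B"
proof -
  have "\<bar>drag s t\<bar> \<le> (LINT y|lperp G. B * indicator (disk G) y)"
    unfolding drag_def set_lebesgue_integral_def real_scaleR_def
  proof (rule abs_integral_le)
    show "integrable (lperp G) (\<lambda>y. B * indicator (disk G) y)"
      using disk_finite by (intro integrable_mult_right integrable_real_indicator) auto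
  qed (use le in \<open>auto simp: indicator_def\<close>)
  then show ?thesis
    by (simp add: mult.commute)
qed

end

section \<open>Constants of the drag estimates\<close>

context gas
begin

definition q :: real where "q = real DIM('a) + p"

lemma q_gt_1: "q > 1"
proof -
  have "real DIM('a) \<ge> 1"
    using DIM_positive[where 'a='a] by linarith
  then show ?thesis
    using p_pos unfolding q_def by linarith
qed

definition Adrag :: real where
  "Adrag = measure (lperp G) (disk G) * ((Nmax + Amax) * Cl)"

text \<open>The first summand comes from collisions after time t / 2, where 1 + \<sigma> is at least
  half of 1 + t. In the second, \<open>2 + 4 / (q - 1)\<close> comes from integrating the decay of
  the velocity, and the last bracket is the constant of \<open>tmass_decay\<close>.\<close>

definition Cleft :: real where
  "Cleft = Adrag * ((2 powr q) powr (p + 1) +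
     (2 + 4 / (q - 1)) powr (p + 1) * (2 ^ (DIM('a) - 1) + Bmax * (16 * radius G) ^ (DIM('a) - 1)))"

definition \<rho>t :: real where
  "\<rho>t = (SOME \<rho>. \<rho> > 0 \<and> (\<forall>w\<in>hyperplane G. norm w \<le> \<rho> \<longrightarrow> trans G 0 / 2 \<le> trans G w))"

lemma \<rho>t: "\<rho>t > 0" "\<And>w. w \<in> hyperplane G \<Longrightarrow> norm w \<le> \<rho>t \<Longrightarrow> trans G 0 / 2 \<le> trans G w"
proof -
  have "(trans G \<longlongrightarrow> trans G 0) (at 0 within hyperplane G)"
    using trans_cont by (auto simp: continuous_on_def)
  then have "\<forall>\<^sub>F w in at 0 within hyperplane G. trans G 0 / 2 < trans G w"
    by (rule order_tendstoD) (use trans_zero in simp)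
  then obtain d where d: "d > 0" "\<And>w. w \<in> hyperplane G \<Longrightarrow> w \<noteq> 0 \<Longrightarrow> dist w 0 < d \<Longrightarrow> trans G 0 / 2 < trans G w"
    by (auto simp: eventually_at)
  have "trans G 0 / 2 \<le> trans G w" if "w \<in> hyperplane G" "norm w \<le> d / 2" for w
  proof (cases "w = 0")
    case False
    then show ?thesis
      using d(2)[of w] that d(1) by auto
  qed (use trans_zero in simp)
  then have "\<exists>\<rho>. \<rho> > 0 \<and> (\<forall>w\<in>hyperplane G. norm w \<le> \<rho> \<longrightarrow> trans G 0 / 2 \<le> trans G w)"
    using d(1) by (intro exI[of _ "d / 2"]) auto
  then have "\<rho>t > 0 \<and> (\<forall>w\<in>hyperplane G. norm w \<le> \<rho>t \<longrightarrow> trans G 0 / 2 \<le> trans G w)"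
    unfolding \<rho>t_def by (rule someI_ex)
  then show "\<rho>t > 0" "\<And>w. w \<in> hyperplane G \<Longrightarrow> norm w \<le> \<rho>t \<Longrightarrow> trans G 0 / 2 \<le> trans G w"
    by auto
qed

text \<open>A particle with transversal speed at most \<open>rspread / (1 + t)\<close> moves less
  than half a radius within time t, so it cannot leave the disk if it ends in the concentric half
  disk; moreover \<open>trans G\<close> is at least half of its central value at such
  speeds.\<close>

definition rspread :: real where "rspread = min (radius G / 2) \<rho>t"

lemma rspread_pos: "rspread > 0"
  using \<rho>t(1) radius_pos by (simp add: rspread_def)

text \<open>Half disk of end positions, times gain \<delta>, times lower bound of \<open>ell\<close>
  on an axial window of offset and length \<eta> / 4, times lower bound of the transversal mass of
  the slow particles.\<close>

definition cleft :: real where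
  "cleft = measure (lperp G) {y \<in> hyperplane G. norm y \<le> radius G / 2} * (\<delta> * cl * (1 / 4) powr (p + 1) *
     (trans G 0 / 2 * (2 * rspread / real DIM('a)) ^ (DIM('a) - 1)))"

lemma cleft_pos: "cleft > 0"
proof -
  have "0 < (2 * (radius G / 2) / real DIM('a)) ^ (DIM('a) - 1)"
    using radius_pos by simp
  also have "\<dots> \<le> measure (lperp G) {y \<in> hyperplane G. norm y \<le> radius G / 2}"
    using radius_pos by (intro measure_ball_ge) simp
  finally have "measure (lperp G) {y \<in> hyperplane G. norm y \<le> radius G / 2} > 0" .
  then show ?thesis
    unfolding cleft_def using delta_pos cl_pos trans_zero rspread_pos by (intro mult_pos_pos) auto
qed

lemma Adrag_nonneg: "Adrag \<ge> 0"
  using Nmax_nonneg Amax_nonneg Cl_nonneg by (simp add: Adrag_def)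

end

section \<open>Bounds of the drag at the two ends\<close>

context kinetic
begin

text \<open>A particle that hits the right end again is slower than the body now and has a velocity
  \<open>V \<sigma>\<close> of the body in the past, so it lies between \<open>Vinf\<close> and
  \<open>V t\<close>.\<close>

lemma drag_right_le:
  assumes T: "near T" and t: "0 \<le> t" "t \<le> T" and above: "\<And>\<sigma>. 0 \<le> \<sigma> \<Longrightarrow> \<sigma> \<le> t \<Longrightarrow> Vinf \<le> V \<sigma>"
  shows "\<bar>drag 1 t\<bar> \<le> Adrag * (V t - Vinf) powr (p + 1)"
proof -
  have "\<bar>excess 1 t y\<bar> \<le> (Nmax + Amax) * Cl * ((V t - Vinf) powr (p + 1) + 0 powr (p + 1) * tmass 0)"
    if y: "y \<in> disk G" for y
  proof (rule excess_le[OF T t _ y])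
    fix z w assume z: "1 * (z - V t) < 0" and hit: "hit G X t y z w"
    have "last_crossing X t z \<in> crossings X t z"
      by (rule hit_near(4)[OF T t(2) hit]) (use z in simp)
    moreover from this obtain \<sigma> where "last_crossing X t z < \<sigma>" "\<sigma> < t" "z = V \<sigma>"
      by (rule crossing_mean)
    ultimately have \<sigma>: "0 < \<sigma>" "\<sigma> < t" "z = V \<sigma>"
      by (auto simp: crossings_def)
    then have "Vinf \<le> z"
      using above by auto
    then show "(z \<in> {Vinf..V t} \<and> \<bar>z - V t\<bar> \<le> V t - Vinf) \<or> (z \<in> {0..0} \<and> \<bar>z - V t\<bar> \<le> 0 \<and> norm w \<le> 0)"
      using z by auto
  qed (use above t in auto)
  then have "\<bar>excess 1 t y\<bar> \<le> (Nmax + Amax) * Cl * (V t - Vinf) powr (p + 1)" if y: "y \<in> disk G" for y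
    using y p_pos by simp
  then have "\<bar>drag 1 t\<bar> \<le> measure (lperp G) (disk G) * ((Nmax + Amax) * Cl * (V t - Vinf) powr (p + 1))"
    by (intro drag_le[OF T t]) auto
  then show ?thesis
    by (simp add: Adrag_def mult.assoc)
qed

text \<open>If \<open>V t\<close> is the smallest velocity so far, no mean velocity lies below it
  and nothing can hit the right end a second time.\<close>

lemma drag_right_zero:
  assumes T: "near T" and t: "0 \<le> t" "t \<le> T" and dec: "\<And>\<sigma>. 0 \<le> \<sigma> \<Longrightarrow> \<sigma> \<le> t \<Longrightarrow> V t \<le> V \<sigma>"
  shows "drag 1 t = 0"
proof -
  have "\<bar>excess 1 t y\<bar> \<le> (Nmax + Amax) * Cl * (0 powr (p + 1) + 0 powr (p + 1) * tmass 0)"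
    if y: "y \<in> disk G" for y
  proof (rule excess_le[OF T t _ y])
    fix z w assume z: "1 * (z - V t) < 0" and hit: "hit G X t y z w"
    have "last_crossing X t z \<in> crossings X t z"
      by (rule hit_near(4)[OF T t(2) hit]) (use z in simp)
    moreover from this obtain \<sigma> where "last_crossing X t z < \<sigma>" "\<sigma> < t" "z = V \<sigma>"
      by (rule crossing_mean)
    ultimately have \<sigma>: "0 < \<sigma>" "\<sigma> < t" "z = V \<sigma>"
      by (auto simp: crossings_def)
    then show "(z \<in> {0..0} \<and> \<bar>z - V t\<bar> \<le> 0) \<or> (z \<in> {0..0} \<and> \<bar>z - V t\<bar> \<le> 0 \<and> norm w \<le> 0)"
      using z dec[of \<sigma>] by auto
  qed auto
  then have "\<bar>drag 1 t\<bar> \<le> measure (lperp G) (disk G) * 0"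
    by (intro drag_le[OF T t]) (use p_pos in auto)
  then show ?thesis
    by simp
qed

text \<open>For t at most 1 the total mass 1 is enough, afterwards the volume of the ball decides.
  The factor 16 is 2 for the side of the cube, 4 from the radius, and 2 from 1 / t being at most 2 /
  (1 + t).\<close>

lemma tmass_decay:
  assumes "t \<ge> 0"
  shows "tmass (4 * radius G / t) \<le> (2 ^ (DIM('a) - 1) + Bmax * (16 * radius G) ^ (DIM('a) - 1)) * (1 / (1 + t)) ^ (DIM('a) - 1)"
proof -
  let ?n = "DIM('a) - 1"
  have nonneg: "0 \<le> Bmax * (16 * radius G) ^ ?n" "0 \<le> (2::real) ^ ?n"
    using Bmax_nonneg radius_pos by auto
  show ?thesis
  proof (cases "t \<le> 1")
    case True
    have "tmass (4 * radius G / t) \<le> 1 ^ ?n"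
      using tmass_le_1 by simp
    also have "\<dots> \<le> (2 * (1 / (1 + t))) ^ ?n"
      using True assms by (intro power_mono) (auto simp: field_simps)
    also have "\<dots> = 2 ^ ?n * (1 / (1 + t)) ^ ?n"
      by (rule power_mult_distrib)
    also have "\<dots> \<le> (2 ^ ?n + Bmax * (16 * radius G) ^ ?n) * (1 / (1 + t)) ^ ?n"
      using nonneg assms by (intro mult_right_mono) auto
    finally show ?thesis .
  next
    case False
    have "tmass (4 * radius G / t) \<le> Bmax * (2 * (4 * radius G / t)) ^ ?n"
      using False radius_pos by (intro tmass_le) simp
    also have "\<dots> \<le> Bmax * (16 * radius G * (1 / (1 + t))) ^ ?n"
      using False radius_pos Bmax_nonneg by (intro mult_left_mono power_mono) (auto simp: field_simps)
    also have "\<dots> = Bmax * (16 * radius G) ^ ?n * (1 / (1 + t)) ^ ?n"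
      by (simp only: power_mult_distrib mult.assoc)
    also have "\<dots> \<le> (2 ^ ?n + Bmax * (16 * radius G) ^ ?n) * (1 / (1 + t)) ^ ?n"
      using nonneg assms by (intro mult_right_mono) auto
    finally show ?thesis .
  qed
qed

text \<open>The displacement relative to uniform motion is at most the integral of the assumed
  bound, which is finite because q > 1. The integral appears as monotonicity of h, built from the
  antiderivative.\<close>

lemma mean_decay:
  assumes m: "0 < m" "m < t" and up: "\<And>\<sigma>. 0 \<le> \<sigma> \<Longrightarrow> \<sigma> \<le> t \<Longrightarrow> V \<sigma> - Vinf \<le> \<Gamma> * (1 + \<sigma>) powr (- q)" and \<Gamma>: "\<Gamma> \<ge> 0"
  shows "X t - X m - (t - m) * Vinf \<le> \<Gamma> / (q - 1)"
proof -
  define h where "h \<sigma> = X \<sigma> - \<sigma> * Vinf + \<Gamma> / (q - 1) * (1 + \<sigma>) powr (1 - q)" for \<sigma>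
  have "h t \<le> h m"
  proof (rule DERIV_nonpos_imp_nonincreasing[of m t h])
    fix \<sigma> assume \<sigma>: "m \<le> \<sigma>" "\<sigma> \<le> t"
    have "at \<sigma> within {0..} = at \<sigma>"
      using \<sigma> m by (intro at_within_interior) (auto simp: interior_real_atLeast)
    then have [derivative_intros]: "(X has_real_derivative V \<sigma>) (at \<sigma>)"
      using X_deriv[of \<sigma>] \<sigma> m by auto
    have [derivative_intros]: "((\<lambda>\<sigma>. (1 + \<sigma>) powr (1 - q)) has_real_derivative (1 - q) * (1 + \<sigma>) powr (- q)) (at \<sigma>)"
      using DERIV_fun_powr[of "\<lambda>\<sigma>. 1 + \<sigma>" 1 \<sigma> "1 - q"] \<sigma> m by (auto intro!: derivative_eq_intros)
    have "(h has_real_derivative V \<sigma> - Vinf + \<Gamma> / (q - 1) * ((1 - q) * (1 + \<sigma>) powr (- q))) (at \<sigma>)"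
      unfolding h_def[abs_def] using q_gt_1 by (auto intro!: derivative_eq_intros)
    moreover have "\<Gamma> / (q - 1) * ((1 - q) * (1 + \<sigma>) powr (- q)) = - \<Gamma> * (1 + \<sigma>) powr (- q)"
    proof -
      define a where "a = \<Gamma> / (q - 1)"
      have "q - 1 \<noteq> 0"
        using q_gt_1 by linarith
      then have "\<Gamma> = a * (q - 1)"
        by (simp add: a_def)
      moreover have "a * ((1 - q) * (1 + \<sigma>) powr (- q)) = - (a * (q - 1)) * (1 + \<sigma>) powr (- q)"
        by (simp add: algebra_simps)
      ultimately show ?thesis
        unfolding a_def[symmetric] by simp
    qed
    ultimately have "(h has_real_derivative V \<sigma> - Vinf - \<Gamma> * (1 + \<sigma>) powr (- q)) (at \<sigma>)"
      by simp
    then show "\<exists>y. DERIV h \<sigma> :> y \<and> y \<le> 0"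
      using up[of \<sigma>] \<sigma> m by (intro exI[of _ "V \<sigma> - Vinf - \<Gamma> * (1 + \<sigma>) powr (- q)"]) auto
  qed (use m in simp)
  then have "X t - X m - (t - m) * Vinf \<le> \<Gamma> / (q - 1) * (1 + m) powr (1 - q) - \<Gamma> / (q - 1) * (1 + t) powr (1 - q)"
    by (simp add: h_def algebra_simps)
  also have "\<dots> \<le> \<Gamma> / (q - 1) * 1 - 0"
  proof -
    have "(1 + m) powr (1 - q) \<le> (1 + m) powr 0"
      using m q_gt_1 by (intro powr_mono) auto
    then show ?thesis
      using m q_gt_1 \<Gamma> by (intro diff_mono mult_left_mono) auto
  qed
  finally show ?thesis
    by simp
qed

text \<open>Particles are split by the time of their last collision. If it is after t / 2, their
  relative velocity is bounded by the assumed decay at t / 2. If it is before, the relative velocity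
  is only of order 1 / t, but the particle has stayed in front of the disk for a time t / 2, so its
  transversal velocity is of order 1 / t as well.\<close>

lemma drag_left_le:
  assumes T: "near T" and t: "0 \<le> t" "t \<le> T" and \<Gamma>: "\<Gamma> > 0"
    and above: "\<And>\<sigma>. 0 \<le> \<sigma> \<Longrightarrow> \<sigma> \<le> t \<Longrightarrow> Vinf \<le> V \<sigma>"
    and up: "\<And>\<sigma>. 0 \<le> \<sigma> \<Longrightarrow> \<sigma> \<le> t \<Longrightarrow> V \<sigma> - Vinf \<le> \<Gamma> * (1 + \<sigma>) powr (- q)"
  shows "\<bar>drag (- 1) t\<bar> \<le> Cleft * \<Gamma> powr (p + 1) * (1 + t) powr (- q)"
proof -
  define \<eta>1 where "\<eta>1 = \<Gamma> * (2 powr q * (1 + t) powr (- q))"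
  define \<eta>2 where "\<eta>2 = \<Gamma> * ((2 + 4 / (q - 1)) * (1 / (1 + t)))"
  have nonneg: "0 \<le> \<eta>1" "0 \<le> \<eta>2"
    using \<Gamma> q_gt_1 t by (auto simp: \<eta>1_def \<eta>2_def)
  have "\<bar>excess (- 1) t y\<bar> \<le> (Nmax + Amax) * Cl * (\<eta>1 powr (p + 1) + \<eta>2 powr (p + 1) * tmass (4 * radius G / t))"
    if y: "y \<in> disk G" for y
  proof (rule excess_le[OF T t _ y])
    fix z w assume z: "- 1 * (z - V t) < 0" and hit: "hit G X t y z w"
    define m where "m = last_crossing X t z"
    have m: "m \<in> crossings X t z"
      unfolding m_def by (rule hit_near(4)[OF T t(2) hit]) (use z in simp)
    then obtain \<sigma> where \<sigma>: "m < \<sigma>" "\<sigma> < t" "z = V \<sigma>"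
      using crossing_mean by blast
    have m0: "0 < m" "m < t" "X t - X m = (t - m) * z"
      using m by (auto simp: crossings_def)
    have zl: "V t < z" "Vinf \<le> V t"
      using z above[of t] t by auto
    show "(z \<in> {Vinf..Vinf + \<eta>1} \<and> \<bar>z - V t\<bar> \<le> \<eta>1) \<or> (z \<in> {Vinf..Vinf + \<eta>2} \<and> \<bar>z - V t\<bar> \<le> \<eta>2 \<and> norm w \<le> 4 * radius G / t)"
    proof (cases "m \<ge> t / 2")
      case True
      have "z - Vinf \<le> \<Gamma> * (1 + \<sigma>) powr (- q)"
        using up[of \<sigma>] \<sigma> m0 by simp
      also have "\<dots> \<le> \<Gamma> * ((1 + t) / 2) powr (- q)"
        using \<Gamma> True \<sigma> t q_gt_1 by (intro mult_left_mono powr_mono2') auto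
      also have "\<dots> = \<eta>1"
        using t by (simp add: \<eta>1_def powr_divide powr_minus field_simps)
      finally show ?thesis
        using zl by auto
    next
      case False
      have "(t - m) * (z - Vinf) \<le> \<Gamma> / (q - 1)"
        using mean_decay[OF m0(1,2) up] \<Gamma> m0(3) by (simp add: algebra_simps)
      moreover have "t / 2 * (z - Vinf) \<le> (t - m) * (z - Vinf)"
        using False zl by (intro mult_right_mono) auto
      ultimately have 1: "t * (z - Vinf) \<le> 2 * \<Gamma> / (q - 1)"
        by simp
      have "z - Vinf \<le> \<Gamma> * (1 + \<sigma>) powr (- q)"
        using up[of \<sigma>] \<sigma> m0 by simp
      also have "\<dots> \<le> \<Gamma> * 1"
        using \<Gamma> \<sigma> m0 q_gt_1 by (intro mult_left_mono) (auto simp: powr_minus powr_le1 field_simps ge_one_powr_ge_zero)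
      finally have 2: "z - Vinf \<le> \<Gamma>"
        by simp
      \<comment> \<open>The integrated bound is useless for small t and the pointwise one for large
        t; their sum gives the decay 1 / (1 + t) at all times.\<close>
      have "(1 + t) * (z - Vinf) \<le> \<Gamma> + 2 * \<Gamma> / (q - 1)"
        using 1 2 by (simp add: algebra_simps)
      also have "\<dots> \<le> \<Gamma> * (2 + 4 / (q - 1))"
      proof -
        have "0 \<le> \<Gamma> / (q - 1)"
          using \<Gamma> q_gt_1 by simp
        moreover have "\<Gamma> * (2 + 4 / (q - 1)) = 2 * \<Gamma> + 4 * (\<Gamma> / (q - 1))" "2 * \<Gamma> / (q - 1) = 2 * (\<Gamma> / (q - 1))"
          by (simp_all add: distrib_left)
        ultimately show ?thesis
          using \<Gamma> by linarith
      qed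
      finally have "z - Vinf \<le> \<eta>2"
        using t by (simp add: \<eta>2_def field_simps)
      \<comment> \<open>Two points of the disk are at most two radii apart, and the flight took at
        least the time t / 2.\<close>
      moreover have "norm w \<le> 4 * radius G / t"
      proof -
        have ny: "norm (y - (t - m) *\<^sub>R w) \<le> radius G" "norm y \<le> radius G"
          using hit y by (auto simp: hit_def m_def disk_def)
        have "norm ((t - m) *\<^sub>R w) \<le> norm y + norm (y - (t - m) *\<^sub>R w)"
          by (metis norm_triangle_sub norm_minus_commute)
        then have "(t - m) * norm w \<le> 2 * radius G"
          using ny m0 by simp
        moreover have "t / 2 * norm w \<le> (t - m) * norm w"
          using False by (intro mult_right_mono) auto
        ultimately show ?thesis
          using m0 by (simp add: field_simps)
      qed
      ultimately show ?thesis
        using zl by auto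
    qed
  qed (use nonneg in auto)
  then have "\<bar>drag (- 1) t\<bar> \<le> measure (lperp G) (disk G) *
      ((Nmax + Amax) * Cl * (\<eta>1 powr (p + 1) + \<eta>2 powr (p + 1) * tmass (4 * radius G / t)))"
    by (intro drag_le[OF T t]) auto
  also have "\<dots> = Adrag * (\<eta>1 powr (p + 1) + \<eta>2 powr (p + 1) * tmass (4 * radius G / t))"
    by (simp add: Adrag_def)
  also have "\<dots> \<le> Adrag * (\<Gamma> powr (p + 1) * ((2 powr q) powr (p + 1) * (1 + t) powr (- q)) +
      \<Gamma> powr (p + 1) * ((2 + 4 / (q - 1)) powr (p + 1) * (1 / (1 + t)) powr (p + 1)) *
      ((2 ^ (DIM('a) - 1) + Bmax * (16 * radius G) ^ (DIM('a) - 1)) * (1 / (1 + t)) ^ (DIM('a) - 1)))"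
  proof (intro mult_left_mono add_mono mult_mono tmass_decay t Adrag_nonneg tmass_nonneg)
    have "\<eta>1 powr (p + 1) = \<Gamma> powr (p + 1) * ((2 powr q) powr (p + 1) * ((1 + t) powr (- q)) powr (p + 1))"
      using \<Gamma> t by (simp add: \<eta>1_def powr_mult)
    also have "((1 + t) powr (- q)) powr (p + 1) \<le> (1 + t) powr (- q)"
    proof -
      have "(1 + t) powr (- q) \<le> 1"
        using t q_gt_1 by (auto simp: powr_minus field_simps ge_one_powr_ge_zero)
      then have "((1 + t) powr (- q)) powr (p + 1) \<le> ((1 + t) powr (- q)) powr 1"
        using p_pos t by (intro powr_mono') auto
      then show ?thesis
        using t by simp
    qed
    finally show "\<eta>1 powr (p + 1) \<le> \<Gamma> powr (p + 1) * ((2 powr q) powr (p + 1) * (1 + t) powr (- q))"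
      by (simp add: mult_left_mono)
    show "\<eta>2 powr (p + 1) \<le> \<Gamma> powr (p + 1) * ((2 + 4 / (q - 1)) powr (p + 1) * (1 / (1 + t)) powr (p + 1))"
      using \<Gamma> t q_gt_1 by (simp add: \<eta>2_def powr_mult powr_divide)
  qed auto
  also have "\<dots> = Cleft * \<Gamma> powr (p + 1) * (1 + t) powr (- q)"
  proof -
    \<comment> \<open>The axial exponent p + 1 and the transversal exponent d - 1 add up to
      q.\<close>
    have "(1 / (1 + t)) powr (p + 1) * (1 / (1 + t)) ^ (DIM('a) - 1) = (1 / (1 + t)) powr (p + 1 + real (DIM('a) - 1))"
      using t powr_realpow[of "1 / (1 + t)" "DIM('a) - 1"] by (simp only: powr_add[of _ "p + 1"]) simp
    also have "p + 1 + real (DIM('a) - 1) = q"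
      using DIM_positive[where 'a='a] by (simp add: q_def of_nat_diff)
    also have "(1 / (1 + t)) powr q = (1 + t) powr (- q)"
      using t by (simp add: powr_divide powr_minus_divide)
    finally have *: "(1 / (1 + t)) powr (p + 1) * (1 / (1 + t)) ^ (DIM('a) - 1) = (1 + t) powr (- q)" .
    show ?thesis
      unfolding Cleft_def *[symmetric] by (simp add: algebra_simps)
  qed
  finally show ?thesis .
qed

lemma excess_left_nonneg:
  assumes T: "near T" and t: "0 \<le> t" "t \<le> T" and y: "y \<in> disk G"
  shows "0 \<le> excess (- 1) t y"
  unfolding excess_integral
proof (rule integral_nonneg_AE)
  show "AE u in lborel. 0 \<le> excess_density (- 1) t y u"
    using AE_inner_neq[of "V t"]
  proof eventually_elim
    case (elim u)
    have "\<delta> \<le> psi (- 1) t y (u \<bullet> axis G) (perp G u) - dens G (u \<bullet> axis G)"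
      if "u \<in> face_in G (- 1) (V t)" "hit G X t y (u \<bullet> axis G) (perp G u)"
      using psi_left_gain[OF T t y _ perp_hyperplane that(2)] that(1) elim by (auto simp: face_in_def)
    then show ?case
      using delta_pos ell_nonneg trans_nonneg[OF perp_hyperplane]
      by (subst excess_density_eq[OF t(1) _ y elim]) (auto intro!: mult_nonneg_nonneg)
  qed
qed

text \<open>An explicit set of particles must hit: those with axial velocity strictly between
  \<open>V t\<close> and the mean velocity over [0, t], by \<open>crossing_exists\<close>, and so
  slow transversally that they have not left the disk. Each of them gains at least \<delta>, and all
  others contribute nonnegatively.\<close>

lemma excess_left_ge:
  assumes T: "near T" and t: "0 < t" "t \<le> T" and y: "y \<in> disk G" "norm y \<le> radius G / 2"
    and \<eta>: "\<eta> = (X t - X 0) / t - V t" "\<eta> > 0"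
  shows "\<delta> * cl * (1 / 4) powr (p + 1) * (trans G 0 / 2 * (2 * rspread / real DIM('a)) ^ (DIM('a) - 1)) *
    (\<eta> powr (p + 1) * (1 / (1 + t)) ^ (DIM('a) - 1)) \<le> excess (- 1) t y"
proof -
  define \<rho> where "\<rho> = rspread * (1 / (1 + t))"
  have \<rho>: "0 \<le> \<rho>" "\<rho> \<le> \<rho>t" "t * \<rho> \<le> radius G / 2"
  proof -
    show "0 \<le> \<rho>"
      using rspread_pos t by (simp add: \<rho>_def)
    have "\<rho> \<le> rspread"
      using rspread_pos t by (simp add: \<rho>_def field_simps)
    then show "\<rho> \<le> \<rho>t"
      by (simp add: rspread_def)
    have "t * \<rho> \<le> rspread"
      using rspread_pos t by (simp add: \<rho>_def field_simps)
    then show "t * \<rho> \<le> radius G / 2"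
      by (simp add: rspread_def)
  qed
  \<comment> \<open>Staying below \<eta> guarantees a crossing, staying above \<eta> / 4 bounds
    \<open>ell\<close> from below, and the window has length \<eta> / 4.\<close>
  let ?a = "V t + \<eta> / 4" and ?b = "V t + \<eta> / 2"
  let ?c = "\<delta> * (cl * (\<eta> / 4) powr p)"
  define g where "g u = ?c * indicator {?a..?b} (u \<bullet> axis G) * (indicator {w. norm w \<le> \<rho>} (perp G u) * trans G (perp G u))" for u
  have J: "integrable lborel (\<lambda>z. ?c * indicator {?a..?b} z :: real)"
    by (intro integrable_mult_right integrable_real_indicator) (auto simp: emeasure_lborel_Icc_eq)
  note P = has_integral_product[OF J tmass_integrable[of \<rho>], folded g_def]
  have c0: "?c \<ge> 0"
    using delta_pos cl_pos by simp
  \<comment> \<open>The mean velocity is attained by the body, so \<eta> is at most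
    \<open>2 * \<epsilon>\<close> and \<open>ell_ge\<close> applies in the window.\<close>
  obtain \<sigma> where \<sigma>: "0 < \<sigma>" "\<sigma> < t" "X t - X 0 = (t - 0) * V \<sigma>"
    using X_mvt[of 0 t] t by auto
  have "(X t - X 0) / t = V \<sigma>"
    using \<sigma> t by simp
  then have \<eta>2: "\<eta> \<le> 2 * \<epsilon>"
    using T \<sigma> t \<eta> unfolding near_def by (smt (verit) atLeastAtMost_iff)
  have ge: "g u \<le> excess_density (- 1) t y u" if u: "u \<bullet> axis G \<noteq> V t" for u
  proof -
    let ?z = "u \<bullet> axis G" and ?w = "perp G u"
    have w0: "trans G ?w \<ge> 0"
      by (rule trans_nonneg) simp
    show ?thesis
    proof (cases "?z \<in> {?a..?b} \<and> norm ?w \<le> \<rho>")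
      case True
      then have z: "V t < ?z" "?z < V t + \<eta>" "\<eta> / 4 \<le> ?z - V t" "?z - V t \<le> 2 * \<epsilon>"
        using \<eta>(2) \<eta>2 by auto
      have ne: "crossings X t ?z \<noteq> {}"
      proof (rule crossing_exists)
        have "t * ?z < t * ((X t - X 0) / t)"
          using z \<eta> t by (intro mult_strict_left_mono) auto
        then show "- 1 * (X t - X 0 - t * ?z) < 0"
          using t by simp
      qed (use z t in auto)
      let ?m = "last_crossing X t ?z"
      have m: "0 < ?m" "?m < t"
        using last_crossing(1)[OF u ne] by (auto simp: crossings_def)
      have "norm (y - (t - ?m) *\<^sub>R ?w) \<le> norm y + (t - ?m) * norm ?w"
        using m norm_triangle_ineq4[of y "(t - ?m) *\<^sub>R ?w"] by simp
      also have "\<dots> \<le> radius G / 2 + t * \<rho>"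
        using y m True t by (intro add_mono mult_mono) auto
      finally have "norm (y - (t - ?m) *\<^sub>R ?w) \<le> radius G"
        using \<rho> by simp
      with ne have hit: "hit G X t y ?z ?w"
        by (simp add: hit_def)
      have in_face: "u \<in> face_in G (- 1) (V t)"
        using z by (simp add: face_in_def)
      have gain: "\<delta> \<le> psi (- 1) t y ?z ?w - dens G ?z"
        using psi_left_gain[OF T _ t(2) y(1) z(1) perp_hyperplane hit] t by simp
      have "cl * (\<eta> / 4) powr p \<le> cl * \<bar>?z - V t\<bar> powr p"
        using z \<eta> cl_pos p_pos by (intro mult_left_mono powr_mono2) auto
      also have "\<dots> \<le> ell G (?z - V t)"
        using z \<eta> by (intro ell_ge) auto
      finally have e: "cl * (\<eta> / 4) powr p \<le> ell G (?z - V t)" .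
      have "g u = (cl * (\<eta> / 4) powr p) * (trans G ?w * \<delta>)"
        using True by (simp add: g_def)
      also have "\<dots> \<le> ell G (?z - V t) * (trans G ?w * (psi (- 1) t y ?z ?w - dens G ?z))"
        using e gain w0 cl_pos delta_pos ell_nonneg by (intro mult_mono mult_left_mono mult_nonneg_nonneg) auto
      also have "\<dots> = excess_density (- 1) t y u"
        using t hit in_face by (subst excess_density_eq[OF _ _ y(1) u]) auto
      finally show ?thesis .
    next
      case False
      then have "g u = 0"
        by (auto simp: g_def indicator_def)
      moreover have "0 \<le> excess_density (- 1) t y u"
      proof -
        have "\<delta> \<le> psi (- 1) t y ?z ?w - dens G ?z"
          if "u \<in> face_in G (- 1) (V t)" "hit G X t y ?z ?w"
          using psi_left_gain[OF T _ t(2) y(1) _ perp_hyperplane that(2)] that(1) u t by (auto simp: face_in_def)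
        then show ?thesis
          using delta_pos ell_nonneg w0 t
          by (subst excess_density_eq[OF _ _ y(1) u]) (auto intro!: mult_nonneg_nonneg)
      qed
      ultimately show ?thesis
        by simp
    qed
  qed
  have "integral\<^sup>L lborel g \<le> excess (- 1) t y"
    unfolding excess_integral
  proof (rule integral_mono_AE[OF P(1)])
    show "integrable lborel (excess_density (- 1) t y)"
      using t by (intro excess_integrable[OF T _ t(2) _ y(1)]) auto
    show "AE u in lborel. g u \<le> excess_density (- 1) t y u"
      using AE_inner_neq[of "V t"] by eventually_elim (rule ge)
  qed
  moreover have "integral\<^sup>L lborel g = ?c * (\<eta> / 4) * tmass \<rho>"
    using P(2) \<eta>(2) by (simp add: tmass_def)
  moreover have "trans G 0 / 2 * (2 * \<rho> / real DIM('a)) ^ (DIM('a) - 1) \<le> tmass \<rho>"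
  proof -
    let ?S = "{w \<in> hyperplane G. norm w \<le> \<rho>}"
    have fin: "emeasure (lperp G) ?S < \<infinity>"
      using emeasure_ball_le[OF \<rho>(1)] by (auto intro: le_less_trans)
    have "trans G 0 / 2 * (2 * \<rho> / real DIM('a)) ^ (DIM('a) - 1) \<le> trans G 0 / 2 * measure (lperp G) ?S"
      using trans_zero \<rho> by (intro mult_left_mono measure_ball_ge) auto
    also have "\<dots> = (LINT w|lperp G. trans G 0 / 2 * indicator ?S w)"
      by simp
    also have "\<dots> \<le> tmass \<rho>"
      unfolding tmass_def
    proof (rule integral_mono[OF _ tmass_integrable])
      show "integrable (lperp G) (\<lambda>w. trans G 0 / 2 * indicator ?S w)"
        using fin by (intro integrable_mult_right integrable_real_indicator) auto
      show "trans G 0 / 2 * indicator ?S w \<le> indicator {w. norm w \<le> \<rho>} w * trans G w" if "w \<in> space (lperp G)" for w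
        using that \<rho>t(2)[of w] \<rho> by (auto simp: space_lperp indicator_def)
    qed
    finally show ?thesis .
  qed
  then have "?c * (\<eta> / 4) * (trans G 0 / 2 * (2 * \<rho> / real DIM('a)) ^ (DIM('a) - 1)) \<le> ?c * (\<eta> / 4) * tmass \<rho>"
    using c0 \<eta> by (intro mult_left_mono) auto
  moreover have "?c * (\<eta> / 4) * (trans G 0 / 2 * (2 * \<rho> / real DIM('a)) ^ (DIM('a) - 1))
     = \<delta> * cl * (1 / 4) powr (p + 1) * (trans G 0 / 2 * (2 * rspread / real DIM('a)) ^ (DIM('a) - 1)) *
    (\<eta> powr (p + 1) * (1 / (1 + t)) ^ (DIM('a) - 1))"
  proof -
    have "(\<eta> / 4) powr p * (\<eta> / 4) = (1 / 4) powr (p + 1) * \<eta> powr (p + 1)"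
      using \<eta> by (simp add: powr_add powr_divide)
    moreover have "(2 * \<rho> / real DIM('a)) ^ (DIM('a) - 1) = (2 * rspread / real DIM('a)) ^ (DIM('a) - 1) * (1 / (1 + t)) ^ (DIM('a) - 1)"
      unfolding power_mult_distrib[symmetric] by (simp add: \<rho>_def mult.commute)
    ultimately show ?thesis
      by (simp add: mult_ac)
  qed
  ultimately show ?thesis
    by linarith
qed

lemma drag_left_nonneg:
  assumes T: "near T" and t: "0 \<le> t" "t \<le> T"
  shows "0 \<le> drag (- 1) t"
  unfolding drag_def set_lebesgue_integral_def
  using excess_left_nonneg[OF T t] by (intro integral_nonneg_AE AE_I2) (auto simp: indicator_def)

text \<open>Integration of the previous bound over the half disk, outside of which the excess is
  only known to be nonnegative.\<close>

lemma drag_left_ge: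
  assumes T: "near T" and t: "0 < t" "t \<le> T"
    and \<eta>: "\<eta> = (X t - X 0) / t - V t" "\<eta> > 0"
  shows "cleft * (\<eta> powr (p + 1) * (1 / (1 + t)) ^ (DIM('a) - 1)) \<le> drag (- 1) t"
proof -
  let ?S = "{y \<in> hyperplane G. norm y \<le> radius G / 2}"
  define B where "B = \<delta> * cl * (1 / 4) powr (p + 1) * (trans G 0 / 2 * (2 * rspread / real DIM('a)) ^ (DIM('a) - 1)) *
    (\<eta> powr (p + 1) * (1 / (1 + t)) ^ (DIM('a) - 1))"
  have sub: "?S \<subseteq> disk G"
    using radius_pos by (auto simp: disk_def)
  have fin: "emeasure (lperp G) ?S < \<infinity>"
    using emeasure_mono[OF sub disk_lperp] disk_finite by (auto intro: le_less_trans)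
  have "cleft * (\<eta> powr (p + 1) * (1 / (1 + t)) ^ (DIM('a) - 1)) = (LINT y|lperp G. B * indicator ?S y)"
  proof -
    have "?S \<inter> space (lperp G) = ?S"
      by (auto simp: space_lperp)
    then have "(LINT y|lperp G. B * indicator ?S y) = B * measure (lperp G) ?S"
      by (simp only: integral_mult_right_zero Bochner_Integration.integral_indicator)
    then show ?thesis
      by (simp only: cleft_def B_def mult_ac)
  qed
  also have "\<dots> \<le> drag (- 1) t"
    unfolding drag_def set_lebesgue_integral_def real_scaleR_def
  proof (rule integral_mono)
    show "integrable (lperp G) (\<lambda>y. B * indicator ?S y)"
      by (intro integrable_mult_right integrable_real_indicator ball_lperp fin)
    show "integrable (lperp G) (\<lambda>y. indicator (disk G) y * excess (- 1) t y)"
      using t by (intro drag_integrable(1)[OF T]) auto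
    show "B * indicator ?S y \<le> indicator (disk G) y * excess (- 1) t y" for y
    proof (cases "y \<in> disk G")
      case True
      show ?thesis
      proof (cases "y \<in> ?S")
        case S: True
        have "B \<le> excess (- 1) t y"
          unfolding B_def using S by (intro excess_left_ge[OF T t True _ \<eta>]) auto
        then show ?thesis
          using S True by simp
      next
        case False
        then have "indicator ?S y = (0::real)"
          by (rule indicator_simps)
        then show ?thesis
          using excess_left_nonneg[OF T _ t(2) True] t True by simp
      qed
    next
      case False
      then show ?thesis
        using sub by (auto simp: indicator_def)
    qed
  qed
  finally show ?thesis .
qed

end

section \<open>Relaxation under a drag with power decay\<close>

lemma eventually_powr_less:
  fixes a y :: real
  assumes "a > 0" "y > 0"
  shows "\<forall>\<^sub>F x in at_right 0. x powr a < y"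
proof -
  have "x powr a < y" if "0 < x" "x < y powr (1 / a)" for x
  proof -
    have "x powr a < (y powr (1 / a)) powr a"
      using that assms by (intro powr_less_mono2) auto
    then show ?thesis
      using assms by (simp add: powr_powr)
  qed
  then show ?thesis
    unfolding eventually_at_right_field using assms by (intro exI[of _ "y powr (1 / a)"]) auto
qed

lemma at_within_nonneg: "t > 0 \<Longrightarrow> at t within {0..} = at (t :: real)"
  by (intro at_within_interior) (auto simp: interior_real_atLeast)

text \<open>The differential inequality is separated from the gas, so that it can be applied to true
  and to truncated motions alike. Here n stands for d - 1; b and B are bounds of the derivative of
  \<open>F0\<close> that do not depend on \<gamma>.\<close>

locale relaxation =
  fixes p q A cL CL b B :: real and n :: nat
  assumes p_pos: "p > 0" and q_eq: "q = real n + 1 + p" and A_nonneg: "A \<ge> 0"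
    and cL_pos: "cL > 0" and CL_nonneg: "CL \<ge> 0" and b_pos: "b > 0" and b_le_B: "b \<le> B"
begin

lemma q_gt: "q > 1"
  using p_pos q_eq by simp

text \<open>The constant with which half of the exponential rate beats the power; it comes from ln x
  being at most x - 1 at x = b * (1 + t) / (2 * q).\<close>

definition D0 :: real where "D0 = exp (b / 2 - q - q * ln (b / (2 * q)))"

lemma D0_pos: "D0 > 0"
  by (simp add: D0_def)

text \<open>Only half of the rate is spent on the power. The other half is kept to gain a power of
  \<gamma> at times of order ln \<gamma>.\<close>

lemma exp_decay:
  assumes "t \<ge> 0"
  shows "exp (- b * t) \<le> D0 * exp (- b * t / 2) * (1 + t) powr (- q)"
proof -
  define a where "a = b / (2 * q)"
  have a: "a > 0" "q * a = b / 2"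
    using b_pos q_gt by (auto simp: a_def)
  have "ln (a * (1 + t)) \<le> a * (1 + t) - 1"
    using a assms by (intro ln_le_minus_one) auto
  then have "ln (1 + t) \<le> a * (1 + t) - 1 - ln a"
    using a assms by (simp add: ln_mult)
  then have "q * ln (1 + t) \<le> q * (a * (1 + t) - 1 - ln a)"
    using q_gt by (intro mult_left_mono) auto
  also have "\<dots> = (q * a) * (1 + t) - q - q * ln a"
    by (simp add: algebra_simps)
  finally have "- b * t \<le> (b / 2 - q - q * ln a) + (- b * t / 2) + - q * ln (1 + t)"
    unfolding a(2) by (simp add: algebra_simps)
  then have "exp (- b * t) \<le> exp ((b / 2 - q - q * ln a) + (- b * t / 2) + - q * ln (1 + t))"
    by simp
  also have "\<dots> = D0 * exp (- b * t / 2) * (1 + t) powr (- q)"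
    using assms by (simp add: D0_def a_def powr_def exp_add[symmetric])
  finally show ?thesis .
qed

text \<open>The margin over B separates the slopes at time 0, where the lower envelope and W
  agree.\<close>

definition Bt :: real where "Bt = B + 1"
text \<open>\<open>D0\<close> absorbs the exponential part of the solution, 1 the part caused by the
  drags.\<close>

definition Dq :: real where "Dq = D0 + 1"
text \<open>Both drags together, once W is inserted from the upper envelope.\<close>

definition A1 :: real where "A1 = (A + CL) * Dq powr (p + 1)"
text \<open>With the shifted power (m + t) to the -q, the logarithmic derivative q / (m + t) is at
  most b / 2, so half of the damping is left for the source.\<close>

definition m :: real where "m = max 1 (2 * q / b)"
text \<open>Chosen such that the remaining damping b / 2 of the comparison function covers the
  source; \<open>m powr q\<close> is the price for shifting from 1 + t to m + t, and
  \<open>A1 + 1\<close> instead of \<open>A1\<close> keeps the constant positive.\<close>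

definition C1 :: real where "C1 = 2 * (A1 + 1) * m powr q / b"
text \<open>Up to time \<kappa> times the absolute value of ln \<gamma> the lower envelope is at
  least \<gamma> to the power 1 + p / 2. The bound 1 makes that time at most the t_0 of the
  theorem.\<close>

definition \<kappa> :: real where "\<kappa> = min 1 (p / (2 * Bt))"
text \<open>The integral of \<open>exp (- Bt * s)\<close> over [0, 1], hence the displacement that
  the lower envelope guarantees by time 1, divided by \<gamma>.\<close>

definition c1 :: real where "c1 = (1 - exp (- Bt)) / Bt"
text \<open>Half of \<open>c1\<close> is what remains of the mean velocity after W has been
  subtracted from it at late times.\<close>

definition c2 :: real where "c2 = cL * (c1 / 2) powr (p + 1)"

text \<open>In this order the conditions make the late regime start after time 1, make the drag part
  of the upper bound at most the envelope, let damping win in the early regime, and make W at late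
  times so small that it is at most half of the guaranteed mean velocity and that the drag at the
  right end is at most half of the one at the left end.\<close>

definition small :: "real \<Rightarrow> bool" where
  "small \<gamma> \<longleftrightarrow> 0 < \<gamma> \<and> \<gamma> < 1 \<and> \<kappa> * \<bar>ln \<gamma>\<bar> \<ge> 1 \<and> C1 * \<gamma> powr p \<le> 1 \<and> A1 * \<gamma> powr (p / 2) < b \<and>
     D0 * \<gamma> powr (\<kappa> * b / 2) + C1 * \<gamma> powr p \<le> min (1 / 2) (c1 / 2) \<and>
     A * (D0 * \<gamma> powr (\<kappa> * b / 2) + C1 * \<gamma> powr p) \<le> c2 / 2"

text \<open>
  \<open>W\<close> is the velocity relative to \<open>Vinf\<close> and \<open>Y\<close> the displacement relative to uniform motion, so
  \<open>Y t / t\<close> is the mean relative velocity; \<open>h\<close> stands for \<open>F0 (V t) - E\<close>, and \<open>PR\<close>, \<open>PL\<close>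
  for the drags at the right and left end.
\<close>
definition admissible ::
  "real \<Rightarrow> real \<Rightarrow> real \<Rightarrow> (real \<Rightarrow> real) \<Rightarrow> (real \<Rightarrow> real) \<Rightarrow> bool" where
  "admissible \<gamma> \<beta>\<^sub>0 \<beta>\<^sub>1 W Y \<longleftrightarrow> W 0 = \<gamma> \<and> continuous_on {0..} W \<and> Y 0 = 0 \<and>
     (\<forall>t\<ge>0. (\<forall>\<sigma>\<in>{0..t}. 0 \<le> W \<sigma> \<and> W \<sigma> \<le> \<gamma>) \<longrightarrow>
       (Y has_real_derivative W t) (at t within {0..}) \<and>
       (\<exists>h PR PL. (W has_real_derivative PL - PR - h) (at t within {0..}) \<and>
         \<beta>\<^sub>1 * W t \<le> h \<and> h \<le> \<beta>\<^sub>0 * W t \<and>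
         \<bar>PR\<bar> \<le> A * W t powr (p + 1) \<and> ((\<forall>\<sigma>\<in>{0..t}. W t \<le> W \<sigma>) \<longrightarrow> PR = 0) \<and> 0 \<le> PL \<and>
         (t > 0 \<longrightarrow> Y t / t - W t > 0 \<longrightarrow> cL * ((Y t / t - W t) powr (p + 1) * (1 / (1 + t)) ^ n) \<le> PL) \<and>
         (\<forall>\<Gamma>>0. (\<forall>\<sigma>\<in>{0..t}. W \<sigma> \<le> \<Gamma> * (1 + \<sigma>) powr (- q)) \<longrightarrow> PL \<le> CL * \<Gamma> powr (p + 1) * (1 + t) powr (- q))))"

lemma constants: "Bt > 0" "Dq > 1" "A1 \<ge> 0" "m \<ge> 1" "2 * q / b \<le> m" "C1 > 0" "0 < \<kappa>" "\<kappa> \<le> 1"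
  "\<kappa> * Bt \<le> p / 2" "c1 > 0" "c2 > 0"
proof -
  show Bt: "Bt > 0" and "Dq > 1" and m: "m \<ge> 1" "2 * q / b \<le> m"
    using b_pos b_le_B D0_pos by (auto simp: Bt_def Dq_def m_def)
  show A1: "A1 \<ge> 0"
    using A_nonneg CL_nonneg by (simp add: A1_def)
  show "C1 > 0"
    using A1 m b_pos by (simp add: C1_def)
  show "0 < \<kappa>" "\<kappa> \<le> 1"
    using p_pos Bt by (auto simp: \<kappa>_def)
  have "\<kappa> * Bt \<le> p / (2 * Bt) * Bt"
    using Bt by (intro mult_right_mono) (auto simp: \<kappa>_def)
  then show "\<kappa> * Bt \<le> p / 2"
    using Bt by simp
  show c1: "c1 > 0"
    using Bt by (simp add: c1_def)
  then show "c2 > 0"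
    using cL_pos by (simp add: c2_def)
qed

lemma eventually_small: "\<forall>\<^sub>F \<gamma> in at_right 0. small \<gamma>"
proof -
  have e: "\<forall>\<^sub>F \<gamma> in at_right 0. K * \<gamma> powr a < y" if "a > 0" "y > 0" "K \<ge> 0" for K a y :: real
  proof -
    have "\<forall>\<^sub>F \<gamma> in at_right 0. \<gamma> powr a < y / (K + 1)"
      using that by (intro eventually_powr_less) auto
    then show ?thesis
    proof eventually_elim
      case (elim x)
      have "K * x powr a \<le> K * (y / (K + 1))"
        using elim that by (intro mult_left_mono) auto
      also have "\<dots> < y"
        using that by (simp add: field_simps)
      finally show ?case .
    qed
  qed
  \<comment> \<open>A common threshold for the two summands in the last two conditions of
    \<open>small\<close>.\<close>
  define y where "y = min (min (1 / 4) (c1 / 4)) (c2 / (4 * (A + 1)))"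
  have y: "y > 0" "y \<le> 1 / 4" "y \<le> c1 / 4" "A * (2 * y) \<le> c2 / 2"
  proof -
    show "y > 0"
      using constants A_nonneg by (auto simp: y_def)
    show "y \<le> 1 / 4" "y \<le> c1 / 4"
      unfolding y_def by linarith+
    have "A * (2 * y) \<le> (A + 1) * (2 * (c2 / (4 * (A + 1))))"
      using A_nonneg \<open>y > 0\<close> by (intro mult_mono) (auto simp: y_def)
    also have "\<dots> = c2 / 2"
    proof -
      have "a * (2 * (c2 / (4 * a))) = c2 / 2" if "a \<noteq> 0" for a :: real
        using that by simp
      from this[of "A + 1"] show ?thesis
        using A_nonneg by simp
    qed
    finally show "A * (2 * y) \<le> c2 / 2" .
  qed
  have pos: "\<forall>\<^sub>F \<gamma> in at_right 0. 0 < (\<gamma> :: real)"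
    by (simp add: eventually_at_right_less)
  have 1: "\<forall>\<^sub>F \<gamma> in at_right 0. \<gamma> powr 1 < exp (- 1 / \<kappa>)"
    by (intro eventually_powr_less) auto
  have 2: "\<forall>\<^sub>F \<gamma> in at_right 0. C1 * \<gamma> powr p < y"
    using p_pos y constants by (intro e) auto
  have 3: "\<forall>\<^sub>F \<gamma> in at_right 0. A1 * \<gamma> powr (p / 2) < b"
    using p_pos b_pos constants by (intro e) auto
  have 4: "\<forall>\<^sub>F \<gamma> in at_right 0. D0 * \<gamma> powr (\<kappa> * b / 2) < y"
    using b_pos y constants D0_pos by (intro e) auto
  from pos 1 2 3 4 show ?thesis
  proof eventually_elim
    case (elim \<gamma>)
    have g: "\<gamma> < exp (- 1 / \<kappa>)"
      using elim by simp
    then have "ln \<gamma> < - 1 / \<kappa>"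
      using elim by (metis exp_less_cancel_iff exp_ln)
    then have "\<kappa> * ln \<gamma> < \<kappa> * (- 1 / \<kappa>)"
      using constants by (intro mult_strict_left_mono) auto
    then have k: "\<kappa> * ln \<gamma> < - 1"
      using constants by simp
    then have "ln \<gamma> < 0"
      using constants by (smt (verit) mult_nonneg_nonneg)
    then have "\<kappa> * \<bar>ln \<gamma>\<bar> \<ge> 1" "\<gamma> < 1"
      using k elim by auto
    moreover have "A * (D0 * \<gamma> powr (\<kappa> * b / 2) + C1 * \<gamma> powr p) \<le> A * (2 * y)"
      using elim A_nonneg by (intro mult_left_mono) auto
    ultimately show ?case
      unfolding small_def using elim y by auto
  qed
qed

section \<open>Bootstrap of the velocity envelope\<close>

context
  fixes \<gamma> \<beta>\<^sub>0 \<beta>\<^sub>1 :: real and W Y :: "real \<Rightarrow> real"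
  assumes small: "small \<gamma>" and adm: "admissible \<gamma> \<beta>\<^sub>0 \<beta>\<^sub>1 W Y" and \<beta>: "b \<le> \<beta>\<^sub>1" "\<beta>\<^sub>0 \<le> B"
begin

text \<open>The factor by which W has fallen below \<open>\<gamma> * (1 + t) powr (- q)\<close> in
  the late regime: a part from the exponential and a part from the drags, both small with
  \<gamma>.\<close>

definition \<epsilon>1 :: real where "\<epsilon>1 = D0 * \<gamma> powr (\<kappa> * b / 2) + C1 * \<gamma> powr p"

lemma gam: "0 < \<gamma>" "\<gamma> < 1" "\<kappa> * \<bar>ln \<gamma>\<bar> \<ge> 1" "C1 * \<gamma> powr p \<le> 1" "A1 * \<gamma> powr (p / 2) < b"
  "\<epsilon>1 \<le> 1 / 2" "\<epsilon>1 \<le> c1 / 2" "A * \<epsilon>1 \<le> c2 / 2" "0 < \<epsilon>1"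
  using small constants D0_pos by (auto simp: small_def \<epsilon>1_def add_pos_pos)

text \<open>
  Up to time \<open>\<kappa> * \<bar>ln \<gamma>\<bar>\<close> the linear damping dominates, \<open>W\<close> decreases and \<open>PR\<close> vanishes. Later
  \<open>W\<close> is much smaller than the mean velocity \<open>Y t / t\<close>, which is at least \<open>c1 * \<gamma> / t\<close>,
  so \<open>PL\<close> exceeds \<open>PR\<close>. Either way the envelope holds with strict inequalities and cannot be left.
\<close>
definition envelope :: "real \<Rightarrow> bool" where
  "envelope t \<longleftrightarrow> \<gamma> * exp (- Bt * t) \<le> W t \<and> W t \<le> \<gamma> \<and> W t \<le> Dq * \<gamma> * (1 + t) powr (- q)"

definition good :: "real \<Rightarrow> bool" where
  "good T \<longleftrightarrow> (\<forall>t\<in>{0..T}. envelope t)"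

lemma W0: "W 0 = \<gamma>" and Y0: "Y 0 = 0" and W_cont: "continuous_on {0..} W"
  using adm by (auto simp: admissible_def)

lemma good_range: "good T \<Longrightarrow> 0 \<le> t \<Longrightarrow> t \<le> T \<Longrightarrow> 0 < W t \<and> W t \<le> \<gamma>"
  using gam by (auto simp: good_def envelope_def intro: less_le_trans[of 0 "\<gamma> * exp (- Bt * t)"])

lemma good_mono: "good T \<Longrightarrow> t \<le> T \<Longrightarrow> good t"
  by (auto simp: good_def)

lemma good_derivs:
  assumes "good t" "t \<ge> 0"
  obtains h PR PL where "(Y has_real_derivative W t) (at t within {0..})"
    "(W has_real_derivative PL - PR - h) (at t within {0..})"
    "\<beta>\<^sub>1 * W t \<le> h" "h \<le> \<beta>\<^sub>0 * W t" "\<bar>PR\<bar> \<le> A * W t powr (p + 1)"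
    "(\<forall>\<sigma>\<in>{0..t}. W t \<le> W \<sigma>) \<Longrightarrow> PR = 0" "0 \<le> PL"
    "t > 0 \<Longrightarrow> Y t / t - W t > 0 \<Longrightarrow> cL * ((Y t / t - W t) powr (p + 1) * (1 / (1 + t)) ^ n) \<le> PL"
    "PL \<le> CL * (Dq * \<gamma>) powr (p + 1) * (1 + t) powr (- q)"
proof -
  have r: "\<forall>\<sigma>\<in>{0..t}. 0 \<le> W \<sigma> \<and> W \<sigma> \<le> \<gamma>"
    using good_range[OF assms(1)] by (auto intro: less_imp_le)
  have e: "\<forall>\<sigma>\<in>{0..t}. W \<sigma> \<le> Dq * \<gamma> * (1 + \<sigma>) powr (- q)"
    using assms(1) by (auto simp: good_def envelope_def)
  have "Dq * \<gamma> > 0"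
    using constants gam by simp
  with r e show ?thesis
    using adm assms(2) that unfolding admissible_def by blast
qed

text \<open>Inside the envelope the two drags act as one source of size \<gamma> to the p + 1. The
  decay of the term with W is even faster than needed, since \<open>(1 + t) powr (- q)\<close> is at
  most 1.\<close>

lemma drift_bound:
  assumes "good t" "t \<ge> 0"
  obtains D where "(W has_real_derivative D) (at t within {0..})"
    "D \<le> - \<beta>\<^sub>1 * W t + A1 * \<gamma> powr (p + 1) * (1 + t) powr (- q)"
proof -
  obtain h PR PL where *: "(W has_real_derivative PL - PR - h) (at t within {0..})"
    "\<beta>\<^sub>1 * W t \<le> h" "\<bar>PR\<bar> \<le> A * W t powr (p + 1)" "PL \<le> CL * (Dq * \<gamma>) powr (p + 1) * (1 + t) powr (- q)"
    using good_derivs[OF assms] by metis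
  have Dg: "(Dq * \<gamma>) powr (p + 1) = Dq powr (p + 1) * \<gamma> powr (p + 1)"
    using constants gam by (intro powr_mult)
  have "W t \<le> Dq * \<gamma> * (1 + t) powr (- q)"
    using assms by (auto simp: good_def envelope_def)
  then have "W t powr (p + 1) \<le> (Dq * \<gamma> * (1 + t) powr (- q)) powr (p + 1)"
    using good_range[OF assms(1), of t] assms p_pos by (intro powr_mono2) auto
  also have "\<dots> = (Dq * \<gamma>) powr (p + 1) * ((1 + t) powr (- q)) powr (p + 1)"
    using constants gam by (intro powr_mult)
  also have "\<dots> \<le> (Dq * \<gamma>) powr (p + 1) * (1 + t) powr (- q)"
  proof (rule mult_left_mono)
    have "(1 + t) powr (- q) \<le> (1 + t) powr 0"
      using assms q_gt by (intro powr_mono) auto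
    then have "((1 + t) powr (- q)) powr (p + 1) \<le> ((1 + t) powr (- q)) powr 1"
      using p_pos assms by (intro powr_mono') auto
    then show "((1 + t) powr (- q)) powr (p + 1) \<le> (1 + t) powr (- q)"
      using assms by simp
  qed simp
  finally have "A * W t powr (p + 1) \<le> A * ((Dq * \<gamma>) powr (p + 1) * (1 + t) powr (- q))"
    using A_nonneg by (rule mult_left_mono)
  then have "PL - PR - h \<le> - \<beta>\<^sub>1 * W t + (A + CL) * (Dq * \<gamma>) powr (p + 1) * (1 + t) powr (- q)"
    using * by (simp add: algebra_simps)
  with *(1) show ?thesis
    unfolding Dg by (intro that) (auto simp: A1_def mult.assoc)
qed

text \<open>Comparison with a supersolution of the damped equation. The power part of it is strictly
  positive at time 0, and this makes the inequality strict.\<close>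

lemma upper_bound:
  assumes good: "good T" and t: "0 \<le> t" "t \<le> T"
  shows "W t < \<gamma> * exp (- \<beta>\<^sub>1 * t) + C1 * \<gamma> powr (p + 1) * (1 + t) powr (- q)"
proof -
  define C2 where "C2 = C1 * \<gamma> powr (p + 1)"
  have C2: "C2 > 0"
    using constants gam by (simp add: C2_def)
  \<comment> \<open>The difference to the particular supersolution with the shifted power,
    multiplied by the integrating factor.\<close>
  define \<phi> where "\<phi> s = exp (\<beta>\<^sub>1 * s) * (W s - C2 * (m + s) powr (- q))" for s
  have dec: "\<phi> t \<le> \<phi> 0"
  proof (cases "t = 0")
    case False
    show ?thesis
    proof (rule DERIV_nonpos_imp_decreasing_open[of 0 t \<phi>])
      show "0 \<le> t" by (rule t)
      show "continuous_on {0..t} \<phi>"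
        unfolding \<phi>_def[abs_def] using constants
        by (intro continuous_intros continuous_on_subset[OF W_cont]) auto
      fix s assume s: "0 < s" "s < t"
      have "good s"
        using good_mono[OF good] s t by auto
      then obtain D where D: "(W has_real_derivative D) (at s within {0..})"
        "D \<le> - \<beta>\<^sub>1 * W s + A1 * \<gamma> powr (p + 1) * (1 + s) powr (- q)"
        using drift_bound s by (metis less_imp_le)
      have [derivative_intros]: "(W has_real_derivative D) (at s)"
        using D(1) at_within_nonneg[of s] s by simp
      have [derivative_intros]: "((\<lambda>s. (m + s) powr (- q)) has_real_derivative - q * (m + s) powr (- q - 1)) (at s)"
        using DERIV_fun_powr[of "\<lambda>s. m + s" 1 s "- q"] s constants by (auto intro!: derivative_eq_intros)
      let ?D = "exp (\<beta>\<^sub>1 * s) * (\<beta>\<^sub>1 * W s + D - (\<beta>\<^sub>1 * (C2 * (m + s) powr (- q)) - C2 * (q * (m + s) powr (- q - 1))))"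
      have "(\<phi> has_real_derivative ?D) (at s)"
        unfolding \<phi>_def[abs_def] using s constants(4) by (auto intro!: derivative_eq_intros simp: algebra_simps)
      moreover have "?D \<le> 0"
      proof -
        have "A1 * (1 + s) powr (- q) \<le> b / 2 * (C1 * (m + s) powr (- q))"
        proof -
          have "(m * (1 + s)) powr (- q) \<le> (m + s) powr (- q)"
          proof (rule powr_mono2')
            have "1 * s \<le> m * s"
              using constants(4) s by (intro mult_right_mono) auto
            then show "m + s \<le> m * (1 + s)"
              by (simp add: algebra_simps)
          qed (use q_gt s constants in auto)
          then have "m powr (- q) * (1 + s) powr (- q) \<le> (m + s) powr (- q)"
            using constants s by (simp add: powr_mult)
          then have "m powr q * (m powr (- q) * (1 + s) powr (- q)) \<le> m powr q * (m + s) powr (- q)"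
            by (intro mult_left_mono) auto
          moreover have "m powr q * m powr (- q) = 1"
            using constants(4) by (simp add: powr_minus)
          ultimately have "(1 + s) powr (- q) \<le> m powr q * (m + s) powr (- q)"
            by (simp add: mult.assoc[symmetric])
          then have "A1 * (1 + s) powr (- q) \<le> (A1 + 1) * (m powr q * (m + s) powr (- q))"
            using constants by (intro mult_mono) auto
          moreover have C1_eq: "b / 2 * (C1 * (m + s) powr (- q)) = (A1 + 1) * (m powr q * (m + s) powr (- q))"
            using b_pos by (simp add: C1_def)
          ultimately show ?thesis
            by (simp only: C1_eq)
        qed
        then have 1: "A1 * \<gamma> powr (p + 1) * (1 + s) powr (- q) \<le> b / 2 * (C2 * (m + s) powr (- q))"
          using gam by (simp add: C2_def mult_ac)
        have "q * (m + s) powr (- q - 1) = q / (m + s) * (m + s) powr (- q)"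
          using s constants by (simp add: powr_diff)
        also have "\<dots> \<le> b / 2 * (m + s) powr (- q)"
        proof (rule mult_right_mono)
          have "2 * q \<le> m * b"
            using constants(5) b_pos by (simp add: field_simps)
          also have "\<dots> \<le> (m + s) * b"
            using s b_pos by (intro mult_right_mono) auto
          finally show "q / (m + s) \<le> b / 2"
            using s constants by (simp add: field_simps)
        qed simp
        finally have "C2 * (q * (m + s) powr (- q - 1)) \<le> C2 * (b / 2 * (m + s) powr (- q))"
          using C2 by (intro mult_left_mono) auto
        moreover have "b * (C2 * (m + s) powr (- q)) \<le> \<beta>\<^sub>1 * (C2 * (m + s) powr (- q))"
          using \<beta> C2 by (intro mult_right_mono) auto
        ultimately have "\<beta>\<^sub>1 * W s + D - (\<beta>\<^sub>1 * (C2 * (m + s) powr (- q)) - C2 * (q * (m + s) powr (- q - 1))) \<le> 0"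
          using D(2) 1 by (simp add: algebra_simps)
        then show ?thesis
          by (simp add: mult_nonneg_nonpos)
      qed
      ultimately show "\<exists>y. DERIV \<phi> s :> y \<and> y \<le> 0"
        by blast
    qed
  qed simp
  have "\<phi> 0 < \<gamma>"
    using C2 constants by (simp add: \<phi>_def W0)
  with dec have "exp (\<beta>\<^sub>1 * t) * (W t - C2 * (m + t) powr (- q)) < \<gamma>"
    by (simp add: \<phi>_def)
  then have "W t - C2 * (m + t) powr (- q) < \<gamma> * exp (- \<beta>\<^sub>1 * t)"
    by (simp add: exp_minus field_simps)
  moreover have "C2 * (m + t) powr (- q) \<le> C2 * (1 + t) powr (- q)"
    using C2 constants t q_gt by (intro mult_left_mono powr_mono2') auto
  ultimately show ?thesis
    by (simp add: C2_def)
qed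

text \<open>In this time span W is at least \<gamma> to the power 1 + p / 2, so the damping exceeds
  the drags, which are of order \<gamma> to the power 1 + p.\<close>

lemma early_decrease:
  assumes good: "good T" and t: "0 \<le> t" "t \<le> T" "t \<le> \<kappa> * \<bar>ln \<gamma>\<bar>"
  obtains D where "(W has_real_derivative D) (at t within {0..})" "D < 0"
proof -
  obtain D where D: "(W has_real_derivative D) (at t within {0..})"
    "D \<le> - \<beta>\<^sub>1 * W t + A1 * \<gamma> powr (p + 1) * (1 + t) powr (- q)"
    using drift_bound[OF good_mono[OF good t(2)] t(1)] .
  have "\<gamma> powr (1 + p / 2) = \<gamma> * exp (- (p / 2) * \<bar>ln \<gamma>\<bar>)"
  proof -
    have "\<gamma> powr (p / 2) = exp (- (p / 2) * \<bar>ln \<gamma>\<bar>)"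
      using gam by (simp add: powr_def)
    then show ?thesis
      using gam by (simp add: powr_add)
  qed
  also have "\<dots> \<le> \<gamma> * exp (- Bt * t)"
  proof -
    have "Bt * t \<le> Bt * (\<kappa> * \<bar>ln \<gamma>\<bar>)"
      using t constants by (intro mult_left_mono) auto
    also have "\<dots> = \<kappa> * Bt * \<bar>ln \<gamma>\<bar>"
      by simp
    also have "\<dots> \<le> p / 2 * \<bar>ln \<gamma>\<bar>"
      using constants by (intro mult_right_mono) auto
    finally show ?thesis
      using gam by simp
  qed
  also have "\<dots> \<le> W t"
    using good t by (auto simp: good_def envelope_def)
  finally have "b * \<gamma> powr (1 + p / 2) \<le> \<beta>\<^sub>1 * W t"
    using \<beta> b_pos by (intro mult_mono) auto
  moreover have "A1 * \<gamma> powr (p + 1) * (1 + t) powr (- q) < b * \<gamma> powr (1 + p / 2)"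
  proof -
    have "(1 + t) powr (- q) \<le> (1 + t) powr 0"
      using t q_gt by (intro powr_mono) auto
    then have "A1 * \<gamma> powr (p + 1) * (1 + t) powr (- q) \<le> A1 * \<gamma> powr (p + 1) * 1"
      using constants t by (intro mult_left_mono) auto
    also have "\<dots> = (A1 * \<gamma> powr (p / 2)) * \<gamma> powr (1 + p / 2)"
      using powr_add[of \<gamma> "p / 2" "1 + p / 2"] by (simp add: add_ac)
    also have "\<dots> < b * \<gamma> powr (1 + p / 2)"
      using gam by (intro mult_strict_right_mono) auto
    finally show ?thesis .
  qed
  ultimately have "D < 0"
    using D(2) by linarith
  with D(1) show ?thesis
    by (rule that)
qed

lemma early_antimono:
  assumes good: "good T" and t: "0 \<le> s" "s < t" "t \<le> T" "t \<le> \<kappa> * \<bar>ln \<gamma>\<bar>"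
  shows "W t < W s"
proof (rule DERIV_neg_imp_decreasing_open[OF t(2)])
  show "continuous_on {s..t} W"
    by (rule continuous_on_subset[OF W_cont]) (use t in auto)
  fix x assume x: "s < x" "x < t"
  obtain D where D: "(W has_real_derivative D) (at x within {0..})" "D < 0"
    by (rule early_decrease[OF good, of x]) (use x t in auto)
  then show "\<exists>y. DERIV W x :> y \<and> y < 0"
    using at_within_nonneg[of x] x t by auto
qed

text \<open>At these times the unspent half of the exponential rate is at most \<gamma> to the power
  \<kappa> * b / 2.\<close>

lemma late_bound:
  assumes good: "good T" and t: "\<kappa> * \<bar>ln \<gamma>\<bar> \<le> t" "t \<le> T"
  shows "W t < \<epsilon>1 * \<gamma> * (1 + t) powr (- q)"
proof -
  have t0: "t \<ge> 1"
    using t gam by simp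
  have "W t < \<gamma> * exp (- \<beta>\<^sub>1 * t) + C1 * \<gamma> powr (p + 1) * (1 + t) powr (- q)"
    using upper_bound[OF good _ t(2)] t0 by simp
  also have "\<gamma> * exp (- \<beta>\<^sub>1 * t) \<le> \<gamma> * (D0 * \<gamma> powr (\<kappa> * b / 2) * (1 + t) powr (- q))"
  proof (rule mult_left_mono)
    have "b * t \<le> \<beta>\<^sub>1 * t"
      using \<beta> t0 by (intro mult_right_mono) auto
    then have "exp (- \<beta>\<^sub>1 * t) \<le> exp (- b * t)"
      by simp
    also have "\<dots> \<le> D0 * exp (- b * t / 2) * (1 + t) powr (- q)"
      using t0 by (intro exp_decay) simp
    also have "exp (- b * t / 2) \<le> \<gamma> powr (\<kappa> * b / 2)"
    proof -
      have "b * (\<kappa> * \<bar>ln \<gamma>\<bar>) \<le> b * t"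
        using t b_pos by (intro mult_left_mono) auto
      then show ?thesis
        using gam by (simp add: powr_def algebra_simps)
    qed
    finally show "exp (- \<beta>\<^sub>1 * t) \<le> D0 * \<gamma> powr (\<kappa> * b / 2) * (1 + t) powr (- q)"
      using D0_pos by (simp add: mult_left_mono mult_right_mono)
  qed (use gam in simp)
  also have "\<gamma> * (D0 * \<gamma> powr (\<kappa> * b / 2) * (1 + t) powr (- q)) + C1 * \<gamma> powr (p + 1) * (1 + t) powr (- q)
     = \<epsilon>1 * \<gamma> * (1 + t) powr (- q)"
    using gam by (simp add: \<epsilon>1_def powr_add algebra_simps)
  finally show ?thesis
    by simp
qed

text \<open>The lower envelope is integrated; after time 1 the displacement keeps at least what was
  accumulated until then.\<close>

lemma mean_lower:
  assumes good: "good T" and t: "1 \<le> t" "t \<le> T"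
  shows "c1 * \<gamma> \<le> Y t"
proof -
  have "Y 0 + \<gamma> / Bt * exp (- Bt * 0) \<le> Y t + \<gamma> / Bt * exp (- Bt * t)"
  proof (rule DERIV_nonneg_imp_increasing_open[of 0 t "\<lambda>s. Y s + \<gamma> / Bt * exp (- Bt * s)"])
    have "continuous_on {0..t} Y"
    proof (rule DERIV_continuous_on)
      fix s assume s: "s \<in> {0..t}"
      have "(Y has_real_derivative W s) (at s within {0..})"
        using good_derivs[OF good_mono[OF good], of s] s t by (metis atLeastAtMost_iff order_trans)
      then show "(Y has_real_derivative W s) (at s within {0..t})"
        by (rule DERIV_subset) auto
    qed
    then show "continuous_on {0..t} (\<lambda>s. Y s + \<gamma> / Bt * exp (- Bt * s))"
      by (intro continuous_intros)
    fix s assume s: "0 < s" "s < t"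
    have [derivative_intros]: "(Y has_real_derivative W s) (at s)"
      using good_derivs[OF good_mono[OF good], of s] s t at_within_nonneg[of s] by (metis less_imp_le order_trans)
    have "((\<lambda>s. Y s + \<gamma> / Bt * exp (- Bt * s)) has_real_derivative W s - \<gamma> * exp (- Bt * s)) (at s)"
      using constants by (auto intro!: derivative_eq_intros)
    moreover have "0 \<le> W s - \<gamma> * exp (- Bt * s)"
      using good s t by (auto simp: good_def envelope_def)
    ultimately show "\<exists>y. DERIV (\<lambda>s. Y s + \<gamma> / Bt * exp (- Bt * s)) s :> y \<and> 0 \<le> y"
      by blast
  qed (use t in simp)
  then have "\<gamma> / Bt - \<gamma> / Bt * exp (- Bt * t) \<le> Y t"
    by (simp add: Y0)
  moreover have "\<gamma> / Bt * exp (- Bt * t) \<le> \<gamma> / Bt * exp (- Bt)"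
    using gam constants t by (intro mult_left_mono) auto
  moreover have "c1 * \<gamma> = \<gamma> / Bt - \<gamma> / Bt * exp (- Bt)"
    by (simp add: c1_def diff_divide_distrib algebra_simps)
  ultimately show ?thesis
    by linarith
qed

text \<open>The drags together always push forward. In the early regime the right one vanishes and
  the left one is positive because W decreases. In the late regime the left one is estimated by
  \<open>c2\<close> and the right one by half of that, so a definite source remains.\<close>

lemma lower_drift:
  assumes good: "good T" and t: "0 < t" "t \<le> T"
  obtains D where "(W has_real_derivative D) (at t within {0..})" "- \<beta>\<^sub>0 * W t < D"
    "\<kappa> * \<bar>ln \<gamma>\<bar> \<le> t \<Longrightarrow> - \<beta>\<^sub>0 * W t + c2 / 2 * \<gamma> powr (p + 1) * (1 + t) powr (- q) \<le> D"
proof -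
  have t0: "0 \<le> t"
    using t by simp
  obtain h PR PL where *: "(W has_real_derivative PL - PR - h) (at t within {0..})"
    "h \<le> \<beta>\<^sub>0 * W t" "\<bar>PR\<bar> \<le> A * W t powr (p + 1)"
    "(\<forall>\<sigma>\<in>{0..t}. W t \<le> W \<sigma>) \<Longrightarrow> PR = 0" "0 \<le> PL"
    "t > 0 \<Longrightarrow> Y t / t - W t > 0 \<Longrightarrow> cL * ((Y t / t - W t) powr (p + 1) * (1 / (1 + t)) ^ n) \<le> PL"
    using good_derivs[OF good_mono[OF good t(2)] t0] by metis
  have late: "c2 / 2 * \<gamma> powr (p + 1) * (1 + t) powr (- q) \<le> PL - PR" if lt: "\<kappa> * \<bar>ln \<gamma>\<bar> \<le> t"
  proof -
    have t1: "1 \<le> t"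
      using gam lt by simp
    note W = late_bound[OF good lt t(2)]
    have le1: "(1 + t) powr (- q) \<le> 1 / (1 + t)"
    proof -
      have "(1 + t) powr (- q) \<le> (1 + t) powr (- 1)"
        using t q_gt by (intro powr_mono) auto
      then show ?thesis
        using t by (simp add: powr_minus divide_inverse)
    qed
    have "\<epsilon>1 * \<gamma> * (1 + t) powr (- q) \<le> (c1 / 2) * \<gamma> * (1 / (1 + t))"
      using gam le1 constants by (intro mult_mono) auto
    with W have 1: "W t \<le> c1 / 2 * \<gamma> / (1 + t)"
      by simp
    have "c1 * \<gamma> / (1 + t) \<le> c1 * \<gamma> / t"
      using t constants gam by (intro divide_left_mono) auto
    also have "\<dots> \<le> Y t / t"
      using mean_lower[OF good t1 t(2)] t by (intro divide_right_mono) auto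
    finally have "c1 * \<gamma> / (1 + t) \<le> Y t / t" .
    note ymean = this
    have 2: "c1 / 2 * \<gamma> / (1 + t) \<le> Y t / t - W t"
    proof -
      have "c1 * \<gamma> / (1 + t) = c1 / 2 * \<gamma> / (1 + t) + c1 / 2 * \<gamma> / (1 + t)"
      proof -
        have "x * y / z = x / 2 * y / z + x / 2 * y / z" for x y z :: real
          by (simp add: field_simps)
        then show ?thesis .
      qed
      moreover define a where "a = c1 / 2 * \<gamma> / (1 + t)"
      ultimately show ?thesis
        using 1 ymean unfolding a_def[symmetric] by linarith
    qed
    moreover have "0 < c1 / 2 * \<gamma> / (1 + t)"
      using constants gam t by simp
    ultimately have "cL * ((c1 / 2 * \<gamma> / (1 + t)) powr (p + 1) * (1 / (1 + t)) ^ n) \<le> cL * ((Y t / t - W t) powr (p + 1) * (1 / (1 + t)) ^ n)"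
      using cL_pos t p_pos by (intro mult_left_mono mult_right_mono powr_mono2) auto
    also have "\<dots> \<le> PL"
      using 2 \<open>0 < c1 / 2 * \<gamma> / (1 + t)\<close> t by (intro *(6)) linarith+
    finally have PL: "cL * ((c1 / 2 * \<gamma> / (1 + t)) powr (p + 1) * (1 / (1 + t)) ^ n) \<le> PL" .
    have "(c1 / 2 * \<gamma> / (1 + t)) powr (p + 1) * (1 / (1 + t)) ^ n
        = (c1 / 2) powr (p + 1) * \<gamma> powr (p + 1) * ((1 / (1 + t)) powr (p + 1) * (1 / (1 + t)) powr real n)"
    proof -
      have "c1 / 2 * \<gamma> / (1 + t) = c1 / 2 * \<gamma> * (1 / (1 + t))"
        by simp
      moreover have "(1 / (1 + t)) powr real n = (1 / (1 + t)) ^ n"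
        using t by (intro powr_realpow) simp
      ultimately show ?thesis
        using t constants gam by (simp only: powr_mult mult.assoc)
    qed
    also have "(1 / (1 + t)) powr (p + 1) * (1 / (1 + t)) powr real n = (1 + t) powr (- q)"
    proof -
      have "p + 1 + real n = q"
        by (simp add: q_eq)
      then show ?thesis
        using t unfolding powr_add[symmetric] by (simp add: powr_divide powr_minus_divide)
    qed
    finally have PL': "c2 * \<gamma> powr (p + 1) * (1 + t) powr (- q) \<le> PL"
      using PL by (simp add: c2_def mult_ac)
    have Wp: "0 < W t"
      using good_range[OF good t0 t(2)] by simp
    have "W t powr (p + 1) \<le> (\<epsilon>1 * \<gamma> * (1 + t) powr (- q)) powr (p + 1)"
      using W Wp p_pos by (intro powr_mono2) auto
    also have "\<dots> = \<gamma> powr (p + 1) * (\<epsilon>1 * (1 + t) powr (- q)) powr (p + 1)"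
      using gam by (simp add: powr_mult mult_ac)
    also have "\<dots> \<le> \<gamma> powr (p + 1) * (\<epsilon>1 * (1 + t) powr (- q))"
    proof (rule mult_left_mono)
      have "(1 + t) powr (- q) \<le> (1 + t) powr 0"
        using t q_gt by (intro powr_mono) auto
      then have "\<epsilon>1 * (1 + t) powr (- q) \<le> 1 * 1"
        using gam t by (intro mult_mono) auto
      then have "(\<epsilon>1 * (1 + t) powr (- q)) powr (p + 1) \<le> (\<epsilon>1 * (1 + t) powr (- q)) powr 1"
        using p_pos gam by (intro powr_mono') auto
      then show "(\<epsilon>1 * (1 + t) powr (- q)) powr (p + 1) \<le> \<epsilon>1 * (1 + t) powr (- q)"
        using gam by simp
    qed simp
    finally have "A * W t powr (p + 1) \<le> A * (\<gamma> powr (p + 1) * (\<epsilon>1 * (1 + t) powr (- q)))"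
      using A_nonneg by (rule mult_left_mono)
    also have "\<dots> = (A * \<epsilon>1) * (\<gamma> powr (p + 1) * (1 + t) powr (- q))"
      by simp
    also have "\<dots> \<le> c2 / 2 * (\<gamma> powr (p + 1) * (1 + t) powr (- q))"
      using gam by (intro mult_right_mono) auto
    finally show ?thesis
      using PL' *(3) by (simp add: algebra_simps)
  qed
  have pos: "0 < PL - PR"
  proof (cases "\<kappa> * \<bar>ln \<gamma>\<bar> \<le> t")
    case True
    have "0 < c2 / 2 * \<gamma> powr (p + 1) * (1 + t) powr (- q)"
      using constants gam t by simp
    then show ?thesis
      using late[OF True] by linarith
  next
    case False
    have anti: "W t < W \<sigma>" if "0 \<le> \<sigma>" "\<sigma> < t" for \<sigma>
      using early_antimono[OF good that] t False by simp
    then have "PR = 0"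
      by (intro *(4)) (metis atLeastAtMost_iff less_imp_le order_le_less order_refl)
    \<comment> \<open>The mean relative velocity is attained at an earlier time, when W was larger
      than it is now.\<close>
    obtain l \<sigma> where \<sigma>: "0 < \<sigma>" "\<sigma> < t" "DERIV Y \<sigma> :> l" "Y t - Y 0 = (t - 0) * l"
    proof -
      have D: "(Y has_real_derivative W s) (at s within {0..})" if "s \<in> {0..t}" for s
        using good_derivs[OF good_mono[OF good], of s] that t by (metis atLeastAtMost_iff order_trans)
      have "continuous_on {0..t} Y"
        by (rule DERIV_continuous_on[OF DERIV_subset[OF D]]) auto
      moreover have "Y differentiable at s" if "0 < s" "s < t" for s
        using D[of s] that at_within_nonneg[of s] by (auto simp: real_differentiable_def)
      ultimately show ?thesis
        using MVT[OF t(1), of Y] that by blast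
    qed
    have "(Y has_real_derivative W \<sigma>) (at \<sigma>)"
      using good_derivs[OF good_mono[OF good], of \<sigma>] \<sigma> t at_within_nonneg[of \<sigma>] by (metis less_imp_le order_trans)
    then have "l = W \<sigma>"
      using \<sigma>(3) DERIV_unique by blast
    then have "Y t / t - W t = W \<sigma> - W t"
      using \<sigma>(4) t by (simp add: Y0)
    then have "0 < Y t / t - W t"
      using anti[of \<sigma>] \<sigma> by simp
    moreover from this have "0 < cL * ((Y t / t - W t) powr (p + 1) * (1 / (1 + t)) ^ n)"
      using cL_pos t by (intro mult_pos_pos) auto
    ultimately show ?thesis
      using *(6) t \<open>PR = 0\<close> by simp
  qed
  show ?thesis
  proof (rule that[OF *(1)])
    show "- \<beta>\<^sub>0 * W t < PL - PR - h"
      using pos *(2) by simp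
    show "- \<beta>\<^sub>0 * W t + c2 / 2 * \<gamma> powr (p + 1) * (1 + t) powr (- q) \<le> PL - PR - h" if "\<kappa> * \<bar>ln \<gamma>\<bar> \<le> t"
      using late[OF that] *(2) by simp
  qed
qed

lemma exp_weighted_deriv:
  assumes "(W has_real_derivative D) (at t within {0..})" "t > 0"
  shows "((\<lambda>s. exp (\<beta>\<^sub>0 * s) * W s) has_real_derivative exp (\<beta>\<^sub>0 * t) * (D + \<beta>\<^sub>0 * W t)) (at t)"
proof -
  have [derivative_intros]: "(W has_real_derivative D) (at t)"
    using assms at_within_nonneg[of t] by simp
  show ?thesis
    by (auto intro!: derivative_eq_intros simp: algebra_simps)
qed

lemma lower_bound:
  assumes good: "good T" and t: "0 < t" "t \<le> T"
  shows "\<gamma> * exp (- \<beta>\<^sub>0 * t) < W t"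
proof -
  have "exp (\<beta>\<^sub>0 * 0) * W 0 < exp (\<beta>\<^sub>0 * t) * W t"
  proof (rule DERIV_pos_imp_increasing_open[OF t(1), of "\<lambda>s. exp (\<beta>\<^sub>0 * s) * W s"])
    show "continuous_on {0..t} (\<lambda>s. exp (\<beta>\<^sub>0 * s) * W s)"
      by (intro continuous_intros continuous_on_subset[OF W_cont]) auto
    fix s assume s: "0 < s" "s < t"
    obtain D where D: "(W has_real_derivative D) (at s within {0..})" "- \<beta>\<^sub>0 * W s < D"
      by (rule lower_drift[OF good, of s]) (use s t in auto)
    have "0 < exp (\<beta>\<^sub>0 * s) * (D + \<beta>\<^sub>0 * W s)"
      using D(2) by simp
    then show "\<exists>y. DERIV (\<lambda>s. exp (\<beta>\<^sub>0 * s) * W s) s :> y \<and> 0 < y"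
      using exp_weighted_deriv[OF D(1) s(1)] by blast
  qed
  then show ?thesis
    by (simp add: W0 exp_minus field_simps)
qed

text \<open>The source of the late regime is integrated only over the last unit of time. The
  interval lies in the late regime because \<kappa> is at most 1, which explains the threshold one
  unit after t_0.\<close>

lemma lower_bound_late:
  assumes good: "good T" and t: "\<bar>ln \<gamma>\<bar> + 1 \<le> t" "t \<le> T"
  shows "\<gamma> * exp (- \<beta>\<^sub>0 * t) + exp (- B) * (c2 / 2) * \<gamma> powr (p + 1) * (1 + t) powr (- q) \<le> W t"
proof -
  have lg: "\<kappa> * \<bar>ln \<gamma>\<bar> \<le> \<bar>ln \<gamma>\<bar>"
    using constants by (simp add: mult_left_le_one_le)
  then have t2: "1 \<le> t - 1"
    using gam t by linarith
  define k where "k = c2 / 2 * \<gamma> powr (p + 1) * (1 + t) powr (- q)"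
  have k: "k \<ge> 0"
    using constants by (simp add: k_def)
  let ?\<phi> = "\<lambda>s. exp (\<beta>\<^sub>0 * s) * W s"
  \<comment> \<open>On the last unit interval the weight \<open>exp (\<beta>\<^sub>0 * s)\<close> is
    bounded below by this constant; the maximum with 0 covers both signs of the rate.\<close>
  let ?\<psi> = "\<lambda>s. ?\<phi> s - exp (\<beta>\<^sub>0 * t - max \<beta>\<^sub>0 0) * k * s"
  have "?\<psi> (t - 1) \<le> ?\<psi> t"
  proof (rule DERIV_nonneg_imp_increasing_open[of "t - 1" t ?\<psi>])
    show "continuous_on {t - 1..t} ?\<psi>"
      using t2 by (intro continuous_intros continuous_on_subset[OF W_cont]) auto
    fix s assume s: "t - 1 < s" "s < t"
    obtain D where D: "(W has_real_derivative D) (at s within {0..})"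
      "- \<beta>\<^sub>0 * W s + c2 / 2 * \<gamma> powr (p + 1) * (1 + s) powr (- q) \<le> D"
    proof (rule lower_drift[OF good, of s])
      fix D assume D: "(W has_real_derivative D) (at s within {0..})"
        "\<kappa> * \<bar>ln \<gamma>\<bar> \<le> s \<Longrightarrow> - \<beta>\<^sub>0 * W s + c2 / 2 * \<gamma> powr (p + 1) * (1 + s) powr (- q) \<le> D"
      show thesis
        by (rule that[OF D(1) D(2)]) (use s t lg in linarith)
    qed (use s t t2 in auto)
    have [derivative_intros]: "(?\<phi> has_real_derivative exp (\<beta>\<^sub>0 * s) * (D + \<beta>\<^sub>0 * W s)) (at s)"
      using exp_weighted_deriv[OF D(1)] s t2 by simp
    have "(?\<psi> has_real_derivative exp (\<beta>\<^sub>0 * s) * (D + \<beta>\<^sub>0 * W s) - exp (\<beta>\<^sub>0 * t - max \<beta>\<^sub>0 0) * k) (at s)"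
      by (auto intro!: derivative_eq_intros)
    moreover have "exp (\<beta>\<^sub>0 * t - max \<beta>\<^sub>0 0) * k \<le> exp (\<beta>\<^sub>0 * s) * (D + \<beta>\<^sub>0 * W s)"
    proof (rule mult_mono)
      have "\<beta>\<^sub>0 * (t - s) \<le> max \<beta>\<^sub>0 0 * 1"
        using s by (intro mult_mono) auto
      then show "exp (\<beta>\<^sub>0 * t - max \<beta>\<^sub>0 0) \<le> exp (\<beta>\<^sub>0 * s)"
        by (simp add: algebra_simps)
      have "k \<le> c2 / 2 * \<gamma> powr (p + 1) * (1 + s) powr (- q)"
        unfolding k_def using constants s t2 q_gt by (intro mult_left_mono powr_mono2') auto
      then show "k \<le> D + \<beta>\<^sub>0 * W s"
        using D(2) by simp
    qed (use k in auto)
    ultimately show "\<exists>y. DERIV ?\<psi> s :> y \<and> 0 \<le> y"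
      by (intro exI conjI) (assumption, simp)
  qed simp
  then have 1: "?\<phi> (t - 1) + exp (\<beta>\<^sub>0 * t - max \<beta>\<^sub>0 0) * k \<le> ?\<phi> t"
    by (simp add: algebra_simps)
  have "\<gamma> * exp (- \<beta>\<^sub>0 * (t - 1)) < W (t - 1)"
    using t2 t by (intro lower_bound[OF good]) auto
  then have "exp (\<beta>\<^sub>0 * (t - 1)) * (\<gamma> * exp (- \<beta>\<^sub>0 * (t - 1))) \<le> ?\<phi> (t - 1)"
    by (intro mult_left_mono) auto
  moreover have "exp (\<beta>\<^sub>0 * (t - 1)) * (\<gamma> * exp (- \<beta>\<^sub>0 * (t - 1))) = \<gamma>"
    by (simp add: mult.left_commute mult_exp_exp)
  ultimately have "\<gamma> \<le> ?\<phi> (t - 1)"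
    by (simp only:)
  with 1 have "\<gamma> + exp (\<beta>\<^sub>0 * t - max \<beta>\<^sub>0 0) * k \<le> exp (\<beta>\<^sub>0 * t) * W t"
    by linarith
  then have "exp (- \<beta>\<^sub>0 * t) * (\<gamma> + exp (\<beta>\<^sub>0 * t - max \<beta>\<^sub>0 0) * k) \<le> exp (- \<beta>\<^sub>0 * t) * (exp (\<beta>\<^sub>0 * t) * W t)"
    by (intro mult_left_mono) auto
  then have "\<gamma> * exp (- \<beta>\<^sub>0 * t) + exp (- max \<beta>\<^sub>0 0) * k \<le> W t"
    by (simp add: exp_minus exp_diff field_simps)
  moreover have "exp (- B) * k \<le> exp (- max \<beta>\<^sub>0 0) * k"
    using \<beta> b_le_B b_pos k by (intro mult_right_mono) auto
  ultimately show ?thesis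
    by (simp add: k_def mult.assoc)
qed

text \<open>The bounds derived from the envelope are strictly better than the envelope itself; this
  is what lets it be continued.\<close>

lemma strict_envelope:
  assumes good: "good T" and T: "0 < T"
  shows "\<gamma> * exp (- Bt * T) < W T" "W T < \<gamma>" "W T < Dq * \<gamma> * (1 + T) powr (- q)"
proof -
  have "\<beta>\<^sub>0 * T \<le> Bt * T"
    using \<beta> T by (intro mult_right_mono) (auto simp: Bt_def)
  then have "\<gamma> * exp (- Bt * T) \<le> \<gamma> * exp (- \<beta>\<^sub>0 * T)"
    using gam by simp
  also have "\<dots> < W T"
    by (rule lower_bound[OF good T]) simp
  finally show "\<gamma> * exp (- Bt * T) < W T" .
  show "W T < \<gamma>"
  proof (cases "\<kappa> * \<bar>ln \<gamma>\<bar> \<le> T")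
    case True
    have "(1 + T) powr (- q) \<le> (1 + T) powr 0"
      using T q_gt by (intro powr_mono) auto
    then have "\<epsilon>1 * \<gamma> * (1 + T) powr (- q) \<le> 1 * \<gamma> * 1"
      using gam T by (intro mult_mono) auto
    then show ?thesis
      using late_bound[OF good True] by simp
  next
    case False
    then show ?thesis
      using early_antimono[OF good, of 0 T] T W0 by simp
  qed
  have "W T < \<gamma> * exp (- \<beta>\<^sub>1 * T) + C1 * \<gamma> powr (p + 1) * (1 + T) powr (- q)"
    using T by (intro upper_bound[OF good]) auto
  also have "\<dots> \<le> \<gamma> * (D0 * (1 + T) powr (- q)) + \<gamma> * (1 * (1 + T) powr (- q))"
  proof (intro add_mono mult_left_mono)
    have "b * T \<le> \<beta>\<^sub>1 * T"
      using \<beta> T by (intro mult_right_mono) auto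
    then have "exp (- \<beta>\<^sub>1 * T) \<le> exp (- b * T)"
      by simp
    also have "\<dots> \<le> D0 * exp (- b * T / 2) * (1 + T) powr (- q)"
      using T by (intro exp_decay) simp
    also have "\<dots> \<le> D0 * 1 * (1 + T) powr (- q)"
      using D0_pos b_pos T by (intro mult_left_mono mult_right_mono) auto
    finally show "exp (- \<beta>\<^sub>1 * T) \<le> D0 * (1 + T) powr (- q)"
      by simp
    have "C1 * \<gamma> powr (p + 1) * (1 + T) powr (- q) = \<gamma> * ((C1 * \<gamma> powr p) * (1 + T) powr (- q))"
      using gam by (simp add: powr_add)
    also have "\<dots> \<le> \<gamma> * (1 * (1 + T) powr (- q))"
      using gam by (intro mult_left_mono mult_right_mono) auto
    finally show "C1 * \<gamma> powr (p + 1) * (1 + T) powr (- q) \<le> \<gamma> * (1 * (1 + T) powr (- q))" .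
  qed (use gam in auto)
  also have "\<dots> = Dq * \<gamma> * (1 + T) powr (- q)"
    by (simp add: Dq_def algebra_simps)
  finally show "W T < Dq * \<gamma> * (1 + T) powr (- q)" .
qed

lemma envelope_continues:
  assumes good: "good T" and T: "0 \<le> T"
  shows "\<exists>d>0. \<forall>t. T < t \<longrightarrow> t < T + d \<longrightarrow> envelope t"
proof (cases "T = 0")
  case False
  then have T: "0 < T"
    using T by simp
  have "(W \<longlongrightarrow> W T) (at T within {0..})"
    using W_cont T by (auto simp: continuous_on_def)
  then have W: "(W \<longlongrightarrow> W T) (at T)"
    using at_within_nonneg[OF T] by simp
  have e1: "((\<lambda>t. W t - \<gamma> * exp (- Bt * t)) \<longlongrightarrow> W T - \<gamma> * exp (- Bt * T)) (at T)"
    by (intro tendsto_intros W)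
  have e2: "((\<lambda>t. Dq * \<gamma> * (1 + t) powr (- q) - W t) \<longlongrightarrow> Dq * \<gamma> * (1 + T) powr (- q) - W T) (at T)"
    by (intro tendsto_intros W) (use T in auto)
  have "\<forall>\<^sub>F t in at T. 0 < W t - \<gamma> * exp (- Bt * t)"
    by (rule order_tendstoD(1)[OF e1]) (use strict_envelope[OF good T] in simp)
  moreover have "\<forall>\<^sub>F t in at T. 0 < Dq * \<gamma> * (1 + t) powr (- q) - W t"
    by (rule order_tendstoD(1)[OF e2]) (use strict_envelope[OF good T] in simp)
  moreover have "\<forall>\<^sub>F t in at T. W t < \<gamma>"
    by (rule order_tendstoD(2)[OF W]) (use strict_envelope[OF good T] in simp)
  ultimately have "\<forall>\<^sub>F t in at T. envelope t"
    by eventually_elim (auto simp: envelope_def)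
  then obtain d where "d > 0" "\<And>t. t \<noteq> T \<Longrightarrow> dist t T < d \<Longrightarrow> envelope t"
    by (auto simp: eventually_at)
  then show ?thesis
    by (intro exI[of _ d]) (auto simp: dist_real_def)
next
  \<comment> \<open>At time 0 the lower bound and the bound by \<gamma> are equalities, so slopes
    have to be compared; the third bound is strict since \<open>Dq\<close> exceeds 1.\<close>
  case True
  have g0: "good 0"
    using good True by simp
  obtain h PR PL where *: "(W has_real_derivative PL - PR - h) (at 0 within {0..})"
    "h \<le> \<beta>\<^sub>0 * W 0" "(\<forall>\<sigma>\<in>{0..0}. W 0 \<le> W \<sigma>) \<Longrightarrow> PR = 0" "0 \<le> PL"
    using good_derivs[OF g0] by (metis order_refl)
  have "PR = 0"
    by (intro *(3)) auto
  then have low: "- Bt * \<gamma> < PL - PR - h"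
  proof -
    have "\<beta>\<^sub>0 * \<gamma> < Bt * \<gamma>"
      using gam \<beta> by (intro mult_strict_right_mono) (auto simp: Bt_def)
    then show ?thesis
      using *(2,4) \<open>PR = 0\<close> by (simp add: W0)
  qed
  obtain D where neg: "(W has_real_derivative D) (at 0 within {0..})" "D < 0"
    by (rule early_decrease[OF g0, of 0]) (use gam in auto)
  have "((\<lambda>t. W t - \<gamma> * exp (- Bt * t)) has_real_derivative (PL - PR - h) + Bt * \<gamma>) (at 0 within {0..})"
    by (rule derivative_eq_intros *(1) refl)+ simp
  from has_real_derivative_pos_inc_right[OF this] low obtain d1 where d1: "d1 > 0"
    "\<And>t. 0 < t \<Longrightarrow> t < d1 \<Longrightarrow> 0 < W t - \<gamma> * exp (- Bt * t)"
    by (auto simp: W0)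
  from has_real_derivative_neg_dec_right[OF neg] obtain d2 where d2: "d2 > 0"
    "\<And>t. 0 < t \<Longrightarrow> t < d2 \<Longrightarrow> W t < \<gamma>"
    by (auto simp: W0)
  have W: "(W \<longlongrightarrow> W 0) (at 0 within {0..})"
    using W_cont by (auto simp: continuous_on_def)
  have e2: "((\<lambda>t. Dq * \<gamma> * (1 + t) powr (- q) - W t) \<longlongrightarrow> Dq * \<gamma> * (1 + 0) powr (- q) - W 0) (at 0 within {0..})"
    by (intro tendsto_intros W) auto
  have "\<forall>\<^sub>F t in at 0 within {0..}. 0 < Dq * \<gamma> * (1 + t) powr (- q) - W t"
    by (rule order_tendstoD(1)[OF e2]) (use gam constants in \<open>simp add: W0\<close>)
  then obtain d3 where d3: "d3 > 0" "\<And>t. 0 < t \<Longrightarrow> t < d3 \<Longrightarrow> 0 < Dq * \<gamma> * (1 + t) powr (- q) - W t"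
    by (force simp: eventually_at)
  show ?thesis
  proof (intro exI[of _ "min d1 (min d2 d3)"] conjI allI impI)
    fix t assume "T < t" "t < T + min d1 (min d2 d3)"
    then show "envelope t"
      using d1(2)[of t] d2(2)[of t] d3(2)[of t] True by (auto simp: envelope_def)
  qed (use d1 d2 d3 in auto)
qed

text \<open>At the infimum of the failure times the envelope still holds by continuity, and then it
  holds a little longer.\<close>

lemma good_all: "good T"
proof (rule ccontr)
  assume "\<not> good T"
  then obtain t0 where t0: "0 \<le> t0" "\<not> envelope t0"
    by (auto simp: good_def)
  define S where "S = {t. 0 \<le> t \<and> \<not> envelope t}"
  have S: "S \<noteq> {}" "bdd_below S"
    using t0 by (auto simp: S_def bdd_below_def)
  define s where "s = Inf S"
  have s0: "0 \<le> s"
    unfolding s_def using S by (intro cInf_greatest) (auto simp: S_def)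
  have before: "envelope t" if "0 \<le> t" "t < s" for t
    using cInf_lower[OF _ S(2), of t] that by (fastforce simp: S_def s_def)
  have "envelope s"
  proof (cases "s = 0")
    case True
    then show ?thesis
      using constants gam by (simp add: envelope_def W0)
  next
    case False
    then have s: "0 < s"
      using s0 by simp
    have "(W \<longlongrightarrow> W s) (at s within {0..})"
      using W_cont s by (auto simp: continuous_on_def)
    then have lim: "(W \<longlongrightarrow> W s) (at_left s)"
      using at_within_nonneg[OF s] filterlim_at_split by fastforce
    have ev: "\<forall>\<^sub>F t in at_left s. envelope t"
      using before s by (auto simp: eventually_at_left_field intro!: exI[of _ 0])
    have "\<gamma> * exp (- Bt * s) \<le> W s"
      by (rule tendsto_le[OF _ lim, of "\<lambda>t. \<gamma> * exp (- Bt * t)"])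
         (use ev in \<open>auto intro!: tendsto_intros elim: eventually_mono simp: envelope_def\<close>)
    moreover have "W s \<le> \<gamma>"
      by (rule tendsto_le[OF _ tendsto_const lim])
         (use ev in \<open>auto elim: eventually_mono simp: envelope_def\<close>)
    moreover have "W s \<le> Dq * \<gamma> * (1 + s) powr (- q)"
    proof (rule tendsto_le[OF _ _ lim])
      show "((\<lambda>t. Dq * \<gamma> * (1 + t) powr (- q)) \<longlongrightarrow> Dq * \<gamma> * (1 + s) powr (- q)) (at_left s)"
        by (intro tendsto_intros) (use s in auto)
    qed (use ev in \<open>auto elim: eventually_mono simp: envelope_def\<close>)
    ultimately show ?thesis
      by (simp add: envelope_def)
  qed
  then have "good s"
    using before by (auto simp: good_def) (metis order_le_less)
  from envelope_continues[OF this s0] obtain d where d: "d > 0" "\<And>t. s < t \<Longrightarrow> t < s + d \<Longrightarrow> envelope t"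
    by blast
  have "Inf S < s + d"
    using d by (simp add: s_def)
  then obtain t where "t \<in> S" "t < s + d"
    using cInf_less_iff[OF S] by blast
  then show False
    using before[of t] d(2)[of t] \<open>envelope s\<close> by (cases t s rule: linorder_cases) (auto simp: S_def)
qed

theorem relaxation_bounds:
  assumes "t > 0"
  shows "0 < W t" "W t < \<gamma>"
    and "\<gamma> * exp (- \<beta>\<^sub>0 * t) + (if t \<ge> \<bar>ln \<gamma>\<bar> + 1 then exp (- B) * (c2 / 4) * 2 powr (- q) * \<gamma> powr (p + 1) / t powr q else 0) < W t"
    and "W t < \<gamma> * exp (- \<beta>\<^sub>1 * t) + C1 * \<gamma> powr (p + 1) / (1 + t) powr q"
proof -
  note good = good_all[of t]
  show "0 < W t" "W t < \<gamma>"
    using good_range[OF good, of t] strict_envelope[OF good] assms by auto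
  show "W t < \<gamma> * exp (- \<beta>\<^sub>1 * t) + C1 * \<gamma> powr (p + 1) / (1 + t) powr q"
    using upper_bound[OF good, of t] assms by (simp add: powr_minus divide_inverse)
  show "\<gamma> * exp (- \<beta>\<^sub>0 * t) + (if t \<ge> \<bar>ln \<gamma>\<bar> + 1 then exp (- B) * (c2 / 4) * 2 powr (- q) * \<gamma> powr (p + 1) / t powr q else 0) < W t"
  proof (cases "t \<ge> \<bar>ln \<gamma>\<bar> + 1")
    case True
    \<comment> \<open>For t at least 1 the sum 1 + t is at most 2 * t. Passing from c2 / 2 to c2 / 4
      below makes the inequality strict.\<close>
    have "2 powr (- q) / t powr q = (2 * t) powr (- q)"
      using assms by (simp add: powr_mult powr_minus divide_inverse)
    also have "\<dots> \<le> (1 + t) powr (- q)"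
      using True assms q_gt by (intro powr_mono2') auto
    finally have "exp (- B) * (c2 / 4) * \<gamma> powr (p + 1) * (2 powr (- q) / t powr q) \<le> exp (- B) * (c2 / 4) * \<gamma> powr (p + 1) * (1 + t) powr (- q)"
      using constants by (intro mult_left_mono) auto
    also have "\<dots> < exp (- B) * (c2 / 2) * \<gamma> powr (p + 1) * (1 + t) powr (- q)"
      using constants gam assms by simp
    finally have "exp (- B) * (c2 / 4) * 2 powr (- q) * \<gamma> powr (p + 1) / t powr q
        < exp (- B) * (c2 / 2) * \<gamma> powr (p + 1) * (1 + t) powr (- q)"
      by (simp add: mult_ac)
    then show ?thesis
      using lower_bound_late[OF good True] unfolding if_P[OF True] by linarith
  next
    case False
    then show ?thesis
      using lower_bound[OF good, of t] assms by simp
  qed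
qed

end

end

section \<open>Dependence of recollisions on the motion\<close>

locale gas_at = gas G p Vinf \<epsilon> cl Cl Kmax Amax Bmax \<delta> M
  for G :: "'a::euclidean_space body_gas" and p Vinf \<epsilon> cl Cl Kmax Amax Bmax \<delta> M +
  fixes X0 :: real
begin

text \<open>Truncated velocities: since they stay within \<epsilon> of \<open>Vinf\<close> at all
  times, every estimate of the gas applies to them without further conditions.\<close>

definition hist :: "(real \<Rightarrow> real) \<Rightarrow> bool" where
  "hist V \<longleftrightarrow> continuous_on UNIV V \<and> (\<forall>t. \<bar>V t - Vinf\<bar> \<le> \<epsilon>)"

text \<open>For negative t the interval is empty and the value is \<open>X0\<close>, so that
  \<open>pos V\<close> is continuous on the whole line.\<close>

definition pos :: "(real \<Rightarrow> real) \<Rightarrow> real \<Rightarrow> real" where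
  "pos V t = X0 + integral {0..t} V"

lemma hist_cont: "hist V \<Longrightarrow> continuous_on S V"
  by (auto simp: hist_def intro: continuous_on_subset)

lemma hist_near: "hist V \<Longrightarrow> \<bar>V t - Vinf\<bar> \<le> \<epsilon>"
  by (simp add: hist_def)

lemma pos_0: "pos V 0 = X0"
  by (simp add: pos_def)

lemma pos_deriv:
  assumes "hist V" "t \<ge> 0"
  shows "(pos V has_real_derivative V t) (at t within {0..})"
proof -
  have "((\<lambda>x. integral {0..x} V) has_real_derivative V t) (at t within {0..t + 1})"
    using assms by (intro integral_has_real_derivative hist_cont) auto
  then have "((\<lambda>x. X0 + integral {0..x} V) has_real_derivative V t) (at t within {0..t + 1})"
    by (auto intro!: derivative_eq_intros)
  moreover have "at t within {0..t + 1} = at t within {0..}"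
    using assms by (intro at_within_nhd[of t "{..<t + 1}"]) auto
  ultimately show ?thesis
    by (simp add: pos_def[abs_def])
qed

lemma trajectory_pos: "hist V \<Longrightarrow> trajectory (pos V) V"
  by unfold_locales (auto intro: pos_deriv hist_cont)

lemma pos_cont: "hist V \<Longrightarrow> continuous_on UNIV (pos V)"
proof -
  assume V: "hist V"
  interpret trajectory "pos V" V
    by (rule trajectory_pos[OF V])
  have "continuous_on {..0} (pos V)"
  proof -
    have "pos V t = X0" if "t \<in> {..0}" for t
    proof (cases "t = 0")
      case False
      then have "{0..t} = {}"
        using that by auto
      then show ?thesis
        by (simp add: pos_def)
    qed (simp add: pos_0)
    then show ?thesis
      by (subst continuous_on_cong[OF refl, of _ _ "\<lambda>_. X0"]) auto
  qed
  then have "continuous_on ({..0} \<union> {0..}) (pos V)"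
    using X_cont by (intro continuous_on_closed_Un) auto
  moreover have "{..0} \<union> {0..} = (UNIV :: real set)"
    by auto
  ultimately show ?thesis
    by simp
qed

text \<open>Locally uniform convergence on the half line; values at negative times are left
  free.\<close>

definition hconv :: "(nat \<Rightarrow> real \<Rightarrow> real) \<Rightarrow> (real \<Rightarrow> real) \<Rightarrow> bool" where
  "hconv Vn V \<longleftrightarrow> (\<forall>n. hist (Vn n)) \<and> hist V \<and> (\<forall>T. uniform_limit {0..T} Vn V sequentially)"

lemma hconv_const: "hist V \<Longrightarrow> hconv (\<lambda>_. V) V"
  by (simp add: hconv_def uniform_limit_const)

lemma hconv_hist: "hconv Vn V \<Longrightarrow> hist V" "hconv Vn V \<Longrightarrow> hist (Vn n)"
  by (auto simp: hconv_def)

lemma hconv_pos: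
  assumes "hconv Vn V" "T \<ge> 0"
  shows "uniform_limit {0..T} (\<lambda>n. pos (Vn n)) (pos V) sequentially"
proof (rule uniform_limitI)
  fix e :: real assume e: "e > 0"
  have "uniform_limit {0..T} Vn V sequentially"
    using assms by (simp add: hconv_def)
  then have "\<forall>\<^sub>F n in sequentially. \<forall>x\<in>{0..T}. dist (Vn n x) (V x) < e / (T + 1)"
    by (rule uniform_limitD) (use assms e in simp)
  then show "\<forall>\<^sub>F n in sequentially. \<forall>x\<in>{0..T}. dist (pos (Vn n) x) (pos V x) < e"
  proof eventually_elim
    case (elim n)
    show ?case
    proof
      fix x assume x: "x \<in> {0..T}"
      have i: "Vn n integrable_on {0..x}" "V integrable_on {0..x}"
        using hconv_hist[OF assms(1)] by (auto intro!: integrable_continuous_real hist_cont)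
      have "\<bar>integral {0..x} (\<lambda>y. Vn n y - V y)\<bar> \<le> e / (T + 1) * (x - 0)"
      proof -
        have "norm (integral {0..x} (\<lambda>y. Vn n y - V y)) \<le> e / (T + 1) * (x - 0)"
        proof (rule integral_bound)
          show "continuous_on {0..x} (\<lambda>y. Vn n y - V y)"
            by (rule continuous_on_diff[OF hist_cont[OF hconv_hist(2)[OF assms(1)]] hist_cont[OF hconv_hist(1)[OF assms(1)]]])
        qed (use x elim in \<open>auto simp: dist_real_def intro: less_imp_le\<close>)
        then show ?thesis
          by simp
      qed
      also have "\<dots> \<le> e / (T + 1) * T"
        using x e assms by (intro mult_left_mono) auto
      also have "\<dots> < e"
        using e assms by (simp add: field_simps)
      finally show "dist (pos (Vn n) x) (pos V x) < e"
        using i by (simp add: pos_def dist_real_def Henstock_Kurzweil_Integration.integral_diff)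
    qed
  qed
qed

lemma uniform_limit_moving:
  fixes f :: "nat \<Rightarrow> real \<Rightarrow> real"
  assumes "uniform_limit S f l sequentially" "continuous_on S l" "tn \<longlonglongrightarrow> t" "\<And>n. tn n \<in> S" "t \<in> S"
  shows "(\<lambda>n. f n (tn n)) \<longlonglongrightarrow> l t"
proof -
  have "(\<lambda>n. l (tn n)) \<longlonglongrightarrow> l t"
    using assms by (intro continuous_on_tendsto_compose[OF assms(2,3)]) auto
  moreover have "(\<lambda>n. f n (tn n) - l (tn n)) \<longlonglongrightarrow> 0"
  proof (rule tendstoI)
    fix e :: real assume "e > 0"
    from uniform_limitD[OF assms(1) this] show "\<forall>\<^sub>F n in sequentially. dist (f n (tn n) - l (tn n)) 0 < e"
      by eventually_elim (use assms(4) in \<open>auto simp: dist_real_def\<close>)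
  qed
  ultimately have "(\<lambda>n. (f n (tn n) - l (tn n)) + l (tn n)) \<longlonglongrightarrow> 0 + l t"
    by (intro tendsto_add)
  then show ?thesis
    by simp
qed

lemma bounded_times:
  assumes "tn \<longlonglongrightarrow> (t :: real)" "\<And>n. tn n \<ge> 0"
  obtains T where "T > t" "T > 0" "\<And>n. tn n \<in> {0..T}" "t \<in> {0..T}"
proof -
  obtain B where B: "\<And>n. \<bar>tn n\<bar> \<le> B"
    using convergent_imp_Bseq[of tn] assms(1) by (auto simp: convergent_def Bseq_def)
  have "t \<ge> 0"
    using assms by (intro LIMSEQ_le_const[of tn t 0]) auto
  have B': "tn n \<le> B" for n
    using B[of n] by simp
  have "0 \<le> B"
    using B'[of 0] assms(2)[of 0] by linarith
  moreover have "tn n \<le> B + t + 1" for n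
    using B'[of n] \<open>t \<ge> 0\<close> by linarith
  ultimately show ?thesis
    using \<open>t \<ge> 0\<close> assms(2) by (intro that[of "B + t + 1"]) auto
qed

lemma hconv_V:
  assumes "hconv Vn V" "tn \<longlonglongrightarrow> t" "\<And>n. tn n \<ge> 0"
  shows "(\<lambda>n. Vn n (tn n)) \<longlonglongrightarrow> V t"
proof -
  obtain T where T: "T > t" "T > 0" "\<And>n. tn n \<in> {0..T}" "t \<in> {0..T}"
    using bounded_times[OF assms(2,3)] by blast
  show ?thesis
  proof (rule uniform_limit_moving[OF _ _ assms(2) T(3,4)])
    show "uniform_limit {0..T} Vn V sequentially"
      using assms(1) by (simp add: hconv_def)
    show "continuous_on {0..T} V"
      by (rule hist_cont[OF hconv_hist(1)[OF assms(1)]])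
  qed
qed

lemma hconv_pos_moving:
  assumes "hconv Vn V" "tn \<longlonglongrightarrow> t" "\<And>n. tn n \<ge> 0"
  shows "(\<lambda>n. pos (Vn n) (tn n)) \<longlonglongrightarrow> pos V t"
proof -
  obtain T where T: "T > t" "T > 0" "\<And>n. tn n \<in> {0..T}" "t \<in> {0..T}"
    using bounded_times[OF assms(2,3)] by blast
  have "continuous_on {0..T} (pos V)"
    using pos_cont[OF hconv_hist(1)[OF assms(1)]] by (rule continuous_on_subset) auto
  then show ?thesis
    using T(2) by (intro uniform_limit_moving[OF hconv_pos[OF assms(1)] _ assms(2) T(3,4)]) auto
qed

text \<open>The value \<open>0\<close> encodes that there is no crossing.\<close>
definition lcross :: "(real \<Rightarrow> real) \<Rightarrow> real \<Rightarrow> real \<Rightarrow> real" where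
  "lcross V t z = (if z \<noteq> V t \<and> crossings (pos V) t z \<noteq> {} then last_crossing (pos V) t z else 0)"

lemma lcross_cases:
  assumes "hist V" "z \<noteq> V t"
  shows "crossings (pos V) t z = {} \<and> lcross V t z = 0 \<or>
    lcross V t z \<in> crossings (pos V) t z \<and> (\<forall>\<tau>\<in>crossings (pos V) t z. \<tau> \<le> lcross V t z) \<and> lcross V t z = last_crossing (pos V) t z"
proof -
  interpret trajectory "pos V" V
    by (rule trajectory_pos[OF assms(1)])
  show ?thesis
    using last_crossing[OF assms(2)] assms(2) by (auto simp: lcross_def)
qed

lemma lcross_pos:
  assumes "hist V" "lcross V t z > 0"
  shows "lcross V t z \<in> crossings (pos V) t z" "lcross V t z < t" "\<bar>z - Vinf\<bar> \<le> \<epsilon>" "z \<noteq> V t"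
    "lcross V t z = last_crossing (pos V) t z"
proof -
  interpret trajectory "pos V" V
    by (rule trajectory_pos[OF assms(1)])
  show z: "z \<noteq> V t"
    using assms by (auto simp: lcross_def)
  show c: "lcross V t z \<in> crossings (pos V) t z" and "lcross V t z = last_crossing (pos V) t z"
    using lcross_cases[OF assms(1) z] assms(2) by auto
  show "lcross V t z < t"
    using c by (simp add: crossings_def)
  obtain \<sigma> where "z = V \<sigma>"
    using crossing_mean[OF c] .
  then show "\<bar>z - Vinf\<bar> \<le> \<epsilon>"
    using hist_near[OF assms(1)] by simp
qed

lemma lcross_nonneg: "hist V \<Longrightarrow> lcross V t z \<ge> 0"
  using lcross_cases[of V z t] by (cases "z = V t") (auto simp: lcross_def crossings_def)

text \<open>For a > 0 the set where the last crossing is at least a is a countable union of closed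
  sets, minus the closed set of grazing velocities. For a at most 0 it is everything.\<close>

lemma lcross_measurable:
  assumes V: "hist V"
  shows "(\<lambda>(t, z). lcross V t z) \<in> borel_measurable borel"
proof (subst borel_measurable_iff_ge, intro allI)
  fix a :: real
  show "{x \<in> space borel. a \<le> (case x of (t, z) \<Rightarrow> lcross V t z)} \<in> sets borel"
  proof (cases "a > 0")
    case False
    then have "{x \<in> space borel. a \<le> (case x of (t, z) \<Rightarrow> lcross V t z)} = UNIV"
      using lcross_nonneg[OF V] by (auto intro: order_trans[of a 0])
    then show ?thesis
      by simp
  next
    case True
    \<comment> \<open>A closed relation between \<tau> and (t, z) is projected along a compact
      interval of \<tau>. Keeping \<tau> at a positive distance from t makes the relation closed;
      the distance and the interval are exhausted as m grows.\<close>
    define C where "C m = {x. \<exists>\<tau>. \<tau> \<in> {a..real m} \<and> (\<tau>, x) \<in> {y :: real \<times> real \<times> real.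
       fst y \<le> fst (snd y) - 1 / real (Suc m) \<and> pos V (fst (snd y)) - pos V (fst y) = (fst (snd y) - fst y) * snd (snd y)}}" for m
    have pc: "continuous_on UNIV (\<lambda>x. pos V (f x))" if "continuous_on UNIV f" for f :: "real \<times> real \<times> real \<Rightarrow> real"
      using that by (intro continuous_on_compose2[OF pos_cont[OF V]]) auto
    have "closed (C m)" for m
      unfolding C_def
      by (rule closed_compact_projection)
         (auto intro!: closed_Collect_conj closed_Collect_le closed_Collect_eq continuous_intros pc)
    then have "(\<Union>m. C m) \<in> sets borel"
      by auto
    moreover have "{x. snd x \<noteq> V (fst x)} \<in> sets borel"
    proof -
      have "open {x :: real \<times> real. snd x \<noteq> V (fst x)}"
        by (intro open_Collect_neq continuous_on_snd continuous_on_id continuous_on_compose2[OF hist_cont[OF V, of UNIV] continuous_on_fst]) auto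
      then show ?thesis
        by auto
    qed
    moreover have "{x \<in> space borel. a \<le> (case x of (t, z) \<Rightarrow> lcross V t z)} = {x. snd x \<noteq> V (fst x)} \<inter> (\<Union>m. C m)"
    proof (intro set_eqI iffI)
      fix x assume "x \<in> {x \<in> space borel. a \<le> (case x of (t, z) \<Rightarrow> lcross V t z)}"
      then obtain t z where x: "x = (t, z)" "a \<le> lcross V t z"
        by (cases x) auto
      then have l: "lcross V t z > 0"
        using True by simp
      note L = lcross_pos[OF V l]
      define \<tau> where "\<tau> = lcross V t z"
      obtain m1 :: nat where m1: "\<tau> \<le> real m1"
        using real_arch_simple by blast
      obtain m2 :: nat where m2: "1 / real (Suc m2) < t - \<tau>"
        using L(2) reals_Archimedean[of "t - \<tau>"] by (auto simp: \<tau>_def inverse_eq_divide)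
      define m where "m = max m1 m2"
      have "1 / real (Suc m) \<le> 1 / real (Suc m2)"
        by (intro divide_left_mono) (auto simp: m_def)
      then have "x \<in> C m"
        using m1 m2 L(1) x by (auto simp: C_def m_def crossings_def \<tau>_def intro!: exI[of _ "lcross V t z"])
      then show "x \<in> {x. snd x \<noteq> V (fst x)} \<inter> (\<Union>m. C m)"
        using L(4) x by auto
    next
      fix x assume "x \<in> {x. snd x \<noteq> V (fst x)} \<inter> (\<Union>m. C m)"
      then obtain m \<tau> t z where x: "x = (t, z)" "z \<noteq> V t" "a \<le> \<tau>" "\<tau> \<le> t - 1 / real (Suc m)" "pos V t - pos V \<tau> = (t - \<tau>) * z"
        by (cases x) (auto simp: C_def)
      have "1 / real (Suc m) > 0"
        by simp
      then have "0 < \<tau>" "\<tau> < t"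
        using x True by linarith+
      then have "\<tau> \<in> crossings (pos V) t z"
        using x by (simp add: crossings_def)
      then have "\<tau> \<le> lcross V t z"
        using lcross_cases[OF V x(2)] by auto
      then show "x \<in> {x \<in> space borel. a \<le> (case x of (t, z) \<Rightarrow> lcross V t z)}"
        using x by simp
    qed
    ultimately show ?thesis
      by auto
  qed
qed

definition gap :: "(real \<Rightarrow> real) \<Rightarrow> real \<Rightarrow> real \<Rightarrow> real \<Rightarrow> real" where
  "gap V t z \<tau> = pos V t - pos V \<tau> - (t - \<tau>) * z"

text \<open>The gap touches zero at the last crossing without changing its sign. A perturbation of
  the motion can remove such a crossing, and then the last crossing time jumps.\<close>

definition tangent :: "(real \<Rightarrow> real) \<Rightarrow> real \<Rightarrow> real set" where
  "tangent V t = {z. \<exists>s\<in>{1, - 1}. s * (z - V t) < 0 \<and> lcross V t z > 0 \<and>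
     (\<exists>e>0. \<forall>\<tau>. lcross V t z - e < \<tau> \<longrightarrow> \<tau> < lcross V t z \<longrightarrow> 0 < \<tau> \<longrightarrow> 0 \<le> s * gap V t z \<tau>)}"

text \<open>Such a \<open>z\<close> is a locally extremal value of the mean velocity \<open>\<tau> \<mapsto> (X t - X \<tau>) / (t - \<tau>)\<close>, and a
  rational interval on which the extremum is attained determines \<open>z\<close>.\<close>
lemma countable_tangent:
  assumes V: "hist V"
  shows "countable (tangent V t)"
proof -
  interpret trajectory "pos V" V
    by (rule trajectory_pos[OF V])
  define P where "P s a b z \<longleftrightarrow> b < t \<and> (\<exists>m. a < m \<and> m < b \<and> gap V t z m = 0) \<and> (\<forall>\<tau>. a < \<tau> \<longrightarrow> \<tau> < b \<longrightarrow> 0 \<le> s * gap V t z \<tau>)" for s a b z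
  have uniq: "z = z'" if s: "s \<in> {1, - 1}" and P: "P s a b z" "P s a b z'" for s a b z z' :: real
  proof -
    obtain m m' where m: "b < t" "a < m" "m < b" "gap V t z m = 0" "a < m'" "m' < b" "gap V t z' m' = 0"
      using P by (auto simp: P_def)
    have "0 \<le> s * gap V t z' m" "0 \<le> s * gap V t z m'"
      using P m by (auto simp: P_def)
    moreover have "gap V t z' m = (t - m) * (z - z')" "gap V t z m' = (t - m') * (z' - z)"
      using m(4,7) by (auto simp: gap_def algebra_simps)
    ultimately have "0 \<le> (t - m) * (s * (z - z'))" "0 \<le> (t - m') * (s * (z' - z))"
      by (auto simp: mult_ac)
    then have "0 \<le> s * (z - z')" "0 \<le> s * (z' - z)"
      using m by (auto simp: zero_le_mult_iff)
    then show "z = z'"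
      using s by auto
  qed
  have "countable {z. P s a b z}" if "s \<in> {1, - 1}" for s a b
  proof (cases "\<exists>z. P s a b z")
    case True
    then obtain z where "P s a b z"
      by auto
    then have "{z. P s a b z} \<subseteq> {z}"
      using uniq[OF that] by auto
    then show ?thesis
      by (rule countable_subset) simp
  qed simp
  then have "countable (\<Union>s\<in>{1, - 1}. \<Union>a\<in>\<rat>. \<Union>b\<in>\<rat>. {z. P s a b z})"
    by (intro countable_UN countable_rat) auto
  moreover have "tangent V t \<subseteq> (\<Union>s\<in>{1, - 1}. \<Union>a\<in>\<rat>. \<Union>b\<in>\<rat>. {z. P s a b z})"
  proof
    fix z assume "z \<in> tangent V t"
    then obtain s e where s: "s \<in> {1, - 1}" "s * (z - V t) < 0" and l: "lcross V t z > 0" and e: "e > 0"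
      "\<And>\<tau>. lcross V t z - e < \<tau> \<Longrightarrow> \<tau> < lcross V t z \<Longrightarrow> 0 < \<tau> \<Longrightarrow> 0 \<le> s * gap V t z \<tau>"
      unfolding tangent_def by blast
    define m where "m = lcross V t z"
    note L = lcross_pos[OF V l, folded m_def]
    obtain a where a: "a \<in> \<rat>" "max 0 (m - e) < a" "a < m"
      using Rats_dense_in_real[of "max 0 (m - e)" m] l e(1) by (auto simp: m_def)
    obtain b where b: "b \<in> \<rat>" "m < b" "b < t"
      using Rats_dense_in_real[OF L(2)] by auto
    have "0 \<le> s * gap V t z \<tau>" if "a < \<tau>" "\<tau> < b" for \<tau>
    proof (cases \<tau> m rule: linorder_cases)
      case less
      then show ?thesis
        using e(2)[of \<tau>] a that by (simp add: m_def)
    next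
      case equal
      then show ?thesis
        using L(1) by (auto simp: crossings_def gap_def)
    next
      case greater
      have "s * (pos V t - pos V \<tau> - (t - \<tau>) * z) > 0"
        using greater that b L by (intro sign_after_last[OF s(2)]) auto
      then show ?thesis
        by (simp add: gap_def)
    qed
    then have "P s a b z"
      using a b L(1) unfolding P_def by (auto simp: crossings_def gap_def intro!: exI[of _ m])
    then show "z \<in> (\<Union>s\<in>{1, - 1}. \<Union>a\<in>\<rat>. \<Union>b\<in>\<rat>. {z. P s a b z})"
      using a b s by blast
  qed
  ultimately show ?thesis
    by (rule countable_subset[rotated])
qed

text \<open>The velocities at which the last crossing may jump: grazing at time t, a crossing at the
  initial time, which does not count as a precollision, and tangential crossings.\<close>

definition exceptional :: "(real \<Rightarrow> real) \<Rightarrow> real \<Rightarrow> real set" where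
  "exceptional V t = insert (V t) (insert ((pos V t - pos V 0) / t) (tangent V t))"

lemma AE_exceptional: "hist V \<Longrightarrow> AE z in lborel. z \<notin> exceptional V t"
  unfolding exceptional_def
  by (intro AE_not_in countable_imp_null_set_lborel countable_insert countable_tangent)

lemma gap_continuous:
  assumes "hist V"
  shows "continuous_on S (gap V t z)"
  unfolding gap_def[abs_def]
  by (intro continuous_intros continuous_on_subset[OF pos_cont[OF assms]]) auto

lemma gap_uniform:
  assumes c: "hconv Vn V" and tn: "tn \<longlonglongrightarrow> t" "\<And>n. tn n \<ge> 0" and T: "T \<ge> 0"
  shows "uniform_limit {0..T} (\<lambda>n. gap (Vn n) (tn n) z) (gap V t z) sequentially"
proof -
  have "uniform_limit {0..T} (\<lambda>n \<tau>. (pos (Vn n) (tn n) - tn n * z) - pos (Vn n) \<tau> + \<tau> * z)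
      (\<lambda>\<tau>. (pos V t - t * z) - pos V \<tau> + \<tau> * z) sequentially"
  proof (rule uniform_limit_add[OF uniform_limit_minus[OF _ hconv_pos[OF c T]] uniform_limit_const])
    show "uniform_limit {0..T} (\<lambda>n \<tau>. pos (Vn n) (tn n) - tn n * z) (\<lambda>\<tau>. pos V t - t * z) sequentially"
      using tendsto_diff[OF hconv_pos_moving[OF c tn] tendsto_mult_right[OF tn(1), of z]]
      by (auto simp: uniform_limit_iff tendsto_iff)
  qed
  then show ?thesis
    by (simp add: gap_def[abs_def] algebra_simps)
qed

text \<open>The gap vanishes at \<tau> = t, so uniform convergence says nothing about its sign near
  t. There the sign is obtained from the velocities, uniformly in n.\<close>

lemma gap_near_end:
  assumes c: "hconv Vn V" and tn: "tn \<longlonglongrightarrow> t" "\<And>n. tn n \<ge> 0" and z: "s * (z - V t) < 0"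
  obtains \<eta> where "\<eta> > 0" "\<forall>\<^sub>F n in sequentially. \<forall>\<tau>. 0 \<le> \<tau> \<longrightarrow> t - \<eta> < \<tau> \<longrightarrow> \<tau> < tn n \<longrightarrow> s * gap (Vn n) (tn n) z \<tau> > 0"
proof -
  define \<theta> where "\<theta> = s * (V t - z)"
  have th: "\<theta> > 0"
    using z by (simp add: \<theta>_def algebra_simps)
  have V: "hist V"
    using c by (rule hconv_hist)
  have "isCont (\<lambda>\<sigma>. s * (V \<sigma> - z)) t"
    using V by (intro continuous_intros) (auto simp: hist_def continuous_on_eq_continuous_at)
  then have "((\<lambda>\<sigma>. s * (V \<sigma> - z)) \<longlongrightarrow> \<theta>) (at t)"
    by (simp add: isCont_def \<theta>_def)
  then have "\<forall>\<^sub>F \<sigma> in at t. s * (V \<sigma> - z) > \<theta> / 2"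
    by (rule order_tendstoD) (use th in simp)
  then obtain d where d: "d > 0" "\<And>\<sigma>. \<sigma> \<noteq> t \<Longrightarrow> dist \<sigma> t < d \<Longrightarrow> s * (V \<sigma> - z) > \<theta> / 2"
    by (auto simp: eventually_at)
  have d': "s * (V \<sigma> - z) > \<theta> / 2" if "\<bar>\<sigma> - t\<bar> < d" for \<sigma>
    using d(2)[of \<sigma>] that th by (cases "\<sigma> = t") (auto simp: dist_real_def \<theta>_def)
  obtain T where T: "T > t" "T > 0" "\<And>n. tn n \<in> {0..T}" "t \<in> {0..T}"
    using bounded_times[OF tn] by blast
  define e where "e = \<theta> / (2 * (\<bar>s\<bar> + 1))"
  have e: "e > 0" "\<bar>s\<bar> * e \<le> \<theta> / 2"
    using th by (auto simp: e_def field_simps)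
  have "uniform_limit {0..T} Vn V sequentially"
    using c by (simp add: hconv_def)
  then have "\<forall>\<^sub>F n in sequentially. \<forall>x\<in>{0..T}. dist (Vn n x) (V x) < e"
    by (rule uniform_limitD) (rule e)
  moreover have "\<forall>\<^sub>F n in sequentially. tn n < t + d"
    using order_tendstoD(2)[OF tn(1)] d(1) by simp
  ultimately have "\<forall>\<^sub>F n in sequentially. \<forall>\<tau>. 0 \<le> \<tau> \<longrightarrow> t - d < \<tau> \<longrightarrow> \<tau> < tn n \<longrightarrow> s * gap (Vn n) (tn n) z \<tau> > 0"
  proof eventually_elim
    case (elim n)
    interpret trajectory "pos (Vn n)" "Vn n"
      by (rule trajectory_pos) (use c in \<open>rule hconv_hist\<close>)
    show ?case
    proof (intro allI impI)
      fix \<tau> assume \<tau>: "0 \<le> \<tau>" "t - d < \<tau>" "\<tau> < tn n"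
      obtain \<sigma> where \<sigma>: "\<tau> < \<sigma>" "\<sigma> < tn n" "pos (Vn n) (tn n) - pos (Vn n) \<tau> = (tn n - \<tau>) * Vn n \<sigma>"
        using X_mvt[OF \<tau>(1,3)] by auto
      have "\<sigma> \<in> {0..T}"
        using \<sigma> \<tau> T(3)[of n] by auto
      then have "\<bar>Vn n \<sigma> - V \<sigma>\<bar> < e"
        using elim by (auto simp: dist_real_def)
      then have "\<bar>s\<bar> * \<bar>Vn n \<sigma> - V \<sigma>\<bar> \<le> \<bar>s\<bar> * e"
        by (intro mult_left_mono) auto
      then have "\<bar>s * (Vn n \<sigma> - V \<sigma>)\<bar> \<le> \<theta> / 2"
        unfolding abs_mult by (rule order_trans[OF _ e(2)])
      moreover have "s * (V \<sigma> - z) > \<theta> / 2"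
        using \<sigma> \<tau> elim by (intro d') auto
      moreover have "s * (Vn n \<sigma> - z) = s * (Vn n \<sigma> - V \<sigma>) + s * (V \<sigma> - z)"
        by (simp add: algebra_simps)
      ultimately have "s * (Vn n \<sigma> - z) > 0"
        by linarith
      then have "(tn n - \<tau>) * (s * (Vn n \<sigma> - z)) > 0"
        using \<tau> by simp
      then show "s * gap (Vn n) (tn n) z \<tau> > 0"
        unfolding gap_def \<sigma>(3) by (simp add: algebra_simps)
    qed
  qed
  then show ?thesis
    by (rule that[OF d(1)])
qed

text \<open>Near t by \<open>gap_near_end\<close>; on the remaining compact interval the gap has a
  positive minimum, which uniform convergence preserves.\<close>

lemma gap_positive_stable:
  assumes c: "hconv Vn V" and tn: "tn \<longlonglongrightarrow> t" "\<And>n. tn n \<ge> 0" and z: "s * (z - V t) < 0"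
    and a: "0 \<le> a" and pos: "\<And>\<tau>. a \<le> \<tau> \<Longrightarrow> \<tau> < t \<Longrightarrow> s * gap V t z \<tau> > 0"
  shows "\<forall>\<^sub>F n in sequentially. \<forall>\<tau>. a \<le> \<tau> \<longrightarrow> \<tau> < tn n \<longrightarrow> s * gap (Vn n) (tn n) z \<tau> > 0"
proof -
  obtain \<eta> where \<eta>: "\<eta> > 0" "\<forall>\<^sub>F n in sequentially. \<forall>\<tau>. 0 \<le> \<tau> \<longrightarrow> t - \<eta> < \<tau> \<longrightarrow> \<tau> < tn n \<longrightarrow> s * gap (Vn n) (tn n) z \<tau> > 0"
    using gap_near_end[where s = s and z = z, OF c tn z] by blast
  show ?thesis
  proof (cases "a \<le> t - \<eta> / 2")
    case False
    from \<eta>(2) show ?thesis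
      by eventually_elim (use False a \<eta>(1) in auto)
  next
    case True
    have V: "hist V"
      using c by (rule hconv_hist)
    have "continuous_on {a..t - \<eta> / 2} (\<lambda>\<tau>. s * gap V t z \<tau>)"
      by (intro continuous_intros gap_continuous V)
    then obtain x where x: "x \<in> {a..t - \<eta> / 2}" "\<And>\<tau>. \<tau> \<in> {a..t - \<eta> / 2} \<Longrightarrow> s * gap V t z x \<le> s * gap V t z \<tau>"
      using continuous_attains_inf[of "{a..t - \<eta> / 2}" "\<lambda>\<tau>. s * gap V t z \<tau>"] True by auto
    define \<kappa> where "\<kappa> = s * gap V t z x"
    have k: "\<kappa> > 0"
      unfolding \<kappa>_def using x(1) \<eta>(1) by (intro pos) auto
    have "t \<ge> 0"
      using True a \<eta>(1) by simp
    have "\<forall>\<^sub>F n in sequentially. \<forall>\<tau>\<in>{0..t}. dist (gap (Vn n) (tn n) z \<tau>) (gap V t z \<tau>) < \<kappa> / (\<bar>s\<bar> + 1)"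
      using k by (intro uniform_limitD[OF gap_uniform[OF c tn \<open>t \<ge> 0\<close>]]) simp
    with \<eta>(2) show ?thesis
    proof eventually_elim
      case (elim n)
      show ?case
      proof (intro allI impI)
        fix \<tau> assume \<tau>: "a \<le> \<tau>" "\<tau> < tn n"
        show "s * gap (Vn n) (tn n) z \<tau> > 0"
        proof (cases "t - \<eta> < \<tau>")
          case True
          then show ?thesis
            using elim(1) \<tau> a by auto
        next
          case False
          then have \<tau>': "\<tau> \<in> {a..t - \<eta> / 2}" "\<tau> \<in> {0..t}"
            using \<tau> \<eta>(1) a by auto
          then have "\<bar>gap (Vn n) (tn n) z \<tau> - gap V t z \<tau>\<bar> < \<kappa> / (\<bar>s\<bar> + 1)"
            using elim(2) by (auto simp: dist_real_def)
          then have "\<bar>s\<bar> * \<bar>gap (Vn n) (tn n) z \<tau> - gap V t z \<tau>\<bar> \<le> \<bar>s\<bar> * (\<kappa> / (\<bar>s\<bar> + 1))"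
            by (intro mult_left_mono) auto
          also have "\<dots> < \<kappa>"
            using k by (simp add: field_simps)
          finally have "\<bar>s * gap (Vn n) (tn n) z \<tau> - s * gap V t z \<tau>\<bar> < \<kappa>"
            by (simp add: abs_mult[symmetric] right_diff_distrib)
          then show ?thesis
            using x(2)[OF \<tau>'(1)] by (simp add: \<kappa>_def)
        qed
      qed
    qed
  qed
qed

lemma crossing_gap: "\<tau> \<in> crossings (pos V) t z \<longleftrightarrow> 0 < \<tau> \<and> \<tau> < t \<and> gap V t z \<tau> = 0"
  by (auto simp: crossings_def gap_def)

text \<open>The perturbed last crossing is trapped: above the limiting one the sign of the gap is
  stable, and just below it there is a point of the opposite sign, which persists too and forces a
  crossing in between.\<close>

lemma lcross_tendsto:
  assumes c: "hconv Vn V" and tn: "tn \<longlonglongrightarrow> t" "\<And>n. tn n \<ge> 0" and z: "z \<notin> exceptional V t"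
  shows "(\<lambda>n. lcross (Vn n) (tn n) z) \<longlonglongrightarrow> lcross V t z"
    and "\<forall>\<^sub>F n in sequentially. lcross (Vn n) (tn n) z > 0 \<longleftrightarrow> lcross V t z > 0"
proof -
  have V: "hist V" and Vn: "\<And>n. hist (Vn n)"
    using c by (auto simp: hconv_hist)
  interpret trajectory "pos V" V
    by (rule trajectory_pos[OF V])
  have t: "t \<ge> 0"
    using tn by (intro LIMSEQ_le_const[of tn t 0]) auto
  define s where "s = (if z < V t then 1 else - 1 :: real)"
  have s: "s \<in> {1, - 1}" "s * (z - V t) < 0"
    using z by (auto simp: s_def exceptional_def)
  have zn: "\<forall>\<^sub>F n in sequentially. s * (z - Vn n (tn n)) < 0"
    using s(2) by (intro order_tendstoD(2)[OF tendsto_mult_left[OF tendsto_diff[OF tendsto_const hconv_V[OF c tn]]]]) auto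
  have "((\<lambda>n. lcross (Vn n) (tn n) z) \<longlonglongrightarrow> lcross V t z) \<and>
    (\<forall>\<^sub>F n in sequentially. lcross (Vn n) (tn n) z > 0 \<longleftrightarrow> lcross V t z > 0)"
  proof (cases "lcross V t z > 0")
    case False
    then have l0: "lcross V t z = 0"
      using lcross_nonneg[OF V, of t z] by simp
    then have ne: "crossings (pos V) t z = {}"
      using lcross_cases[OF V, of z t] s by (auto simp: crossings_def)
    have pos1: "s * gap V t z \<tau> > 0" if "0 < \<tau>" "\<tau> < t" for \<tau>
      using sign_after_last_crossing[OF s(2) order_refl _ that] ne by (simp add: gap_def)
    \<comment> \<open>The interval has to be closed at 0 for stability; there the gap does not
      vanish because the mean velocity over [0, t] is exceptional.\<close>
    have pos: "s * gap V t z \<tau> > 0" if "0 \<le> \<tau>" "\<tau> < t" for \<tau>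
    proof (cases "\<tau> = 0")
      case False
      then show ?thesis
        using pos1 that by simp
    next
      case True
      then have t0: "t > 0"
        using that by simp
      have "isCont (\<lambda>\<tau>. s * gap V t z \<tau>) 0"
        using gap_continuous[OF V, of UNIV] by (intro continuous_intros) (auto simp: continuous_on_eq_continuous_at)
      then have lim: "((\<lambda>\<tau>. s * gap V t z \<tau>) \<longlongrightarrow> s * gap V t z 0) (at_right 0)"
        by (simp add: isCont_def filterlim_at_split)
      have "0 \<le> s * gap V t z 0"
        by (rule tendsto_lowerbound[OF lim])
           (use pos1 t0 in \<open>auto simp: eventually_at_right_field intro!: exI[of _ t] less_imp_le\<close>)
      moreover have "gap V t z 0 \<noteq> 0"
        using z t0 by (auto simp: gap_def exceptional_def field_simps)
      ultimately show ?thesis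
        using True s(1) by auto
    qed
    have "\<forall>\<^sub>F n in sequentially. \<forall>\<tau>. 0 \<le> \<tau> \<longrightarrow> \<tau> < tn n \<longrightarrow> s * gap (Vn n) (tn n) z \<tau> > 0"
      by (rule gap_positive_stable[OF c tn s(2) order_refl pos])
    from this zn have "\<forall>\<^sub>F n in sequentially. lcross (Vn n) (tn n) z = 0"
    proof eventually_elim
      case (elim n)
      have "crossings (pos (Vn n)) (tn n) z = {}"
        using elim(1) unfolding crossing_gap set_eq_iff by (metis empty_iff less_imp_le less_irrefl mult_zero_right)
      then show ?case
        by (simp add: lcross_def)
    qed
    then have ev: "\<forall>\<^sub>F n in sequentially. lcross (Vn n) (tn n) z = lcross V t z"
      by (simp add: l0)
    then have "(\<lambda>n. lcross (Vn n) (tn n) z) \<longlonglongrightarrow> lcross V t z"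
      by (rule tendsto_eventually)
    moreover have "\<forall>\<^sub>F n in sequentially. lcross (Vn n) (tn n) z > 0 \<longleftrightarrow> lcross V t z > 0"
      using ev by eventually_elim simp
    ultimately show ?thesis
      by simp
  next
    case True
    define m where "m = lcross V t z"
    note L = lcross_pos[OF V True, folded m_def]
    have m0: "m > 0"
      using True by (simp add: m_def)
    have close: "\<forall>\<^sub>F n in sequentially. m - e < lcross (Vn n) (tn n) z \<and> lcross (Vn n) (tn n) z < m + e \<and> lcross (Vn n) (tn n) z > 0"
      if e: "e > 0" for e
    proof -
      have after: "s * gap V t z \<tau> > 0" if "m + e \<le> \<tau>" "\<tau> < t" for \<tau>
        using sign_after_last[OF s(2), of \<tau>] L that e by (auto simp: gap_def)
      have above: "\<forall>\<^sub>F n in sequentially. \<forall>\<tau>. m + e \<le> \<tau> \<longrightarrow> \<tau> < tn n \<longrightarrow> s * gap (Vn n) (tn n) z \<tau> > 0"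
        by (rule gap_positive_stable[where s = s and z = z, OF c tn s(2) _ after]) (use m0 e in auto)
      \<comment> \<open>This is where tangential velocities are excluded: it yields a point just
        before the crossing at which the gap has the other sign.\<close>
      have "z \<notin> tangent V t"
        using z by (simp add: exceptional_def)
      then obtain \<tau>0 where \<tau>0: "m - e < \<tau>0" "\<tau>0 < m" "0 < \<tau>0" "s * gap V t z \<tau>0 < 0"
        using s True e unfolding tangent_def m_def by (auto simp: not_le)
      have "(\<lambda>n. s * gap (Vn n) (tn n) z \<tau>0) \<longlonglongrightarrow> s * gap V t z \<tau>0"
        using \<tau>0 by (intro tendsto_intros tendsto_uniform_limitI[OF gap_uniform[OF c tn, of \<tau>0]]) auto
      then have "\<forall>\<^sub>F n in sequentially. s * gap (Vn n) (tn n) z \<tau>0 < 0"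
        using order_tendstoD(2) \<tau>0(4) by blast
      moreover have "\<forall>\<^sub>F n in sequentially. \<tau>0 < tn n"
        using order_tendstoD(1)[OF tn(1)] \<tau>0 L(2) by simp
      ultimately show ?thesis
        using above zn
      proof eventually_elim
        case (elim n)
        interpret Tn: trajectory "pos (Vn n)" "Vn n"
          by (rule trajectory_pos[OF Vn])
        have zVn: "z \<noteq> Vn n (tn n)"
          using elim(4) by auto
        obtain \<tau>1 where \<tau>1: "\<tau>0 < \<tau>1" "\<tau>1 \<in> crossings (pos (Vn n)) (tn n) z"
        proof (rule ccontr)
          assume "\<not> thesis"
          then have no: "\<tau> \<notin> crossings (pos (Vn n)) (tn n) z" if "\<tau>0 < \<tau>" for \<tau>
            using that \<open>\<And>\<tau>1. \<lbrakk>\<tau>0 < \<tau>1; \<tau>1 \<in> crossings (pos (Vn n)) (tn n) z\<rbrakk> \<Longrightarrow> thesis\<close> by blast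
          have posn: "s * gap (Vn n) (tn n) z \<tau> > 0" if "\<tau>0 < \<tau>" "\<tau> < tn n" for \<tau>
            using Tn.sign_after_last_crossing[OF elim(4), of \<tau>0 \<tau>] no that \<tau>0 by (simp add: gap_def)
          have "isCont (\<lambda>\<tau>. s * gap (Vn n) (tn n) z \<tau>) \<tau>0"
            using gap_continuous[OF Vn, of UNIV] by (intro continuous_intros) (auto simp: continuous_on_eq_continuous_at)
          then have lim: "((\<lambda>\<tau>. s * gap (Vn n) (tn n) z \<tau>) \<longlongrightarrow> s * gap (Vn n) (tn n) z \<tau>0) (at_right \<tau>0)"
            by (simp add: isCont_def filterlim_at_split)
          have "0 \<le> s * gap (Vn n) (tn n) z \<tau>0"
            by (rule tendsto_lowerbound[OF lim])
               (use posn elim(2) in \<open>auto simp: eventually_at_right_field intro!: exI[of _ "tn n"] less_imp_le\<close>)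
          then show False
            using elim(1) by simp
        qed
        then have l: "lcross (Vn n) (tn n) z \<in> crossings (pos (Vn n)) (tn n) z" "\<tau>1 \<le> lcross (Vn n) (tn n) z"
          using lcross_cases[OF Vn zVn] by auto
        then have "lcross (Vn n) (tn n) z < m + e"
          using elim(3) unfolding crossing_gap by (metis less_irrefl mult_zero_right not_le)
        then show ?case
          using l \<tau>1 \<tau>0 by (auto simp: crossings_def)
      qed
    qed
    have "(\<lambda>n. lcross (Vn n) (tn n) z) \<longlonglongrightarrow> m"
    proof (rule tendstoI)
      fix e :: real assume "e > 0"
      from close[OF this] show "\<forall>\<^sub>F n in sequentially. dist (lcross (Vn n) (tn n) z) m < e"
        by eventually_elim (auto simp: dist_real_def)
    qed
    moreover have "\<forall>\<^sub>F n in sequentially. lcross (Vn n) (tn n) z > 0 \<longleftrightarrow> lcross V t z > 0"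
      using close[of 1] True by (auto elim: eventually_mono)
    ultimately show ?thesis
      by (simp add: m_def)
  qed
  then show "(\<lambda>n. lcross (Vn n) (tn n) z) \<longlonglongrightarrow> lcross V t z"
    and "\<forall>\<^sub>F n in sequentially. lcross (Vn n) (tn n) z > 0 \<longleftrightarrow> lcross V t z > 0"
    by auto
qed

section \<open>Boundary densities of a prescribed motion\<close>

lemma kx_tendsto:
  assumes "f \<longlonglongrightarrow> a" "g \<longlonglongrightarrow> b"
  shows "(\<lambda>n. kx G (f n) (g n)) \<longlonglongrightarrow> kx G a b"
  using continuous_on_tendsto_compose[OF kx_cont tendsto_Pair[OF assms]] by simp

lemma kx_shift_measurable: "(\<lambda>z. kx G a (z - b)) \<in> borel_measurable borel"
  by measurable

lemma ell_shift_measurable: "(\<lambda>z. ell G (z - b)) \<in> borel_measurable borel"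
  by measurable

text \<open>The arguments that a recolliding particle can have. Being closed, the set contains the
  limits of its sequences.\<close>

definition Dom :: "(real \<times> 'a \<times> real) set" where
  "Dom = {0..} \<times> disk G \<times> {Vinf - \<epsilon>..Vinf + \<epsilon>}"

lemma Dom_iff: "(t, y, v) \<in> Dom \<longleftrightarrow> t \<ge> 0 \<and> y \<in> disk G \<and> \<bar>v - Vinf\<bar> \<le> \<epsilon>"
  by (auto simp: Dom_def)

lemma closed_Dom: "closed Dom"
  unfolding Dom_def by (intro closed_Times closed_disk) auto

definition lands :: "(real \<Rightarrow> real) \<Rightarrow> real \<Rightarrow> 'a \<Rightarrow> real \<Rightarrow> 'a \<Rightarrow> bool" where
  "lands V t y z w \<longleftrightarrow> lcross V t z > 0 \<and> norm (y - (t - lcross V t z) *\<^sub>R w) \<le> radius G"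

text \<open>
  In the following \<open>H V s t y v\<close> is a candidate for the density, divided by the transversal profile,
  that the end \<open>s\<close> reemits at time \<open>t\<close> and transversal position \<open>y\<close> with axial velocity \<open>v\<close>;
  the true one is the fixed point \<open>Rem\<close> of \<open>step\<close>.
\<close>
definition jump :: "((real \<Rightarrow> real) \<Rightarrow> real \<Rightarrow> real \<Rightarrow> 'a \<Rightarrow> real \<Rightarrow> real) \<Rightarrow>
    (real \<Rightarrow> real) \<Rightarrow> real \<Rightarrow> real \<Rightarrow> 'a \<Rightarrow> real \<Rightarrow> 'a \<Rightarrow> real" where
  "jump H V s t y z w = (if lands V t y z w
     then H V s (lcross V t z) (y - (t - lcross V t z) *\<^sub>R w) z - dens G z else 0)"

definition dev :: "((real \<Rightarrow> real) \<Rightarrow> real \<Rightarrow> real \<Rightarrow> 'a \<Rightarrow> real \<Rightarrow> real) \<Rightarrow>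
    (real \<Rightarrow> real) \<Rightarrow> real \<Rightarrow> real \<Rightarrow> 'a \<Rightarrow> real \<Rightarrow> real" where
  "dev H V s t y z = (LINT w|lperp G. trans G w * jump H V s t y z w)"

text \<open>The invariant of the iteration: bounded by \<open>Nmax\<close> and sequentially
  continuous jointly in the motion and the arguments, on \<open>Dom\<close> only. The value 0
  outside is a convention that makes measurability follow.\<close>

definition nice :: "((real \<Rightarrow> real) \<Rightarrow> real \<Rightarrow> real \<Rightarrow> 'a \<Rightarrow> real \<Rightarrow> real) \<Rightarrow> bool" where
  "nice H \<longleftrightarrow> (\<forall>V s t y v. (t, y, v) \<notin> Dom \<longrightarrow> H V s t y v = 0) \<and>
     (\<forall>V s t y v. hist V \<longrightarrow> s \<in> {1, - 1} \<longrightarrow> \<bar>H V s t y v\<bar> \<le> Nmax) \<and>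
     (\<forall>Vn V s tn t yn y vn v. hconv Vn V \<longrightarrow> s \<in> {1, - 1} \<longrightarrow> (\<forall>n. (tn n, yn n, vn n) \<in> Dom) \<longrightarrow>
        tn \<longlonglongrightarrow> t \<longrightarrow> yn \<longlonglongrightarrow> y \<longrightarrow> vn \<longlonglongrightarrow> v \<longrightarrow> (\<lambda>n. H (Vn n) s (tn n) (yn n) (vn n)) \<longlonglongrightarrow> H V s t y v)"

lemma nice_bound: "nice H \<Longrightarrow> hist V \<Longrightarrow> s \<in> {1, - 1} \<Longrightarrow> \<bar>H V s t y v\<bar> \<le> Nmax"
  unfolding nice_def by blast

lemma nice_outside: "nice H \<Longrightarrow> (t, y, v) \<notin> Dom \<Longrightarrow> H V s t y v = 0"
  unfolding nice_def by blast

lemma nice_tendsto: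
  "nice H \<Longrightarrow> hconv Vn V \<Longrightarrow> s \<in> {1, - 1} \<Longrightarrow> (\<And>n. (tn n, yn n, vn n) \<in> Dom) \<Longrightarrow>
     tn \<longlonglongrightarrow> t \<Longrightarrow> yn \<longlonglongrightarrow> y \<Longrightarrow> vn \<longlonglongrightarrow> v \<Longrightarrow> (\<lambda>n. H (Vn n) s (tn n) (yn n) (vn n)) \<longlonglongrightarrow> H V s t y v"
  unfolding nice_def by blast

text \<open>Continuity along the constant sequence of motions gives continuity on the closed set
  \<open>Dom\<close>, and outside of it the function is 0.\<close>

lemma nice_measurable:
  assumes H: "nice H" and V: "hist V" and s: "s \<in> {1, - 1}"
  shows "(\<lambda>(t, y, v). H V s t y v) \<in> borel_measurable borel"
proof -
  have "continuous_on Dom (\<lambda>(t, y, v). H V s t y v)"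
  proof (rule continuous_on_sequentiallyI)
    fix u :: "nat \<Rightarrow> real \<times> 'a \<times> real" and a
    assume u: "\<forall>n. u n \<in> Dom" "a \<in> Dom" "u \<longlonglongrightarrow> a"
    have "(\<lambda>n. H V s (fst (u n)) (fst (snd (u n))) (snd (snd (u n)))) \<longlonglongrightarrow> H V s (fst a) (fst (snd a)) (snd (snd a))"
      using u by (intro nice_tendsto[OF H hconv_const[OF V] s] tendsto_fst tendsto_snd) auto
    then show "(\<lambda>n. case u n of (t, y, v) \<Rightarrow> H V s t y v) \<longlonglongrightarrow> (case a of (t, y, v) \<Rightarrow> H V s t y v)"
      by (simp add: case_prod_beta)
  qed
  then have "(\<lambda>x. indicator Dom x *\<^sub>R (case x of (t, y, v) \<Rightarrow> H V s t y v)) \<in> borel_measurable borel"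
    using closed_Dom by (intro borel_measurable_continuous_on_indicator) auto
  moreover have "(\<lambda>x. indicator Dom x *\<^sub>R (case x of (t, y, v) \<Rightarrow> H V s t y v)) = (\<lambda>(t, y, v). H V s t y v)"
    using nice_outside[OF H] by (auto simp: fun_eq_iff indicator_def)
  ultimately show ?thesis
    by simp
qed

lemma nice_measurable':
  assumes "nice H" "hist V" "s \<in> {1, - 1}"
    and "f \<in> borel_measurable N" "g \<in> borel_measurable N" "h \<in> borel_measurable N"
  shows "(\<lambda>x. H V s (f x) (g x) (h x)) \<in> borel_measurable N"
proof -
  have "(\<lambda>x. (f x, g x, h x)) \<in> N \<rightarrow>\<^sub>M borel"
    using assms by (intro borel_measurable_Pair)
  from measurable_compose[OF this nice_measurable[OF assms(1-3)]] show ?thesis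
    by simp
qed

lemma lcross_measurable':
  assumes "hist V" "f \<in> borel_measurable N" "g \<in> borel_measurable N"
  shows "(\<lambda>x. lcross V (f x) (g x)) \<in> borel_measurable N"
proof -
  have "(\<lambda>x. (f x, g x)) \<in> N \<rightarrow>\<^sub>M borel"
    using assms by (intro borel_measurable_Pair)
  from measurable_compose[OF this lcross_measurable[OF assms(1)]] show ?thesis
    by simp
qed

lemma lands_measurable:
  assumes V: "hist V"
    and [measurable]: "ft \<in> borel_measurable N" "fy \<in> borel_measurable N" "fz \<in> borel_measurable N" "fw \<in> borel_measurable N"
  shows "Measurable.pred N (\<lambda>x. lands V (ft x) (fy x) (fz x) (fw x))"
proof -
  have [measurable]: "(\<lambda>x. lcross V (ft x) (fz x)) \<in> borel_measurable N"
    by (rule lcross_measurable'[OF V]) measurable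
  show ?thesis
    unfolding lands_def by measurable
qed

lemma jump_measurable:
  assumes H: "nice H" and V: "hist V" and s: "s \<in> {1, - 1}"
    and [measurable]: "ft \<in> borel_measurable N" "fy \<in> borel_measurable N" "fz \<in> borel_measurable N" "fw \<in> borel_measurable N"
  shows "(\<lambda>x. jump H V s (ft x) (fy x) (fz x) (fw x)) \<in> borel_measurable N"
proof -
  have [measurable]: "(\<lambda>x. lcross V (ft x) (fz x)) \<in> borel_measurable N"
    by (rule lcross_measurable'[OF V]) measurable
  have [measurable]: "Measurable.pred N (\<lambda>x. lands V (ft x) (fy x) (fz x) (fw x))"
    by (rule lands_measurable[OF V]) measurable
  have [measurable]: "(\<lambda>x. H V s (lcross V (ft x) (fz x)) (fy x - (ft x - lcross V (ft x) (fz x)) *\<^sub>R fw x) (fz x)) \<in> borel_measurable N"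
    by (rule nice_measurable'[OF H V s]) measurable
  show ?thesis
    unfolding jump_def by measurable
qed

lemma dev_measurable:
  assumes H: "nice H" and V: "hist V" and s: "s \<in> {1, - 1}"
    and [measurable]: "ft \<in> borel_measurable N" "fy \<in> borel_measurable N" "fz \<in> borel_measurable N"
  shows "(\<lambda>x. dev H V s (ft x) (fy x) (fz x)) \<in> borel_measurable N"
proof -
  have w: "(\<lambda>x. snd x) \<in> borel_measurable (N \<Otimes>\<^sub>M lperp G)"
    by (rule measurable_compose[OF measurable_snd incl_lperp])
  have "(\<lambda>x. trans G (snd x) * jump H V s (ft (fst x)) (fy (fst x)) (fz (fst x)) (snd x)) \<in> borel_measurable (N \<Otimes>\<^sub>M lperp G)"
  proof (rule borel_measurable_times)
    show "(\<lambda>x. trans G (snd x)) \<in> borel_measurable (N \<Otimes>\<^sub>M lperp G)"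
      by (rule measurable_compose[OF measurable_snd]) (use trans_integrable in auto)
    show "(\<lambda>x. jump H V s (ft (fst x)) (fy (fst x)) (fz (fst x)) (snd x)) \<in> borel_measurable (N \<Otimes>\<^sub>M lperp G)"
      by (rule jump_measurable[OF H V s _ _ _ w]) measurable
  qed
  then show ?thesis
    unfolding dev_def by (intro lp.borel_measurable_lebesgue_integral) (simp add: case_prod_beta)
qed

abbreviation window :: "real \<Rightarrow> real" where
  "window \<equiv> indicator {Vinf - \<epsilon>..Vinf + \<epsilon>}"

lemma window_integral: "integrable lborel (\<lambda>z. c * window z)" "(LINT z|lborel. c * window z) = c * (2 * \<epsilon>)"
proof -
  show "integrable lborel (\<lambda>z. c * window z)"
    by (intro integrable_mult_right integrable_real_indicator) (auto simp: emeasure_lborel_Icc_eq)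
  show "(LINT z|lborel. c * window z) = c * (2 * \<epsilon>)"
    using eps_pos by simp
qed

lemma lands_window:
  assumes "hist V" "lands V t y z w"
  shows "window z = 1"
  using lcross_pos(3)[OF assms(1), of t z] assms(2) by (auto simp: lands_def indicator_def abs_le_iff)

lemma jump_bound:
  assumes H: "nice H" and V: "hist V" and s: "s \<in> {1, - 1}"
  shows "\<bar>jump H V s t y z w\<bar> \<le> (Nmax + Amax) * window z"
  using nice_bound[OF H V s, of "lcross V t z" "y - (t - lcross V t z) *\<^sub>R w" z]
    dens_nonneg[of z] dens_le[of z] lands_window[OF V, of t y z w] Nmax_nonneg Amax_nonneg
  by (auto simp: jump_def)

lemma trans_times_integrable:
  assumes "f \<in> borel_measurable (lperp G)" "\<And>w. w \<in> hyperplane G \<Longrightarrow> \<bar>f w\<bar> \<le> c"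
  shows "integrable (lperp G) (\<lambda>w. trans G w * f w)" "\<bar>LINT w|lperp G. trans G w * f w\<bar> \<le> c"
proof -
  have c: "integrable (lperp G) (\<lambda>w. trans G w * c)"
    using trans_integrable by simp
  have le: "\<bar>trans G w * f w\<bar> \<le> trans G w * c" if "w \<in> hyperplane G" for w
    using assms(2)[OF that] trans_nonneg[OF that] by (simp add: abs_mult mult_left_mono)
  show "integrable (lperp G) (\<lambda>w. trans G w * f w)"
  proof (rule Bochner_Integration.integrable_bound[OF c])
    show "(\<lambda>w. trans G w * f w) \<in> borel_measurable (lperp G)"
      using trans_integrable assms(1) by (intro borel_measurable_times) auto
    show "AE w in lperp G. norm (trans G w * f w) \<le> norm (trans G w * c)"
    proof (rule AE_I2)
      fix w assume "w \<in> space (lperp G)"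
      then show "norm (trans G w * f w) \<le> norm (trans G w * c)"
        using le[of w] by (simp add: space_lperp)
    qed
  qed
  have "\<bar>LINT w|lperp G. trans G w * f w\<bar> \<le> (LINT w|lperp G. trans G w * c)"
    by (rule abs_integral_le[OF c AE_I2]) (use le in \<open>simp add: space_lperp\<close>)
  then show "\<bar>LINT w|lperp G. trans G w * f w\<bar> \<le> c"
    by (simp add: trans_integral)
qed

lemma jump_measurable_w:
  assumes "nice H" "hist V" "s \<in> {1, - 1}"
  shows "jump H V s t y z \<in> borel_measurable (lperp G)"
  using jump_measurable[OF assms, of "\<lambda>_. t" "lperp G" "\<lambda>_. y" "\<lambda>_. z" "\<lambda>w. w"] incl_lperp[of G] by simp

lemma dev_bound:
  assumes "nice H" "hist V" "s \<in> {1, - 1}"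
  shows "\<bar>dev H V s t y z\<bar> \<le> (Nmax + Amax) * window z"
  unfolding dev_def using jump_bound[OF assms] by (intro trans_times_integrable(2) jump_measurable_w assms)

text \<open>For a landing particle the reemitted density replaces \<open>dens\<close> instead of
  being added to it. Bounding the sum at once gives \<open>Nmax\<close> rather than
  \<open>Nmax + Amax\<close>, which is what lets \<open>Nmax\<close> reproduce itself in
  \<open>step_bound\<close>.\<close>

lemma dens_dev_bound:
  assumes H: "nice H" and V: "hist V" and s: "s \<in> {1, - 1}"
  shows "\<bar>dens G z + dev H V s t y z\<bar> \<le> dens G z + Nmax * window z"
proof -
  note J = trans_times_integrable(1)[OF jump_measurable_w[OF assms] jump_bound[OF assms], of t y z]
  have "dens G z + dev H V s t y z = (LINT w|lperp G. trans G w * dens G z) + (LINT w|lperp G. trans G w * jump H V s t y z w)"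
    by (simp add: dev_def trans_integral)
  also have "\<dots> = (LINT w|lperp G. trans G w * (dens G z + jump H V s t y z w))"
    using J trans_integrable by (subst Bochner_Integration.integral_add[symmetric]) (auto simp: distrib_left)
  also have "\<bar>\<dots>\<bar> \<le> dens G z + Nmax * window z"
  proof (rule trans_times_integrable(2))
    show "(\<lambda>w. dens G z + jump H V s t y z w) \<in> borel_measurable (lperp G)"
      using jump_measurable_w[OF assms] by auto
    show "\<bar>dens G z + jump H V s t y z w\<bar> \<le> dens G z + Nmax * window z" for w
      using nice_bound[OF H V s, of "lcross V t z" "y - (t - lcross V t z) *\<^sub>R w" z]
        dens_nonneg[of z] lands_window[OF V, of t y z w] Nmax_nonneg
      by (auto simp: jump_def)
  qed
  finally show ?thesis .
qed

lemma dev_diff_bound: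
  assumes H: "nice H" "nice H'" and V: "hist V" and s: "s \<in> {1, - 1}"
    and c: "\<And>t y v. \<bar>H V s t y v - H' V s t y v\<bar> \<le> c"
  shows "\<bar>dev H V s t y z - dev H' V s t y z\<bar> \<le> c * window z"
proof -
  note J = trans_times_integrable(1)[OF jump_measurable_w jump_bound, OF H(1) V s H(1) V s, of t y z]
    trans_times_integrable(1)[OF jump_measurable_w jump_bound, OF H(2) V s H(2) V s, of t y z]
  have c0: "c \<ge> 0"
    using c[of 0 0 0] by linarith
  have "dev H V s t y z - dev H' V s t y z = (LINT w|lperp G. trans G w * (jump H V s t y z w - jump H' V s t y z w))"
    unfolding dev_def using J by (subst Bochner_Integration.integral_diff[symmetric]) (auto simp: right_diff_distrib)
  also have "\<bar>\<dots>\<bar> \<le> c * window z"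
  proof (rule trans_times_integrable(2))
    show "(\<lambda>w. jump H V s t y z w - jump H' V s t y z w) \<in> borel_measurable (lperp G)"
      using jump_measurable_w[OF H(1) V s] jump_measurable_w[OF H(2) V s] by auto
    show "\<bar>jump H V s t y z w - jump H' V s t y z w\<bar> \<le> c * window z" for w
      using c[of "lcross V t z" "y - (t - lcross V t z) *\<^sub>R w" z] lands_window[OF V, of t y z w] c0
      by (auto simp: jump_def)
  qed
  finally show ?thesis .
qed

text \<open>The only discontinuity left besides exceptional velocities is at the rim of the disk;
  strictly inside and strictly outside, landing is stable under convergence.\<close>

lemma jump_tendsto:
  assumes H: "nice H" and c: "hconv Vn V" and s: "s \<in> {1, - 1}"
    and tn: "tn \<longlonglongrightarrow> t" "\<And>n. tn n \<ge> 0" and yn: "yn \<longlonglongrightarrow> y" "\<And>n. yn n \<in> disk G"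
    and z: "z \<notin> exceptional V t" and w: "w \<in> hyperplane G"
    and r: "lcross V t z > 0 \<Longrightarrow> norm (y - (t - lcross V t z) *\<^sub>R w) \<noteq> radius G"
  shows "(\<lambda>n. jump H (Vn n) s (tn n) (yn n) z w) \<longlonglongrightarrow> jump H V s t y z w"
proof -
  have V: "hist V" and Vn: "\<And>n. hist (Vn n)"
    using c by (auto simp: hconv_hist)
  note L = lcross_tendsto[OF c tn z]
  define l where "l = lcross V t z"
  define ln where "ln n = lcross (Vn n) (tn n) z" for n
  have l_lim: "ln \<longlonglongrightarrow> l"
    using L(1) by (simp add: ln_def[abs_def] l_def)
  show ?thesis
  proof (cases "l > 0")
    case False
    have "\<forall>\<^sub>F n in sequentially. jump H (Vn n) s (tn n) (yn n) z w = jump H V s t y z w"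
      using L(2) by eventually_elim (use False in \<open>simp add: jump_def lands_def l_def\<close>)
    then show ?thesis
      by (rule tendsto_eventually)
  next
    case True
    define x where "x = y - (t - l) *\<^sub>R w"
    define xn where "xn n = yn n - (tn n - ln n) *\<^sub>R w" for n
    have x_lim: "xn \<longlonglongrightarrow> x"
      unfolding x_def xn_def[abs_def] by (intro tendsto_intros l_lim tn yn)
    have xh: "xn n \<in> hyperplane G" for n
      unfolding xn_def using yn(2)[of n] w by (intro hyperplane_diff) (auto simp: disk_def)
    have xhl: "x \<in> hyperplane G"
      by (rule closed_sequentially[OF closed_hyperplane _ x_lim]) (rule xh)
    have ev_l: "\<forall>\<^sub>F n in sequentially. ln n > 0"
      using L(2) by eventually_elim (use True in \<open>simp add: ln_def l_def\<close>)
    have "norm x \<noteq> radius G"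
      using r True by (simp add: x_def l_def)
    then consider "norm x < radius G" | "norm x > radius G"
      by linarith
    then show ?thesis
    proof cases
      case 1
      have ev: "\<forall>\<^sub>F n in sequentially. norm (xn n) < radius G"
        using order_tendstoD(2)[OF tendsto_norm[OF x_lim] 1] .
      \<comment> \<open>\<open>nice\<close> speaks about sequences that are in \<open>Dom\<close>
        from the beginning. The finitely many terms that may violate this are replaced by the
        limit.\<close>
      define ln' where "ln' n = (if ln n > 0 \<and> norm (xn n) < radius G then ln n else l)" for n
      define xn' where "xn' n = (if ln n > 0 \<and> norm (xn n) < radius G then xn n else x)" for n
      have zw: "\<bar>z - Vinf\<bar> \<le> \<epsilon>"
        using lcross_pos(3)[OF V] True by (simp add: l_def)
      have eq: "\<forall>\<^sub>F n in sequentially. ln' n = ln n \<and> xn' n = xn n"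
        using ev ev_l by eventually_elim (simp add: ln'_def xn'_def)
      have "ln' \<longlonglongrightarrow> l"
        by (rule Lim_transform_eventually[OF l_lim]) (use eq in eventually_elim, simp)
      moreover have "xn' \<longlonglongrightarrow> x"
        by (rule Lim_transform_eventually[OF x_lim]) (use eq in eventually_elim, simp)
      moreover have "(ln' n, xn' n, z) \<in> Dom" for n
        using True zw 1 xh xhl by (auto simp: Dom_iff ln'_def xn'_def disk_def)
      ultimately have "(\<lambda>n. H (Vn n) s (ln' n) (xn' n) z) \<longlonglongrightarrow> H V s l x z"
        by (intro nice_tendsto[OF H c s] tendsto_const)
      then have lim: "(\<lambda>n. H (Vn n) s (ln' n) (xn' n) z - dens G z) \<longlonglongrightarrow> H V s l x z - dens G z"
        by (intro tendsto_intros)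
      have "\<forall>\<^sub>F n in sequentially. H (Vn n) s (ln' n) (xn' n) z - dens G z = jump H (Vn n) s (tn n) (yn n) z w"
        using eq ev ev_l by eventually_elim (auto simp: jump_def lands_def xn_def ln_def)
      moreover have "jump H V s t y z w = H V s l x z - dens G z"
        using True 1 by (simp add: jump_def lands_def x_def l_def)
      ultimately show ?thesis
        using lim by (simp add: Lim_transform_eventually)
    next
      case 2
      have "\<forall>\<^sub>F n in sequentially. norm (xn n) > radius G"
        using order_tendstoD(1)[OF tendsto_norm[OF x_lim] 2] .
      then have "\<forall>\<^sub>F n in sequentially. jump H (Vn n) s (tn n) (yn n) z w = jump H V s t y z w"
        by eventually_elim (use 2 in \<open>auto simp: jump_def lands_def xn_def ln_def x_def l_def\<close>)
      then show ?thesis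
        by (rule tendsto_eventually)
    qed
  qed
qed

text \<open>Dominated convergence in the transversal velocity: the velocities that lead exactly to
  the rim form a sphere, which is a null set by \<open>perp_sphere_null\<close>.\<close>

lemma dev_tendsto:
  assumes H: "nice H" and c: "hconv Vn V" and s: "s \<in> {1, - 1}"
    and tn: "tn \<longlonglongrightarrow> t" "\<And>n. tn n \<ge> 0" and yn: "yn \<longlonglongrightarrow> y" "\<And>n. yn n \<in> disk G"
    and z: "z \<notin> exceptional V t"
  shows "(\<lambda>n. dev H (Vn n) s (tn n) (yn n) z) \<longlonglongrightarrow> dev H V s t y z"
  unfolding dev_def
proof (rule integral_dominated_convergence)
  have V: "hist V" and Vn: "\<And>n. hist (Vn n)"
    using c by (auto simp: hconv_hist)
  have y: "y \<in> disk G"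
    by (rule closed_sequentially[OF closed_disk _ yn(1)]) (rule yn(2))
  show "(\<lambda>w. trans G w * jump H V s t y z w) \<in> borel_measurable (lperp G)"
    using trans_integrable jump_measurable_w[OF H V s] by (intro borel_measurable_times) auto
  show "(\<lambda>w. trans G w * jump H (Vn n) s (tn n) (yn n) z w) \<in> borel_measurable (lperp G)" for n
    using trans_integrable jump_measurable_w[OF H Vn s] by (intro borel_measurable_times) auto
  show "integrable (lperp G) (\<lambda>w. trans G w * (Nmax + Amax))"
    using trans_integrable by simp
  show "AE w in lperp G. norm (trans G w * jump H (Vn n) s (tn n) (yn n) z w) \<le> trans G w * (Nmax + Amax)" for n
  proof (rule AE_I2)
    fix w assume "w \<in> space (lperp G)"
    then have "trans G w \<ge> 0"
      by (simp add: space_lperp trans_nonneg)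
    moreover have "(Nmax + Amax) * window z \<le> Nmax + Amax"
      using Nmax_nonneg Amax_nonneg by (auto simp: indicator_def)
    then have "\<bar>jump H (Vn n) s (tn n) (yn n) z w\<bar> \<le> Nmax + Amax"
      using jump_bound[OF H Vn s] order_trans by blast
    ultimately show "norm (trans G w * jump H (Vn n) s (tn n) (yn n) z w) \<le> trans G w * (Nmax + Amax)"
      by (simp add: abs_mult mult_left_mono)
  qed
  have sphere: "AE w in lperp G. lcross V t z > 0 \<longrightarrow> norm (y - (t - lcross V t z) *\<^sub>R w) \<noteq> radius G"
  proof (cases "lcross V t z > 0")
    case True
    have "AE w in lperp G. norm (y + (- (t - lcross V t z)) *\<^sub>R w) \<noteq> radius G"
      using lcross_pos(2)[OF V True] radius_pos y by (intro perp_sphere_null) (auto simp: disk_def)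
    moreover have "y + (- (t - lcross V t z)) *\<^sub>R w = y - (t - lcross V t z) *\<^sub>R w" for w
      by (simp add: algebra_simps)
    ultimately have "AE w in lperp G. norm (y - (t - lcross V t z) *\<^sub>R w) \<noteq> radius G"
      by (simp only:)
    then show ?thesis
      by eventually_elim simp
  qed simp
  show "AE w in lperp G. (\<lambda>n. trans G w * jump H (Vn n) s (tn n) (yn n) z w) \<longlonglongrightarrow> trans G w * jump H V s t y z w"
    using sphere AE_space[of "lperp G"]
  proof eventually_elim
    case (elim w)
    then show ?case
      by (intro tendsto_mult_left jump_tendsto[OF H c s tn yn z]) (auto simp: space_lperp)
  qed
qed

lemma half_line_tendsto:
  assumes "wn \<longlonglongrightarrow> w" "z \<noteq> w" "s \<in> {1, - 1 :: real}"
  shows "(\<lambda>n. indicator {z. s * (z - wn n) \<le> 0} z :: real) \<longlonglongrightarrow> indicator {z. s * (z - w) \<le> 0} z"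
proof (rule tendsto_eventually)
  have lim: "(\<lambda>n. s * (z - wn n)) \<longlonglongrightarrow> s * (z - w)"
    by (intro tendsto_intros assms)
  have "s * (z - w) \<noteq> 0"
    using assms by auto
  then consider "s * (z - w) < 0" | "s * (z - w) > 0"
    by linarith
  then show "\<forall>\<^sub>F n in sequentially. (indicator {z. s * (z - wn n) \<le> 0} z :: real) = indicator {z. s * (z - w) \<le> 0} z"
  proof cases
    case 1
    from order_tendstoD(2)[OF lim 1] show ?thesis
      by eventually_elim (use 1 in auto)
  next
    case 2
    from order_tendstoD(1)[OF lim 2] show ?thesis
      by eventually_elim (use 2 in auto)
  qed
qed

text \<open>The weight \<kappa> is the kernel when the reemission is computed and \<open>ell\<close>
  when the force is computed, so the estimates are proved once for both.\<close>

definition dev_integral :: "((real \<Rightarrow> real) \<Rightarrow> real \<Rightarrow> real \<Rightarrow> 'a \<Rightarrow> real \<Rightarrow> real) \<Rightarrow>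
    (real \<Rightarrow> real) \<Rightarrow> real \<Rightarrow> real \<Rightarrow> 'a \<Rightarrow> (real \<Rightarrow> real) \<Rightarrow> real" where
  "dev_integral H V s t y \<kappa> = (LINT z|lborel. indicator {z. s * (z - V t) \<le> 0} z * (\<kappa> z * dev H V s t y z))"

lemma dev_integrand:
  assumes H: "nice H" and V: "hist V" and s: "s \<in> {1, - 1}" and \<kappa>[measurable]: "\<kappa> \<in> borel_measurable borel"
    and Kb: "\<And>z. \<bar>z - Vinf\<bar> \<le> \<epsilon> \<Longrightarrow> \<bar>\<kappa> z\<bar> \<le> Kb"
  shows "(\<lambda>z. indicator {z. s * (z - V t) \<le> 0} z * (\<kappa> z * dev H V s t y z)) \<in> borel_measurable lborel" (is ?m)
    and "\<bar>indicator {z. s * (z - V t) \<le> 0} z * (\<kappa> z * dev H V s t y z)\<bar> \<le> Kb * (Nmax + Amax) * window z" (is ?b)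
    and "integrable lborel (\<lambda>z. indicator {z. s * (z - V t) \<le> 0} z * (\<kappa> z * dev H V s t y z))" (is ?i)
proof -
  have [measurable]: "(\<lambda>z. dev H V s t y z) \<in> borel_measurable borel"
    by (rule dev_measurable[OF H V s]) auto
  show m: ?m
    by measurable
  have b: "\<bar>indicator {z. s * (z - V t) \<le> 0} z * (\<kappa> z * dev H V s t y z)\<bar> \<le> Kb * (Nmax + Amax) * window z" for z
  proof (cases "\<bar>z - Vinf\<bar> \<le> \<epsilon>")
    case True
    have "\<bar>\<kappa> z * dev H V s t y z\<bar> \<le> Kb * ((Nmax + Amax) * window z)"
      unfolding abs_mult using Kb[OF True] dev_bound[OF H V s] by (intro mult_mono) auto
    moreover have "\<bar>indicator {z. s * (z - V t) \<le> 0} z * (\<kappa> z * dev H V s t y z)\<bar> \<le> \<bar>\<kappa> z * dev H V s t y z\<bar>"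
      by (auto simp: indicator_def)
    ultimately show ?thesis
      by (simp add: mult.assoc)
  next
    case False
    then have "window z = 0"
      by (auto simp: indicator_def abs_le_iff)
    moreover from this have "dev H V s t y z = 0"
      using dev_bound[OF H V s, of t y z] by simp
    ultimately show ?thesis
      by simp
  qed
  then show ?b .
  show ?i
    by (rule Bochner_Integration.integrable_bound[OF window_integral(1)[of "Kb * (Nmax + Amax)"] m])
       (simp only: real_norm_def, intro AE_I2 order_trans[OF b abs_ge_self])
qed

lemma dev_integral_bound:
  assumes "nice H" "hist V" "s \<in> {1, - 1}" "\<kappa> \<in> borel_measurable borel"
    and "\<And>z. \<bar>z - Vinf\<bar> \<le> \<epsilon> \<Longrightarrow> \<bar>\<kappa> z\<bar> \<le> Kb"
  shows "\<bar>dev_integral H V s t y \<kappa>\<bar> \<le> Kb * (Nmax + Amax) * (2 * \<epsilon>)"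
  unfolding dev_integral_def window_integral(2)[symmetric]
  by (intro abs_integral_le window_integral(1) AE_I2 dev_integrand(2) assms)

lemma dev_integral_tendsto:
  assumes H: "nice H" and c: "hconv Vn V" and s: "s \<in> {1, - 1}"
    and tn: "tn \<longlonglongrightarrow> t" "\<And>n. tn n \<ge> 0" and yn: "yn \<longlonglongrightarrow> y" "\<And>n. yn n \<in> disk G"
    and \<kappa>: "\<kappa> \<in> borel_measurable borel" "\<And>n. \<kappa>n n \<in> borel_measurable borel"
    and Kb: "\<And>n z. \<bar>z - Vinf\<bar> \<le> \<epsilon> \<Longrightarrow> \<bar>\<kappa>n n z\<bar> \<le> Kb" "\<And>z. \<bar>z - Vinf\<bar> \<le> \<epsilon> \<Longrightarrow> \<bar>\<kappa> z\<bar> \<le> Kb"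
    and lim: "\<And>z. (\<lambda>n. \<kappa>n n z) \<longlonglongrightarrow> \<kappa> z"
  shows "(\<lambda>n. dev_integral H (Vn n) s (tn n) (yn n) (\<kappa>n n)) \<longlonglongrightarrow> dev_integral H V s t y \<kappa>"
  unfolding dev_integral_def
proof (rule integral_dominated_convergence)
  have V: "hist V" and Vn: "\<And>n. hist (Vn n)"
    using c by (auto simp: hconv_hist)
  show "(\<lambda>z. indicator {z. s * (z - V t) \<le> 0} z * (\<kappa> z * dev H V s t y z)) \<in> borel_measurable lborel"
    by (rule dev_integrand(1)[OF H V s \<kappa>(1) Kb(2)])
  show "(\<lambda>z. indicator {z. s * (z - Vn n (tn n)) \<le> 0} z * (\<kappa>n n z * dev H (Vn n) s (tn n) (yn n) z)) \<in> borel_measurable lborel" for n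
    by (rule dev_integrand(1)[OF H Vn s \<kappa>(2) Kb(1)])
  show "integrable lborel (\<lambda>z. Kb * (Nmax + Amax) * window z)"
    by (rule window_integral)
  show "AE z in lborel. norm (indicator {z. s * (z - Vn n (tn n)) \<le> 0} z * (\<kappa>n n z * dev H (Vn n) s (tn n) (yn n) z)) \<le> Kb * (Nmax + Amax) * window z" for n
    unfolding real_norm_def by (intro AE_I2 dev_integrand(2) H Vn s \<kappa> Kb)
  show "AE z in lborel. (\<lambda>n. indicator {z. s * (z - Vn n (tn n)) \<le> 0} z * (\<kappa>n n z * dev H (Vn n) s (tn n) (yn n) z))
      \<longlonglongrightarrow> indicator {z. s * (z - V t) \<le> 0} z * (\<kappa> z * dev H V s t y z)"
    using AE_exceptional[OF V, of t]
  proof eventually_elim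
    case (elim z)
    then have "z \<noteq> V t"
      by (simp add: exceptional_def)
    then show ?case
      by (intro tendsto_mult half_line_tendsto[OF hconv_V[OF c tn]] lim dev_tendsto[OF H c s tn yn elim] s)
  qed
qed

lemma fresh_tendsto:
  assumes wn: "wn \<longlonglongrightarrow> w" "\<And>n. \<bar>wn n - Vinf\<bar> \<le> \<epsilon>" and vn: "vn \<longlonglongrightarrow> v" "\<And>n. \<bar>vn n - Vinf\<bar> \<le> \<epsilon>"
    and s: "s \<in> {1, - 1}"
  shows "(\<lambda>n. fresh s (wn n) (vn n)) \<longlonglongrightarrow> fresh s w v"
  unfolding fresh_def set_lebesgue_integral_def real_scaleR_def
proof (rule integral_dominated_convergence[OF _ _ M_int])
  have b: "\<bar>vn n - wn n\<bar> \<le> 2 * \<epsilon>" for n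
    using wn(2)[of n] vn(2)[of n] by linarith
  show "(\<lambda>z. indicator {z. s * (z - w) \<le> 0} z * (kx G (v - w) (z - w) * dens G z)) \<in> borel_measurable lborel"
    by measurable
  show "(\<lambda>z. indicator {z. s * (z - wn n) \<le> 0} z * (kx G (vn n - wn n) (z - wn n) * dens G z)) \<in> borel_measurable lborel" for n
    by measurable
  show "AE z in lborel. norm (indicator {z. s * (z - wn n) \<le> 0} z * (kx G (vn n - wn n) (z - wn n) * dens G z)) \<le> M z" for n
    using kx_dens_le[OF b wn(2)] kx_nonneg dens_nonneg M_nonneg by (intro AE_I2) (auto simp: indicator_def)
  have "AE z in lborel. z \<notin> {w}"
    by (intro AE_not_in countable_imp_null_set_lborel) simp
  then show "AE z in lborel. (\<lambda>n. indicator {z. s * (z - wn n) \<le> 0} z * (kx G (vn n - wn n) (z - wn n) * dens G z))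
      \<longlonglongrightarrow> indicator {z. s * (z - w) \<le> 0} z * (kx G (v - w) (z - w) * dens G z)"
  proof eventually_elim
    case (elim z)
    then show ?case
      by (intro tendsto_mult half_line_tendsto[OF wn(1)] kx_tendsto tendsto_diff tendsto_const vn(1) wn(1) s) auto
  qed
qed

definition step :: "((real \<Rightarrow> real) \<Rightarrow> real \<Rightarrow> real \<Rightarrow> 'a \<Rightarrow> real \<Rightarrow> real) \<Rightarrow>
    (real \<Rightarrow> real) \<Rightarrow> real \<Rightarrow> real \<Rightarrow> 'a \<Rightarrow> real \<Rightarrow> real" where
  "step H V s t y v = (if (t, y, v) \<in> Dom
     then fresh s (V t) v + dev_integral H V s t y (\<lambda>z. kx G (v - V t) (z - V t)) else 0)"

lemma kx_window:
  assumes "hist V" "\<bar>z - Vinf\<bar> \<le> \<epsilon>"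
  shows "\<bar>kx G a (z - V t)\<bar> \<le> Kmax"
proof -
  have "\<bar>z - V t\<bar> \<le> 2 * \<epsilon>"
    using hist_near[OF assms(1), of t] assms(2) by linarith
  then show ?thesis
    using kx_le kx_nonneg by simp
qed

text \<open>The same balance that defines \<open>Nmax\<close>: half of it from fresh particles, and
  by \<open>small1\<close> at most half from recolliding ones.\<close>

lemma step_bound:
  assumes H: "nice H" and V: "hist V" and s: "s \<in> {1, - 1}"
  shows "\<bar>step H V s t y v\<bar> \<le> Nmax"
proof (cases "(t, y, v) \<in> Dom")
  case True
  let ?I = "\<lambda>z. indicator {z. s * (z - V t) \<le> 0} z :: real" and ?k = "\<lambda>z. kx G (v - V t) (z - V t)"
  have vV: "\<bar>v - V t\<bar> \<le> 2 * \<epsilon>" "\<bar>V t - Vinf\<bar> \<le> \<epsilon>"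
    using True hist_near[OF V, of t] by (auto simp: Dom_iff)
  have km: "?k \<in> borel_measurable borel"
    by measurable
  note F = fresh_integrable[OF vV, of s] and D = dev_integrand(3)[OF H V s km kx_window[OF V], of t y]
  have "step H V s t y v = (LINT z|lborel. ?I z * (?k z * dens G z)) + (LINT z|lborel. ?I z * (?k z * dev H V s t y z))"
    using True by (simp add: step_def fresh_def dev_integral_def set_lebesgue_integral_def)
  also have "\<dots> = (LINT z|lborel. ?I z * (?k z * (dens G z + dev H V s t y z)))"
    using Bochner_Integration.integral_add[OF F D] by (simp add: distrib_left)
  finally have eq: "step H V s t y v = (LINT z|lborel. ?I z * (?k z * (dens G z + dev H V s t y z)))" .
  have "\<bar>step H V s t y v\<bar> \<le> (LINT z|lborel. M z + Kmax * Nmax * window z)"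
    unfolding eq
  proof (rule abs_integral_le)
    show "integrable lborel (\<lambda>z. M z + Kmax * Nmax * window z)"
      by (intro Bochner_Integration.integrable_add M_int window_integral)
    have "\<bar>?I z * (?k z * (dens G z + dev H V s t y z))\<bar> \<le> M z + Kmax * Nmax * window z" for z
    proof -
      have "\<bar>?I z * (?k z * (dens G z + dev H V s t y z))\<bar> \<le> ?k z * \<bar>dens G z + dev H V s t y z\<bar>"
        using kx_nonneg by (auto simp: indicator_def abs_mult)
      also have "\<dots> \<le> ?k z * (dens G z + Nmax * window z)"
        by (intro mult_left_mono dens_dev_bound H V s kx_nonneg)
      also have "\<dots> = ?k z * dens G z + ?k z * (Nmax * window z)"
        by (rule distrib_left)
      also have "\<dots> \<le> M z + Kmax * (Nmax * window z)"
      proof (rule add_mono)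
        show "?k z * dens G z \<le> M z"
          by (rule kx_dens_le[OF vV])
        show "?k z * (Nmax * window z) \<le> Kmax * (Nmax * window z)"
        proof (cases "\<bar>z - Vinf\<bar> \<le> \<epsilon>")
          case True
          show ?thesis
            using kx_window[OF V True, of "v - V t" t] Nmax_nonneg by (intro mult_right_mono) auto
        next
          case False
          then have "window z = 0"
            by (auto simp: indicator_def abs_le_iff)
          then show ?thesis
            by simp
        qed
      qed
      finally show ?thesis
        by (simp add: mult.assoc)
    qed
    then show "AE z in lborel. \<bar>?I z * (?k z * (dens G z + dev H V s t y z))\<bar> \<le> M z + Kmax * Nmax * window z"
      by simp
  qed
  also have "\<dots> = Nmax / 2 + (2 * \<epsilon> * Kmax) * Nmax"
  proof -
    have "(LINT z|lborel. M z + Kmax * Nmax * window z) = integral\<^sup>L lborel M + (LINT z|lborel. Kmax * Nmax * window z)"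
      by (rule Bochner_Integration.integral_add[OF M_int window_integral(1)])
    also have "\<dots> = Nmax / 2 + Kmax * Nmax * (2 * \<epsilon>)"
      unfolding window_integral(2)[of "Kmax * Nmax"] by (simp add: Nmax_def)
    finally show ?thesis
      by (simp only: mult_ac)
  qed
  also have "\<dots> \<le> Nmax / 2 + 1 / 2 * Nmax"
    by (intro add_left_mono mult_right_mono small1 Nmax_nonneg)
  finally show ?thesis
    by simp
qed (simp add: step_def Nmax_nonneg)

lemma nice_step:
  assumes H: "nice H"
  shows "nice (step H)"
  unfolding nice_def
proof (intro conjI allI impI)
  show "step H V s t y v = 0" if "(t, y, v) \<notin> Dom" for V s t y v
    using that by (simp add: step_def)
  show "\<bar>step H V s t y v\<bar> \<le> Nmax" if "hist V" "s \<in> {1, - 1}" for V s t y v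
    by (rule step_bound[OF H that])
  fix Vn V s tn t yn y vn v
  assume c: "hconv Vn V" and s: "s \<in> {1, - 1 :: real}" and D: "\<forall>n. (tn n, yn n, vn n) \<in> Dom"
    and lim: "tn \<longlonglongrightarrow> t" "yn \<longlonglongrightarrow> y" "vn \<longlonglongrightarrow> v"
  have V: "hist V" and Vn: "\<And>n. hist (Vn n)"
    using c by (auto simp: hconv_hist)
  have D': "(t, y, v) \<in> Dom"
    by (rule closed_sequentially[OF closed_Dom, of "\<lambda>n. (tn n, yn n, vn n)"]) (use D lim in \<open>auto intro!: tendsto_intros\<close>)
  have tn: "tn n \<ge> 0" and yn: "yn n \<in> disk G" and vn: "\<bar>vn n - Vinf\<bar> \<le> \<epsilon>" for n
    using D by (auto simp: Dom_iff)
  have Vlim: "(\<lambda>n. Vn n (tn n)) \<longlonglongrightarrow> V t"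
    by (rule hconv_V[OF c lim(1) tn])
  have "(\<lambda>n. fresh s (Vn n (tn n)) (vn n) + dev_integral H (Vn n) s (tn n) (yn n) (\<lambda>z. kx G (vn n - Vn n (tn n)) (z - Vn n (tn n))))
    \<longlonglongrightarrow> fresh s (V t) v + dev_integral H V s t y (\<lambda>z. kx G (v - V t) (z - V t))"
  proof (intro tendsto_add fresh_tendsto dev_integral_tendsto H c s lim tn yn vn Vlim hist_near[OF Vn] kx_shift_measurable)
    show "(\<lambda>n. kx G (vn n - Vn n (tn n)) (z - Vn n (tn n))) \<longlonglongrightarrow> kx G (v - V t) (z - V t)" for z
      by (intro kx_tendsto tendsto_diff tendsto_const lim Vlim)
    show "\<bar>kx G (vn n - Vn n (tn n)) (z - Vn n (tn n))\<bar> \<le> Kmax" if "\<bar>z - Vinf\<bar> \<le> \<epsilon>" for n z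
      by (rule kx_window[OF Vn that])
    show "\<bar>kx G (v - V t) (z - V t)\<bar> \<le> Kmax" if "\<bar>z - Vinf\<bar> \<le> \<epsilon>" for z
      by (rule kx_window[OF V that])
  qed
  then show "(\<lambda>n. step H (Vn n) s (tn n) (yn n) (vn n)) \<longlonglongrightarrow> step H V s t y v"
    using D D' by (simp add: step_def)
qed

lemma step_contract:
  assumes H: "nice H" "nice H'" and V: "hist V" and s: "s \<in> {1, - 1}"
    and c: "\<And>t y v. \<bar>H V s t y v - H' V s t y v\<bar> \<le> c"
  shows "\<bar>step H V s t y v - step H' V s t y v\<bar> \<le> c / 2"
proof (cases "(t, y, v) \<in> Dom")
  case True
  let ?I = "\<lambda>z. indicator {z. s * (z - V t) \<le> 0} z :: real" and ?k = "\<lambda>z. kx G (v - V t) (z - V t)"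
  have c0: "c \<ge> 0"
    using c[of 0 0 0] by linarith
  have km: "?k \<in> borel_measurable borel"
    by measurable
  note D = dev_integrand(3)[OF H(1) V s km kx_window[OF V], of t y] dev_integrand(3)[OF H(2) V s km kx_window[OF V], of t y]
  have eq: "step H V s t y v - step H' V s t y v = (LINT z|lborel. ?I z * (?k z * (dev H V s t y z - dev H' V s t y z)))"
    using True Bochner_Integration.integral_diff[OF D] by (simp add: step_def dev_integral_def right_diff_distrib)
  have "\<bar>step H V s t y v - step H' V s t y v\<bar> \<le> (LINT z|lborel. Kmax * c * window z)"
    unfolding eq
  proof (rule abs_integral_le[OF window_integral(1) AE_I2])
    fix z
    have "\<bar>?I z * (?k z * (dev H V s t y z - dev H' V s t y z))\<bar> \<le> ?k z * \<bar>dev H V s t y z - dev H' V s t y z\<bar>"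
      using kx_nonneg by (auto simp: indicator_def abs_mult)
    also have "\<dots> \<le> ?k z * (c * window z)"
      by (intro mult_left_mono dev_diff_bound H V s c kx_nonneg)
    also have "\<dots> \<le> Kmax * (c * window z)"
    proof (cases "\<bar>z - Vinf\<bar> \<le> \<epsilon>")
      case True
      show ?thesis
        using kx_window[OF V True, of "v - V t" t] c0 by (intro mult_right_mono) auto
    next
      case False
      then have "window z = 0"
        by (auto simp: indicator_def abs_le_iff)
      then show ?thesis
        by simp
    qed
    finally show "\<bar>?I z * (?k z * (dev H V s t y z - dev H' V s t y z))\<bar> \<le> Kmax * c * window z"
      by (simp add: mult.assoc)
  qed
  also have "\<dots> = (2 * \<epsilon> * Kmax) * c"
    unfolding window_integral(2)[of "Kmax * c"] by (simp only: mult_ac)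
  also have "\<dots> \<le> 1 / 2 * c"
    by (intro mult_right_mono small1 c0)
  finally show ?thesis
    by simp
next
  case False
  then show ?thesis
    using c[of 0 0 0] by (simp add: step_def)
qed

section \<open>Fixed point of the reemission map\<close>

fun iter :: "nat \<Rightarrow> (real \<Rightarrow> real) \<Rightarrow> real \<Rightarrow> real \<Rightarrow> 'a \<Rightarrow> real \<Rightarrow> real" where
  "iter 0 = (\<lambda>V s t y v. 0)"
| "iter (Suc j) = step (iter j)"

lemma nice_iter: "nice (iter j)"
proof (induction j)
  case 0
  then show ?case
    by (simp add: nice_def Nmax_nonneg)
qed (simp add: nice_step)

lemma iter_Suc_diff:
  assumes "hist V" "s \<in> {1, - 1}"
  shows "\<bar>iter (Suc j) V s t y v - iter j V s t y v\<bar> \<le> Nmax * (1 / 2) ^ j"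
proof (induction j arbitrary: t y v)
  case 0
  then show ?case
    using step_bound[OF nice_iter[of 0] assms] by simp
next
  case (Suc j)
  have "\<bar>step (iter (Suc j)) V s t y v - step (iter j) V s t y v\<bar> \<le> Nmax * (1 / 2) ^ j / 2"
    by (rule step_contract[where H = "iter (Suc j)" and H' = "iter j" and c = "Nmax * (1 / 2) ^ j", OF nice_iter nice_iter assms Suc.IH])
  then show ?case
    by simp
qed

text \<open>As a pointwise limit of explicit iterates it inherits what induction gives for each of
  them, in particular continuity in the motion and causality.\<close>

definition Rem :: "(real \<Rightarrow> real) \<Rightarrow> real \<Rightarrow> real \<Rightarrow> 'a \<Rightarrow> real \<Rightarrow> real" where
  "Rem V s t y v = lim (\<lambda>j. iter j V s t y v)"

lemma iter_Rem:
  assumes "hist V" "s \<in> {1, - 1}"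
  shows "(\<lambda>j. iter j V s t y v) \<longlonglongrightarrow> Rem V s t y v"
    and "\<bar>Rem V s t y v - iter j V s t y v\<bar> \<le> 2 * Nmax * (1 / 2) ^ j"
proof -
  let ?h = "\<lambda>j. iter j V s t y v"
  \<comment> \<open>The partial geometric sum is kept exactly, so that the induction closes without
    loss.\<close>
  have tail: "\<bar>?h (j + i) - ?h j\<bar> \<le> 2 * Nmax * (1 / 2) ^ j * (1 - (1 / 2) ^ i)" for i j
  proof (induction i)
    case (Suc i)
    have "\<bar>?h (Suc (j + i)) - ?h (j + i)\<bar> \<le> Nmax * (1 / 2) ^ (j + i)"
      by (rule iter_Suc_diff[OF assms])
    with Suc show ?case
      by (simp add: power_add algebra_simps)
  qed simp
  have tail': "\<bar>?h (j + i) - ?h j\<bar> \<le> 2 * Nmax * (1 / 2) ^ j" for i j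
  proof -
    have "2 * Nmax * (1 / 2) ^ j * (1 - (1 / 2) ^ i) \<le> 2 * Nmax * (1 / 2) ^ j * 1"
      using Nmax_nonneg by (intro mult_left_mono) auto
    then show ?thesis
      using tail[where i = i and j = j] by simp
  qed
  have "Cauchy ?h"
  proof (rule CauchyI')
    fix e :: real assume e: "e > 0"
    have "(\<lambda>j. 2 * Nmax * (1 / 2) ^ j) \<longlonglongrightarrow> 0"
      by (intro tendsto_mult_right_zero LIMSEQ_power_zero) simp
    then have "\<forall>\<^sub>F j in sequentially. 2 * Nmax * (1 / 2) ^ j < e"
      using e by (intro order_tendstoD)
    then obtain J where J: "2 * Nmax * (1 / 2) ^ j < e" if "j \<ge> J" for j
      by (auto simp: eventually_sequentially)
    show "\<exists>M. \<forall>m\<ge>M. \<forall>n>m. dist (?h m) (?h n) < e"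
    proof (intro exI[of _ J] allI impI)
      fix m n assume mn: "J \<le> m" "m < n"
      then obtain i where "n = m + i"
        by (metis less_imp_add_positive)
      then have "\<bar>?h n - ?h m\<bar> \<le> 2 * Nmax * (1 / 2) ^ m"
        using tail' by simp
      then show "dist (?h m) (?h n) < e"
        using J[OF mn(1)] by (simp add: dist_real_def abs_minus_commute)
    qed
  qed
  then have "convergent ?h"
    by (rule Cauchy_convergent)
  then show lim: "?h \<longlonglongrightarrow> Rem V s t y v"
    unfolding Rem_def by (simp add: convergent_LIMSEQ_iff)
  have "(\<lambda>i. \<bar>?h (i + j) - ?h j\<bar>) \<longlonglongrightarrow> \<bar>Rem V s t y v - ?h j\<bar>"
    by (intro tendsto_intros LIMSEQ_ignore_initial_segment lim)
  then show "\<bar>Rem V s t y v - ?h j\<bar> \<le> 2 * Nmax * (1 / 2) ^ j"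
    by (rule LIMSEQ_le_const2) (use tail'[where j = j] in \<open>simp add: add.commute[of _ j]\<close>)
qed

lemma half_power_small:
  assumes "e > 0"
  obtains j where "2 * Nmax * (1 / 2) ^ j < e"
proof -
  have "(\<lambda>j. 2 * Nmax * (1 / 2) ^ j) \<longlonglongrightarrow> 0"
    by (intro tendsto_mult_right_zero LIMSEQ_power_zero) simp
  then have "\<forall>\<^sub>F j in sequentially. 2 * Nmax * (1 / 2) ^ j < e"
    using assms by (intro order_tendstoD)
  then show ?thesis
    using that by (auto simp: eventually_sequentially)
qed

text \<open>The error of the iterates depends neither on the motion nor on the arguments, so
  continuity survives the limit.\<close>

lemma nice_Rem: "nice Rem"
  unfolding nice_def
proof (intro conjI allI impI)
  show "Rem V s t y v = 0" if "(t, y, v) \<notin> Dom" for V s t y v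
    using nice_outside[OF nice_iter that] by (simp add: Rem_def)
  show "\<bar>Rem V s t y v\<bar> \<le> Nmax" if "hist V" "s \<in> {1, - 1}" for V s t y v
    by (rule LIMSEQ_le_const2[OF tendsto_rabs[OF iter_Rem(1)[OF that]]])
       (use nice_bound[OF nice_iter that] in auto)
  fix Vn V s tn t yn y vn v
  assume c: "hconv Vn V" and s: "s \<in> {1, - 1 :: real}" and D: "\<forall>n. (tn n, yn n, vn n) \<in> Dom"
    and lim: "tn \<longlonglongrightarrow> t" "yn \<longlonglongrightarrow> y" "vn \<longlonglongrightarrow> v"
  have V: "hist V" and Vn: "\<And>n. hist (Vn n)"
    using c by (auto simp: hconv_hist)
  show "(\<lambda>n. Rem (Vn n) s (tn n) (yn n) (vn n)) \<longlonglongrightarrow> Rem V s t y v"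
  proof (rule tendstoI)
    fix e :: real assume e: "e > 0"
    obtain j where j: "2 * Nmax * (1 / 2) ^ j < e / 3"
      using half_power_small[of "e / 3"] e by auto
    have "(\<lambda>n. iter j (Vn n) s (tn n) (yn n) (vn n)) \<longlonglongrightarrow> iter j V s t y v"
      using D by (intro nice_tendsto[OF nice_iter c s] lim) auto
    then have "\<forall>\<^sub>F n in sequentially. dist (iter j (Vn n) s (tn n) (yn n) (vn n)) (iter j V s t y v) < e / 3"
      using e by (intro tendstoD) auto
    then show "\<forall>\<^sub>F n in sequentially. dist (Rem (Vn n) s (tn n) (yn n) (vn n)) (Rem V s t y v) < e"
    proof eventually_elim
      case (elim n)
      have "\<bar>Rem (Vn n) s (tn n) (yn n) (vn n) - iter j (Vn n) s (tn n) (yn n) (vn n)\<bar> < e / 3"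
        "\<bar>Rem V s t y v - iter j V s t y v\<bar> < e / 3"
        using iter_Rem(2)[OF Vn s, of n "tn n" "yn n" "vn n" j] iter_Rem(2)[OF V s, of t y v j] j by linarith+
      then show ?case
        using elim unfolding dist_real_def by linarith
    qed
  qed
qed

lemma Rem_fixed:
  assumes "hist V" "s \<in> {1, - 1}"
  shows "step Rem V s t y v = Rem V s t y v"
proof -
  have "(\<lambda>j. iter (Suc j) V s t y v - step Rem V s t y v) \<longlonglongrightarrow> 0"
  proof (rule Lim_null_comparison)
    show "(\<lambda>j. 2 * Nmax * (1 / 2) ^ j / 2) \<longlonglongrightarrow> 0"
      by (intro tendsto_divide_zero tendsto_mult_right_zero LIMSEQ_power_zero) simp
    have "\<bar>step (iter j) V s t y v - step Rem V s t y v\<bar> \<le> 2 * Nmax * (1 / 2) ^ j / 2" for j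
      using iter_Rem(2)[OF assms, of _ _ _ j]
      by (intro step_contract[OF nice_iter nice_Rem assms]) (simp add: abs_minus_commute)
    then show "\<forall>\<^sub>F j in sequentially. norm (iter (Suc j) V s t y v - step Rem V s t y v) \<le> 2 * Nmax * (1 / 2) ^ j / 2"
      by simp
  qed
  then have "(\<lambda>j. iter (Suc j) V s t y v) \<longlonglongrightarrow> step Rem V s t y v"
    by (simp add: LIM_zero_iff)
  moreover have "(\<lambda>j. iter (Suc j) V s t y v) \<longlonglongrightarrow> Rem V s t y v"
    using LIMSEQ_Suc[OF iter_Rem(1)[OF assms]] .
  ultimately show ?thesis
    by (rule LIMSEQ_unique)
qed

section \<open>The force as a continuous functional of the motion\<close>

definition kick :: "(real \<Rightarrow> real) \<Rightarrow> real \<Rightarrow> real \<Rightarrow> 'a \<Rightarrow> real" where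
  "kick V s t y = dev_integral Rem V s t y (\<lambda>z. ell G (z - V t))"

text \<open>It turns out to be the \<open>drag\<close> of the constructed densities, in a form whose
  dependence on the motion is explicit.\<close>

definition pull :: "(real \<Rightarrow> real) \<Rightarrow> real \<Rightarrow> real \<Rightarrow> real" where
  "pull V s t = (LINT y:disk G|lperp G. kick V s t y)"

definition pullmax :: real where
  "pullmax = measure (lperp G) (disk G) * (Cl * (2 * \<epsilon>) powr p * (Nmax + Amax) * (2 * \<epsilon>))"

lemma ell_window:
  assumes "hist V" "\<bar>z - Vinf\<bar> \<le> \<epsilon>"
  shows "\<bar>ell G (z - V t)\<bar> \<le> Cl * (2 * \<epsilon>) powr p"
proof -
  have z: "\<bar>z - V t\<bar> \<le> 2 * \<epsilon>"
    using hist_near[OF assms(1), of t] assms(2) by linarith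
  have "ell G (z - V t) \<le> Cl * \<bar>z - V t\<bar> powr p"
    by (rule ell_le[OF z])
  also have "\<dots> \<le> Cl * (2 * \<epsilon>) powr p"
    using z p_pos Cl_nonneg by (intro mult_left_mono powr_mono2) auto
  finally show ?thesis
    using ell_nonneg by simp
qed

lemma kick_bound:
  assumes V: "hist V" and s: "s \<in> {1, - 1}"
  shows "\<bar>kick V s t y\<bar> \<le> Cl * (2 * \<epsilon>) powr p * (Nmax + Amax) * (2 * \<epsilon>)"
  unfolding kick_def by (rule dev_integral_bound[OF nice_Rem V s ell_shift_measurable ell_window[OF V]])

lemma kick_measurable:
  assumes V: "hist V" and s: "s \<in> {1, - 1}"
  shows "kick V s t \<in> borel_measurable borel"
proof -
  have [measurable]: "(\<lambda>x. dev Rem V s t (fst x) (snd x)) \<in> borel_measurable (borel \<Otimes>\<^sub>M lborel)"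
    by (rule dev_measurable[OF nice_Rem V s]) measurable
  show ?thesis
    unfolding kick_def[abs_def] dev_integral_def
    by (intro lborel.borel_measurable_lebesgue_integral) (simp add: case_prod_beta, measurable)
qed

text \<open>This continuity is what allows the passage to the limit in the delay scheme. Exceptional
  velocities disappear in the axial integral, rim velocities in the transversal one.\<close>

lemma pull_tendsto:
  assumes c: "hconv Vn V" and s: "s \<in> {1, - 1}" and tn: "tn \<longlonglongrightarrow> t" "\<And>n. tn n \<ge> 0"
  shows "(\<lambda>n. pull (Vn n) s (tn n)) \<longlonglongrightarrow> pull V s t"
  unfolding pull_def set_lebesgue_integral_def real_scaleR_def
proof (rule integral_dominated_convergence)
  have V: "hist V" and Vn: "\<And>n. hist (Vn n)"
    using c by (auto simp: hconv_hist)
  let ?B = "Cl * (2 * \<epsilon>) powr p * (Nmax + Amax) * (2 * \<epsilon>)"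
  have ind: "(\<lambda>y. indicator (disk G) y :: real) \<in> borel_measurable (lperp G)"
    by measurable
  show "(\<lambda>y. indicator (disk G) y * kick V s t y) \<in> borel_measurable (lperp G)"
    by (intro borel_measurable_times ind borel_measurable_lperp kick_measurable V s)
  show "(\<lambda>y. indicator (disk G) y * kick (Vn n) s (tn n) y) \<in> borel_measurable (lperp G)" for n
    by (intro borel_measurable_times ind borel_measurable_lperp kick_measurable Vn s)
  show "integrable (lperp G) (\<lambda>y. ?B * indicator (disk G) y)"
    using disk_finite by (intro integrable_mult_right integrable_real_indicator) auto
  show "AE y in lperp G. norm (indicator (disk G) y * kick (Vn n) s (tn n) y) \<le> ?B * indicator (disk G) y" for n
    using kick_bound[OF Vn s] by (intro AE_I2) (auto simp: indicator_def)
  have Vlim: "(\<lambda>n. Vn n (tn n)) \<longlonglongrightarrow> V t"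
    by (rule hconv_V[OF c tn])
  have "(\<lambda>n. kick (Vn n) s (tn n) y) \<longlonglongrightarrow> kick V s t y" if y: "y \<in> disk G" for y
    unfolding kick_def
  proof (intro dev_integral_tendsto nice_Rem c s tn tendsto_const y ell_shift_measurable)
    show "(\<lambda>n. ell G (z - Vn n (tn n))) \<longlonglongrightarrow> ell G (z - V t)" for z
      by (intro continuous_on_tendsto_compose[OF ell_cont] tendsto_intros Vlim) auto
    show "\<bar>ell G (z - Vn n (tn n))\<bar> \<le> Cl * (2 * \<epsilon>) powr p" if "\<bar>z - Vinf\<bar> \<le> \<epsilon>" for n z
      by (rule ell_window[OF Vn that])
    show "\<bar>ell G (z - V t)\<bar> \<le> Cl * (2 * \<epsilon>) powr p" if "\<bar>z - Vinf\<bar> \<le> \<epsilon>" for z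
      by (rule ell_window[OF V that])
  qed
  then show "AE y in lperp G. (\<lambda>n. indicator (disk G) y * kick (Vn n) s (tn n) y) \<longlonglongrightarrow> indicator (disk G) y * kick V s t y"
    by (intro AE_I2) (auto simp: indicator_def)
qed

lemma pull_bound:
  assumes V: "hist V" and s: "s \<in> {1, - 1}"
  shows "\<bar>pull V s t\<bar> \<le> pullmax"
proof -
  let ?B = "Cl * (2 * \<epsilon>) powr p * (Nmax + Amax) * (2 * \<epsilon>)"
  have "\<bar>pull V s t\<bar> \<le> (LINT y|lperp G. ?B * indicator (disk G) y)"
    unfolding pull_def set_lebesgue_integral_def real_scaleR_def
  proof (rule abs_integral_le)
    show "integrable (lperp G) (\<lambda>y. ?B * indicator (disk G) y)"
      using disk_finite by (intro integrable_mult_right integrable_real_indicator) auto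
    show "AE y in lperp G. \<bar>indicator (disk G) y * kick V s t y\<bar> \<le> ?B * indicator (disk G) y"
      using kick_bound[OF V s] by (intro AE_I2) (auto simp: indicator_def)
  qed
  then show ?thesis
    by (simp add: pullmax_def mult.commute)
qed

section \<open>Densities on the surface of the body and their boundary laws\<close>

lemma dev_split:
  fixes t :: real and y :: 'a
  assumes H: "nice H" and V: "hist V" and s: "s \<in> {1, - 1}" and \<kappa>[measurable]: "\<kappa> \<in> borel_measurable borel"
    and Kb: "\<And>z. \<bar>z - Vinf\<bar> \<le> \<epsilon> \<Longrightarrow> \<bar>\<kappa> z\<bar> \<le> Kb"
  defines "g \<equiv> \<lambda>u. indicator (face_in G s (V t)) u * (\<kappa> (u \<bullet> axis G) * (trans G (perp G u) * jump H V s t y (u \<bullet> axis G) (perp G u)))"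
  shows "\<bar>g u\<bar> \<le> Kb * (Nmax + Amax) * window (u \<bullet> axis G) * trans G (perp G u)"
    and "integrable lborel g" and "integral\<^sup>L lborel g = dev_integral H V s t y \<kappa>"
proof -
  have b: "\<bar>g u\<bar> \<le> Kb * (Nmax + Amax) * window (u \<bullet> axis G) * trans G (perp G u)" for u
  proof -
    let ?z = "u \<bullet> axis G" and ?w = "perp G u"
    have w0: "0 \<le> trans G ?w"
      by (simp add: trans_nonneg)
    have "\<bar>g u\<bar> \<le> \<bar>\<kappa> ?z\<bar> * (trans G ?w * \<bar>jump H V s t y ?z ?w\<bar>)"
      using w0 by (auto simp: g_def indicator_def abs_mult)
    also have "\<dots> \<le> \<bar>\<kappa> ?z\<bar> * (trans G ?w * ((Nmax + Amax) * window ?z))"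
      using w0 jump_bound[OF H V s, of t y ?z ?w] by (intro mult_left_mono) auto
    also have "\<dots> \<le> Kb * (trans G ?w * ((Nmax + Amax) * window ?z))"
    proof (cases "\<bar>?z - Vinf\<bar> \<le> \<epsilon>")
      case True
      show ?thesis
        using Kb[OF True] w0 Nmax_nonneg Amax_nonneg by (intro mult_right_mono) auto
    next
      case False
      then have "window ?z = 0"
        by (auto simp: indicator_def abs_le_iff)
      then show ?thesis
        by simp
    qed
    finally show ?thesis
      by (simp add: mult_ac)
  qed
  then show "\<bar>g u\<bar> \<le> Kb * (Nmax + Amax) * window (u \<bullet> axis G) * trans G (perp G u)" .
  have [measurable]: "(\<lambda>u. jump H V s t y (u \<bullet> axis G) (perp G u)) \<in> borel_measurable borel"
    by (rule jump_measurable[OF H V s]) measurable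
  have m: "g \<in> borel_measurable borel"
    unfolding g_def by measurable
  note W = trans_mass_interval(1)[of "Vinf - \<epsilon>" "Vinf + \<epsilon>" "Kb * (Nmax + Amax)"]
  show i: "integrable lborel g"
  proof (rule Bochner_Integration.integrable_bound)
    show "integrable lborel (\<lambda>u. Kb * (Nmax + Amax) * window (u \<bullet> axis G) * trans G (perp G u))"
      using eps_pos by (intro W) simp
    show "AE u in lborel. norm (g u) \<le> norm (Kb * (Nmax + Amax) * window (u \<bullet> axis G) * trans G (perp G u))"
      unfolding real_norm_def by (intro AE_I2 order_trans[OF b abs_ge_self])
  qed (use m in simp)
  have "integral\<^sup>L lborel g = (LINT z|lborel. LINT w|lperp G. g (z *\<^sub>R axis G + w))"
    by (rule integral_lborel_split[OF i])
  also have "\<dots> = (LINT z|lborel. LINT w|lperp G. indicator {z. s * (z - V t) \<le> 0} z * \<kappa> z * (trans G w * jump H V s t y z w))"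
    by (intro Bochner_Integration.integral_cong refl) (auto simp: space_lperp g_def face_in_def indicator_def)
  also have "\<dots> = dev_integral H V s t y \<kappa>"
    by (simp add: dev_integral_def dev_def mult.assoc)
  finally show "integral\<^sup>L lborel g = dev_integral H V s t y \<kappa>" .
qed

text \<open>Densities are functions of the position, so the end has to be recovered from it. Points
  that are not axially inside the body count as end points, in agreement with the convention about
  the edges.\<close>

definition side :: "(real \<Rightarrow> real) \<Rightarrow> real \<Rightarrow> 'a \<Rightarrow> real" where
  "side V t x = (if x \<bullet> axis G > pos V t then 1 else - 1)"

definition lat :: "(real \<Rightarrow> real) \<Rightarrow> real \<Rightarrow> 'a \<Rightarrow> bool" where
  "lat V t x \<longleftrightarrow> \<bar>x \<bullet> axis G - pos V t\<bar> < halflen G"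

definition Fm :: "(real \<Rightarrow> real) \<Rightarrow> real \<Rightarrow> 'a \<Rightarrow> 'a \<Rightarrow> real" where
  "Fm V t x u = f0 G u + (if lat V t x then 0
     else trans G (perp G u) * jump Rem V (side V t x) t (perp G x) (u \<bullet> axis G) (perp G u))"

definition Fp :: "(real \<Rightarrow> real) \<Rightarrow> real \<Rightarrow> 'a \<Rightarrow> 'a \<Rightarrow> real" where
  "Fp V t x v = (if lat V t x
     then LINT u:{u. u \<bullet> normal G x \<le> 0}|lborel. latker G (normal G x) v u * f0 G u
     else LINT u:face_in G (side V t x) (V t)|lborel. K G (v - V t *\<^sub>R axis G) (u - V t *\<^sub>R axis G) * Fm V t x u)"

lemma face_side:
  assumes "x \<in> face G s (pos V t)" "s \<in> {1, - 1}"
  shows "side V t x = s" "\<not> lat V t x"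
  using assms halflen_pos by (auto simp: face_def side_def lat_def)

lemma lateral_lat: "x \<in> lateral G (pos V t) \<Longrightarrow> lat V t x"
  by (simp add: lateral_def lat_def)

lemma Fm_face:
  assumes "y \<in> disk G" "s \<in> {1, - 1}"
  shows "Fm V t (face_point G s (pos V t) y) u =
    f0 G u + trans G (perp G u) * jump Rem V s t y (u \<bullet> axis G) (perp G u)"
  using face_side[OF face_point_face[OF assms(1)] assms(2)] assms(1) by (simp add: Fm_def disk_def)

lemma K_shift: "K G (v - c *\<^sub>R axis G) (u - c *\<^sub>R axis G) = kx G (v \<bullet> axis G - c) (u \<bullet> axis G - c) * trans G (perp G v)"
  by (simp add: K_def inner_diff_left perp_diff perp_scaleR)

text \<open>Convergence of the fresh part is a premise because for large axial velocities a it will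
  be known only for almost every a; the deviation always converges.\<close>

lemma reflect_split:
  assumes V: "hist V" and s: "s \<in> {1, - 1}" and y: "y \<in> disk G"
    and dens: "integrable lborel (\<lambda>z. indicator {z. s * (z - V t) \<le> 0} z * (kx G (a - V t) (z - V t) * dens G z))"
  defines "g \<equiv> \<lambda>u. indicator (face_in G s (V t)) u * (kx G (a - V t) (u \<bullet> axis G - V t) * Fm V t (face_point G s (pos V t) y) u)"
  shows "integrable lborel g"
    and "integral\<^sup>L lborel g = fresh s (V t) a + dev_integral Rem V s t y (\<lambda>z. kx G (a - V t) (z - V t))"
proof -
  let ?h = "\<lambda>z. indicator {z. s * (z - V t) \<le> 0} z * (kx G (a - V t) (z - V t) * dens G z)"
  note P = has_integral_product[OF dens trans_integrable]
  note D = dev_split(2,3)[OF nice_Rem V s kx_shift_measurable kx_window[OF V, where a = "a - V t" and t = t], where t = t and y = y]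
  have g: "g = (\<lambda>u. ?h (u \<bullet> axis G) * trans G (perp G u) +
     indicator (face_in G s (V t)) u * (kx G (a - V t) (u \<bullet> axis G - V t) * (trans G (perp G u) * jump Rem V s t y (u \<bullet> axis G) (perp G u))))"
    unfolding g_def Fm_face[OF y s] f0_def by (auto simp: fun_eq_iff face_in_def indicator_def algebra_simps)
  show "integrable lborel g"
    unfolding g by (intro Bochner_Integration.integrable_add P(1) D(1))
  show "integral\<^sup>L lborel g = fresh s (V t) a + dev_integral Rem V s t y (\<lambda>z. kx G (a - V t) (z - V t))"
  proof -
    have "integral\<^sup>L lborel g = (LINT u|lborel. ?h (u \<bullet> axis G) * trans G (perp G u)) +
      (LINT u|lborel. indicator (face_in G s (V t)) u * (kx G (a - V t) (u \<bullet> axis G - V t) * (trans G (perp G u) * jump Rem V s t y (u \<bullet> axis G) (perp G u))))"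
      unfolding g by (rule Bochner_Integration.integral_add[OF P(1) D(1)])
    then show ?thesis
      by (simp only: P(2) D(2) trans_integral mult_1_right fresh_def set_lebesgue_integral_def real_scaleR_def)
  qed
qed

text \<open>\<open>Rem\<close> represents the reemitted density only for axial velocities within
  \<epsilon> of \<open>Vinf\<close>. Every particle that lands has such a velocity, so this suffices
  for the precollision law.\<close>

lemma Fp_face:
  assumes V: "hist V" and s: "s \<in> {1, - 1}" and y: "y \<in> disk G" and t: "t \<ge> 0" and v: "\<bar>v \<bullet> axis G - Vinf\<bar> \<le> \<epsilon>"
  shows "Fp V t (face_point G s (pos V t) y) v = trans G (perp G v) * Rem V s t y (v \<bullet> axis G)"
proof -
  have vV: "\<bar>v \<bullet> axis G - V t\<bar> \<le> 2 * \<epsilon>" "\<bar>V t - Vinf\<bar> \<le> \<epsilon>"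
    using v hist_near[OF V, of t] by auto
  note R = reflect_split(2)[OF V s y fresh_integrable[OF vV]]
  have "(t, y, v \<bullet> axis G) \<in> Dom"
    using t y v by (simp add: Dom_iff)
  then have "fresh s (V t) (v \<bullet> axis G) + dev_integral Rem V s t y (\<lambda>z. kx G (v \<bullet> axis G - V t) (z - V t)) = Rem V s t y (v \<bullet> axis G)"
    using Rem_fixed[OF V s, of t y "v \<bullet> axis G"] by (simp add: step_def)
  with R show ?thesis
    using face_side[OF face_point_face[OF y] s]
    by (simp add: Fp_def set_lebesgue_integral_def K_shift mult_ac)
qed

lemma lands_hit:
  assumes "hist V" "z \<noteq> V t"
  shows "lands V t y z w \<longleftrightarrow> hit G (pos V) t y z w"
    and "hit G (pos V) t y z w \<Longrightarrow> last_crossing (pos V) t z = lcross V t z"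
  using lcross_cases[OF assms] by (auto simp: lands_def hit_def crossings_def)

lemma pre_law_Fm:
  assumes V: "hist V"
  shows "pre_law G (pos V) V (Fm V) (Fp V)"
  unfolding pre_law_def
proof (intro conjI allI impI ballI)
  fix t x u
  show "Fm V t x u = f0 G u" if "x \<in> lateral G (pos V t)"
    using lateral_lat[OF that] by (simp add: Fm_def)
  fix s :: real
  assume t: "0 \<le> t" and s: "s \<in> {1, - 1}" and x: "x \<in> face G s (pos V t)" and u: "u \<in> face_in G s (V t)" "u \<bullet> axis G \<noteq> V t"
  obtain y where y: "y \<in> disk G" "x = face_point G s (pos V t) y"
    using x face_iff by blast
  let ?z = "u \<bullet> axis G" and ?w = "perp G u"
  note P = precollisions_last[OF trajectory_pos[OF V] y(1) u(2), of s, folded y(2)]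
  note L = lands_hit[OF V u(2), of y ?w]
  show "Fm V t x u = (if precollisions G (pos V) s t x u = {} then f0 G u
      else let \<tau> = GREATEST \<tau>. \<tau> \<in> precollisions G (pos V) s t x u in Fp V \<tau> (x - (t - \<tau>) *\<^sub>R u) u)"
  proof (cases "lands V t y ?z ?w")
    case False
    then have "jump Rem V s t y ?z ?w = 0"
      by (simp add: jump_def)
    then have "Fm V t x u = f0 G u"
      unfolding y(2) Fm_face[OF y(1) s] by simp
    moreover have "precollisions G (pos V) s t x u = {}"
      using P(1) L(1) False by simp
    ultimately show ?thesis
      by simp
  next
    case True
    define \<tau> where "\<tau> = lcross V t ?z"
    have ne: "precollisions G (pos V) s t x u \<noteq> {}"
      using P(1) L(1) True by simp
    have gr: "(GREATEST \<tau>. \<tau> \<in> precollisions G (pos V) s t x u) = \<tau>"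
      using P(2)[OF ne] L True by (simp add: \<tau>_def)
    have "lcross V t ?z > 0"
      using True by (simp add: lands_def)
    note C = lcross_pos[OF V this, folded \<tau>_def]
    have \<tau>0: "\<tau> \<ge> 0"
      using C(1) by (simp add: crossings_def)
    have yh: "y \<in> hyperplane G"
      using y by (simp add: disk_def)
    have y': "y - (t - \<tau>) *\<^sub>R ?w \<in> disk G"
      using True yh by (auto simp: lands_def \<tau>_def disk_def hyperplane_diff)
    have "x - (t - \<tau>) *\<^sub>R u = face_point G s (pos V \<tau>) (y - (t - \<tau>) *\<^sub>R ?w)"
      unfolding y(2) by (rule face_point_back[OF yh C(1)])
    then have "Fp V \<tau> (x - (t - \<tau>) *\<^sub>R u) u = trans G ?w * Rem V s \<tau> (y - (t - \<tau>) *\<^sub>R ?w) ?z"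
      using Fp_face[OF V s y' \<tau>0 C(3)] by simp
    moreover have "Fm V t x u = trans G ?w * Rem V s \<tau> (y - (t - \<tau>) *\<^sub>R ?w) ?z"
      unfolding y(2) Fm_face[OF y(1) s] using True by (simp add: jump_def f0_def \<tau>_def algebra_simps)
    ultimately show ?thesis
      using ne gr by simp
  qed
qed

lemma AE_inner:
  assumes "AE z in lborel. P (z :: real)"
  shows "AE u in lborel. P ((u :: 'a) \<bullet> axis G - c)"
proof -
  obtain N where N: "N \<in> null_sets lborel" "{z. \<not> P z} \<subseteq> N"
    using assms by (auto elim!: AE_E simp: null_sets_def)
  then have [measurable]: "N \<in> sets borel"
    by auto
  have "emeasure lborel {u :: 'a. u \<bullet> axis G - c \<in> N} = (\<integral>\<^sup>+u. indicator {u. u \<bullet> axis G - c \<in> N} u \<partial>lborel)"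
    by simp
  also have "\<dots> = (\<integral>\<^sup>+u. indicator N (u \<bullet> axis G - c) * 1 \<partial>(lborel :: 'a measure))"
    by (intro nn_integral_cong) (auto simp: indicator_def)
  also have "\<dots> = (\<integral>\<^sup>+z. indicator N (z - c) \<partial>lborel) * (\<integral>\<^sup>+w. 1 \<partial>lperp G)"
    by (rule nn_integral_product[of "\<lambda>z. indicator N (z - c)" "\<lambda>_. 1"]) auto
  also have "(\<integral>\<^sup>+z. indicator N (z - c) \<partial>lborel) = (\<integral>\<^sup>+z. indicator N z \<partial>lborel)"
    using nn_integral_real_affine[of "indicator N" 1 "- c"] by simp
  also have "\<dots> = 0"
    using N by (auto simp: null_sets_def)
  finally have "{u :: 'a. u \<bullet> axis G - c \<in> N} \<in> null_sets lborel"
    by (auto simp: null_sets_def)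
  from AE_not_in[OF this] show ?thesis
    by eventually_elim (use N in auto)
qed

text \<open>Weighted with the outgoing velocity and integrated over it, the reflection integral
  equals a first moment of \<open>dens\<close> by Tonelli's theorem and mass conservation. So it is
  finite for almost all positive velocities, and for negative ones since the kernel is even.\<close>

lemma AE_reflection_converges:
  "AE a in lborel. integrable lborel (\<lambda>z. kx G a (z - w) * dens G z)"
proof -
  have fin: "(\<integral>\<^sup>+z. ennreal (\<bar>z - w\<bar> * dens G z) \<partial>lborel) < \<infinity>"
  proof -
    have i1: "integrable lborel (\<lambda>z. \<bar>z\<bar> * dens G z)"
      by (rule dens_moment)
    have i2: "integrable lborel (\<lambda>z :: real. indicator {- 1..1} z * Amax :: real)"
      by (intro integrable_mult_left integrable_real_indicator) (auto simp: emeasure_lborel_Icc_eq)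
    have "integrable lborel (\<lambda>z. (1 + \<bar>w\<bar>) * (\<bar>z\<bar> * dens G z) + \<bar>w\<bar> * (indicator {- 1..1} z * Amax))"
      by (intro Bochner_Integration.integrable_add integrable_mult_right i1 i2)
    then have "integrable lborel (\<lambda>z. \<bar>z - w\<bar> * dens G z)"
    proof (rule Bochner_Integration.integrable_bound)
      show "AE z in lborel. norm (\<bar>z - w\<bar> * dens G z) \<le> norm ((1 + \<bar>w\<bar>) * (\<bar>z\<bar> * dens G z) + \<bar>w\<bar> * (indicator {- 1..1} z * Amax))"
      proof (rule AE_I2)
        fix z
        have "\<bar>z - w\<bar> * dens G z \<le> (\<bar>z\<bar> + \<bar>w\<bar>) * dens G z"
          using dens_nonneg by (intro mult_right_mono) auto
        also have "\<dots> = \<bar>z\<bar> * dens G z + \<bar>w\<bar> * dens G z"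
          by (rule distrib_right)
        also have "\<bar>w\<bar> * dens G z \<le> \<bar>w\<bar> * (\<bar>z\<bar> * dens G z + indicator {- 1..1} z * Amax)"
        proof (rule mult_left_mono)
          show "dens G z \<le> \<bar>z\<bar> * dens G z + indicator {- 1..1} z * Amax"
          proof (cases "z \<in> {- 1..1}")
            case True
            then show ?thesis
              using dens_nonneg[of z] dens_le[of z] by (simp add: add_increasing)
          next
            case False
            then have "1 * dens G z \<le> \<bar>z\<bar> * dens G z"
              using dens_nonneg by (intro mult_right_mono) auto
            then show ?thesis
              using False by simp
          qed
        qed simp
        finally show "norm (\<bar>z - w\<bar> * dens G z) \<le> norm ((1 + \<bar>w\<bar>) * (\<bar>z\<bar> * dens G z) + \<bar>w\<bar> * (indicator {- 1..1} z * Amax))"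
          using dens_nonneg[of z] Amax_nonneg by (simp add: algebra_simps)
      qed
    qed measurable
    then show ?thesis
      using dens_nonneg by (simp add: integrable_iff_bounded abs_mult)
  qed
  define I where "I a = (\<integral>\<^sup>+z. ennreal (kx G a (z - w) * dens G z) \<partial>lborel)" for a
  have "(\<integral>\<^sup>+a\<in>{0..}. ennreal a * I a \<partial>lborel)
      = (\<integral>\<^sup>+a. \<integral>\<^sup>+z. ennreal (a * kx G a (z - w)) * indicator {0..} a * ennreal (dens G z) \<partial>lborel \<partial>lborel)"
  proof (rule nn_integral_cong)
    fix a :: real
    have "ennreal a * I a * indicator {0..} a = (\<integral>\<^sup>+z. ennreal a * indicator {0..} a * ennreal (kx G a (z - w) * dens G z) \<partial>lborel)"
      unfolding I_def by (subst nn_integral_cmult) (auto simp: mult_ac)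
    also have "\<dots> = (\<integral>\<^sup>+z. ennreal (a * kx G a (z - w)) * indicator {0..} a * ennreal (dens G z) \<partial>lborel)"
      using kx_nonneg dens_nonneg by (intro nn_integral_cong) (auto simp: indicator_def ennreal_mult mult_ac)
    finally show "ennreal a * I a * indicator {0..} a = (\<integral>\<^sup>+z. ennreal (a * kx G a (z - w)) * indicator {0..} a * ennreal (dens G z) \<partial>lborel)" .
  qed
  also have "\<dots> = (\<integral>\<^sup>+z. \<integral>\<^sup>+a. ennreal (a * kx G a (z - w)) * indicator {0..} a * ennreal (dens G z) \<partial>lborel \<partial>lborel)"
    by (rule lborel_pair.Fubini') measurable
  also have "\<dots> = (\<integral>\<^sup>+z. ennreal (\<bar>z - w\<bar> * dens G z) \<partial>lborel)"
  proof (rule nn_integral_cong)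
    fix z
    have "(\<integral>\<^sup>+a. ennreal (a * kx G a (z - w)) * indicator {0..} a * ennreal (dens G z) \<partial>lborel)
        = (\<integral>\<^sup>+a\<in>{0..}. ennreal (a * kx G a (z - w)) \<partial>lborel) * ennreal (dens G z)"
      by (rule nn_integral_multc) measurable
    then show "(\<integral>\<^sup>+a. ennreal (a * kx G a (z - w)) * indicator {0..} a * ennreal (dens G z) \<partial>lborel) = ennreal (\<bar>z - w\<bar> * dens G z)"
      using kx_mass[of "z - w"] dens_nonneg by (simp add: ennreal_mult)
  qed
  finally have "(\<integral>\<^sup>+a\<in>{0..}. ennreal a * I a \<partial>lborel) < \<infinity>"
    using fin by simp
  moreover have Im: "I \<in> borel_measurable borel"
    unfolding I_def[abs_def] by measurable
  ultimately have "AE a in lborel. ennreal a * I a * indicator {0..} a \<noteq> \<infinity>"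
    by (intro nn_integral_PInf_AE) auto
  then have pos: "AE a in lborel. 0 < a \<longrightarrow> I a < \<infinity>"
    by eventually_elim (auto simp: ennreal_mult_eq_top_iff less_top[symmetric] indicator_def)
  have even: "I (- a) = I a" for a
    by (simp add: I_def kx_even)
  have neg: "AE a in lborel. a < 0 \<longrightarrow> I a < \<infinity>"
  proof -
    obtain N where N: "N \<in> null_sets lborel" "{a. \<not> (0 < a \<longrightarrow> I a < \<infinity>)} \<subseteq> N"
      using pos by (auto elim!: AE_E simp: null_sets_def)
    then have [measurable]: "N \<in> sets borel"
      by auto
    have "emeasure lborel {a. - a \<in> N} = (\<integral>\<^sup>+a. indicator {a. - a \<in> N} a \<partial>lborel)"
      by simp
    also have "\<dots> = (\<integral>\<^sup>+a. indicator N (- a) \<partial>lborel)"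
      by (intro nn_integral_cong) (auto simp: indicator_def)
    also have "\<dots> = (\<integral>\<^sup>+a. indicator N a \<partial>lborel)"
      using nn_integral_real_affine[of "indicator N" "- 1" 0] by simp
    also have "\<dots> = 0"
      using N by (auto simp: null_sets_def)
    finally have "{a. - a \<in> N} \<in> null_sets lborel"
      by (auto simp: null_sets_def)
    from AE_not_in[OF this] show ?thesis
    proof eventually_elim
      case (elim a)
      then have "0 < - a \<longrightarrow> I (- a) < \<infinity>"
        using N(2) by blast
      then show ?case
        by (simp add: even)
    qed
  qed
  have "AE a in lborel. a \<notin> {0 :: real}"
    by (intro AE_not_in countable_imp_null_set_lborel) simp
  with pos neg show ?thesis
  proof eventually_elim
    case (elim a)
    then have "I a < \<infinity>"
      by (cases "a > 0") auto
    then show ?case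
      using kx_nonneg dens_nonneg unfolding I_def by (intro integrableI_nonneg) auto
  qed
qed

lemma post_law_Fp:
  assumes V: "hist V"
  shows "post_law G (pos V) V (Fm V) (Fp V)"
  unfolding post_law_def Let_def
proof (intro conjI allI impI ballI)
  fix t x v
  show "Fp V t x v = (LINT u:{u. u \<bullet> normal G x \<le> 0}|lborel. latker G (normal G x) v u * f0 G u)" if "x \<in> lateral G (pos V t)"
    using lateral_lat[OF that] by (simp add: Fp_def)
  fix s :: real
  assume t: "0 \<le> t" and s: "s \<in> {1, - 1}" and x: "x \<in> face G s (pos V t)"
  show "Fp V t x v = (LINT u:face_in G s (V t)|lborel. K G (v - V t *\<^sub>R axis G) (u - V t *\<^sub>R axis G) * Fm V t x u)"
    using face_side[OF x s] by (simp add: Fp_def)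
  obtain y where y: "y \<in> disk G" "x = face_point G s (pos V t) y"
    using x face_iff by blast
  show "AE v in lborel. v \<in> face_out G s (V t) \<longrightarrow>
      set_integrable lborel (face_in G s (V t)) (\<lambda>u. K G (v - V t *\<^sub>R axis G) (u - V t *\<^sub>R axis G) * Fm V t x u)"
    using AE_inner[OF AE_reflection_converges[of "V t"], of "V t"]
  proof eventually_elim
    case (elim v)
    have "integrable lborel (\<lambda>z. indicator {z. s * (z - V t) \<le> 0} z * (kx G (v \<bullet> axis G - V t) (z - V t) * dens G z))"
      by (rule Bochner_Integration.integrable_bound[OF elim]) (measurable, auto simp: indicator_def)
    from reflect_split(1)[OF V s y(1) this] show ?case
      unfolding set_integrable_def y(2) K_shift by (simp add: mult_ac)
  qed
qed

lemma pos_measurable: "hist V \<Longrightarrow> pos V \<in> borel_measurable borel"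
  by (intro borel_measurable_continuous_onI pos_cont)

lemma hist_measurable: "hist V \<Longrightarrow> V \<in> borel_measurable borel"
  by (intro borel_measurable_continuous_onI hist_cont)

lemma Fm_measurable:
  assumes V: "hist V"
    and [measurable]: "ft \<in> borel_measurable N" "fx \<in> borel_measurable N" "fu \<in> borel_measurable N"
  shows "(\<lambda>x. Fm V (ft x) (fx x) (fu x)) \<in> borel_measurable N"
proof -
  note [measurable] = pos_measurable[OF V]
  have [measurable]: "(\<lambda>x. jump Rem V s (ft x) (perp G (fx x)) (fu x \<bullet> axis G) (perp G (fu x))) \<in> borel_measurable N"
    if "s \<in> {1, - 1}" for s
    by (rule jump_measurable[OF nice_Rem V that]) measurable
  have eq: "Fm V t x u = f0 G u + (if \<bar>x \<bullet> axis G - pos V t\<bar> < halflen G then 0 else trans G (perp G u) *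
     (if x \<bullet> axis G > pos V t then jump Rem V 1 t (perp G x) (u \<bullet> axis G) (perp G u)
      else jump Rem V (- 1) t (perp G x) (u \<bullet> axis G) (perp G u)))" for t x u
    by (simp add: Fm_def lat_def side_def)
  have [measurable]: "(\<lambda>x. trans G (perp G (fu x))) \<in> borel_measurable N"
    by (rule measurable_compose[OF _ trans_perp_measurable]) measurable
  show ?thesis
    unfolding eq by measurable
qed

lemma face_measurable:
  assumes V: "hist V" and [measurable]: "ft \<in> borel_measurable N" "fx \<in> borel_measurable N"
  shows "Measurable.pred N (\<lambda>x. fx x \<in> face G s (pos V (ft x)))"
    and "Measurable.pred N (\<lambda>x. fx x \<in> lateral G (pos V (ft x)))"
  using pos_measurable[OF V] unfolding face_def lateral_def mem_Collect_eq by measurable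

lemma normal_measurable [measurable]: "normal G \<in> borel_measurable borel"
  unfolding normal_def[abs_def] by measurable

lemma phase_measurable:
  assumes V: "hist V"
  shows "in_phase G (pos V) V \<in> sets (borel \<Otimes>\<^sub>M borel \<Otimes>\<^sub>M borel)" "out_phase G (pos V) V \<in> sets (borel \<Otimes>\<^sub>M borel \<Otimes>\<^sub>M borel)"
proof -
  let ?P = "borel \<Otimes>\<^sub>M borel \<Otimes>\<^sub>M borel :: (real \<times> 'a \<times> 'a) measure"
  note [measurable] = hist_measurable[OF V]
  have [measurable]: "Measurable.pred ?P (\<lambda>x. fst (snd x) \<in> face G s (pos V (fst x)))" for s
    by (rule face_measurable(1)[OF V]) measurable
  have [measurable]: "Measurable.pred ?P (\<lambda>x. fst (snd x) \<in> lateral G (pos V (fst x)))"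
    by (rule face_measurable(2)[OF V]) measurable
  have "in_phase G (pos V) V = {x \<in> space ?P. fst x \<ge> 0 \<and>
     ((\<exists>s\<in>{1, -1}. fst (snd x) \<in> face G s (pos V (fst x)) \<and> s * (snd (snd x) \<bullet> axis G - V (fst x)) \<le> 0) \<or>
      (fst (snd x) \<in> lateral G (pos V (fst x)) \<and> snd (snd x) \<bullet> normal G (fst (snd x)) \<le> 0))}"
    by (auto simp: in_phase_def face_in_def space_pair_measure)
  also have "\<dots> \<in> sets ?P"
    by measurable
  finally show "in_phase G (pos V) V \<in> sets ?P" .
  have "out_phase G (pos V) V = {x \<in> space ?P. fst x \<ge> 0 \<and>
     ((\<exists>s\<in>{1, -1}. fst (snd x) \<in> face G s (pos V (fst x)) \<and> s * (snd (snd x) \<bullet> axis G - V (fst x)) \<ge> 0) \<or>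
      (fst (snd x) \<in> lateral G (pos V (fst x)) \<and> snd (snd x) \<bullet> normal G (fst (snd x)) \<ge> 0))}"
    by (auto simp: out_phase_def face_out_def space_pair_measure)
  also have "\<dots> \<in> sets ?P"
    by measurable
  finally show "out_phase G (pos V) V \<in> sets ?P" .
qed

lemma fm_meas_Fm:
  assumes V: "hist V"
  shows "set_borel_measurable borel (in_phase G (pos V) V) (\<lambda>(t, x, u). Fm V t x u)"
proof -
  let ?P = "borel \<Otimes>\<^sub>M borel \<Otimes>\<^sub>M borel :: (real \<times> 'a \<times> 'a) measure"
  have [measurable]: "(\<lambda>x. Fm V (fst x) (fst (snd x)) (snd (snd x))) \<in> borel_measurable ?P"
    by (rule Fm_measurable[OF V]) measurable
  note [measurable] = phase_measurable[OF V]
  have "(\<lambda>x. indicator (in_phase G (pos V) V) x *\<^sub>R Fm V (fst x) (fst (snd x)) (snd (snd x))) \<in> borel_measurable ?P"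
    by measurable
  then show ?thesis
    unfolding set_borel_measurable_def case_prod_beta borel_prod .
qed

lemma fp_meas_Fp:
  assumes V: "hist V" and latm: "(\<lambda>(n, v, u). latker G n v u) \<in> borel_measurable borel"
  shows "set_borel_measurable borel (out_phase G (pos V) V) (\<lambda>(t, x, v). Fp V t x v)"
proof -
  note [measurable] = hist_measurable[OF V] pos_measurable[OF V]
  let ?P = "borel \<Otimes>\<^sub>M borel \<Otimes>\<^sub>M borel :: (real \<times> 'a \<times> 'a) measure"
  have 1: "(\<lambda>x. LINT u:{u. u \<bullet> normal G (fst (snd x)) \<le> 0}|lborel. latker G (normal G (fst (snd x))) (snd (snd x)) u * f0 G u) \<in> borel_measurable ?P"
  proof -
    have [measurable]: "(\<lambda>z :: (real \<times> 'a \<times> 'a) \<times> 'a. latker G (normal G (fst (snd (fst z)))) (snd (snd (fst z))) (snd z)) \<in> borel_measurable (?P \<Otimes>\<^sub>M lborel)"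
    proof -
      have "(\<lambda>z :: (real \<times> 'a \<times> 'a) \<times> 'a. (normal G (fst (snd (fst z))), snd (snd (fst z)), snd z)) \<in> (?P \<Otimes>\<^sub>M lborel) \<rightarrow>\<^sub>M borel"
        by (intro borel_measurable_Pair) measurable
      from measurable_compose[OF this latm] show ?thesis
        by simp
    qed
    have "(\<lambda>z :: (real \<times> 'a \<times> 'a) \<times> 'a. indicator {u. u \<bullet> normal G (fst (snd (fst z))) \<le> 0} (snd z) *
       (latker G (normal G (fst (snd (fst z)))) (snd (snd (fst z))) (snd z) * f0 G (snd z))) \<in> borel_measurable (?P \<Otimes>\<^sub>M lborel)"
      unfolding indicator_def mem_Collect_eq by measurable
    then show ?thesis
      unfolding set_lebesgue_integral_def real_scaleR_def
      by (intro lborel.borel_measurable_lebesgue_integral) (simp add: case_prod_beta)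
  qed
  have 2: "(\<lambda>x. LINT u:face_in G s (V (fst x))|lborel. K G (snd (snd x) - V (fst x) *\<^sub>R axis G) (u - V (fst x) *\<^sub>R axis G) * Fm V (fst x) (fst (snd x)) u) \<in> borel_measurable ?P" for s
  proof -
    have [measurable]: "(\<lambda>z :: (real \<times> 'a \<times> 'a) \<times> 'a. Fm V (fst (fst z)) (fst (snd (fst z))) (snd z)) \<in> borel_measurable (?P \<Otimes>\<^sub>M lborel)"
      by (rule Fm_measurable[OF V]) measurable
    have [measurable]: "(\<lambda>z :: (real \<times> 'a \<times> 'a) \<times> 'a. trans G (perp G (snd (snd (fst z))))) \<in> borel_measurable (?P \<Otimes>\<^sub>M lborel)"
      by (rule measurable_compose[OF _ trans_perp_measurable]) measurable
    have "(\<lambda>z :: (real \<times> 'a \<times> 'a) \<times> 'a. indicator (face_in G s (V (fst (fst z)))) (snd z) *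
       (K G (snd (snd (fst z)) - V (fst (fst z)) *\<^sub>R axis G) (snd z - V (fst (fst z)) *\<^sub>R axis G) * Fm V (fst (fst z)) (fst (snd (fst z))) (snd z)))
       \<in> borel_measurable (?P \<Otimes>\<^sub>M lborel)"
      unfolding indicator_def face_in_def mem_Collect_eq K_shift by measurable
    then show ?thesis
      unfolding set_lebesgue_integral_def real_scaleR_def
      by (intro lborel.borel_measurable_lebesgue_integral) (simp add: case_prod_beta)
  qed
  have [measurable]: "Measurable.pred ?P (\<lambda>x. lat V (fst x) (fst (snd x)))"
    unfolding lat_def by measurable
  have "Fp V (fst x) (fst (snd x)) (snd (snd x)) =
     (if lat V (fst x) (fst (snd x))
      then LINT u:{u. u \<bullet> normal G (fst (snd x)) \<le> 0}|lborel. latker G (normal G (fst (snd x))) (snd (snd x)) u * f0 G u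
      else if fst (snd x) \<bullet> axis G > pos V (fst x)
      then LINT u:face_in G 1 (V (fst x))|lborel. K G (snd (snd x) - V (fst x) *\<^sub>R axis G) (u - V (fst x) *\<^sub>R axis G) * Fm V (fst x) (fst (snd x)) u
      else LINT u:face_in G (- 1) (V (fst x))|lborel. K G (snd (snd x) - V (fst x) *\<^sub>R axis G) (u - V (fst x) *\<^sub>R axis G) * Fm V (fst x) (fst (snd x)) u)" for x
    by (simp add: Fp_def side_def)
  moreover note [measurable] = 1 2
  ultimately have "(\<lambda>x. Fp V (fst x) (fst (snd x)) (snd (snd x))) \<in> borel_measurable ?P"
    by simp
  then have "(\<lambda>x. indicator (out_phase G (pos V) V) x *\<^sub>R Fp V (fst x) (fst (snd x)) (snd (snd x))) \<in> borel_measurable ?P"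
    using phase_measurable(2)[OF V] by measurable
  then show ?thesis
    unfolding set_borel_measurable_def case_prod_beta borel_prod .
qed

lemma f0_bounds: "0 \<le> f0 G u" "f0 G u \<le> Amax * Bmax"
  unfolding f0_def using dens_nonneg dens_le trans_nonneg[OF perp_hyperplane] trans_le[OF perp_hyperplane] Amax_nonneg
  by (auto intro: mult_mono)

lemma Fm_bounded:
  assumes V: "hist V"
  shows "\<bar>Fm V t x u\<bar> \<le> Amax * Bmax + Bmax * (Nmax + Amax)"
proof -
  have "\<bar>trans G (perp G u) * jump Rem V (side V t x) t (perp G x) (u \<bullet> axis G) (perp G u)\<bar> \<le> Bmax * (Nmax + Amax)"
    unfolding abs_mult
  proof (rule mult_mono)
    show "\<bar>trans G (perp G u)\<bar> \<le> Bmax"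
      using trans_nonneg[OF perp_hyperplane] trans_le[OF perp_hyperplane] by simp
    have "side V t x \<in> {1, - 1}"
      by (simp add: side_def)
    then have "\<bar>jump Rem V (side V t x) t (perp G x) (u \<bullet> axis G) (perp G u)\<bar> \<le> (Nmax + Amax) * window (u \<bullet> axis G)"
      by (rule jump_bound[OF nice_Rem V])
    also have "\<dots> \<le> Nmax + Amax"
      using Nmax_nonneg Amax_nonneg by (auto simp: indicator_def)
    finally show "\<bar>jump Rem V (side V t x) t (perp G x) (u \<bullet> axis G) (perp G u)\<bar> \<le> Nmax + Amax" .
  qed (use Bmax_nonneg in auto)
  then show ?thesis
    using f0_bounds[of u] Bmax_nonneg Nmax_nonneg Amax_nonneg by (auto simp: Fm_def)
qed

lemma force_converges_Fm:
  assumes V: "hist V" and s: "s \<in> {1, - 1}"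
  shows "force_converges G (pos V) V (Fm V) s t"
proof -
  interpret Q: pair_sigma_finite "lperp G" "lborel :: 'a measure" ..
  let ?D = "indicator (disk G) :: 'a \<Rightarrow> real" and ?I = "indicator (face_in G s (V t)) :: 'a \<Rightarrow> real"
  have fd: "integrable (lperp G) ?D"
    using disk_finite by (intro integrable_real_indicator) auto
  have prod: "integrable (lperp G \<Otimes>\<^sub>M lborel) (\<lambda>x. ?D (fst x) * h (snd x))" if h: "integrable lborel h" for h :: "'a \<Rightarrow> real"
  proof (rule Q.Fubini_integrable)
    have [measurable]: "h \<in> borel_measurable lborel" "?D \<in> borel_measurable (lperp G)"
      using h fd by auto
    show "(\<lambda>x. ?D (fst x) * h (snd x)) \<in> borel_measurable (lperp G \<Otimes>\<^sub>M lborel)"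
      by measurable
    show "integrable (lperp G) (\<lambda>x. LINT y|lborel. norm (?D (fst (x, y)) * h (snd (x, y))))"
      using fd by (simp add: abs_mult)
    show "AE x in lperp G. integrable lborel (\<lambda>y. ?D (fst (x, y)) * h (snd (x, y)))"
      using h by simp
  qed
  have i1: "integrable lborel (\<lambda>u. ?I u * (ell G (u \<bullet> axis G - V t) * f0 G u))"
    by (rule Bochner_Integration.integrable_bound[OF ell_int[of "V t"]]) (measurable, auto simp: indicator_def)
  let ?c = "Cl * (2 * \<epsilon>) powr p"
  let ?j = "\<lambda>x. ?I (snd x) * (ell G (snd x \<bullet> axis G - V t) * (trans G (perp G (snd x)) * jump Rem V s t (fst x) (snd x \<bullet> axis G) (perp G (snd x))))"
  have jm: "?j \<in> borel_measurable (lperp G \<Otimes>\<^sub>M lborel)"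
  proof -
    have [measurable]: "(\<lambda>x. fst x) \<in> borel_measurable (lperp G \<Otimes>\<^sub>M (lborel :: 'a measure))"
      by (rule measurable_compose[OF measurable_fst incl_lperp])
    have [measurable]: "(\<lambda>x. jump Rem V s t (fst x) (snd x \<bullet> axis G) (perp G (snd x))) \<in> borel_measurable (lperp G \<Otimes>\<^sub>M lborel)"
      by (rule jump_measurable[OF nice_Rem V s]) measurable
    have [measurable]: "(\<lambda>x. trans G (perp G (snd x))) \<in> borel_measurable (lperp G \<Otimes>\<^sub>M lborel)"
      by (rule measurable_compose[OF _ trans_perp_measurable]) measurable
    show ?thesis
      by measurable
  qed
  have Dm: "(\<lambda>x. ?D (fst x)) \<in> borel_measurable (lperp G \<Otimes>\<^sub>M (lborel :: 'a measure))"
    using fd by measurable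
  have W: "integrable lborel (\<lambda>u. ?c * (Nmax + Amax) * window (u \<bullet> axis G) * trans G (perp G u))"
    using eps_pos by (intro trans_mass_interval) simp
  have i2: "integrable (lperp G \<Otimes>\<^sub>M lborel) (\<lambda>x. ?D (fst x) * ?j x)"
  proof (rule Bochner_Integration.integrable_bound[OF prod[OF W]])
    show "(\<lambda>x. ?D (fst x) * ?j x) \<in> borel_measurable (lperp G \<Otimes>\<^sub>M lborel)"
      by (intro borel_measurable_times Dm jm)
    have "\<bar>?j x\<bar> \<le> ?c * (Nmax + Amax) * window (snd x \<bullet> axis G) * trans G (perp G (snd x))" for x
      by (rule dev_split(1)[OF nice_Rem V s ell_shift_measurable ell_window[OF V]])
    then show "AE x in lperp G \<Otimes>\<^sub>M lborel. norm (?D (fst x) * ?j x) \<le> norm (?D (fst x) * (?c * (Nmax + Amax) * window (snd x \<bullet> axis G) * trans G (perp G (snd x))))"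
      unfolding real_norm_def abs_mult[of "?D _"] by (intro AE_I2 mult_left_mono order_trans[OF _ abs_ge_self]) auto
  qed
  have "(\<lambda>x. indicator (disk G \<times> face_in G s (V t)) x *\<^sub>R (case x of (y, u) \<Rightarrow> ell G (u \<bullet> axis G - V t) * Fm V t (face_point G s (pos V t) y) u))
     = (\<lambda>x. ?D (fst x) * (?I (snd x) * (ell G (snd x \<bullet> axis G - V t) * f0 G (snd x))) + ?D (fst x) * ?j x)"
    using Fm_face[OF _ s, of _ V t] by (auto simp: fun_eq_iff indicator_def algebra_simps)
  then show ?thesis
    using prod[OF i1] i2 by (simp add: force_converges_def set_integrable_def)
qed

text \<open>Any motion near \<open>Vinf\<close> with its densities satisfies the conditions under
  which the drags were estimated, so the estimates are available before the equation of motion is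
  solved.\<close>

lemma kinetic_Fm:
  assumes V: "hist V"
  shows "kinetic G p Vinf \<epsilon> cl Cl Kmax Amax Bmax \<delta> M (pos V) V (Fm V) (Fp V)"
proof -
  interpret trajectory "pos V" V
    by (rule trajectory_pos[OF V])
  show ?thesis
  proof (unfold_locales)
    show "set_borel_measurable borel (in_phase G (pos V) V) (\<lambda>(t, x, u). Fm V t x u)"
      by (rule fm_meas_Fm[OF V])
    show "bounded_on (in_phase G (pos V) V) (Fm V)"
      unfolding bounded_on_def using Fm_bounded[OF V] by (intro exI[of _ "Amax * Bmax + Bmax * (Nmax + Amax)"]) auto
    show "pre_law G (pos V) V (Fm V) (Fp V)" "post_law G (pos V) V (Fm V) (Fp V)"
      by (rule pre_law_Fm[OF V] post_law_Fp[OF V])+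
    show "force_converges G (pos V) V (Fm V) s t" if "s \<in> {1, - 1}" for s t
      by (rule force_converges_Fm[OF V that])
  qed
qed

lemma force_Fm:
  assumes V: "hist V" and t: "t \<ge> 0"
  shows "force G (pos V) V (Fm V) t = F0 G (V t) + pull V 1 t - pull V (- 1) t"
proof -
  interpret kinetic G p Vinf \<epsilon> cl Cl Kmax Amax Bmax \<delta> M "pos V" V "Fm V" "Fp V"
    by (rule kinetic_Fm[OF V])
  have ex: "excess s t y = kick V s t y" if s: "s \<in> {1, - 1}" and y: "y \<in> disk G" for s y
  proof -
    have "excess s t y = (LINT u|lborel. indicator (face_in G s (V t)) u * (ell G (u \<bullet> axis G - V t) * (trans G (perp G u) * jump Rem V s t y (u \<bullet> axis G) (perp G u))))"
      unfolding excess_def set_lebesgue_integral_def real_scaleR_def Fm_face[OF y s] by simp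
    also have "\<dots> = kick V s t y"
      unfolding kick_def by (rule dev_split(3)[OF nice_Rem V s ell_shift_measurable ell_window[OF V]])
    finally show ?thesis .
  qed
  have dr: "drag s t = pull V s t" if "s \<in> {1, - 1}" for s
    unfolding drag_def pull_def set_lebesgue_integral_def
    by (intro Bochner_Integration.integral_cong refl) (auto simp: indicator_def ex[OF that])
  have "near t"
    using hist_near[OF V] by (simp add: near_def)
  from force_eq[OF this t order_refl] show ?thesis
    by (simp add: dr)
qed

text \<open>The part that comes from \<open>f0\<close> is bounded by
  \<open>bounded_emission\<close>. The deviation only involves incoming velocities in the short
  window, where the kernel is at most \<open>Kmax\<close> for every outgoing velocity.\<close>

lemma Fp_bounded:
  assumes V: "hist V" and em: "bounded_emission G Vinf \<gamma>s" and \<gamma>s: "\<epsilon> < \<gamma>s"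
    and latm: "(\<lambda>(n, v, u). latker G n v u) \<in> borel_measurable borel"
    and latn: "\<And>n v u. latker G n v u \<ge> 0"
  shows "bounded_on (out_phase G (pos V) V) (Fp V)"
proof -
  obtain M1 where M1: "\<And>w v. w \<in> {Vinf - \<gamma>s<..<Vinf + \<gamma>s} \<Longrightarrow>
      (\<integral>\<^sup>+u. ennreal (K G (v - w *\<^sub>R axis G) (u - w *\<^sub>R axis G) * f0 G u) \<partial>lborel) \<le> ennreal M1"
    using em unfolding bounded_emission_def by blast
  obtain M2 where M2: "\<And>n v. n \<in> hyperplane G \<Longrightarrow> norm n = 1 \<Longrightarrow> v \<bullet> n \<ge> 0 \<Longrightarrow>
      (\<integral>\<^sup>+u\<in>{u. u \<bullet> n \<le> 0}. ennreal (latker G n v u * f0 G u) \<partial>lborel) \<le> ennreal M2"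
    using em unfolding bounded_emission_def by blast
  have le: "\<bar>integral\<^sup>L lborel f\<bar> \<le> \<bar>B\<bar>"
    if "(\<integral>\<^sup>+u. ennreal (f u) \<partial>lborel) \<le> ennreal B" "\<And>u. 0 \<le> f u" for f :: "'a \<Rightarrow> real" and B
  proof (cases "integrable lborel f")
    case True
    have "ennreal (integral\<^sup>L lborel f) \<le> ennreal \<bar>B\<bar>"
      using that nn_integral_eq_integral[OF True] by (simp add: ennreal_leI order_trans[OF _ ennreal_leI[OF abs_ge_self]])
    moreover have "0 \<le> integral\<^sup>L lborel f"
      using that by simp
    ultimately show ?thesis
      by simp
  qed (simp add: not_integrable_integral_eq)
  let ?R = "Kmax * (Nmax + Amax) * (2 * \<epsilon>)"
  have R0: "0 \<le> ?R"
    using Kmax_nonneg Nmax_nonneg Amax_nonneg eps_pos by simp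
  have "\<bar>Fp V t x v\<bar> \<le> \<bar>M2\<bar> + (\<bar>M1\<bar> + Bmax * ?R)" if ph: "(t, x, v) \<in> out_phase G (pos V) V" for t x v
  proof (cases "lat V t x")
    case True
    then have x: "x \<in> lateral G (pos V t)" "v \<bullet> normal G x \<ge> 0"
      using ph face_side(2)[of x _ V t] by (auto simp: out_phase_def)
    let ?n = "normal G x"
    have n: "?n \<in> hyperplane G" "norm ?n = 1"
      using x radius_pos perp_hyperplane[of x] by (auto simp: normal_def lateral_def hyperplane_def)
    have "\<bar>Fp V t x v\<bar> = \<bar>LINT u|lborel. indicator {u. u \<bullet> ?n \<le> 0} u * (latker G ?n v u * f0 G u)\<bar>"
      using True by (simp add: Fp_def set_lebesgue_integral_def)
    also have "\<dots> \<le> \<bar>M2\<bar>"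
    proof (rule le)
      have "(\<integral>\<^sup>+u. ennreal (indicator {u. u \<bullet> ?n \<le> 0} u * (latker G ?n v u * f0 G u)) \<partial>lborel)
         = (\<integral>\<^sup>+u\<in>{u. u \<bullet> ?n \<le> 0}. ennreal (latker G ?n v u * f0 G u) \<partial>lborel)"
        by (intro nn_integral_cong) (auto simp: indicator_def)
      then show "(\<integral>\<^sup>+u. ennreal (indicator {u. u \<bullet> ?n \<le> 0} u * (latker G ?n v u * f0 G u)) \<partial>lborel) \<le> ennreal M2"
        using M2[OF n x(2)] by simp
    qed (use latn f0_bounds in simp)
    finally show ?thesis
      using mult_nonneg_nonneg[OF Bmax_nonneg R0] by linarith
  next
    case False
    then obtain s where s: "s \<in> {1, - 1}" "x \<in> face G s (pos V t)" and t: "t \<ge> 0"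
      using ph lateral_lat[of x V t] by (auto simp: out_phase_def)
    obtain y where y: "y \<in> disk G" "x = face_point G s (pos V t) y"
      using s face_iff by blast
    let ?I = "indicator (face_in G s (V t)) :: 'a \<Rightarrow> real"
    let ?k = "\<lambda>u. K G (v - V t *\<^sub>R axis G) (u - V t *\<^sub>R axis G) * f0 G u"
    have w0: "0 \<le> trans G (perp G v)" "trans G (perp G v) \<le> Bmax"
      by (simp_all add: trans_nonneg trans_le)
    have k0: "0 \<le> ?k u" for u
      using w0 kx_nonneg f0_bounds by (simp add: K_shift)
    have "V t \<in> {Vinf - \<gamma>s<..<Vinf + \<gamma>s}"
      using hist_near[OF V, of t] \<gamma>s by auto
    note em1 = M1[OF this, of v]
    have km: "?k \<in> borel_measurable lborel"
      unfolding K_shift by measurable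
    have "integrable lborel ?k"
    proof (rule integrableI_nonneg[OF km])
      show "(\<integral>\<^sup>+u. ennreal (?k u) \<partial>lborel) < \<infinity>"
        using em1 by (auto intro: le_less_trans)
    qed (use k0 in simp)
    then have i1: "integrable lborel (\<lambda>u. ?I u * ?k u)"
      by (rule Bochner_Integration.integrable_bound) (use km in \<open>auto simp: indicator_def\<close>)
    define j where "j u = ?I u * (kx G (v \<bullet> axis G - V t) (u \<bullet> axis G - V t) * (trans G (perp G u) * jump Rem V s t y (u \<bullet> axis G) (perp G u)))" for u
    have j1: "integrable lborel j"
      unfolding j_def[abs_def] by (rule dev_split(2)[OF nice_Rem V s(1) kx_shift_measurable kx_window[OF V]])
    have j2: "integral\<^sup>L lborel j = dev_integral Rem V s t y (\<lambda>z. kx G (v \<bullet> axis G - V t) (z - V t))"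
      unfolding j_def[abs_def] by (rule dev_split(3)[OF nice_Rem V s(1) kx_shift_measurable kx_window[OF V]])
    have "Fp V t x v = (LINT u|lborel. ?I u * ?k u + trans G (perp G v) * j u)"
      using face_side[OF s(2,1)] False
      by (simp add: Fp_def set_lebesgue_integral_def y(2) Fm_face[OF y(1) s(1)] K_shift j_def algebra_simps)
    also have "\<dots> = (LINT u|lborel. ?I u * ?k u) + (LINT u|lborel. trans G (perp G v) * j u)"
      by (rule Bochner_Integration.integral_add[OF i1 integrable_mult_right[OF j1]])
    also have "\<dots> = (LINT u|lborel. ?I u * ?k u) + trans G (perp G v) * dev_integral Rem V s t y (\<lambda>z. kx G (v \<bullet> axis G - V t) (z - V t))"
      by (simp only: integral_mult_right_zero j2)
    finally have eq: "Fp V t x v = \<dots>" .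
    have "\<bar>LINT u|lborel. ?I u * ?k u\<bar> \<le> \<bar>M1\<bar>"
    proof (rule le)
      have "(\<integral>\<^sup>+u. ennreal (?I u * ?k u) \<partial>lborel) \<le> (\<integral>\<^sup>+u. ennreal (?k u) \<partial>lborel)"
        using k0 by (intro nn_integral_mono) (auto simp: indicator_def)
      then show "(\<integral>\<^sup>+u. ennreal (?I u * ?k u) \<partial>lborel) \<le> ennreal M1"
        using em1 by (rule order_trans)
    qed (use k0 in simp)
    moreover have "\<bar>trans G (perp G v) * dev_integral Rem V s t y (\<lambda>z. kx G (v \<bullet> axis G - V t) (z - V t))\<bar> \<le> Bmax * ?R"
      unfolding abs_mult using w0 dev_integral_bound[OF nice_Rem V s(1) kx_shift_measurable kx_window[OF V]] Bmax_nonneg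
      by (intro mult_mono) auto
    ultimately show ?thesis
      unfolding eq by linarith
  qed
  then show ?thesis
    unfolding bounded_on_def by fast
qed

end

section \<open>Existence by a delay scheme\<close>

text \<open>V is the velocity that the gas sees, Z the one obtained by integrating the acceleration.
  They agree while Z is within \<epsilon> of \<open>Vinf\<close>, which covers all times at which
  \<open>admissible\<close> demands anything. For a true solution both are the same
  function.\<close>

lemma (in kinetic) admissible_velocity:
  assumes R: "relaxation p q Adrag cleft Cleft b B (DIM('a) - 1)" and \<gamma>: "0 < \<gamma>" "\<gamma> \<le> \<epsilon>"
    and Z0: "Z 0 = Vinf + \<gamma>"
    and Z: "\<And>t. t \<ge> 0 \<Longrightarrow> (Z has_real_derivative F0 G Vinf - force G X V fm t) (at t within {0..})"
    and eq: "\<And>t. t \<ge> 0 \<Longrightarrow> \<bar>Z t - Vinf\<bar> \<le> \<epsilon> \<Longrightarrow> V t = Z t"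
    and F0: "\<And>w. 0 \<le> w \<Longrightarrow> w \<le> \<gamma> \<Longrightarrow> \<beta>\<^sub>1 * w \<le> F0 G (Vinf + w) - F0 G Vinf"
      "\<And>w. 0 \<le> w \<Longrightarrow> w \<le> \<gamma> \<Longrightarrow> F0 G (Vinf + w) - F0 G Vinf \<le> \<beta>\<^sub>0 * w"
  shows "relaxation.admissible p q Adrag cleft Cleft (DIM('a) - 1) \<gamma> \<beta>\<^sub>0 \<beta>\<^sub>1 (\<lambda>t. Z t - Vinf) (\<lambda>t. X t - X 0 - t * Vinf)"
  unfolding relaxation.admissible_def[OF R]
proof (intro conjI allI impI)
  show "Z 0 - Vinf = \<gamma>" "X 0 - X 0 - 0 * Vinf = 0"
    by (simp_all add: Z0)
  have "continuous_on {0..} Z"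
    using Z by (intro DERIV_continuous_on) auto
  then show "continuous_on {0..} (\<lambda>t. Z t - Vinf)"
    by (intro continuous_intros)
  fix t :: real
  assume t: "t \<ge> 0" and range: "\<forall>\<sigma>\<in>{0..t}. 0 \<le> Z \<sigma> - Vinf \<and> Z \<sigma> - Vinf \<le> \<gamma>"
  have VZ: "V \<sigma> = Z \<sigma>" if "0 \<le> \<sigma>" "\<sigma> \<le> t" for \<sigma>
  proof (rule eq[OF that(1)])
    have "0 \<le> Z \<sigma> - Vinf" "Z \<sigma> - Vinf \<le> \<gamma>"
      using range that by auto
    then show "\<bar>Z \<sigma> - Vinf\<bar> \<le> \<epsilon>"
      using \<gamma> by linarith
  qed
  have near: "near t"
    unfolding near_def
  proof
    fix \<sigma> assume "\<sigma> \<in> {0..t}"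
    then have "0 \<le> V \<sigma> - Vinf" "V \<sigma> - Vinf \<le> \<gamma>"
      using range VZ by auto
    then show "\<bar>V \<sigma> - Vinf\<bar> \<le> \<epsilon>"
      using \<gamma> by linarith
  qed
  have above: "Vinf \<le> V \<sigma>" if "0 \<le> \<sigma>" "\<sigma> \<le> t" for \<sigma>
    using range VZ[OF that] that by auto
  show "((\<lambda>t. X t - X 0 - t * Vinf) has_real_derivative Z t - Vinf) (at t within {0..})"
    using VZ[of t] t by (auto intro!: derivative_eq_intros X_deriv)
  show "\<exists>h PR PL. ((\<lambda>t. Z t - Vinf) has_real_derivative PL - PR - h) (at t within {0..}) \<and>
      \<beta>\<^sub>1 * (Z t - Vinf) \<le> h \<and> h \<le> \<beta>\<^sub>0 * (Z t - Vinf) \<and>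
      \<bar>PR\<bar> \<le> Adrag * (Z t - Vinf) powr (p + 1) \<and>
      ((\<forall>\<sigma>\<in>{0..t}. Z t - Vinf \<le> Z \<sigma> - Vinf) \<longrightarrow> PR = 0) \<and> 0 \<le> PL \<and>
      (0 < t \<longrightarrow> 0 < (X t - X 0 - t * Vinf) / t - (Z t - Vinf) \<longrightarrow>
        cleft * (((X t - X 0 - t * Vinf) / t - (Z t - Vinf)) powr (p + 1) * (1 / (1 + t)) ^ (DIM('a) - 1)) \<le> PL) \<and>
      (\<forall>\<Gamma>>0. (\<forall>\<sigma>\<in>{0..t}. Z \<sigma> - Vinf \<le> \<Gamma> * (1 + \<sigma>) powr - q) \<longrightarrow>
        PL \<le> Cleft * \<Gamma> powr (p + 1) * (1 + t) powr - q)"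
  proof (rule exI[of _ "F0 G (V t) - F0 G Vinf"], rule exI[of _ "drag 1 t"], rule exI[of _ "drag (- 1) t"], intro conjI allI impI)
    have "F0 G Vinf - force G X V fm t = drag (- 1) t - drag 1 t - (F0 G (V t) - F0 G Vinf)"
      using force_eq[OF near t order_refl] by simp
    then show "((\<lambda>t. Z t - Vinf) has_real_derivative drag (- 1) t - drag 1 t - (F0 G (V t) - F0 G Vinf)) (at t within {0..})"
      using Z[OF t] by (auto intro!: derivative_eq_intros)
    show "\<beta>\<^sub>1 * (Z t - Vinf) \<le> F0 G (V t) - F0 G Vinf" "F0 G (V t) - F0 G Vinf \<le> \<beta>\<^sub>0 * (Z t - Vinf)"
      using F0[of "Z t - Vinf"] range t VZ[of t] by auto
    show "\<bar>drag 1 t\<bar> \<le> Adrag * (Z t - Vinf) powr (p + 1)"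
      using drag_right_le[OF near t order_refl above] VZ[of t] t by simp
    show "drag 1 t = 0" if "\<forall>\<sigma>\<in>{0..t}. Z t - Vinf \<le> Z \<sigma> - Vinf"
      using that VZ t by (intro drag_right_zero[OF near]) auto
    show "0 \<le> drag (- 1) t"
      by (rule drag_left_nonneg[OF near t order_refl])
    show "cleft * (((X t - X 0 - t * Vinf) / t - (Z t - Vinf)) powr (p + 1) * (1 / (1 + t)) ^ (DIM('a) - 1)) \<le> drag (- 1) t"
      if "0 < t" "0 < (X t - X 0 - t * Vinf) / t - (Z t - Vinf)"
    proof -
      have "(X t - X 0 - t * Vinf) / t - (Z t - Vinf) = (X t - X 0) / t - V t"
        using that(1) VZ[of t] by (simp add: diff_divide_distrib)
      then show ?thesis
        using that by (intro drag_left_ge[OF near that(1) order_refl]) auto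
    qed
    show "drag (- 1) t \<le> Cleft * \<Gamma> powr (p + 1) * (1 + t) powr - q"
      if "0 < \<Gamma>" "\<forall>\<sigma>\<in>{0..t}. Z \<sigma> - Vinf \<le> \<Gamma> * (1 + \<sigma>) powr - q" for \<Gamma>
    proof -
      have "\<bar>drag (- 1) t\<bar> \<le> Cleft * \<Gamma> powr (p + 1) * (1 + t) powr - q"
        using that VZ by (intro drag_left_le[OF near t order_refl that(1) above]) auto
      then show ?thesis
        by simp
    qed
  qed
qed

text \<open>The theorem of Arzela and Ascoli on the half line: a diagonal subsequence converges at
  all rational points, and the common Lipschitz constant makes it uniformly Cauchy on each
  interval.\<close>

lemma lipschitz_subsequence:
  fixes S :: "nat \<Rightarrow> real \<Rightarrow> real"
  assumes lip: "\<And>n x y. \<bar>S n x - S n y\<bar> \<le> L * \<bar>x - y\<bar>" and bound: "\<And>n x. S n x \<in> {lo..hi}"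
  obtains d V where "strict_mono d" "\<And>T. uniform_limit {0..T} (\<lambda>n. S (d n)) V sequentially"
    "\<And>x y. \<bar>V x - V y\<bar> \<le> L * \<bar>x - y\<bar>" "\<And>x. V x \<in> {lo..hi}"
proof -
  define r where "r = (from_nat_into \<rat> :: nat \<Rightarrow> real)"
  have r: "range r = \<rat>"
    unfolding r_def by (rule range_from_nat_into) (auto simp: countable_rat)
  interpret sub: subseqs "\<lambda>i s. convergent (\<lambda>n. S (s n) (r i))"
  proof
    fix i and s :: "nat \<Rightarrow> nat" assume "strict_mono s"
    have "compact {lo..hi}"
      by simp
    then obtain l f where "strict_mono f" "((\<lambda>n. S (s n) (r i)) \<circ> f) \<longlonglongrightarrow> l"
      using bound unfolding compact_def by metis
    then show "\<exists>r'. strict_mono r' \<and> convergent (\<lambda>n. S ((s \<circ> r') n) (r i))"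
      by (auto simp: convergent_def comp_def)
  qed
  define d where "d = sub.diagseq"
  have d: "strict_mono d"
    unfolding d_def by (rule sub.subseq_diagseq)
  have "convergent (\<lambda>n. S (d n) (r i))" for i
  proof -
    have "convergent (\<lambda>n. S ((d \<circ> ((+) (Suc i))) n) (r i))"
      unfolding d_def
    proof (rule sub.diagseq_holds)
      fix m s and j :: nat assume "strict_mono (m :: nat \<Rightarrow> nat)" "convergent (\<lambda>n. S (s n) (r j))"
      then show "convergent (\<lambda>n. S ((s \<circ> m) n) (r j))"
        using convergent_subseq_convergent[of "\<lambda>n. S (s n) (r j)" m] by (simp add: comp_def)
    qed
    then have "convergent (\<lambda>n. S (d (n + Suc i)) (r i))"
      by (simp add: comp_def add.commute)
    then show ?thesis
      by (rule convergent_ignore_initial_segment[THEN iffD1])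
  qed
  then have cr: "convergent (\<lambda>n. S (d n) x)" if "x \<in> \<rat>" for x
    using that r by (metis rangeE)
  have L0: "L \<ge> 0"
    using lip[of 0 1 0] by simp
  have cauchy: "\<exists>N. \<forall>m\<ge>N. \<forall>n\<ge>N. \<forall>x\<in>{0..T}. \<bar>S (d m) x - S (d n) x\<bar> < e" if e: "e > 0" for T e
  proof -
    \<comment> \<open>A mesh so fine that no function of the sequence varies by e / 3 between a
      point and the mesh point to its left.\<close>
    obtain k :: nat where k: "3 * (L + 1) / e < real k" "k > 0"
      using reals_Archimedean2[of "max 0 (3 * (L + 1) / e)"] by (auto simp: max_def split: if_splits)
    obtain k2 :: nat where k2: "T * real k \<le> real k2"
      using real_arch_simple by blast
    define P where "P = (\<lambda>i. real i / real k) ` {..k2}"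
    have "\<exists>N. \<forall>m\<ge>N. \<forall>n\<ge>N. \<bar>S (d m) x - S (d n) x\<bar> < e / 3" if "x \<in> P" for x
    proof -
      have "x \<in> \<rat>"
        using that by (auto simp: P_def)
      from convergent_Cauchy[OF cr[OF this]] e show ?thesis
        unfolding Cauchy_def dist_real_def by (meson divide_pos_pos zero_less_numeral)
    qed
    then obtain N where N: "\<And>x m n. x \<in> P \<Longrightarrow> m \<ge> N x \<Longrightarrow> n \<ge> N x \<Longrightarrow> \<bar>S (d m) x - S (d n) x\<bar> < e / 3"
      by metis
    show ?thesis
    proof (intro exI[of _ "Max (N ` P)"] allI impI ballI)
      fix m n x assume m: "Max (N ` P) \<le> m" and n: "Max (N ` P) \<le> n" and x: "x \<in> {0..T}"
      define i where "i = nat \<lfloor>x * real k\<rfloor>"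
      have i: "real i \<le> x * real k" "x * real k < real i + 1"
        using x k by (auto simp: i_def of_nat_nat)
      have "x * real k \<le> real k2"
        using x k2 by (meson atLeastAtMost_iff mult_right_mono of_nat_0_le_iff order_trans)
      then have "i \<le> k2"
        using i by linarith
      then have P: "real i / real k \<in> P"
        by (auto simp: P_def)
      have "N (real i / real k) \<le> Max (N ` P)"
        using P by (intro Max_ge) (auto simp: P_def)
      then have 1: "\<bar>S (d m) (real i / real k) - S (d n) (real i / real k)\<bar> < e / 3"
        using m n by (intro N[OF P]) auto
      have "\<bar>x - real i / real k\<bar> \<le> 1 / real k"
      proof -
        have "x - real i / real k = (x * real k - real i) / real k"
          using k by (simp add: diff_divide_distrib)
        then show ?thesis
          using i k by (simp add: divide_right_mono)
      qed
      then have "L * \<bar>x - real i / real k\<bar> \<le> L * (1 / real k)"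
        using L0 by (intro mult_left_mono)
      also have "\<dots> < e / 3"
        using k e L0 by (simp add: field_simps)
      finally have "\<bar>S j x - S j (real i / real k)\<bar> < e / 3" for j
        using lip[of j x "real i / real k"] by linarith
      from this[of "d m"] this[of "d n"] 1 show "\<bar>S (d m) x - S (d n) x\<bar> < e"
        by linarith
    qed
  qed
  have lim: "convergent (\<lambda>n. S (d n) x)" if x: "x \<ge> 0" for x
  proof (rule Cauchy_convergent, rule metric_CauchyI)
    fix e :: real assume "e > 0"
    from cauchy[OF this, of x] x show "\<exists>M. \<forall>m\<ge>M. \<forall>n\<ge>M. dist (S (d m) x) (S (d n) x) < e"
      by (fastforce simp: dist_real_def)
  qed
  \<comment> \<open>Convergence is known at nonnegative times only; the limit is continued by its
    value at 0.\<close>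
  define V where "V x = lim (\<lambda>n. S (d n) (max 0 x))" for x
  have V: "(\<lambda>n. S (d n) (max 0 x)) \<longlonglongrightarrow> V x" for x
    unfolding V_def using lim[of "max 0 x"] by (simp add: convergent_LIMSEQ_iff)
  show ?thesis
  proof (rule that[OF d])
    show "uniform_limit {0..T} (\<lambda>n. S (d n)) V sequentially" for T
    proof (rule uniform_limitI)
      fix e :: real assume e: "e > 0"
      have "\<exists>N. \<forall>m\<ge>N. \<forall>n\<ge>N. \<forall>x\<in>{0..T}. \<bar>S (d m) x - S (d n) x\<bar> < e / 2"
        using e by (intro cauchy) simp
      then obtain N where N: "\<And>m n x. m \<ge> N \<Longrightarrow> n \<ge> N \<Longrightarrow> x \<in> {0..T} \<Longrightarrow> \<bar>S (d m) x - S (d n) x\<bar> < e / 2"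
        by blast
      have "\<bar>S (d n) x - V x\<bar> \<le> e / 2" if n: "n \<ge> N" and x: "x \<in> {0..T}" for n x
      proof (rule LIMSEQ_le_const2)
        show "(\<lambda>m. \<bar>S (d n) x - S (d m) x\<bar>) \<longlonglongrightarrow> \<bar>S (d n) x - V x\<bar>"
          using V[of x] x by (intro tendsto_intros) (simp add: max_def)
        show "\<exists>M. \<forall>m\<ge>M. \<bar>S (d n) x - S (d m) x\<bar> \<le> e / 2"
          using N[OF n _ x] by (intro exI[of _ N]) (auto intro: less_imp_le)
      qed
      then show "\<forall>\<^sub>F n in sequentially. \<forall>x\<in>{0..T}. dist (S (d n) x) (V x) < e"
        using e unfolding eventually_sequentially dist_real_def by (intro exI[of _ N]) fastforce
    qed
    show "\<bar>V x - V y\<bar> \<le> L * \<bar>x - y\<bar>" for x y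
    proof (rule LIMSEQ_le_const2)
      show "(\<lambda>n. \<bar>S (d n) (max 0 x) - S (d n) (max 0 y)\<bar>) \<longlonglongrightarrow> \<bar>V x - V y\<bar>"
        by (intro tendsto_intros V)
      have "\<bar>S (d n) (max 0 x) - S (d n) (max 0 y)\<bar> \<le> L * \<bar>x - y\<bar>" for n
      proof -
        have "L * \<bar>max 0 x - max 0 y\<bar> \<le> L * \<bar>x - y\<bar>"
          using L0 by (intro mult_left_mono) auto
        then show ?thesis
          using lip[of "d n" "max 0 x" "max 0 y"] by linarith
      qed
      then show "\<exists>N. \<forall>n\<ge>N. \<bar>S (d n) (max 0 x) - S (d n) (max 0 y)\<bar> \<le> L * \<bar>x - y\<bar>"
        by blast
    qed
    show "V x \<in> {lo..hi}" for x
      by (rule closed_sequentially[OF _ _ V[of x]]) (use bound in auto)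
  qed
qed

lemma integral_lipschitz:
  fixes f :: "real \<Rightarrow> real"
  assumes f: "continuous_on {0..} f" and L: "\<And>x. x \<ge> 0 \<Longrightarrow> \<bar>f x\<bar> \<le> L"
  shows "\<bar>integral {0..a} f - integral {0..b} f\<bar> \<le> L * \<bar>a - b\<bar>"
proof -
  have L0: "L \<ge> 0"
    using L[of 0] by simp
  have 1: "\<bar>integral {0..a} f - integral {0..b} f\<bar> \<le> L * (a - b)" if "0 \<le> b" "b \<le> a" for a b
  proof -
    have i: "f integrable_on {0..a}"
      by (intro integrable_continuous_real continuous_on_subset[OF f]) auto
    have "integral {0..a} f - integral {0..b} f = integral {b..a} f"
      using Henstock_Kurzweil_Integration.integral_combine[OF that i] by simp
    also have "norm \<dots> \<le> L * (a - b)"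
      by (rule integral_bound) (use that L in \<open>auto intro: continuous_on_subset[OF f]\<close>)
    finally show ?thesis
      by simp
  qed
  \<comment> \<open>Negative upper limits give an empty interval and the value 0; the delay produces
    such limits at the beginning.\<close>
  have max0: "integral {0..a} f = integral {0..max 0 a} f" for a
  proof (cases "a \<ge> 0")
    case False
    then have "{0..a} = {}" "max 0 a = 0"
      by auto
    then show ?thesis
      by simp
  qed (simp add: max_def)
  have 2: "\<bar>integral {0..a} f - integral {0..b} f\<bar> \<le> L * \<bar>a - b\<bar>" if "b \<le> a" for a b
  proof -
    have "\<bar>integral {0..a} f - integral {0..b} f\<bar> \<le> L * (max 0 a - max 0 b)"
      unfolding max0[of a] max0[of b] using that by (intro 1) auto
    also have "\<dots> \<le> L * \<bar>a - b\<bar>"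
      using that L0 by (intro mult_left_mono) auto
    finally show ?thesis .
  qed
  show ?thesis
    using 2[of a b] 2[of b a] by (cases "b \<le> a") (auto simp: abs_minus_commute)
qed

section \<open>Causality and the delayed equation\<close>

context gas_at
begin

lemma pos_causal:
  assumes "\<And>\<sigma>. 0 \<le> \<sigma> \<Longrightarrow> \<sigma> \<le> T \<Longrightarrow> V \<sigma> = V' \<sigma>" "t \<le> T"
  shows "pos V t = pos V' t"
  unfolding pos_def using assms by (auto intro!: Henstock_Kurzweil_Integration.integral_cong)

lemma lcross_causal:
  assumes eq: "\<And>\<sigma>. 0 \<le> \<sigma> \<Longrightarrow> \<sigma> \<le> T \<Longrightarrow> V \<sigma> = V' \<sigma>" and t: "0 \<le> t" "t \<le> T"
  shows "lcross V t z = lcross V' t z"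
proof -
  have p: "pos V \<tau> = pos V' \<tau>" if "\<tau> \<le> t" for \<tau>
    using that t by (intro pos_causal[of T]) (auto simp: eq)
  have "crossings (pos V) t z = crossings (pos V') t z"
    unfolding crossings_def by (rule Collect_cong) (use p in force)
  then show ?thesis
    using eq[of t] t by (simp add: lcross_def last_crossing_def)
qed

lemma dev_causal:
  assumes V: "hist V" "hist V'" and eq: "\<And>\<sigma>. 0 \<le> \<sigma> \<Longrightarrow> \<sigma> \<le> T \<Longrightarrow> V \<sigma> = V' \<sigma>" and t: "0 \<le> t" "t \<le> T"
    and H: "\<And>t y v. 0 \<le> t \<Longrightarrow> t \<le> T \<Longrightarrow> H V s t y v = H V' s t y v"
  shows "dev H V s t y z = dev H V' s t y z"
proof -
  have l: "lcross V t z = lcross V' t z"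
    by (rule lcross_causal[OF eq t])
  have "lcross V t z \<le> T" if "lcross V t z > 0"
    using lcross_pos(2)[OF V(1) that] t by simp
  then have "jump H V s t y z w = jump H V' s t y z w" for w
    using H[of "lcross V t z"] l by (auto simp: jump_def lands_def)
  then show ?thesis
    by (simp add: dev_def)
qed

lemma iter_causal:
  assumes V: "hist V" "hist V'" and eq: "\<And>\<sigma>. 0 \<le> \<sigma> \<Longrightarrow> \<sigma> \<le> T \<Longrightarrow> V \<sigma> = V' \<sigma>"
  shows "0 \<le> t \<Longrightarrow> t \<le> T \<Longrightarrow> iter j V s t y v = iter j V' s t y v"
proof (induction j arbitrary: t y v)
  case (Suc j)
  have "dev (iter j) V s t y z = dev (iter j) V' s t y z" for z
    by (rule dev_causal[OF V eq]) (use Suc in auto)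
  then show ?case
    using eq[of t] Suc.prems by (simp add: step_def dev_integral_def)
qed simp

text \<open>Every ingredient looks back from time t, and each iterate that defines
  \<open>Rem\<close> evaluates its predecessor at the earlier collision times only. The stages of
  the delay scheme rely on this.\<close>

lemma pull_causal:
  assumes V: "hist V" "hist V'" and eq: "\<And>\<sigma>. 0 \<le> \<sigma> \<Longrightarrow> \<sigma> \<le> T \<Longrightarrow> V \<sigma> = V' \<sigma>" and t: "0 \<le> t" "t \<le> T"
  shows "pull V s t = pull V' s t"
proof -
  have "Rem V s t y v = Rem V' s t y v" if "0 \<le> t" "t \<le> T" for t y v
    using iter_causal[OF V eq that] by (simp add: Rem_def)
  then have "dev Rem V s t y z = dev Rem V' s t y z" for y z
    by (intro dev_causal[OF V eq t]) auto
  then show ?thesis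
    using eq[of t] t by (simp add: pull_def kick_def dev_integral_def)
qed

definition accel :: "(real \<Rightarrow> real) \<Rightarrow> real \<Rightarrow> real" where
  "accel V t = F0 G Vinf - (F0 G (V t) + pull V 1 t - pull V (- 1) t)"

lemma accel_tendsto:
  assumes F0: "continuous_on UNIV (F0 G)" and c: "hconv Vn V" and tn: "tn \<longlonglongrightarrow> t" "\<And>n. tn n \<ge> 0"
  shows "(\<lambda>n. accel (Vn n) (tn n)) \<longlonglongrightarrow> accel V t"
  unfolding accel_def
  by (intro tendsto_intros pull_tendsto[OF c _ tn] continuous_on_tendsto_compose[OF F0] hconv_V[OF c tn]) auto

lemma accel_cont:
  assumes F0: "continuous_on UNIV (F0 G)" and V: "hist V"
  shows "continuous_on {0..} (accel V)"
proof (rule continuous_on_sequentiallyI)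
  fix u :: "nat \<Rightarrow> real" and a
  assume u: "\<forall>n. u n \<in> {0..}" "a \<in> {0..}" "u \<longlonglongrightarrow> a"
  show "(\<lambda>n. accel V (u n)) \<longlonglongrightarrow> accel V a"
    using u by (intro accel_tendsto[OF F0 hconv_const[OF V]]) auto
qed

lemma accel_bounded:
  assumes F0: "continuous_on UNIV (F0 G)"
  obtains L where "\<And>V t. hist V \<Longrightarrow> \<bar>accel V t\<bar> \<le> L"
proof -
  have "compact (F0 G ` {Vinf - \<epsilon>..Vinf + \<epsilon>})"
    by (intro compact_continuous_image continuous_on_subset[OF F0]) auto
  then have "bounded (F0 G ` {Vinf - \<epsilon>..Vinf + \<epsilon>})"
    by (rule compact_imp_bounded)
  then obtain B where "\<forall>x\<in>F0 G ` {Vinf - \<epsilon>..Vinf + \<epsilon>}. norm x \<le> B"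
    unfolding bounded_iff by blast
  then have B: "\<bar>F0 G w\<bar> \<le> B" if "w \<in> {Vinf - \<epsilon>..Vinf + \<epsilon>}" for w
    using that by simp
  have "\<bar>accel V t\<bar> \<le> \<bar>F0 G Vinf\<bar> + B + 2 * pullmax" if V: "hist V" for V t
  proof -
    have "\<bar>F0 G (V t)\<bar> \<le> B"
      using hist_near[OF V, of t] by (intro B) auto
    then show ?thesis
      using pull_bound[OF V, of 1 t] pull_bound[OF V, of "- 1" t] unfolding accel_def by simp
  qed
  then show ?thesis
    by (rule that)
qed

text \<open>The projection to the interval in which the estimates of the gas are valid. It does not
  increase distances, so it preserves Lipschitz bounds.\<close>

definition clamp_vel :: "real \<Rightarrow> real" where
  "clamp_vel x = max (Vinf - \<epsilon>) (min (Vinf + \<epsilon>) x)"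

lemma clamp_vel: "\<bar>clamp_vel x - clamp_vel y\<bar> \<le> \<bar>x - y\<bar>" "\<bar>clamp_vel x - Vinf\<bar> \<le> \<epsilon>"
    "\<bar>x - Vinf\<bar> \<le> \<epsilon> \<Longrightarrow> clamp_vel x = x"
  using eps_pos by (auto simp: clamp_vel_def max_def min_def abs_le_iff)

lemma clamp_vel_cont: "continuous_on UNIV clamp_vel"
  unfolding clamp_vel_def[abs_def] by (intro continuous_intros)

text \<open>The value at time t uses the acceleration until t - \<theta> only, so the fixed-point
  equation can be solved explicitly, interval by interval.\<close>

definition delayed :: "real \<Rightarrow> real \<Rightarrow> (real \<Rightarrow> real) \<Rightarrow> real \<Rightarrow> real" where
  "delayed \<gamma> \<theta> V t = clamp_vel (Vinf + \<gamma> + integral {0..t - \<theta>} (accel V))"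

fun tonelli :: "real \<Rightarrow> real \<Rightarrow> nat \<Rightarrow> real \<Rightarrow> real" where
  "tonelli \<gamma> \<theta> 0 = (\<lambda>t. clamp_vel (Vinf + \<gamma>))"
| "tonelli \<gamma> \<theta> (Suc k) = delayed \<gamma> \<theta> (tonelli \<gamma> \<theta> k)"

lemma lipschitz_hist:
  assumes "\<And>x y. \<bar>V x - V y\<bar> \<le> L * \<bar>x - y\<bar>" "\<And>x. \<bar>V x - Vinf\<bar> \<le> \<epsilon>"
  shows "hist V"
proof -
  have "isCont V x" for x
    unfolding isCont_def
  proof (rule tendstoI)
    fix e :: real assume e: "e > 0"
    have L: "L \<ge> 0"
      using assms(1)[of 0 1] by simp
    have "\<forall>\<^sub>F y in at x. dist y x < e / (L + 1)"
      using e L by (auto simp: eventually_at intro!: exI[of _ "e / (L + 1)"])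
    then show "\<forall>\<^sub>F y in at x. dist (V y) (V x) < e"
    proof eventually_elim
      case (elim y)
      have "\<bar>V y - V x\<bar> \<le> L * \<bar>y - x\<bar>"
        by (rule assms)
      also have "\<dots> \<le> L * (e / (L + 1))"
        using elim L by (intro mult_left_mono) (auto simp: dist_real_def)
      also have "\<dots> < e"
        using e L by (simp add: field_simps)
      finally show ?case
        by (simp add: dist_real_def)
    qed
  qed
  then show ?thesis
    using assms(2) by (simp add: hist_def continuous_on_eq_continuous_at)
qed

lemma delayed_lipschitz:
  assumes F0: "continuous_on UNIV (F0 G)" and V: "hist V" and L: "\<And>t. \<bar>accel V t\<bar> \<le> L"
  shows "\<bar>delayed \<gamma> \<theta> V x - delayed \<gamma> \<theta> V y\<bar> \<le> L * \<bar>x - y\<bar>"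
proof -
  have "\<bar>delayed \<gamma> \<theta> V x - delayed \<gamma> \<theta> V y\<bar> \<le> \<bar>integral {0..x - \<theta>} (accel V) - integral {0..y - \<theta>} (accel V)\<bar>"
    unfolding delayed_def using clamp_vel(1)[of "Vinf + \<gamma> + integral {0..x - \<theta>} (accel V)" "Vinf + \<gamma> + integral {0..y - \<theta>} (accel V)"] by simp
  also have "\<dots> \<le> L * \<bar>(x - \<theta>) - (y - \<theta>)\<bar>"
    by (rule integral_lipschitz[OF accel_cont[OF F0 V] L])
  finally show ?thesis
    by simp
qed

lemma tonelli_lipschitz:
  assumes F0: "continuous_on UNIV (F0 G)" and L: "\<And>V t. hist V \<Longrightarrow> \<bar>accel V t\<bar> \<le> L"
  shows "hist (tonelli \<gamma> \<theta> k)" "\<bar>tonelli \<gamma> \<theta> k x - tonelli \<gamma> \<theta> k y\<bar> \<le> L * \<bar>x - y\<bar>"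
proof -
  have L0: "L \<ge> 0"
    using L[of "\<lambda>_. Vinf" 0] eps_pos by (simp add: hist_def)
  have "hist (tonelli \<gamma> \<theta> k) \<and> (\<forall>x y. \<bar>tonelli \<gamma> \<theta> k x - tonelli \<gamma> \<theta> k y\<bar> \<le> L * \<bar>x - y\<bar>)"
  proof (induction k)
    case 0
    then show ?case
      using L0 clamp_vel(2) by (simp add: hist_def)
  next
    case (Suc k)
    then have V: "hist (tonelli \<gamma> \<theta> k)"
      by simp
    have lip: "\<bar>tonelli \<gamma> \<theta> (Suc k) x - tonelli \<gamma> \<theta> (Suc k) y\<bar> \<le> L * \<bar>x - y\<bar>" for x y
      unfolding tonelli.simps by (rule delayed_lipschitz[OF F0 V L[OF V]])
    moreover have "\<bar>tonelli \<gamma> \<theta> (Suc k) x - Vinf\<bar> \<le> \<epsilon>" for x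
      by (simp add: delayed_def clamp_vel(2))
    ultimately show ?case
      using lipschitz_hist by blast
  qed
  then show "hist (tonelli \<gamma> \<theta> k)" "\<bar>tonelli \<gamma> \<theta> k x - tonelli \<gamma> \<theta> k y\<bar> \<le> L * \<bar>x - y\<bar>"
    by auto
qed

text \<open>By causality each stage extends the exact solution of the delayed equation by another
  \<theta> of time, and later stages do not change what is already there.\<close>

lemma tonelli_stable:
  assumes F0: "continuous_on UNIV (F0 G)" and \<theta>: "\<theta> > 0"
  shows "t \<le> real k * \<theta> \<Longrightarrow> tonelli \<gamma> \<theta> (Suc k) t = tonelli \<gamma> \<theta> k t"
proof (induction k arbitrary: t)
  case 0
  then have "{0..t - \<theta>} = {}"
    using \<theta> by auto
  then show ?case
    by (simp add: delayed_def)
next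
  case (Suc k)
  obtain L where L: "\<And>V t. hist V \<Longrightarrow> \<bar>accel V t\<bar> \<le> L"
    using accel_bounded[OF F0] by blast
  have h: "hist (tonelli \<gamma> \<theta> j)" for j
    by (rule tonelli_lipschitz(1)[OF F0 L])
  have "accel (tonelli \<gamma> \<theta> (Suc k)) \<sigma> = accel (tonelli \<gamma> \<theta> k) \<sigma>" if "\<sigma> \<in> {0..t - \<theta>}" for \<sigma>
  proof -
    have "\<sigma> \<le> real k * \<theta>"
      using that Suc.prems by (simp add: algebra_simps)
    then have eq: "tonelli \<gamma> \<theta> (Suc k) \<tau> = tonelli \<gamma> \<theta> k \<tau>" if "0 \<le> \<tau>" "\<tau> \<le> \<sigma>" for \<tau>
      using that by (intro Suc.IH) auto
    have "pull (tonelli \<gamma> \<theta> (Suc k)) s \<sigma> = pull (tonelli \<gamma> \<theta> k) s \<sigma>" for s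
      using that by (intro pull_causal[OF h h eq]) auto
    then show ?thesis
      using eq[of \<sigma>] that unfolding accel_def by simp
  qed
  then have "integral {0..t - \<theta>} (accel (tonelli \<gamma> \<theta> (Suc k))) = integral {0..t - \<theta>} (accel (tonelli \<gamma> \<theta> k))"
    by (rule Henstock_Kurzweil_Integration.integral_cong)
  then show ?case
    by (simp only: tonelli.simps delayed_def)
qed

text \<open>The common bound of the acceleration is a common Lipschitz constant, which gives
  compactness. The limit solves the equation without delay because the acceleration is continuous
  under \<open>hconv\<close> and the missing piece of the integral is at most L * \<theta>.\<close>

lemma clamped_solution:
  assumes F0: "continuous_on UNIV (F0 G)"
  obtains V where "hist V" "\<And>t. t \<ge> 0 \<Longrightarrow> V t = clamp_vel (Vinf + \<gamma> + integral {0..t} (accel V))"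
proof -
  obtain L where L: "\<And>V t. hist V \<Longrightarrow> \<bar>accel V t\<bar> \<le> L"
    using accel_bounded[OF F0] by blast
  define \<theta> where "\<theta> n = 1 / real (Suc n)" for n
  have \<theta>: "\<theta> n > 0" for n
    by (simp add: \<theta>_def)
  \<comment> \<open>The square of Suc n stages, each of length 1 / Suc n, reaches the time Suc n:
    the delay tends to 0 while the horizon tends to infinity.\<close>
  define S where "S n = tonelli \<gamma> (\<theta> n) (Suc n * Suc n)" for n
  have S: "hist (S n)" "\<bar>S n x - S n y\<bar> \<le> L * \<bar>x - y\<bar>" for n x y
    unfolding S_def by (rule tonelli_lipschitz(1)[OF F0 L], assumption) (rule tonelli_lipschitz(2)[OF F0 L], assumption)
  have S_eq: "S n t = delayed \<gamma> (\<theta> n) (S n) t" if "t \<le> real (Suc n)" for n t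
  proof -
    have "real (Suc n * Suc n) * \<theta> n = real (Suc n)"
      unfolding of_nat_mult \<theta>_def by simp
    then have "t \<le> real (Suc n * Suc n) * \<theta> n"
      using that by simp
    from tonelli_stable[OF F0 \<theta> this, of \<gamma>] show ?thesis
      by (simp add: S_def del: of_nat_Suc mult_Suc mult_Suc_right)
  qed
  have "S n x \<in> {Vinf - \<epsilon>..Vinf + \<epsilon>}" for n x
    using hist_near[OF S(1), of n x] by auto
  then obtain d V where d: "strict_mono d" and u: "\<And>T. uniform_limit {0..T} (\<lambda>n. S (d n)) V sequentially"
    and V_lip: "\<And>x y. \<bar>V x - V y\<bar> \<le> L * \<bar>x - y\<bar>" and V_range: "\<And>x. V x \<in> {Vinf - \<epsilon>..Vinf + \<epsilon>}"
    using lipschitz_subsequence[of S L, OF S(2)] by metis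
  have V: "hist V"
  proof (rule lipschitz_hist[OF V_lip])
    show "\<bar>V x - Vinf\<bar> \<le> \<epsilon>" for x
      using V_range[of x] unfolding abs_le_iff by simp
  qed
  have c: "hconv (\<lambda>n. S (d n)) V"
    using S V u by (simp add: hconv_def)
  have "V t = clamp_vel (Vinf + \<gamma> + integral {0..t} (accel V))" if t: "t \<ge> 0" for t
  proof -
    have "(\<lambda>n. integral {0..t} (accel (S (d n)))) \<longlonglongrightarrow> integral {0..t} (accel V)"
    proof (rule dominated_convergence(2))
      show "accel (S (d n)) integrable_on {0..t}" for n
        by (intro integrable_continuous_real continuous_on_subset[OF accel_cont[OF F0 S(1)]]) auto
      show "(\<lambda>x. L) integrable_on {0..t}"
        by (intro integrable_continuous_real continuous_intros)
      show "norm (accel (S (d n)) x) \<le> L" for n x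
        using L[OF S(1)] by simp
      show "(\<lambda>n. accel (S (d n)) x) \<longlonglongrightarrow> accel V x" if "x \<in> {0..t}" for x
        using that by (intro accel_tendsto[OF F0 c]) auto
    qed
    moreover have "(\<lambda>n. integral {0..t - \<theta> (d n)} (accel (S (d n))) - integral {0..t} (accel (S (d n)))) \<longlonglongrightarrow> 0"
    proof (rule Lim_null_comparison)
      have "\<bar>integral {0..t - \<theta> (d n)} (accel (S (d n))) - integral {0..t} (accel (S (d n)))\<bar> \<le> L * \<theta> (d n)" for n
        using integral_lipschitz[OF accel_cont[OF F0 S(1)] L[OF S(1)], where a = "t - \<theta> (d n)" and b = t] \<theta>[of "d n"] by simp
      then show "\<forall>\<^sub>F n in sequentially. norm (integral {0..t - \<theta> (d n)} (accel (S (d n))) - integral {0..t} (accel (S (d n)))) \<le> L * \<theta> (d n)"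
        by simp
      have "\<theta> \<longlonglongrightarrow> 0"
        unfolding \<theta>_def[abs_def] using LIMSEQ_inverse_real_of_nat by (simp add: inverse_eq_divide)
      from LIMSEQ_subseq_LIMSEQ[OF this d] show "(\<lambda>n. L * \<theta> (d n)) \<longlonglongrightarrow> 0"
        by (intro tendsto_mult_right_zero) (simp add: comp_def)
    qed
    ultimately have "(\<lambda>n. integral {0..t} (accel (S (d n))) + (integral {0..t - \<theta> (d n)} (accel (S (d n))) - integral {0..t} (accel (S (d n))))) \<longlonglongrightarrow> integral {0..t} (accel V) + 0"
      by (rule tendsto_add)
    then have "(\<lambda>n. integral {0..t - \<theta> (d n)} (accel (S (d n)))) \<longlonglongrightarrow> integral {0..t} (accel V)"
      by simp
    then have "(\<lambda>n. delayed \<gamma> (\<theta> (d n)) (S (d n)) t) \<longlonglongrightarrow> clamp_vel (Vinf + \<gamma> + integral {0..t} (accel V))"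
      unfolding delayed_def by (intro continuous_on_tendsto_compose[OF clamp_vel_cont] tendsto_intros) auto
    moreover have "\<forall>\<^sub>F n in sequentially. delayed \<gamma> (\<theta> (d n)) (S (d n)) t = S (d n) t"
    proof -
      obtain N :: nat where N: "t \<le> real N"
        using real_arch_simple by blast
      have "delayed \<gamma> (\<theta> (d n)) (S (d n)) t = S (d n) t" if "n \<ge> N" for n
      proof -
        have "n \<le> d n"
          by (rule seq_suble[OF d])
        then have "t \<le> real (Suc (d n))"
          using N that by simp
        then show ?thesis
          by (rule S_eq[symmetric])
      qed
      then show ?thesis
        by (auto simp: eventually_sequentially)
    qed
    ultimately have "(\<lambda>n. S (d n) t) \<longlonglongrightarrow> clamp_vel (Vinf + \<gamma> + integral {0..t} (accel V))"
      by (rule Lim_transform_eventually)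
    moreover have "(\<lambda>n. S (d n) t) \<longlonglongrightarrow> V t"
      using t by (intro tendsto_uniform_limitI[OF u[of t]]) auto
    ultimately show ?thesis
      by (rule LIMSEQ_unique[symmetric])
  qed
  with V show ?thesis
    by (rule that)
qed

text \<open>An arbitrary solution enters the relaxation estimates without any truncation: the gas
  sees its own velocity.\<close>

lemma solution_bounds:
  assumes R: "relaxation p q Adrag cleft Cleft b B (DIM('a) - 1)"
    and small: "relaxation.small p q Adrag cleft Cleft b B \<gamma>" and \<gamma>: "\<gamma> \<le> \<epsilon>"
    and F0: "\<And>w. 0 \<le> w \<Longrightarrow> w \<le> \<gamma> \<Longrightarrow> \<beta>\<^sub>1 * w \<le> F0 G (Vinf + w) - F0 G Vinf"
      "\<And>w. 0 \<le> w \<Longrightarrow> w \<le> \<gamma> \<Longrightarrow> F0 G (Vinf + w) - F0 G Vinf \<le> \<beta>\<^sub>0 * w"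
    and \<beta>: "b \<le> \<beta>\<^sub>1" "\<beta>\<^sub>0 \<le> B"
    and sol: "solution G (F0 G Vinf) X0 (Vinf + \<gamma>) X V fm fp" and t: "t > 0"
  shows "0 < V t - Vinf"
    and "\<gamma> * exp (- \<beta>\<^sub>0 * t) + (if t \<ge> \<bar>ln \<gamma>\<bar> + 1 then exp (- B) * (relaxation.c2 p cleft B / 4) * 2 powr (- q) * \<gamma> powr (p + 1) / t powr q else 0) < V t - Vinf"
    and "V t - Vinf < \<gamma> * exp (- \<beta>\<^sub>1 * t) + relaxation.C1 p q Adrag Cleft b * \<gamma> powr (p + 1) / (1 + t) powr q"
proof -
  have V: "(V has_real_derivative F0 G Vinf - force G X V fm t) (at t within {0..})" if "t \<ge> 0" for t
    using sol that by (auto simp: solution_def)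
  interpret trajectory X V
  proof
    show "(X has_real_derivative V t) (at t within {0..})" if "t \<ge> 0" for t
      using sol that by (auto simp: solution_def)
    show "continuous_on {0..} V"
      using V by (intro DERIV_continuous_on) auto
  qed
  interpret kinetic G p Vinf \<epsilon> cl Cl Kmax Amax Bmax \<delta> M X V fm fp
    by unfold_locales (use sol in \<open>auto simp: solution_def\<close>)
  have "\<gamma> > 0"
    using small by (simp add: relaxation.small_def[OF R])
  have adm: "relaxation.admissible p q Adrag cleft Cleft (DIM('a) - 1) \<gamma> \<beta>\<^sub>0 \<beta>\<^sub>1 (\<lambda>t. V t - Vinf) (\<lambda>t. X t - X 0 - t * Vinf)"
    using sol by (intro admissible_velocity[OF R \<open>\<gamma> > 0\<close> \<gamma> _ V _ F0]) (auto simp: solution_def)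
  show "0 < V t - Vinf"
    and "\<gamma> * exp (- \<beta>\<^sub>0 * t) + (if t \<ge> \<bar>ln \<gamma>\<bar> + 1 then exp (- B) * (relaxation.c2 p cleft B / 4) * 2 powr (- q) * \<gamma> powr (p + 1) / t powr q else 0) < V t - Vinf"
    and "V t - Vinf < \<gamma> * exp (- \<beta>\<^sub>1 * t) + relaxation.C1 p q Adrag Cleft b * \<gamma> powr (p + 1) / (1 + t) powr q"
    by (rule relaxation.relaxation_bounds[OF R small adm \<beta> t])+
qed

text \<open>The truncation turns out to be inactive: the relaxation bounds hold for the integrated
  velocity and keep it between \<open>Vinf\<close> and \<open>Vinf + \<gamma>\<close>, so the
  truncated problem has been solved by a true solution.\<close>

lemma solution_exists:
  assumes R: "relaxation p q Adrag cleft Cleft b B (DIM('a) - 1)"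
    and small: "relaxation.small p q Adrag cleft Cleft b B \<gamma>" and \<gamma>: "\<gamma> \<le> \<epsilon>"
    and F0: "\<And>w. 0 \<le> w \<Longrightarrow> w \<le> \<gamma> \<Longrightarrow> \<beta>\<^sub>1 * w \<le> F0 G (Vinf + w) - F0 G Vinf"
      "\<And>w. 0 \<le> w \<Longrightarrow> w \<le> \<gamma> \<Longrightarrow> F0 G (Vinf + w) - F0 G Vinf \<le> \<beta>\<^sub>0 * w"
    and \<beta>: "b \<le> \<beta>\<^sub>1" "\<beta>\<^sub>0 \<le> B"
    and F0c: "continuous_on UNIV (F0 G)"
    and lat: "lateral_kernel G" and \<gamma>s: "\<epsilon> < \<gamma>s"
  shows "\<exists>X V fm fp. solution G (F0 G Vinf) X0 (Vinf + \<gamma>) X V fm fp \<and>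
     (bounded_emission G Vinf \<gamma>s \<longrightarrow> bounded_on (out_phase G X V) fp)"
proof -
  have \<gamma>0: "\<gamma> > 0"
    using small by (simp add: relaxation.small_def[OF R])
  obtain V where V: "hist V" and clamp: "\<And>t. t \<ge> 0 \<Longrightarrow> V t = clamp_vel (Vinf + \<gamma> + integral {0..t} (accel V))"
    using clamped_solution[OF F0c] by blast
  define Z where "Z t = Vinf + \<gamma> + integral {0..t} (accel V)" for t
  have acc: "accel V t = F0 G Vinf - force G (pos V) V (Fm V) t" if "t \<ge> 0" for t
    using force_Fm[OF V that] by (simp add: accel_def)
  have Zd: "(Z has_real_derivative F0 G Vinf - force G (pos V) V (Fm V) t) (at t within {0..})" if t: "t \<ge> 0" for t
  proof -
    have "((\<lambda>x. integral {0..x} (accel V)) has_real_derivative accel V t) (at t within {0..t + 1})"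
      using t by (intro integral_has_real_derivative continuous_on_subset[OF accel_cont[OF F0c V]]) auto
    then have "(Z has_real_derivative accel V t) (at t within {0..t + 1})"
      unfolding Z_def[abs_def] by (auto intro!: derivative_eq_intros)
    moreover have "at t within {0..t + 1} = at t within {0..}"
      using t by (intro at_within_nhd[of t "{..<t + 1}"]) auto
    ultimately show ?thesis
      using acc[OF t] by simp
  qed
  interpret kinetic G p Vinf \<epsilon> cl Cl Kmax Amax Bmax \<delta> M "pos V" V "Fm V" "Fp V"
    by (rule kinetic_Fm[OF V])
  have Z0: "Z 0 = Vinf + \<gamma>"
    by (simp add: Z_def)
  have adm: "relaxation.admissible p q Adrag cleft Cleft (DIM('a) - 1) \<gamma> \<beta>\<^sub>0 \<beta>\<^sub>1 (\<lambda>t. Z t - Vinf) (\<lambda>t. pos V t - pos V 0 - t * Vinf)"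
  proof (rule admissible_velocity[OF R \<gamma>0 \<gamma> Z0 Zd _ F0])
    show "V t = Z t" if "t \<ge> 0" "\<bar>Z t - Vinf\<bar> \<le> \<epsilon>" for t
      using clamp[OF that(1)] clamp_vel(3)[OF that(2)] by (simp add: Z_def)
  qed
  \<comment> \<open>The argument is not circular, because \<open>admissible\<close> was verified for
    Z with a gas that sees the truncated velocity.\<close>
  have VZ: "V t = Z t" if t: "t \<ge> 0" for t
  proof -
    have "\<bar>Z t - Vinf\<bar> \<le> \<epsilon>"
    proof (cases "t = 0")
      case True
      then show ?thesis
        using Z0 \<gamma>0 \<gamma> by simp
    next
      case False
      then have "0 < Z t - Vinf" "Z t - Vinf < \<gamma>"
        using relaxation.relaxation_bounds(1,2)[OF R small adm \<beta>, of t] t by auto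
      then show ?thesis
        using \<gamma> by linarith
    qed
    then show ?thesis
      using clamp[OF t] clamp_vel(3)[of "Z t"] by (simp add: Z_def)
  qed
  have latm: "(\<lambda>(n, v, u). latker G n v u) \<in> borel_measurable borel" and latn: "\<And>n v u. latker G n v u \<ge> 0"
    using lat by (auto simp: lateral_kernel_def)
  have "solution G (F0 G Vinf) X0 (Vinf + \<gamma>) (pos V) V (Fm V) (Fp V)"
    unfolding solution_def
  proof (intro conjI allI impI)
    show "pos V 0 = X0"
      by (rule pos_0)
    show "(pos V has_real_derivative V t) (at t within {0..})" if "t \<ge> 0" for t
      by (rule pos_deriv[OF V that])
    show "V 0 = Vinf + \<gamma>"
      using VZ[of 0] Z0 by simp
    show "(V has_real_derivative F0 G Vinf - force G (pos V) V (Fm V) t) (at t within {0..})" if t: "t \<ge> 0" for t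
      by (rule has_field_derivative_transform_within[OF Zd[OF t] zero_less_one]) (use t VZ in auto)
    have "continuous_on {0..} (\<lambda>t. F0 G Vinf - force G (pos V) V (Fm V) t) \<longleftrightarrow> continuous_on {0..} (accel V)"
      by (rule continuous_on_cong) (use acc in auto)
    then show "continuous_on {0..} (\<lambda>t. F0 G Vinf - force G (pos V) V (Fm V) t)"
      using accel_cont[OF F0c V] by simp
    show "\<forall>s\<in>{1, - 1}. force_converges G (pos V) V (Fm V) s t" for t
      using force_converges_Fm[OF V] by blast
    show "set_borel_measurable borel (in_phase G (pos V) V) (\<lambda>(t, x, u). Fm V t x u)"
      by (rule fm_meas_Fm[OF V])
    show "set_borel_measurable borel (out_phase G (pos V) V) (\<lambda>(t, x, v). Fp V t x v)"
      by (rule fp_meas_Fp[OF V latm])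
    show "bounded_on (in_phase G (pos V) V) (Fm V)"
      by (rule fm_bounded)
    show "pre_law G (pos V) V (Fm V) (Fp V)" "post_law G (pos V) V (Fm V) (Fp V)"
      by (rule pre_law_Fm[OF V] post_law_Fp[OF V])+
  qed
  moreover have "bounded_emission G Vinf \<gamma>s \<longrightarrow> bounded_on (out_phase G (pos V) V) (Fp V)"
    using Fp_bounded[OF V _ \<gamma>s latm latn] by blast
  ultimately show ?thesis
    by blast
qed

end

section \<open>The constants of the gas\<close>

lemma transfer_nonneg:
  assumes "A1 G"
  shows "transfer G w \<ge> 0"
  unfolding transfer_def set_lebesgue_integral_def
  using assms by (intro integral_nonneg_AE AE_I2) (auto simp: A1_def)

text \<open>The transfer is differentiable away from 0 only; at 0 the upper power bound squeezes it
  to its value 0.\<close>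

lemma ell_continuous:
  assumes A1: "A1 G" and A3: "A3 G p \<gamma>" and \<gamma>: "\<gamma> > 0"
  shows "continuous_on UNIV (ell G)"
proof -
  obtain C where p: "p > 0" and C: "C > 0" "\<And>u. u \<in> {- \<gamma>..\<gamma>} \<Longrightarrow> transfer G u \<le> C * \<bar>u\<bar> powr p"
    and C1: "transfer G C1_differentiable_on (- {0})"
    using A3 unfolding A3_def by blast
  have cont: "continuous_on (- {0}) (transfer G)"
    by (rule C1_differentiable_imp_continuous_on[OF C1])
  have "isCont (transfer G) u" for u
  proof (cases "u = 0")
    case False
    then show ?thesis
      using cont by (simp add: continuous_on_eq_continuous_at[OF open_Compl[OF closed_singleton]])
  next
    case True
    have "transfer G 0 \<le> C * \<bar>0\<bar> powr p"
      using \<gamma> by (intro C) auto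
    then have t0: "transfer G 0 = 0"
      using transfer_nonneg[OF A1, of 0] by simp
    have "(transfer G \<longlongrightarrow> 0) (at 0)"
    proof (rule Lim_null_comparison)
      have "\<forall>\<^sub>F u in at 0. dist u 0 < \<gamma>"
        using \<gamma> by (auto simp: eventually_at)
      then show "\<forall>\<^sub>F u in at 0. norm (transfer G u) \<le> C * \<bar>u\<bar> powr p"
      proof eventually_elim
        case (elim u)
        then show ?case
          using C(2)[of u] transfer_nonneg[OF A1, of u] by (auto simp: dist_real_def abs_less_iff)
      qed
      have "((\<lambda>u. \<bar>u\<bar> powr p) \<longlongrightarrow> \<bar>0\<bar> powr p) (at (0::real))"
        using p by (intro tendsto_powr' tendsto_intros) auto
      then show "((\<lambda>u. C * \<bar>u\<bar> powr p) \<longlongrightarrow> 0) (at 0)"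
        by (intro tendsto_mult_right_zero) simp
    qed
    then show ?thesis
      using True t0 by (simp add: isCont_def)
  qed
  then have "continuous_on UNIV (transfer G)"
    by (simp add: continuous_on_eq_continuous_at)
  then show ?thesis
    unfolding ell_def[abs_def] by (intro continuous_intros)
qed

lemma ell_power_bounds:
  assumes A1: "A1 G" and A3: "A3 G p \<gamma>" and \<gamma>: "\<gamma> > 0"
  obtains cl Cl where "cl > 0" "Cl \<ge> 0" "\<And>w. \<bar>w\<bar> \<le> \<gamma> \<Longrightarrow> ell G w \<le> Cl * \<bar>w\<bar> powr p"
    "\<And>w. \<bar>w\<bar> \<le> \<gamma> \<Longrightarrow> cl * \<bar>w\<bar> powr p \<le> ell G w"
proof -
  obtain c C where p: "p > 0" "p \<le> 2" and c: "c > 0" "\<And>u. u \<in> {- \<gamma>..\<gamma>} \<Longrightarrow> c * \<bar>u\<bar> powr p \<le> transfer G u"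
    and C: "C > 0" "\<And>u. u \<in> {- \<gamma>..\<gamma>} \<Longrightarrow> transfer G u \<le> C * \<bar>u\<bar> powr p"
    using A3 unfolding A3_def by blast
  show ?thesis
  proof (rule that[of c "\<gamma> powr (2 - p) + C"])
    fix w assume w: "\<bar>w\<bar> \<le> \<gamma>"
    then have w': "w \<in> {- \<gamma>..\<gamma>}"
      by auto
    show "c * \<bar>w\<bar> powr p \<le> ell G w"
      using c(2)[OF w'] zero_le_power2[of w] unfolding ell_def by linarith
    \<comment> \<open>This uses that p is at most 2: near 0 the quadratic part of \<open>ell\<close>
      does not exceed the order p of the transfer.\<close>
    have "w\<^sup>2 \<le> \<gamma> powr (2 - p) * \<bar>w\<bar> powr p"
    proof (cases "w = 0")
      case False
      have "w\<^sup>2 = \<bar>w\<bar> powr 2"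
        using False by (simp add: powr_numeral)
      also have "\<dots> = \<bar>w\<bar> powr (2 - p) * \<bar>w\<bar> powr p"
        by (simp add: powr_add[symmetric])
      also have "\<dots> \<le> \<gamma> powr (2 - p) * \<bar>w\<bar> powr p"
        using w p by (intro mult_right_mono powr_mono2) auto
      finally show ?thesis .
    qed simp
    then show "ell G w \<le> (\<gamma> powr (2 - p) + C) * \<bar>w\<bar> powr p"
      using C(2)[OF w'] by (simp add: ell_def distrib_right)
  qed (use c C in auto)
qed

context axial
begin

text \<open>The transversal profile has mass 1 and integrates out of the conservation law.\<close>

lemma kx_mass_axial:
  assumes A1: "A1 G" and mass: "mass_conservation G"
  shows "(\<integral>\<^sup>+v\<in>{0..}. ennreal (v * kx G v u) \<partial>lborel) = ennreal \<bar>u\<bar>"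
proof -
  have kxc: "continuous_on UNIV (\<lambda>(v, u). kx G v u)" and kx0: "\<And>v u. kx G v u \<ge> 0"
    and tr: "has_bochner_integral (lperp G) (trans G) 1" and tr0: "\<And>y. y \<in> hyperplane G \<Longrightarrow> trans G y \<ge> 0"
    using A1 by (auto simp: A1_def)
  have "continuous_on UNIV (\<lambda>v. kx G v u)"
    using continuous_on_compose2[OF kxc continuous_on_Pair[OF continuous_on_id continuous_on_const], of u UNIV] by simp
  then have [measurable]: "(\<lambda>v. kx G v u) \<in> borel_measurable borel"
    by (rule borel_measurable_continuous_onI)
  have tm: "trans G \<in> borel_measurable (lperp G)"
    using tr by (auto simp: has_bochner_integral_iff)
  have tr1: "(\<integral>\<^sup>+y. ennreal (trans G y) \<partial>lperp G) = 1"
    using tr tr0 by (subst nn_integral_eq_integral) (auto simp: has_bochner_integral_iff space_lperp intro!: AE_I2)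
  have "ennreal \<bar>u\<bar> = (\<integral>\<^sup>+v\<in>{v. v \<bullet> axis G \<ge> 0}. ennreal ((v \<bullet> axis G) * K G v (u *\<^sub>R axis G)) \<partial>lborel)"
    using mass unfolding mass_conservation_def by simp
  also have "\<dots> = (\<integral>\<^sup>+v. (ennreal (v \<bullet> axis G * kx G (v \<bullet> axis G) u) * indicator {0..} (v \<bullet> axis G)) * ennreal (trans G (perp G v)) \<partial>lborel)"
    using tr0[OF perp_hyperplane] kx0
    by (intro nn_integral_cong) (auto simp: K_def indicator_def ennreal_mult'[symmetric] mult.assoc)
  also have "\<dots> = (\<integral>\<^sup>+z. ennreal (z * kx G z u) * indicator {0..} z \<partial>lborel) * (\<integral>\<^sup>+y. ennreal (trans G y) \<partial>lperp G)"
    by (rule nn_integral_product[of "\<lambda>z. ennreal (z * kx G z u) * indicator {0..} z" "\<lambda>y. ennreal (trans G y)"])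
       (use tm in measurable)
  finally show ?thesis
    by (simp add: tr1)
qed

text \<open>Convergence of the force integral at velocity 0 contains a second moment, as
  \<open>ell\<close> is at least quadratic; outside of [-1, 1] it dominates the first moment, and
  inside \<open>dens\<close> is bounded.\<close>

lemma dens_first_moment:
  assumes A1: "A1 G" and ell: "integrable lborel (\<lambda>u. ell G (u \<bullet> axis G - 0) * f0 G u)" and ellc: "continuous_on UNIV (ell G)"
    and Amax: "\<And>z. dens G z \<le> Amax"
  shows "integrable lborel (\<lambda>z. \<bar>z\<bar> * dens G z)"
proof -
  have d0: "\<And>z. dens G z \<ge> 0" and dc: "continuous_on UNIV (dens G)"
    and tr: "has_bochner_integral (lperp G) (trans G) 1" and tr0: "\<And>y. y \<in> hyperplane G \<Longrightarrow> trans G y \<ge> 0"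
    using A1 by (auto simp: A1_def)
  have [measurable]: "dens G \<in> borel_measurable borel" "ell G \<in> borel_measurable borel"
    by (intro borel_measurable_continuous_onI dc ellc)+
  have sq: "z\<^sup>2 \<le> ell G z" for z
    using transfer_nonneg[OF A1, of z] by (simp add: ell_def)
  have e0: "0 \<le> ell G z" for z
    using sq[of z] zero_le_power2[of z] by linarith
  have tm: "trans G \<in> borel_measurable (lperp G)"
    using tr by (auto simp: has_bochner_integral_iff)
  have tr1: "(\<integral>\<^sup>+y. ennreal (trans G y) \<partial>lperp G) = 1"
    using tr tr0 by (subst nn_integral_eq_integral) (auto simp: has_bochner_integral_iff space_lperp intro!: AE_I2)
  have "(\<integral>\<^sup>+z. ennreal (ell G z * dens G z) \<partial>lborel) = (\<integral>\<^sup>+z. ennreal (ell G z * dens G z) \<partial>lborel) * (\<integral>\<^sup>+y. ennreal (trans G y) \<partial>lperp G)"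
    by (simp add: tr1)
  also have "\<dots> = (\<integral>\<^sup>+u. ennreal (ell G (u \<bullet> axis G) * dens G (u \<bullet> axis G)) * ennreal (trans G (perp G u)) \<partial>lborel)"
    by (rule nn_integral_product[of "\<lambda>z. ennreal (ell G z * dens G z)" "\<lambda>y. ennreal (trans G y)", symmetric])
       (use tm in measurable)
  also have "\<dots> = (\<integral>\<^sup>+u. ennreal (norm (ell G (u \<bullet> axis G - 0) * f0 G u)) \<partial>lborel)"
    using e0 d0 tr0[OF perp_hyperplane] by (intro nn_integral_cong) (auto simp: f0_def ennreal_mult' mult.assoc abs_mult)
  also have "\<dots> < \<infinity>"
    using ell by (simp add: integrable_iff_bounded)
  finally have i1: "integrable lborel (\<lambda>z. ell G z * dens G z)"
    using e0 d0 by (intro integrableI_nonneg) auto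
  have i2: "integrable lborel (\<lambda>z :: real. indicator {- 1..1} z * Amax)"
    by (intro integrable_mult_left integrable_real_indicator) (auto simp: emeasure_lborel_Icc_eq)
  show ?thesis
  proof (rule Bochner_Integration.integrable_bound[OF Bochner_Integration.integrable_add[OF i1 i2]])
    show "AE z in lborel. norm (\<bar>z\<bar> * dens G z) \<le> norm (ell G z * dens G z + indicator {- 1..1} z * Amax)"
    proof (rule AE_I2)
      fix z
      have A0: "0 \<le> Amax"
        using d0[of 0] Amax[of 0] by linarith
      have "\<bar>z\<bar> * dens G z \<le> ell G z * dens G z + indicator {- 1..1} z * Amax"
      proof (cases "z \<in> {- 1..1}")
        case True
        then have "\<bar>z\<bar> * dens G z \<le> 1 * Amax"
          using d0 Amax A0 by (intro mult_mono) auto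
        then show ?thesis
          using True mult_nonneg_nonneg[OF e0[of z] d0[of z]] by simp
      next
        case False
        then have "1 * \<bar>z\<bar> \<le> \<bar>z\<bar> * \<bar>z\<bar>"
          by (intro mult_right_mono) auto
        then have "\<bar>z\<bar> \<le> ell G z"
          using sq[of z] by (simp add: power2_eq_square)
        then show ?thesis
          using False d0 by (simp add: mult_right_mono)
      qed
      then show "norm (\<bar>z\<bar> * dens G z) \<le> norm (ell G z * dens G z + indicator {- 1..1} z * Amax)"
        using d0[of z] by (simp add: abs_mult)
    qed
  qed measurable
qed

end

text \<open>The criterion is a strict inequality at one point. Both sides are continuous there, the
  integral by dominated convergence with the majorant of (A4), so it persists uniformly in a
  neighbourhood.\<close>

lemma irreversal_neighbourhood:
  assumes A1: "A1 G" and irr: "irreversal_criterion G Vinf" and \<gamma>: "\<gamma> > 0"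
    and M: "integrable lborel M" "\<And>v w z. \<bar>v\<bar> < 2 * \<gamma> \<Longrightarrow> \<bar>w - Vinf\<bar> < \<gamma> \<Longrightarrow> kx G v (z - w) * dens G z \<le> M z"
  obtains e \<delta> where "e > 0" "\<delta> > 0"
    "\<And>v w z'. \<bar>v\<bar> \<le> 2 * e \<Longrightarrow> \<bar>w - Vinf\<bar> \<le> e \<Longrightarrow> \<bar>z' - Vinf\<bar> \<le> e \<Longrightarrow>
        dens G z' + 2 * \<delta> \<le> (LINT z:{w..}|lborel. kx G v (z - w) * dens G z)"
proof -
  have d0: "\<And>z. dens G z \<ge> 0" and dc: "continuous_on UNIV (dens G)" and kx0: "\<And>v u. kx G v u \<ge> 0"
    and kxc: "continuous_on UNIV (\<lambda>(v, u). kx G v u)"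
    using A1 by (auto simp: A1_def)
  have dm [measurable]: "dens G \<in> borel_measurable borel"
    by (intro borel_measurable_continuous_onI dc)
  have km [measurable]: "(\<lambda>z. kx G v (z - w)) \<in> borel_measurable borel" for v w
  proof -
    have "continuous_on UNIV (\<lambda>z. kx G v (z - w))"
      using continuous_on_compose2[OF kxc continuous_on_Pair[OF continuous_on_const
          continuous_on_diff[OF continuous_on_id continuous_on_const]], of v w UNIV] by simp
    then show ?thesis
      by (rule borel_measurable_continuous_onI)
  qed
  define I where "I v w = (LINT z|lborel. indicator {w..} z * (kx G v (z - w) * dens G z))" for v w
  have I0: "I 0 Vinf > dens G Vinf"
  proof -
    have "I 0 Vinf = (LINT z|lborel. indicator {Vinf..} (Vinf + 1 * z) * (kx G 0 (Vinf + 1 * z - Vinf) * dens G (Vinf + 1 * z)))"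
      unfolding I_def by (subst lborel_integral_real_affine[of 1 _ Vinf]) auto
    also have "\<dots> = (LINT z:{0..}|lborel. kx G 0 z * dens G (z + Vinf))"
      unfolding set_lebesgue_integral_def
      by (intro Bochner_Integration.integral_cong) (auto simp: indicator_def add.commute)
    finally show ?thesis
      using irr by (simp add: irreversal_criterion_def)
  qed
  \<comment> \<open>A quarter of the surplus: the claim with 2 * \<delta> spends one half, the other
    half contradicts the limit.\<close>
  define \<delta> where "\<delta> = (I 0 Vinf - dens G Vinf) / 4"
  have \<delta>: "\<delta> > 0"
    using I0 by (simp add: \<delta>_def)
  \<comment> \<open>Dividing by n + 2 keeps all radii strictly below \<gamma>, as the strict
    inequalities of (A4) demand.\<close>
  have "\<exists>n. \<forall>v w z'. \<bar>v\<bar> \<le> 2 * (\<gamma> / real (n + 2)) \<longrightarrow> \<bar>w - Vinf\<bar> \<le> \<gamma> / real (n + 2) \<longrightarrow> \<bar>z' - Vinf\<bar> \<le> \<gamma> / real (n + 2) \<longrightarrow>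
      dens G z' + 2 * \<delta> \<le> I v w"
  proof (rule ccontr)
    assume "\<not> ?thesis"
    then have "\<forall>n. \<exists>v w z'. \<bar>v\<bar> \<le> 2 * (\<gamma> / real (n + 2)) \<and> \<bar>w - Vinf\<bar> \<le> \<gamma> / real (n + 2) \<and> \<bar>z' - Vinf\<bar> \<le> \<gamma> / real (n + 2) \<and> I v w < dens G z' + 2 * \<delta>"
      by (simp add: not_le)
    then obtain v w z' where *: "\<And>n. \<bar>v n\<bar> \<le> 2 * (\<gamma> / real (n + 2))" "\<And>n. \<bar>w n - Vinf\<bar> \<le> \<gamma> / real (n + 2)"
      "\<And>n. \<bar>z' n - Vinf\<bar> \<le> \<gamma> / real (n + 2)" "\<And>n. I (v n) (w n) < dens G (z' n) + 2 * \<delta>"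
      by metis
    have small: "\<gamma> / real (n + 2) < \<gamma>" for n
      using \<gamma> divide_strict_left_mono[of 1 "real (n + 2)" \<gamma>] by simp
    have "(\<lambda>n. 1 / real (n + 2)) \<longlonglongrightarrow> 0"
      using LIMSEQ_ignore_initial_segment[OF lim_1_over_n, of 2] by simp
    then have e0: "(\<lambda>n. \<gamma> / real (n + 2)) \<longlonglongrightarrow> 0"
      using tendsto_mult_right_zero[of "\<lambda>n. 1 / real (n + 2)" sequentially \<gamma>] by simp
    have v: "v \<longlonglongrightarrow> 0"
      by (rule Lim_null_comparison[of _ "\<lambda>n. 2 * (\<gamma> / real (n + 2))"]) (use *(1) e0 tendsto_mult_right_zero[OF e0, of 2] in auto)
    have w: "w \<longlonglongrightarrow> Vinf"
      by (rule LIM_zero_cancel, rule Lim_null_comparison[OF _ e0]) (use *(2) in auto)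
    have z': "z' \<longlonglongrightarrow> Vinf"
      by (rule LIM_zero_cancel, rule Lim_null_comparison[OF _ e0]) (use *(3) in auto)
    have "(\<lambda>n. I (v n) (w n)) \<longlonglongrightarrow> I 0 Vinf"
      unfolding I_def
    proof (rule integral_dominated_convergence[OF _ _ M(1)])
      show "AE z in lborel. norm (indicator {w n..} z * (kx G (v n) (z - w n) * dens G z)) \<le> M z" for n
      proof (rule AE_I2)
        fix z
        have "kx G (v n) (z - w n) * dens G z \<le> M z"
          using *(1,2)[of n] small[of n] by (intro M(2)) linarith+
        moreover have "0 \<le> kx G (v n) (z - w n) * dens G z"
          using kx0 d0 by simp
        ultimately show "norm (indicator {w n..} z * (kx G (v n) (z - w n) * dens G z)) \<le> M z"
          by (auto simp: indicator_def)
      qed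
      have "AE z in lborel. z \<notin> {Vinf}"
        by (intro AE_not_in countable_imp_null_set_lborel) simp
      then show "AE z in lborel. (\<lambda>n. indicator {w n..} z * (kx G (v n) (z - w n) * dens G z)) \<longlonglongrightarrow> indicator {Vinf..} z * (kx G 0 (z - Vinf) * dens G z)"
      proof eventually_elim
        case (elim z)
        have ind: "(\<lambda>n. indicator {w n..} z :: real) \<longlonglongrightarrow> indicator {Vinf..} z"
        proof (rule tendsto_eventually)
          consider "z < Vinf" | "z > Vinf"
            using elim by fastforce
          then show "\<forall>\<^sub>F n in sequentially. (indicator {w n..} z :: real) = indicator {Vinf..} z"
          proof cases
            case 1
            from order_tendstoD(1)[OF w 1] show ?thesis
              by eventually_elim (use 1 in \<open>auto simp: indicator_def\<close>)
          next
            case 2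
            from order_tendstoD(2)[OF w 2] show ?thesis
              by eventually_elim (use 2 in \<open>auto simp: indicator_def\<close>)
          qed
        qed
        have "(\<lambda>n. (v n, z - w n)) \<longlonglongrightarrow> (0, z - Vinf)"
          by (intro tendsto_intros v w)
        then have "(\<lambda>n. kx G (v n) (z - w n)) \<longlonglongrightarrow> kx G 0 (z - Vinf)"
          using continuous_on_tendsto_compose[OF kxc] by fastforce
        then show ?case
          by (intro tendsto_mult ind tendsto_const)
      qed
    qed measurable
    moreover have "(\<lambda>n. dens G (z' n) + 2 * \<delta>) \<longlonglongrightarrow> dens G Vinf + 2 * \<delta>"
      by (intro tendsto_intros continuous_on_tendsto_compose[OF dc z']) auto
    ultimately have "I 0 Vinf \<le> dens G Vinf + 2 * \<delta>"
      using *(4) by (intro LIMSEQ_le) (auto intro: less_imp_le)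
    then show False
      using \<delta> by (simp add: \<delta>_def field_simps)
  qed
  then obtain n where n: "\<And>v w z'. \<bar>v\<bar> \<le> 2 * (\<gamma> / real (n + 2)) \<Longrightarrow> \<bar>w - Vinf\<bar> \<le> \<gamma> / real (n + 2) \<Longrightarrow> \<bar>z' - Vinf\<bar> \<le> \<gamma> / real (n + 2) \<Longrightarrow>
      dens G z' + 2 * \<delta> \<le> I v w"
    by blast
  show ?thesis
  proof (rule that[of "\<gamma> / real (n + 2)" \<delta>])
    show "dens G z' + 2 * \<delta> \<le> (LINT z:{w..}|lborel. kx G v (z - w) * dens G z)"
      if "\<bar>v\<bar> \<le> 2 * (\<gamma> / real (n + 2))" "\<bar>w - Vinf\<bar> \<le> \<gamma> / real (n + 2)" "\<bar>z' - Vinf\<bar> \<le> \<gamma> / real (n + 2)" for v w z'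
      using n[OF that] by (simp add: I_def set_lebesgue_integral_def)
  qed (use \<gamma> \<delta> in auto)
qed

text \<open>The standing assumptions hold at the fixed scale \<open>\<gamma>s\<close>; the velocity
  range \<epsilon> is then chosen so small that the kernel bound beats its length.\<close>

lemma gas_constants:
  fixes G :: "'a::euclidean_space body_gas"
  assumes cyl: "cylinder G" and \<gamma>s: "\<gamma>s > 0" and mass: "mass_conservation G"
    and A1: "A1 G" and A2: "A2 G \<gamma>s" and A3: "A3 G p \<gamma>s" and A4: "A4 G Vinf \<gamma>s"
    and F0: "F0_regular G Vinf \<gamma>s" and irr: "irreversal_criterion G Vinf"
  obtains \<epsilon> cl Cl Kmax Amax Bmax \<delta> M where "gas G p Vinf \<epsilon> cl Cl Kmax Amax Bmax \<delta> M" "\<epsilon> < \<gamma>s"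
proof -
  interpret axial G
    by unfold_locales (use cyl in \<open>simp add: cylinder_def\<close>)
  have d0: "\<And>z. dens G z \<ge> 0" and kx0: "\<And>v u. kx G v u \<ge> 0" and tr0: "\<And>y. y \<in> hyperplane G \<Longrightarrow> trans G y \<ge> 0"
    and tz: "trans G 0 > 0"
    using A1 by (auto simp: A1_def)
  have "bounded (range (f0 G))"
    using A1 by (auto simp: A1_def)
  then obtain Bf where "\<forall>x\<in>range (f0 G). norm x \<le> Bf"
    unfolding bounded_iff by blast
  then have Bf: "\<bar>f0 G u\<bar> \<le> Bf" for u
    by simp
  have f0: "f0 G (z *\<^sub>R axis G + y) = dens G z * trans G y" if "y \<in> hyperplane G" for z y
    using that by (simp add: f0_def)
  \<comment> \<open>The assumptions bound the product \<open>f0\<close> only; dividing by the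
    positive central value of \<open>trans G\<close> bounds \<open>dens G\<close>.\<close>
  define Amax where "Amax = Bf / trans G 0"
  have Amax: "dens G z \<le> Amax" for z
    using Bf[of "z *\<^sub>R axis G + 0"] f0[of 0 z] tz d0[of z] by (simp add: Amax_def hyperplane_def field_simps)
  \<comment> \<open>The same division bounds \<open>trans G\<close>, provided \<open>dens G\<close>
    is somewhere positive; otherwise the irreversal criterion would read 0 > 0.\<close>
  obtain z0 where z0: "dens G z0 > 0"
  proof (rule ccontr)
    assume "\<not> thesis"
    then have "dens G z = 0" for z
      using that[of z] d0[of z] by force
    then show False
      using irr by (simp add: irreversal_criterion_def set_lebesgue_integral_def)
  qed
  define Bmax where "Bmax = Bf / dens G z0"
  have Bmax: "trans G y \<le> Bmax" if "y \<in> hyperplane G" for y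
    using Bf[of "z0 *\<^sub>R axis G + y"] f0[OF that, of z0] z0 tr0[OF that] by (simp add: Bmax_def field_simps)
  obtain K0 where K0: "\<And>u v. \<bar>u\<bar> \<le> \<gamma>s \<Longrightarrow> kx G v u \<le> K0"
    using A2 unfolding A2_def by blast
  have K0n: "K0 \<ge> 0"
    using K0[of 0 0] kx0[of 0 0] \<gamma>s by simp
  obtain M where M: "integrable lborel M" "\<And>v y z. \<bar>v\<bar> < 2 * \<gamma>s \<Longrightarrow> \<bar>y\<bar> < \<gamma>s \<Longrightarrow> kx G v (z - y - Vinf) * dens G z \<le> M z"
    using A4 unfolding A4_def by blast
  have M': "kx G v (z - w) * dens G z \<le> M z" if "\<bar>v\<bar> < 2 * \<gamma>s" "\<bar>w - Vinf\<bar> < \<gamma>s" for v w z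
    using M(2)[OF that, of z] by simp
  have Mn: "integral\<^sup>L lborel M \<ge> 0"
  proof (rule integral_nonneg_AE, rule AE_I2)
    fix z
    have "0 \<le> kx G 0 (z - Vinf) * dens G z"
      using kx0 d0 by simp
    also have "\<dots> \<le> M z"
      using \<gamma>s by (intro M') auto
    finally show "0 \<le> M z" .
  qed
  obtain e \<delta> where e: "e > 0" "\<delta> > 0" and irr': "\<And>v w z'. \<bar>v\<bar> \<le> 2 * e \<Longrightarrow> \<bar>w - Vinf\<bar> \<le> e \<Longrightarrow> \<bar>z' - Vinf\<bar> \<le> e \<Longrightarrow>
        dens G z' + 2 * \<delta> \<le> (LINT z:{w..}|lborel. kx G v (z - w) * dens G z)"
    using irreversal_neighbourhood[OF A1 irr \<gamma>s M(1) M'] by blast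
  obtain cl Cl where l: "cl > 0" "Cl \<ge> 0" "\<And>w. \<bar>w\<bar> \<le> \<gamma>s \<Longrightarrow> ell G w \<le> Cl * \<bar>w\<bar> powr p"
    "\<And>w. \<bar>w\<bar> \<le> \<gamma>s \<Longrightarrow> cl * \<bar>w\<bar> powr p \<le> ell G w"
    using ell_power_bounds[OF A1 A3 \<gamma>s] by blast
  define N where "N = 2 * integral\<^sup>L lborel M + Amax + 1"
  have N: "N \<ge> 1"
    using Mn d0[of 0] Amax[of 0] by (simp add: N_def)
  \<comment> \<open>The four bounds serve the neighbourhood of the irreversal criterion, the range
    of the standing assumptions up to \<open>2 * \<epsilon>\<close>, \<open>small1\<close> and
    \<open>small2\<close>. Adding 1 to \<open>K0\<close> makes the denominators positive.\<close>
  define \<epsilon> where "\<epsilon> = min (min e (\<gamma>s / 2)) (min (1 / (4 * (K0 + 1))) (\<delta> / (2 * (K0 + 1) * N)))"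
  have \<epsilon>: "\<epsilon> > 0" "\<epsilon> \<le> e" "2 * \<epsilon> \<le> \<gamma>s" "\<epsilon> \<le> 1 / (4 * (K0 + 1))" "\<epsilon> \<le> \<delta> / (2 * (K0 + 1) * N)"
  proof -
    show "\<epsilon> > 0"
      using e \<gamma>s K0n N by (simp add: \<epsilon>_def)
    show "\<epsilon> \<le> e" "2 * \<epsilon> \<le> \<gamma>s" "\<epsilon> \<le> 1 / (4 * (K0 + 1))" "\<epsilon> \<le> \<delta> / (2 * (K0 + 1) * N)"
      unfolding \<epsilon>_def by linarith+
  qed
  have s1: "2 * \<epsilon> * (K0 + 1) \<le> 1 / 2"
    using \<epsilon>(4) K0n by (simp add: field_simps)
  have s2: "2 * \<epsilon> * (K0 + 1) * N \<le> \<delta>"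
  proof -
    have "0 < 2 * (K0 + 1) * N"
      using K0n N by simp
    then have "\<epsilon> * (2 * (K0 + 1) * N) \<le> \<delta>"
      using \<epsilon>(5) by (simp only: pos_le_divide_eq)
    then show ?thesis
      by (simp add: mult_ac)
  qed
  have ellc: "continuous_on UNIV (ell G)"
    by (rule ell_continuous[OF A1 A3 \<gamma>s])
  have ell0: "ell G w \<ge> 0" for w
    using transfer_nonneg[OF A1, of w] by (simp add: ell_def)
  have ell_int: "integrable lborel (\<lambda>u. ell G (u \<bullet> axis G - w) * f0 G u)" for w
    using F0 by (simp add: F0_regular_def)
  have "gas G p Vinf \<epsilon> cl Cl (K0 + 1) Amax Bmax \<delta> M"
  proof (unfold_locales)
    show "radius G > 0" "halflen G > 0"
      using cyl by (auto simp: cylinder_def)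
    show "p > 0"
      using A3 by (simp add: A3_def)
    show "has_bochner_integral (lperp G) (trans G) 1" "continuous_on (hyperplane G) (trans G)"
      "continuous_on UNIV (dens G)" "continuous_on UNIV (\<lambda>(v, u). kx G v u)"
      "kx G (- v) u = kx G v u" for v u
      using A1 by (auto simp: A1_def)
    show "kx G v u \<le> K0 + 1" if "\<bar>u\<bar> \<le> 2 * \<epsilon>" for v u
      using K0[of u v] that \<epsilon> by simp
    show "integrable lborel (\<lambda>z. \<bar>z\<bar> * dens G z)"
      by (rule dens_first_moment[OF A1 ell_int ellc Amax])
    show "(\<integral>\<^sup>+v\<in>{0..}. ennreal (v * kx G v u) \<partial>lborel) = ennreal \<bar>u\<bar>" for u
      by (rule kx_mass_axial[OF A1 mass])
    show "ell G w \<le> Cl * \<bar>w\<bar> powr p" "cl * \<bar>w\<bar> powr p \<le> ell G w" if "\<bar>w\<bar> \<le> 2 * \<epsilon>" for w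
      using l(3,4)[of w] that \<epsilon> by auto
    show "kx G v (z - w) * dens G z \<le> M z" if "\<bar>v\<bar> \<le> 2 * \<epsilon>" "\<bar>w - Vinf\<bar> \<le> \<epsilon>" for v w z
      using that \<epsilon> \<gamma>s by (intro M') auto
    show "dens G z' + 2 * \<delta> \<le> (LINT z:{w..}|lborel. kx G v (z - w) * dens G z)"
      if "\<bar>v\<bar> \<le> 2 * \<epsilon>" "\<bar>w - Vinf\<bar> \<le> \<epsilon>" "\<bar>z' - Vinf\<bar> \<le> \<epsilon>" for v w z'
      using that \<epsilon> by (intro irr') auto
    show "2 * \<epsilon> * (K0 + 1) * (2 * integral\<^sup>L lborel M + Amax) \<le> \<delta>"
    proof -
      have "2 * \<epsilon> * (K0 + 1) * (2 * integral\<^sup>L lborel M + Amax) \<le> 2 * \<epsilon> * (K0 + 1) * N"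
        using \<epsilon> K0n by (intro mult_left_mono) (auto simp: N_def)
      with s2 show ?thesis
        by linarith
    qed
  qed (use \<epsilon> e tz tr0 Bmax d0 Amax kx0 ell0 ellc l ell_int M s1 in auto)
  moreover have "\<epsilon> < \<gamma>s"
    using \<epsilon> by linarith
  ultimately show ?thesis
    by (rule that)
qed

text \<open>The rates \<open>B0\<close> and \<open>Binf\<close> vary with \<gamma>. Their bounds b
  and B are the extremal slopes on the largest interval, so constants built from b and B are
  independent of \<gamma>.\<close>

lemma F0_slopes:
  assumes reg: "F0_regular G Vinf \<gamma>s" and \<gamma>s: "\<gamma>s > 0"
  obtains b B where "b > 0" "b \<le> B"
    "\<And>\<gamma>. 0 < \<gamma> \<Longrightarrow> \<gamma> \<le> \<gamma>s \<Longrightarrow> b \<le> Binf G Vinf \<gamma> \<and> B0 G Vinf \<gamma> \<le> B"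
    "\<And>\<gamma> w. 0 < \<gamma> \<Longrightarrow> \<gamma> \<le> \<gamma>s \<Longrightarrow> 0 \<le> w \<Longrightarrow> w \<le> \<gamma> \<Longrightarrow> Binf G Vinf \<gamma> * w \<le> F0 G (Vinf + w) - F0 G Vinf"
    "\<And>\<gamma> w. 0 < \<gamma> \<Longrightarrow> \<gamma> \<le> \<gamma>s \<Longrightarrow> 0 \<le> w \<Longrightarrow> w \<le> \<gamma> \<Longrightarrow> F0 G (Vinf + w) - F0 G Vinf \<le> B0 G Vinf \<gamma> * w"
proof -
  obtain D where D: "\<And>x. (F0 G has_vector_derivative D x) (at x)" "continuous_on UNIV D"
    using reg by (auto simp: F0_regular_def C1_differentiable_on_def)
  have DD: "(F0 G has_real_derivative D x) (at x)" for x
    using D(1) by (simp add: has_real_derivative_iff_has_vector_derivative)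
  have der: "deriv (F0 G) = D"
    using DD by (auto intro: DERIV_imp_deriv)
  let ?S = "{Vinf - \<gamma>s..Vinf + \<gamma>s}"
  have c: "compact ?S" "?S \<noteq> {}" "continuous_on ?S D"
    using \<gamma>s continuous_on_subset[OF D(2)] by auto
  obtain lo where lo: "lo \<in> ?S" "\<And>x. x \<in> ?S \<Longrightarrow> D lo \<le> D x"
    using continuous_attains_inf[OF c] by blast
  obtain hi where hi: "hi \<in> ?S" "\<And>x. x \<in> ?S \<Longrightarrow> D x \<le> D hi"
    using continuous_attains_sup[OF c] by blast
  have bd: "bdd_below (D ` {Vinf - \<gamma>..Vinf + \<gamma>})" "bdd_above (D ` {Vinf - \<gamma>..Vinf + \<gamma>})" if "\<gamma> \<le> \<gamma>s" for \<gamma>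
    using lo(2) hi(2) that by (auto intro!: bdd_belowI2[where m = "D lo"] bdd_aboveI2[where M = "D hi"])
  have mvt: "\<exists>x. x \<in> {Vinf - \<gamma>..Vinf + \<gamma>} \<and> F0 G (Vinf + w) - F0 G Vinf = D x * w" if "0 \<le> w" "w \<le> \<gamma>" for \<gamma> w
  proof (cases "w = 0")
    case False
    then have "\<exists>x. Vinf < x \<and> x < Vinf + w \<and> F0 G (Vinf + w) - F0 G Vinf = (Vinf + w - Vinf) * D x"
      using that DD by (intro MVT2) auto
    then obtain x where "Vinf < x" "x < Vinf + w" "F0 G (Vinf + w) - F0 G Vinf = (Vinf + w - Vinf) * D x"
      by blast
    then show ?thesis
      using that by (intro exI[of _ x]) (auto simp: mult.commute)
  qed (use that in \<open>auto intro!: exI[of _ Vinf]\<close>)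
  show ?thesis
  proof (rule that[of "D lo" "D hi"])
    show "D lo > 0"
      using reg lo(1) by (auto simp: F0_regular_def der)
    show "D lo \<le> D hi"
      using lo hi by blast
    fix \<gamma> :: real assume \<gamma>: "0 < \<gamma>" "\<gamma> \<le> \<gamma>s"
    show "D lo \<le> Binf G Vinf \<gamma> \<and> B0 G Vinf \<gamma> \<le> D hi"
      unfolding Binf_def B0_def der using \<gamma> lo(2) hi(2) by (intro conjI cINF_greatest cSUP_least) auto
    fix w assume w: "0 \<le> w" "w \<le> \<gamma>"
    obtain x where x: "x \<in> {Vinf - \<gamma>..Vinf + \<gamma>}" "F0 G (Vinf + w) - F0 G Vinf = D x * w"
      using mvt[OF w] by blast
    show "Binf G Vinf \<gamma> * w \<le> F0 G (Vinf + w) - F0 G Vinf"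
      unfolding x(2) Binf_def der using w by (intro mult_right_mono cINF_lower[OF bd(1)[OF \<gamma>(2)] x(1)]) auto
    show "F0 G (Vinf + w) - F0 G Vinf \<le> B0 G Vinf \<gamma> * w"
      unfolding x(2) B0_def der using w by (intro mult_right_mono cSUP_upper[OF x(1) bd(2)[OF \<gamma>(2)]]) auto
  qed
qed

section \<open>Constants independent of the initial velocity, and assembly of the two
  statements\<close>

theorem theorem1p1:
  fixes G :: "'a::euclidean_space body_gas"
    and p \<gamma>s Vinf E X0 :: real
  assumes "cylinder G"
    and "\<gamma>s > 0"
    and "mass_conservation G"
    and "A1 G" and "A2 G \<gamma>s" and "A3 G p \<gamma>s" and "A4 G Vinf \<gamma>s"
    and "lateral_kernel G"
    and "F0_regular G Vinf \<gamma>s"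
    and "Vinf \<ge> 0" and "E = F0 G Vinf"
    and "irreversal_criterion G Vinf"
  shows "\<exists>\<gamma>\<^sub>1>0. \<exists>c>0. \<exists>C>0. \<forall>\<gamma>. 0 < \<gamma> \<and> \<gamma> < \<gamma>\<^sub>1 \<longrightarrow>
     (\<exists>X V fm fp. solution G E X0 (Vinf + \<gamma>) X V fm fp \<and>
        (bounded_emission G Vinf \<gamma>s \<longrightarrow> bounded_on (out_phase G X V) fp)) \<and>
     (\<forall>X V fm fp. solution G E X0 (Vinf + \<gamma>) X V fm fp \<longrightarrow>
        (\<forall>t>0.
           0 < \<gamma> * exp (- B0 G Vinf \<gamma> * t)
               + (if t \<ge> \<bar>ln \<gamma>\<bar> + 1
                  then c * \<gamma> powr (p + 1) / t powr (real DIM('a) + p) else 0) \<and>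
           \<gamma> * exp (- B0 G Vinf \<gamma> * t)
               + (if t \<ge> \<bar>ln \<gamma>\<bar> + 1
                  then c * \<gamma> powr (p + 1) / t powr (real DIM('a) + p) else 0)
             < V t - Vinf \<and>
           V t - Vinf < \<gamma> * exp (- Binf G Vinf \<gamma> * t)
               + C * \<gamma> powr (p + 1) / (1 + t) powr (real DIM('a) + p) \<and>
           V t > Vinf))"
proof -
  obtain \<epsilon> cl Cl Kmax Amax Bmax \<delta> M where gas: "gas G p Vinf \<epsilon> cl Cl Kmax Amax Bmax \<delta> M" and \<epsilon>s: "\<epsilon> < \<gamma>s"
    using gas_constants[OF assms(1-7,9,12)] by blast
  interpret gas G p Vinf \<epsilon> cl Cl Kmax Amax Bmax \<delta> M
    by (rule gas)
  interpret gas_at G p Vinf \<epsilon> cl Cl Kmax Amax Bmax \<delta> M X0 ..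
  obtain b B where b: "b > 0" "b \<le> B"
    and slopes: "\<And>\<gamma>. 0 < \<gamma> \<Longrightarrow> \<gamma> \<le> \<gamma>s \<Longrightarrow> b \<le> Binf G Vinf \<gamma> \<and> B0 G Vinf \<gamma> \<le> B"
    and lower: "\<And>\<gamma> w. 0 < \<gamma> \<Longrightarrow> \<gamma> \<le> \<gamma>s \<Longrightarrow> 0 \<le> w \<Longrightarrow> w \<le> \<gamma> \<Longrightarrow> Binf G Vinf \<gamma> * w \<le> F0 G (Vinf + w) - F0 G Vinf"
    and upper: "\<And>\<gamma> w. 0 < \<gamma> \<Longrightarrow> \<gamma> \<le> \<gamma>s \<Longrightarrow> 0 \<le> w \<Longrightarrow> w \<le> \<gamma> \<Longrightarrow> F0 G (Vinf + w) - F0 G Vinf \<le> B0 G Vinf \<gamma> * w"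
    using F0_slopes[OF assms(9,2)] by blast
  have C1_bound: "Cleft \<ge> 0"
    unfolding Cleft_def using Adrag_nonneg Bmax_nonneg radius_pos
    by (intro mult_nonneg_nonneg add_nonneg_nonneg) auto
  interpret R: relaxation p q Adrag cleft Cleft b B "DIM('a) - 1"
  proof
    show "q = real (DIM('a) - 1) + 1 + p"
      using DIM_positive[where 'a='a] by (simp add: q_def of_nat_diff)
  qed (use p_pos Adrag_nonneg cleft_pos C1_bound b in auto)
  have R: "relaxation p q Adrag cleft Cleft b B (DIM('a) - 1)" ..
  obtain \<gamma>0 where \<gamma>0: "\<gamma>0 > 0" "\<And>\<gamma>. 0 < \<gamma> \<Longrightarrow> \<gamma> < \<gamma>0 \<Longrightarrow> R.small \<gamma>"
    using R.eventually_small unfolding eventually_at_right_field by blast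
  \<comment> \<open>The coefficient in \<open>relaxation_bounds\<close>; it depends on the gas and
    on b and B, but not on \<gamma>.\<close>
  define c where "c = exp (- B) * (R.c2 / 4) * 2 powr (- q)"
  have q: "real DIM('a) + p = q"
    by (simp add: q_def)
  have F0c: "continuous_on UNIV (F0 G)"
    using assms(9) C1_differentiable_imp_continuous_on by (auto simp: F0_regular_def)
  show ?thesis
  \<comment> \<open>Below \<open>\<gamma>0\<close> the smallness conditions of the relaxation hold;
    below \<epsilon> the velocities between \<open>Vinf\<close> and \<open>Vinf + \<gamma>\<close>
    lie in the range where the gas is controlled.\<close>
  proof (rule exI[of _ "min \<gamma>0 \<epsilon>"], intro conjI, goal_cases)
    case 1
    then show ?case
      using \<gamma>0 eps_pos by simp
  next
    case 2
    show ?case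
    proof (rule exI[of _ c], intro conjI, goal_cases)
      case 1
      then show ?case
        using R.constants by (simp add: c_def)
    next
      case 2
      show ?case
      proof (rule exI[of _ R.C1], intro conjI allI impI, goal_cases)
        case 1
        then show ?case
          by (rule R.constants)
      next
        case (2 \<gamma>)
        then have \<gamma>: "0 < \<gamma>" "\<gamma> \<le> \<gamma>s" "\<gamma> \<le> \<epsilon>" "R.small \<gamma>"
          using \<epsilon>s \<gamma>0 by auto
        show ?case
          unfolding assms(11) using slopes[OF \<gamma>(1,2)]
          by (intro solution_exists[OF R \<gamma>(4,3) lower[OF \<gamma>(1,2)] upper[OF \<gamma>(1,2)] _ _ F0c assms(8) \<epsilon>s]) auto
      next
        case (3 \<gamma> X V fm fp t)
        then have \<gamma>: "0 < \<gamma>" "\<gamma> \<le> \<gamma>s" "\<gamma> \<le> \<epsilon>" "R.small \<gamma>"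
          using \<epsilon>s \<gamma>0 by auto
        have "0 \<le> c"
          using R.constants by (simp add: c_def)
        then show ?case
          using \<gamma>(1) by (auto intro!: add_pos_nonneg)
      next
        case (4 \<gamma> X V fm fp t)
        then have \<gamma>: "0 < \<gamma>" "\<gamma> \<le> \<gamma>s" "\<gamma> \<le> \<epsilon>" "R.small \<gamma>"
          using \<epsilon>s \<gamma>0 by auto
        show ?case
          using solution_bounds(2)[OF R \<gamma>(4,3) lower[OF \<gamma>(1,2)] upper[OF \<gamma>(1,2)] _ _ 4(2)[unfolded assms(11)] 4(3)] slopes[OF \<gamma>(1,2)]
          unfolding q c_def by blast
      next
        case (5 \<gamma> X V fm fp t)
        then have \<gamma>: "0 < \<gamma>" "\<gamma> \<le> \<gamma>s" "\<gamma> \<le> \<epsilon>" "R.small \<gamma>"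
          using \<epsilon>s \<gamma>0 by auto
        show ?case
          using solution_bounds(3)[OF R \<gamma>(4,3) lower[OF \<gamma>(1,2)] upper[OF \<gamma>(1,2)] _ _ 5(2)[unfolded assms(11)] 5(3)] slopes[OF \<gamma>(1,2)]
          unfolding q by blast
      next
        case (6 \<gamma> X V fm fp t)
        then have \<gamma>: "0 < \<gamma>" "\<gamma> \<le> \<gamma>s" "\<gamma> \<le> \<epsilon>" "R.small \<gamma>"
          using \<epsilon>s \<gamma>0 by auto
        show ?case
          using solution_bounds(1)[OF R \<gamma>(4,3) lower[OF \<gamma>(1,2)] upper[OF \<gamma>(1,2)] _ _ 6(2)[unfolded assms(11)] 6(3)] slopes[OF \<gamma>(1,2)]
          by simp
      qed
    qed
  qed
qed

end
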